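(* For any theory $T$ (and $p$ as in the context): (1) The equivalence relation $\equiv^{H_1}$ on $p$ is type-definable if and only if $d_{H_1}(p)$ is finite. (2) The cardinality of $H_1(p)$ is one or $\ge 2^{\aleph_0}$.
   Context: **Setting.** $T$ is a complete theory and $\mathcal M=\mathcal M^{\mathrm{eq}}$ a large saturated (monster) model; sets and tuples are small, tuples possibly infinite; $a\equiv b$ means equality of types over $\emptyset$. Fix an $\mathrm{Aut}(\mathcal M)$-invariant ternary relation $A\perp^*_C D$ between small sets satisfying, for all sets: (finite character) $A\perp^*_CD$ iff $a\perp^*_Cd$ for all finite tuples $a\in A$, $d\in D$; (normality) $A\perp^*_CD$ implies $A\perp^*_C\mathrm{acl}(DC)$; (symmetry) $A\perp^*_CD$ iff $D\perp^*_CA$; (transitivity) for $E\subseteq C\subseteq D$, $A\perp^*_ED$ iff $A\perp^*_EC$ and $A\perp^*_CD$; (extension) for $E\subseteq C$ there is $A'\equiv_E A$ with $A'\perp^*_EC$. (One example: $\perp^*$ always holds.) A family is $*$-independent over $C$ if each member is $*$-independent over $C$ from the union of the others. $p$ is a strong type over $B=\mathrm{acl}(B)$; the elements of $B$ are named by constants, so that "over $\emptyset$" means "over $B$". It is assumed that $p$ is the type of an algebraically closed set, or that the algebraic closure of a realization of $p$ is the same as its definable closure. **Simplices and homology.** For a finite $s\subset\omega$, the power set $\mathcal P(s)$ is a category with one morphism $u\to v$ when $u\subseteq v$ and none otherwise. $\mathcal C$ is the category of small subsets of $\mathcal M$ containing $B$, with elementary maps over $B$ as morphisms. For a functor $f$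 write $f^u_v:f(u)\to f(v)$ for the image of $u\to v$, and $f^u_v(u)$ for the set $f^u_v[f(u)]$. An $n$-simplex of $p$ is a functor $f:\mathcal P(s)\to\mathcal C$ with $|s|=n+1$ such that $f(\emptyset)=B$, each $f(\{i\})$ is of the form $\mathrm{acl}(b)$ (that is, $\mathrm{acl}(Bb)$) with $b\models p$, and for nonempty $u\subseteq s$, $f(u)=\mathrm{acl}(\bigcup_{i\in u}f^{\{i\}}_u(\{i\}))$ and $\{f^{\{i\}}_u(\{i\}): i\in u\}$ is $*$-independent over $B$. $C_n$ is the free abelian group on $n$-simplices. For $s=\{s_0<\dots<s_n\}$ put $\partial^i f=f\restriction\mathcal P(s\setminus\{s_i\})$, $\partial f=\sum_{i}(-1)^i\partial^i f$ (extended linearly), and $H^*_n(p)=\ker\partial_n/\mathrm{Im}\,\partial_{n+1}$. $H_1^*(p)$ does not depend on the choice of $\perp^*$ and is written $H_1(p)$. **The relation and the distance.** Let $G=\mathrm{Aut}(p(\mathcal M))=\{\sigma\restriction p(\mathcal M):\sigma\in\mathrm{Aut}(\mathcal M)\}$ with derived subgroup $G'$, and let $K\ge G'$ be the normal subgroup of $G$ of all automorphisms fixing every $G'$-orbit on $p(\mathcal M)$ (one has $H_1(p)=G/K$). For $a,b\models p$, $a\equiv^{H_1}b$ iff $b=f(a)$ for some $f\in K$ (equivalently, for some $f\in G'$). Let $R(a,b)$ hold iff there are $\sigma,\tau\in\mathrm{Aut}(\mathcal M)$ with $b=[\sigma,\tau](a)$, where $[\sigma,\tau]=\sigma^{-1}\tau^{-1}\sigma\tau$;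 let $R_0$ be equality and, for $i\ge1$, $R_i=R\circ\cdots\circ R$ ($i$ times). Then for $a,b\models p$, $a\equiv^{H_1}b$ iff $R_i(a,b)$ for some $i<\omega$. The $H_1$-distance on $p$ is defined for $a,b\models p$ by $d_{H_1}(a,b)=\min\{n: R_n(a,b)\}$ if $a\equiv^{H_1}b$, and $d_{H_1}(a,b)=\infty$ otherwise. The $H_1$-diameter of $p$ is $d_{H_1}(p)=\max\{d_{H_1}(a,b): a,b\models p\}$.
   Formalization: The H_1-diameter is taken as the supremum of d(a,b) over H_1-equivalent pairs a,b only; over all pairs, with distance ∞ on inequivalent ones, (1) fails, e.g. for the circle with cyclic order and rational rotations. *)

theory Defs
  imports "HOL-Library.Extended_Nat" "HOL-Algebra.Bij" "HOL-Algebra.Generated_Groups"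
    "HOL-Algebra.Free_Abelian_Groups"
begin

section \<open>Many-sorted first-order structures\<close>

text \<open>
  Structures are many-sorted, because the standing convention \<open>M = M\<^sup>e\<^sup>q\<close> forces it. The universe is
  the whole type \<^typ>\<open>'a\<close>, split into sorts by \<open>srt\<close>. Variables are pairs of an index
  and a sort.
\<close>

type_synonym 's var = "nat \<times> 's"

datatype ('s, 'f) trm = Var "'s var" | Fn 'f "('s, 'f) trm list"

datatype ('s, 'f, 'r) fm =
    Eq "('s, 'f) trm" "('s, 'f) trm"
  | Rl 'r "('s, 'f) trm list"
  | Neg "('s, 'f, 'r) fm"
  | And "('s, 'f, 'r) fm" "('s, 'f, 'r) fm"
  | Ex "'s var" "('s, 'f, 'r) fm"

record ('s, 'f, 'r, 'a) fo_struct =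
  fdom :: "'f \<Rightarrow> 's list"
  fcod :: "'f \<Rightarrow> 's"
  rdom :: "'r \<Rightarrow> 's list"
  srt :: "'a \<Rightarrow> 's"
  fnI :: "'f \<Rightarrow> 'a list \<Rightarrow> 'a"
  relI :: "'r \<Rightarrow> 'a list set"

definition wf_struct :: "('s, 'f, 'r, 'a) fo_struct \<Rightarrow> bool" where
  "wf_struct M \<longleftrightarrow> surj (srt M) \<and>
     (\<forall>f xs. map (srt M) xs = fdom M f \<longrightarrow> srt M (fnI M f xs) = fcod M f)"

primrec fvt :: "('s, 'f) trm \<Rightarrow> 's var set" where
  "fvt (Var v) = {v}"
| "fvt (Fn f ts) = \<Union> (set (map fvt ts))"

primrec fv :: "('s, 'f, 'r) fm \<Rightarrow> 's var set" where
  "fv (Eq t u) = fvt t \<union> fvt u"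
| "fv (Rl r ts) = \<Union> (fvt ` set ts)"
| "fv (Neg \<phi>) = fv \<phi>"
| "fv (And \<phi> \<psi>) = fv \<phi> \<union> fv \<psi>"
| "fv (Ex v \<phi>) = fv \<phi> - {v}"

primrec trm_sort :: "('s, 'f, 'r, 'a) fo_struct \<Rightarrow> ('s, 'f) trm \<Rightarrow> 's" where
  "trm_sort M (Var v) = snd v"
| "trm_sort M (Fn f ts) = fcod M f"

primrec wft :: "('s, 'f, 'r, 'a) fo_struct \<Rightarrow> ('s, 'f) trm \<Rightarrow> bool" where
  "wft M (Var v) = True"
| "wft M (Fn f ts) = (list_all id (map (wft M) ts) \<and> map (trm_sort M) ts = fdom M f)"

primrec wf_fm :: "('s, 'f, 'r, 'a) fo_struct \<Rightarrow> ('s, 'f, 'r) fm \<Rightarrow> bool" where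
  "wf_fm M (Eq t u) = (wft M t \<and> wft M u \<and> trm_sort M t = trm_sort M u)"
| "wf_fm M (Rl r ts) = (list_all (wft M) ts \<and> map (trm_sort M) ts = rdom M r)"
| "wf_fm M (Neg \<phi>) = wf_fm M \<phi>"
| "wf_fm M (And \<phi> \<psi>) = (wf_fm M \<phi> \<and> wf_fm M \<psi>)"
| "wf_fm M (Ex v \<phi>) = wf_fm M \<phi>"

primrec evalt :: "('s, 'f, 'r, 'a) fo_struct \<Rightarrow> ('s var \<Rightarrow> 'a) \<Rightarrow> ('s, 'f) trm \<Rightarrow> 'a" where
  "evalt M e (Var v) = e v"
| "evalt M e (Fn f ts) = fnI M f (map (evalt M e) ts)"

primrec sat :: "('s, 'f, 'r, 'a) fo_struct \<Rightarrow> ('s, 'f, 'r) fm \<Rightarrow> ('s var \<Rightarrow> 'a) \<Rightarrow> bool" where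
  "sat M (Eq t u) e = (evalt M e t = evalt M e u)"
| "sat M (Rl r ts) e = (map (evalt M e) ts \<in> relI M r)"
| "sat M (Neg \<phi>) e = (\<not> sat M \<phi> e)"
| "sat M (And \<phi> \<psi>) e = (sat M \<phi> e \<and> sat M \<psi> e)"
| "sat M (Ex v \<phi>) e = (\<exists>x. srt M x = snd v \<and> sat M \<phi> (e(v := x)))"

text \<open>
  \<open>holds M \<phi> e\<close>: \<open>\<phi>\<close> is a well-sorted formula, \<open>e\<close> gives each free variable of \<open>\<phi>\<close> a value of the
  right sort, and \<open>M\<close> satisfies \<open>\<phi>\<close> under \<open>e\<close>. The sort conditions are part of the notion, so a
  formula and its negation may both fail at a tuple of the wrong sorts.
\<close>

definition holds :: "('s, 'f, 'r, 'a) fo_struct \<Rightarrow> ('s, 'f, 'r) fm \<Rightarrow> ('s var \<Rightarrow> 'a) \<Rightarrow> bool" where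
  "holds M \<phi> e \<longleftrightarrow> wf_fm M \<phi> \<and> (\<forall>v\<in>fv \<phi>. srt M (e v) = snd v) \<and> sat M \<phi> e"

definition Th :: "('s, 'f, 'r, 'a) fo_struct \<Rightarrow> ('s, 'f, 'r) fm set" where
  "Th M = {\<phi>. wf_fm M \<phi> \<and> fv \<phi> = {} \<and> (\<forall>e. sat M \<phi> e)}"

definition Aut :: "('s, 'f, 'r, 'a) fo_struct \<Rightarrow> ('a \<Rightarrow> 'a) set" where
  "Aut M = {\<sigma>. bij \<sigma> \<and> (\<forall>x. srt M (\<sigma> x) = srt M x) \<and>
     (\<forall>f xs. map (srt M) xs = fdom M f \<longrightarrow> \<sigma> (fnI M f xs) = fnI M f (map \<sigma> xs)) \<and>
     (\<forall>r xs. map (srt M) xs = rdom M r \<longrightarrow> (map \<sigma> xs \<in> relI M r \<longleftrightarrow> xs \<in> relI M r))}"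

definition AutOver :: "('s, 'f, 'r, 'a) fo_struct \<Rightarrow> 'a set \<Rightarrow> ('a \<Rightarrow> 'a) set" where
  "AutOver M B = {\<sigma> \<in> Aut M. \<forall>x\<in>B. \<sigma> x = x}"

definition elementary_on :: "('s, 'f, 'r, 'a) fo_struct \<Rightarrow> 'a set \<Rightarrow> ('a \<Rightarrow> 'a) \<Rightarrow> bool" where
  "elementary_on M X h \<longleftrightarrow> (\<forall>\<phi> e. e ` fv \<phi> \<subseteq> X \<longrightarrow> (holds M \<phi> e \<longleftrightarrow> holds M \<phi> (h \<circ> e)))"

definition same_type :: "('s, 'f, 'r, 'a) fo_struct \<Rightarrow> 'a set \<Rightarrow> 'a set \<Rightarrow> 'a set \<Rightarrow> bool" where
  "same_type M E A A' \<longleftrightarrow> (\<exists>h. elementary_on M (E \<union> A) h \<and> (\<forall>x\<in>E. h x = x) \<and> h ` A = A')"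

definition acl :: "('s, 'f, 'r, 'a) fo_struct \<Rightarrow> 'a set \<Rightarrow> 'a set" where
  "acl M A = {x. \<exists>\<phi> v e. e ` (fv \<phi> - {v}) \<subseteq> A \<and> holds M \<phi> (e(v := x)) \<and>
                  finite {y. holds M \<phi> (e(v := y))}}"

definition dcl :: "('s, 'f, 'r, 'a) fo_struct \<Rightarrow> 'a set \<Rightarrow> 'a set" where
  "dcl M A = {x. \<exists>\<phi> v e. e ` (fv \<phi> - {v}) \<subseteq> A \<and> {y. holds M \<phi> (e(v := y))} = {x}}"

section \<open>Types and the monster model\<close>

text \<open>
  A formula in variables indexed by \<^typ>\<open>'i\<close> with parameters is a pair \<open>(\<phi>, \<rho>)\<close>, where \<open>\<rho>\<close> sends each
  free variable of \<open>\<phi>\<close> either to a coordinate (\<^const>\<open>Inl\<close>) or to a parameter (\<^const>\<open>Inr\<close>).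
  Tuples, possibly infinite, are functions on \<^typ>\<open>'i\<close>.
\<close>

type_synonym ('s, 'f, 'r, 'i, 'a) pfm = "('s, 'f, 'r) fm \<times> ('s var \<Rightarrow> 'i + 'a)"

definition params_in :: "'a set \<Rightarrow> ('s, 'f, 'r, 'i, 'a) pfm \<Rightarrow> bool" where
  "params_in A = (\<lambda>(\<phi>, \<rho>). \<rho> ` fv \<phi> \<subseteq> range Inl \<union> Inr ` A)"

definition pholds :: "('s, 'f, 'r, 'a) fo_struct \<Rightarrow> ('s, 'f, 'r, 'i, 'a) pfm \<Rightarrow> ('i \<Rightarrow> 'a) \<Rightarrow> bool" where
  "pholds M = (\<lambda>(\<phi>, \<rho>) a. holds M \<phi> (case_sum a id \<circ> \<rho>))"

definition tp :: "('s, 'f, 'r, 'a) fo_struct \<Rightarrow> 'a set \<Rightarrow> ('i \<Rightarrow> 'a) \<Rightarrow> ('s, 'f, 'r, 'i, 'a) pfm set" where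
  "tp M B a = {\<xi>. params_in B \<xi> \<and> pholds M \<xi> a}"

definition small :: "'k rel \<Rightarrow> 'x set \<Rightarrow> bool" where
  "small \<kappa> A \<longleftrightarrow> |A| <o \<kappa>"

definition tuples :: "('s, 'f, 'r, 'a) fo_struct \<Rightarrow> 's list \<Rightarrow> 'a list set" where
  "tuples M ss = {xs. map (srt M) xs = ss}"

definition definable :: "('s, 'f, 'r, 'a) fo_struct \<Rightarrow> 's list \<Rightarrow> 'a list set \<Rightarrow> bool" where
  "definable M ss X \<longleftrightarrow> (\<exists>\<phi> vs. wf_fm M \<phi> \<and> distinct vs \<and> map snd vs = ss \<and> fv \<phi> \<subseteq> set vs \<and>
     X = {map e vs | e. (\<forall>v\<in>set vs. srt M (e v) = snd v) \<and> sat M \<phi> e})"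

text \<open>
  \<open>M = M\<^sup>e\<^sup>q\<close>: every equivalence relation that is definable without parameters, on a finite product of
  sorts, is the kernel of a parameter-free definable map into some sort.
\<close>

definition is_eq_closed :: "('s, 'f, 'r, 'a) fo_struct \<Rightarrow> bool" where
  "is_eq_closed M \<longleftrightarrow>
     (\<forall>ss E. definable M (ss @ ss) E \<and>
        equiv (tuples M ss) {(a, b). a \<in> tuples M ss \<and> b \<in> tuples M ss \<and> a @ b \<in> E} \<longrightarrow>
        (\<exists>s F. (\<forall>a\<in>tuples M ss. srt M (F a) = s) \<and>
               definable M (ss @ [s]) {a @ [F a] | a. a \<in> tuples M ss} \<and>
               (\<forall>a\<in>tuples M ss. \<forall>b\<in>tuples M ss. a @ b \<in> E \<longleftrightarrow> F a = F b)))"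

text \<open>
  A monster model: \<open>\<kappa>\<close>-saturated and strongly \<open>\<kappa>\<close>-homogeneous for a cardinal \<open>\<kappa>\<close> above the number of
  formulas; \<open>small\<close> means of size less than \<open>\<kappa>\<close>. This includes the saturated models of cardinality
  \<open>\<kappa>\<close>, and does not exclude theories with finite models. In \<open>saturated\<close>, \<open>\<Phi>\<close> is a set of formulas
  in the single variable \<open>v\<close> with parameters in \<open>A\<close>, the parameters being given by the assignments.
\<close>

locale monster =
  fixes T :: "('s, 'f, 'r) fm set" and M :: "('s, 'f, 'r, 'a) fo_struct" and \<kappa> :: "'k rel"
  assumes wf: "wf_struct M"
    and model: "T = Th M"
    and eq_closed: "is_eq_closed M"
    and card: "Card_order \<kappa>"
    and large: "|UNIV :: ('s, 'f, 'r) fm set| <o \<kappa>"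
    and saturated: "\<And>A v (\<Phi> :: (('s, 'f, 'r) fm \<times> ('s var \<Rightarrow> 'a)) set).
          small \<kappa> A \<Longrightarrow> (\<forall>(\<phi>, e)\<in>\<Phi>. e ` (fv \<phi> - {v}) \<subseteq> A) \<Longrightarrow>
          (\<forall>\<Phi>\<^sub>0\<subseteq>\<Phi>. finite \<Phi>\<^sub>0 \<longrightarrow> (\<exists>x. \<forall>(\<phi>, e)\<in>\<Phi>\<^sub>0. holds M \<phi> (e(v := x)))) \<Longrightarrow>
          \<exists>x. \<forall>(\<phi>, e)\<in>\<Phi>. holds M \<phi> (e(v := x))"
    and homogeneous: "\<And>A h. small \<kappa> A \<Longrightarrow> elementary_on M A h \<Longrightarrow> \<exists>\<sigma>\<in>Aut M. \<forall>x\<in>A. \<sigma> x = h x"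

text \<open>\<open>indep A C D\<close> stands for \<open>A \<perp>\<^sup>*\<^sub>C D\<close>.\<close>

locale star_independence =
  fixes M :: "('s, 'f, 'r, 'a) fo_struct" and \<kappa> :: "'k rel"
    and indep :: "'a set \<Rightarrow> 'a set \<Rightarrow> 'a set \<Rightarrow> bool"
  assumes invariant: "\<And>A C D \<sigma>. small \<kappa> A \<Longrightarrow> small \<kappa> C \<Longrightarrow> small \<kappa> D \<Longrightarrow> \<sigma> \<in> Aut M \<Longrightarrow>
          indep (\<sigma> ` A) (\<sigma> ` C) (\<sigma> ` D) \<longleftrightarrow> indep A C D"
    and finite_character: "\<And>A C D. small \<kappa> A \<Longrightarrow> small \<kappa> C \<Longrightarrow> small \<kappa> D \<Longrightarrow>
          indep A C D \<longleftrightarrow> (\<forall>a d. finite a \<and> a \<subseteq> A \<and> finite d \<and> d \<subseteq> D \<longrightarrow> indep a C d)"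
    and normality: "\<And>A C D. small \<kappa> A \<Longrightarrow> small \<kappa> C \<Longrightarrow> small \<kappa> D \<Longrightarrow>
          indep A C D \<Longrightarrow> indep A C (acl M (D \<union> C))"
    and symmetry: "\<And>A C D. small \<kappa> A \<Longrightarrow> small \<kappa> C \<Longrightarrow> small \<kappa> D \<Longrightarrow>
          indep A C D \<longleftrightarrow> indep D C A"
    and transitivity: "\<And>A E C D. small \<kappa> A \<Longrightarrow> small \<kappa> D \<Longrightarrow> E \<subseteq> C \<Longrightarrow> C \<subseteq> D \<Longrightarrow>
          indep A E D \<longleftrightarrow> indep A E C \<and> indep A C D"
    and extension: "\<And>A E C. small \<kappa> A \<Longrightarrow> small \<kappa> C \<Longrightarrow> E \<subseteq> C \<Longrightarrow>
          \<exists>A'. same_type M E A A' \<and> indep A' E C"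

definition indep_family :: "('a set \<Rightarrow> 'a set \<Rightarrow> 'a set \<Rightarrow> bool) \<Rightarrow> 'a set \<Rightarrow> 'j set \<Rightarrow> ('j \<Rightarrow> 'a set) \<Rightarrow> bool"
  where "indep_family indep C J X \<longleftrightarrow> (\<forall>i\<in>J. indep (X i) C (\<Union>j\<in>J - {i}. X j))"

text \<open>
  The base \<open>B\<close> is kept as an explicit parameter instead of being named by constants; accordingly
  types, automorphisms and algebraic closures below are taken over \<open>B\<close>.
\<close>

definition strong_type ::
  "('s, 'f, 'r, 'a) fo_struct \<Rightarrow> 'k rel \<Rightarrow> 'a set \<Rightarrow> ('s, 'f, 'r, 'i, 'a) pfm set \<Rightarrow> bool" where
  "strong_type M \<kappa> B p \<longleftrightarrow> small \<kappa> B \<and> acl M B = B \<and> small \<kappa> (UNIV :: 'i set) \<and> (\<exists>a. p = tp M B a)"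

definition realizations ::
  "('s, 'f, 'r, 'a) fo_struct \<Rightarrow> 'a set \<Rightarrow> ('s, 'f, 'r, 'i, 'a) pfm set \<Rightarrow> ('i \<Rightarrow> 'a) set" where
  "realizations M B p = {a. tp M B a = p}"

definition type_of_acl_set ::
  "('s, 'f, 'r, 'a) fo_struct \<Rightarrow> 'a set \<Rightarrow> ('s, 'f, 'r, 'i, 'a) pfm set \<Rightarrow> bool" where
  "type_of_acl_set M B p \<longleftrightarrow> (\<forall>a\<in>realizations M B p. acl M (B \<union> range a) = range a)"

definition acl_eq_dcl ::
  "('s, 'f, 'r, 'a) fo_struct \<Rightarrow> 'a set \<Rightarrow> ('s, 'f, 'r, 'i, 'a) pfm set \<Rightarrow> bool" where
  "acl_eq_dcl M B p \<longleftrightarrow> (\<forall>a\<in>realizations M B p. acl M (B \<union> range a) = dcl M (B \<union> range a))"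

section \<open>Simplices and homology\<close>

text \<open>
  A functor from \<open>\<P>(s)\<close> is stored as \<open>s\<close> together with its values on objects and on morphisms
  \<open>u \<subseteq> v\<close>. All components are normalised to be \<^const>\<open>undefined\<close> outside their domains, so that
  equal functors are equal records; this matters because they serve as free generators.
\<close>

record 'a simplex =
  verts :: "nat set"
  obj :: "nat set \<Rightarrow> 'a set"
  mor :: "nat set \<Rightarrow> nat set \<Rightarrow> 'a \<Rightarrow> 'a"

definition is_morphism ::
  "('s, 'f, 'r, 'a) fo_struct \<Rightarrow> 'a set \<Rightarrow> 'a set \<Rightarrow> 'a set \<Rightarrow> ('a \<Rightarrow> 'a) \<Rightarrow> bool" where
  "is_morphism M B X Y h \<longleftrightarrow>
     h \<in> extensional X \<and> h ` X \<subseteq> Y \<and> elementary_on M X h \<and> (\<forall>x\<in>B. h x = x)"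

definition is_functor :: "('s, 'f, 'r, 'a) fo_struct \<Rightarrow> 'k rel \<Rightarrow> 'a set \<Rightarrow> 'a simplex \<Rightarrow> bool" where
  "is_functor M \<kappa> B f \<longleftrightarrow>
     obj f \<in> extensional (Pow (verts f)) \<and>
     (\<forall>u v. \<not> (u \<subseteq> v \<and> v \<subseteq> verts f) \<longrightarrow> mor f u v = undefined) \<and>
     (\<forall>u \<subseteq> verts f. small \<kappa> (obj f u) \<and> B \<subseteq> obj f u) \<and>
     (\<forall>u v. u \<subseteq> v \<and> v \<subseteq> verts f \<longrightarrow> is_morphism M B (obj f u) (obj f v) (mor f u v)) \<and>
     (\<forall>u \<subseteq> verts f. \<forall>x\<in>obj f u. mor f u u x = x) \<and>
     (\<forall>u v w. u \<subseteq> v \<and> v \<subseteq> w \<and> w \<subseteq> verts f \<longrightarrow>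
        (\<forall>x\<in>obj f u. mor f u w x = mor f v w (mor f u v x)))"

definition vertex_image :: "'a simplex \<Rightarrow> nat set \<Rightarrow> nat \<Rightarrow> 'a set" where
  "vertex_image f u i = mor f {i} u ` obj f {i}"

definition simplices ::
  "('s, 'f, 'r, 'a) fo_struct \<Rightarrow> 'k rel \<Rightarrow> ('a set \<Rightarrow> 'a set \<Rightarrow> 'a set \<Rightarrow> bool) \<Rightarrow> 'a set
     \<Rightarrow> ('s, 'f, 'r, 'i, 'a) pfm set \<Rightarrow> nat \<Rightarrow> 'a simplex set" where
  "simplices M \<kappa> indep B p n =
     {f. finite (verts f) \<and> card (verts f) = n + 1 \<and> is_functor M \<kappa> B f \<and>
         obj f {} = B \<and>
         (\<forall>i\<in>verts f. \<exists>b\<in>realizations M B p. obj f {i} = acl M (B \<union> range b)) \<and>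
         (\<forall>u \<subseteq> verts f. u \<noteq> {} \<longrightarrow>
            obj f u = acl M (\<Union>i\<in>u. vertex_image f u i) \<and>
            indep_family indep B u (vertex_image f u))}"

definition face :: "nat \<Rightarrow> 'a simplex \<Rightarrow> 'a simplex" where
  "face i f =
     (let s' = verts f - {sorted_list_of_set (verts f) ! i} in
      \<lparr>verts = s', obj = restrict (obj f) (Pow s'),
       mor = (\<lambda>u v. if u \<subseteq> v \<and> v \<subseteq> s' then mor f u v else undefined)\<rparr>)"

definition boundary :: "('a simplex \<Rightarrow>\<^sub>0 int) \<Rightarrow> ('a simplex \<Rightarrow>\<^sub>0 int)" where
  "boundary = frag_extend (\<lambda>f. \<Sum>i<card (verts f). frag_cmul ((-1) ^ i) (frag_of (face i f)))"

definition chain_group ::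
  "('s, 'f, 'r, 'a) fo_struct \<Rightarrow> 'k rel \<Rightarrow> ('a set \<Rightarrow> 'a set \<Rightarrow> 'a set \<Rightarrow> bool) \<Rightarrow> 'a set
     \<Rightarrow> ('s, 'f, 'r, 'i, 'a) pfm set \<Rightarrow> nat \<Rightarrow> ('a simplex \<Rightarrow>\<^sub>0 int) monoid" where
  "chain_group M \<kappa> indep B p n = free_Abelian_group (simplices M \<kappa> indep B p n)"

text \<open>
  \<open>H\<^sub>n(p) = ker \<partial>\<^sub>n / im \<partial>\<^sub>n\<^sub>+\<^sub>1\<close>, meant for \<open>n \<ge> 1\<close> only (no convention for \<open>\<partial>\<^sub>0\<close> is built in).
\<close>

definition homology ::
  "('s, 'f, 'r, 'a) fo_struct \<Rightarrow> 'k rel \<Rightarrow> ('a set \<Rightarrow> 'a set \<Rightarrow> 'a set \<Rightarrow> bool) \<Rightarrow> 'a set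
     \<Rightarrow> ('s, 'f, 'r, 'i, 'a) pfm set \<Rightarrow> nat \<Rightarrow> ('a simplex \<Rightarrow>\<^sub>0 int) set monoid" where
  "homology M \<kappa> indep B p n =
     (chain_group M \<kappa> indep B p n)
       \<lparr>carrier := kernel (chain_group M \<kappa> indep B p n) (chain_group M \<kappa> indep B p (n - 1)) boundary\<rparr>
     Mod (boundary ` carrier (chain_group M \<kappa> indep B p (n + 1)))"

section \<open>The relation and the distance\<close>

definition AutRestr ::
  "('s, 'f, 'r, 'a) fo_struct \<Rightarrow> 'a set \<Rightarrow> ('s, 'f, 'r, 'i, 'a) pfm set
     \<Rightarrow> (('i \<Rightarrow> 'a) \<Rightarrow> ('i \<Rightarrow> 'a)) monoid" where
  "AutRestr M B p = (BijGroup (realizations M B p))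
     \<lparr>carrier := (\<lambda>\<sigma>. \<lambda>a\<in>realizations M B p. \<sigma> \<circ> a) ` AutOver M B\<rparr>"

definition derived_orbit ::
  "('s, 'f, 'r, 'a) fo_struct \<Rightarrow> 'a set \<Rightarrow> ('s, 'f, 'r, 'i, 'a) pfm set \<Rightarrow> ('i \<Rightarrow> 'a) \<Rightarrow> ('i \<Rightarrow> 'a) set"
  where "derived_orbit M B p a = (\<lambda>g. g a) ` derived (AutRestr M B p) (carrier (AutRestr M B p))"

definition Kgroup ::
  "('s, 'f, 'r, 'a) fo_struct \<Rightarrow> 'a set \<Rightarrow> ('s, 'f, 'r, 'i, 'a) pfm set
     \<Rightarrow> (('i \<Rightarrow> 'a) \<Rightarrow> ('i \<Rightarrow> 'a)) set" where
  "Kgroup M B p = {g \<in> carrier (AutRestr M B p).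
     \<forall>a\<in>realizations M B p. g ` derived_orbit M B p a = derived_orbit M B p a}"

definition H1_equiv ::
  "('s, 'f, 'r, 'a) fo_struct \<Rightarrow> 'a set \<Rightarrow> ('s, 'f, 'r, 'i, 'a) pfm set \<Rightarrow> ('i \<Rightarrow> 'a) rel" where
  "H1_equiv M B p = {(a, b). a \<in> realizations M B p \<and> b \<in> realizations M B p \<and>
     (\<exists>g\<in>Kgroup M B p. b = g a)}"

definition commutator_rel ::
  "('s, 'f, 'r, 'a) fo_struct \<Rightarrow> 'a set \<Rightarrow> ('s, 'f, 'r, 'i, 'a) pfm set \<Rightarrow> ('i \<Rightarrow> 'a) rel" where
  "commutator_rel M B p = {(a, b). a \<in> realizations M B p \<and> b \<in> realizations M B p \<and>
     (\<exists>\<sigma>\<in>AutOver M B. \<exists>\<tau>\<in>AutOver M B.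
        b = (Hilbert_Choice.inv \<sigma> \<circ> Hilbert_Choice.inv \<tau> \<circ> \<sigma> \<circ> \<tau>) \<circ> a)}"

definition H1_dist ::
  "('s, 'f, 'r, 'a) fo_struct \<Rightarrow> 'a set \<Rightarrow> ('s, 'f, 'r, 'i, 'a) pfm set
     \<Rightarrow> ('i \<Rightarrow> 'a) \<Rightarrow> ('i \<Rightarrow> 'a) \<Rightarrow> enat" where
  "H1_dist M B p a b =
     (if (a, b) \<in> H1_equiv M B p then enat (LEAST n. (a, b) \<in> commutator_rel M B p ^^ n) else \<infinity>)"

text \<open>
  The diameter is the largest distance between equivalent realizations (\<open>\<infinity>\<close> if these distances are
  unbounded). Pairs that are not equivalent, which have distance \<open>\<infinity>\<close> by convention, must be left
  out: otherwise a finite diameter would say in addition that there is only one class, and the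
  characterisation of type-definability would fail, e.g. for the circle with its cyclic order and the
  rotations by rational angles, where the relation is infinitesimal closeness.
\<close>

definition H1_diam ::
  "('s, 'f, 'r, 'a) fo_struct \<Rightarrow> 'a set \<Rightarrow> ('s, 'f, 'r, 'i, 'a) pfm set \<Rightarrow> enat" where
  "H1_diam M B p = (SUP (a, b)\<in>H1_equiv M B p. H1_dist M B p a b)"

definition type_definable_on ::
  "('s, 'f, 'r, 'a) fo_struct \<Rightarrow> 'k rel \<Rightarrow> ('i \<Rightarrow> 'a) set \<Rightarrow> ('i \<Rightarrow> 'a) rel \<Rightarrow> bool" where
  "type_definable_on M \<kappa> P E \<longleftrightarrow>
     (\<exists>A (\<Phi> :: ('s, 'f, 'r, 'i + 'i, 'a) pfm set). small \<kappa> A \<and> (\<forall>\<xi>\<in>\<Phi>. params_in A \<xi>) \<and>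
        (\<forall>a\<in>P. \<forall>b\<in>P. (a, b) \<in> E \<longleftrightarrow> (\<forall>\<xi>\<in>\<Phi>. pholds M \<xi> (case_sum a b))))"

end

(* The relation R is type-definable, because b = [s,t](a) only depends on types of pairs, and so are
   its powers R_n, whose union is the H_1-equivalence E. By Ramsey's theorem every definable
   neighbourhood of R is covered by finitely many of its balls.

   Take a maximal filter that is invariant under the automorphisms preserving a set X of realizations; it
   stands for a minimal flow. If some ball of R_n around c in X stays positive for the filter, finitely
   many translates of it cover, and the E-distances in the orbit of c are bounded. If E is type-definable,
   a Baire argument on one class gives such a ball, hence a finite diameter. On the set of all
   realizations, either no such ball exists and the positive sets split into a binary tree whose branches
   are 2^{aleph_0} inequivalent realizations, or there are finitely many classes and a finite diameter; in
   the latter case E is cut out by a definable equivalence relation with finitely many classes, whose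
   codes are algebraic over B, so there is only one class because p is a strong type.

   The classes of E are transferred to homology. Every simplex is a configuration of independent closures in the
   structure together with a choice of automorphisms, and sending an edge to the class of an automorphism
   that carries one end to the other is a homomorphism on 1-chains which kills boundaries; so H_1(p) has at
   least as many elements as E has classes. If there is one class, coning over a vertex independent of
   everything reduces a 1-cycle to differences of two edges with the same ends. These are governed by
   a homomorphism from the automorphism group to H_1(p), which kills commutators and the stabilizer of a
   realization, hence everything. *)
theory Submission
  imports Defs "HOL-Library.Ramsey"
begin

section \<open>Formulas, renaming and automorphisms\<close>

text \<open>Nothing is assumed about the size of the language, so the compact spaces involved need
  not be metrizable and the dichotomies for Borel equivalence relations do not apply. Invariance
  under automorphisms replaces them: E is the union of the increasing closed relations
  \<open>Rn n\<close>, and maximality of the filter makes every positive set syndetic, so a single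
  thick ball bounds distances along an orbit. On the set of all realizations compactness is
  automatic, hence the count of classes needs no type-definability. On one class it has to be
  assumed, and it serves to keep a limit point inside the class. Passing from an orbit to classes
  uses that automorphisms commute up to \<open>Rn 1\<close>.

  In the homology half a vertex is a closed set and does not remember a realization generating it. A
  generator is therefore chosen for each set; the choice does no harm because the edges of a
  triangle share their corners. The assumption on algebraic closures lets an automorphism that fixes
  a realization fix the whole vertex. It serves the upper bound on homology, while the lower bound
  only needs the abelian quotient that measures differences of classes.\<close>

lemma finite_fvt [simp]: "finite (fvt t)"
  by (induction t) auto

lemma finite_fv [simp]: "finite (fv \<phi>)"
  by (induction \<phi>) auto

lemma evalt_cong: "(\<And>v. v \<in> fvt t \<Longrightarrow> e v = e' v) \<Longrightarrow> evalt M e t = evalt M e' t"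
proof (induction t)
  case (Fn f ts)
  then have "map (evalt M e) ts = map (evalt M e') ts"
    by (auto intro!: map_cong)
  then show ?case by (simp only: evalt.simps)
qed auto

lemma sat_cong: "(\<And>v. v \<in> fv \<phi> \<Longrightarrow> e v = e' v) \<Longrightarrow> sat M \<phi> e = sat M \<phi> e'"
proof (induction \<phi> arbitrary: e e')
  case (Eq t u)
  then show ?case using evalt_cong[of t e e' M] evalt_cong[of u e e' M] by simp
next
  case (Rl r ts)
  then have "map (evalt M e) ts = map (evalt M e') ts"
    by (auto intro!: map_cong evalt_cong)
  then show ?case by (simp only: sat.simps)
next
  case (Ex v \<phi>)
  have "sat M \<phi> (e(v := x)) = sat M \<phi> (e'(v := x))" for x
    by (rule Ex.IH) (use Ex.prems in auto)
  then show ?case by simp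
next
  case (Neg \<phi>)
  have "sat M \<phi> e = sat M \<phi> e'" by (rule Neg.IH) (use Neg.prems in simp)
  then show ?case by simp
next
  case (And \<phi> \<psi>)
  have "sat M \<phi> e = sat M \<phi> e'" by (rule And.IH(1)) (use And.prems in simp)
  moreover have "sat M \<psi> e = sat M \<psi> e'" by (rule And.IH(2)) (use And.prems in simp)
  ultimately show ?case by simp
qed

lemma holds_cong: "(\<And>v. v \<in> fv \<phi> \<Longrightarrow> e v = e' v) \<Longrightarrow> holds M \<phi> e = holds M \<phi> e'"
  unfolding holds_def using sat_cong[of \<phi> e e' M] by auto

primrec rename_trm :: "('s var \<Rightarrow> 's var) \<Rightarrow> ('s, 'f) trm \<Rightarrow> ('s, 'f) trm" where
  "rename_trm \<theta> (Var v) = Var (\<theta> v)"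
| "rename_trm \<theta> (Fn f ts) = Fn f (map (rename_trm \<theta>) ts)"

lemma fvt_rename: "fvt (rename_trm \<theta> t) = \<theta> ` fvt t"
  by (induction t) auto

lemma evalt_rename: "evalt M e (rename_trm \<theta> t) = evalt M (e \<circ> \<theta>) t"
proof (induction t)
  case (Fn f ts)
  then have "map (evalt M e \<circ> rename_trm \<theta>) ts = map (evalt M (e \<circ> \<theta>)) ts"
    by (auto simp: o_def)
  then show ?case by (simp only: evalt.simps rename_trm.simps map_map)
qed auto

lemma trm_sort_rename: "\<forall>v\<in>fvt t. snd (\<theta> v) = snd v \<Longrightarrow> trm_sort M (rename_trm \<theta> t) = trm_sort M t"
  by (cases t) auto

lemma wft_rename: "\<forall>v\<in>fvt t. snd (\<theta> v) = snd v \<Longrightarrow> wft M (rename_trm \<theta> t) = wft M t"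
proof (induction t)
  case (Fn f ts)
  have 1: "list_all id (map (wft M) (map (rename_trm \<theta>) ts)) = list_all id (map (wft M) ts)"
    using Fn by (auto simp: list_all_iff)
  have 2: "map (trm_sort M) (map (rename_trm \<theta>) ts) = map (trm_sort M) ts"
    using Fn.prems by (auto simp: trm_sort_rename)
  show ?case using 1 2 by (simp only: wft.simps rename_trm.simps)
qed auto

text \<open>Renaming need not be injective, so bound variables have to be refreshed; an existence
  statement suffices.\<close>

lemma rename_fm:
  fixes \<phi> :: "('s, 'f, 'r) fm" and M :: "('s, 'f, 'r, 'a) fo_struct"
  assumes "\<forall>v\<in>fv \<phi>. snd (\<theta> v) = snd v"
  shows "\<exists>\<phi>' :: ('s, 'f, 'r) fm. wf_fm M \<phi>' = wf_fm M \<phi> \<and> fv \<phi>' = \<theta> ` fv \<phi> \<and>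
           (\<forall>e. sat M \<phi>' e = sat M \<phi> (e \<circ> \<theta>))"
  using assms
proof (induction \<phi> arbitrary: \<theta>)
  case (Eq t u)
  show ?case
    by (rule exI[of _ "Eq (rename_trm \<theta> t) (rename_trm \<theta> u)"])
       (use Eq in \<open>auto simp: fvt_rename wft_rename evalt_rename trm_sort_rename o_def\<close>)
next
  case (Rl r ts)
  have "map (trm_sort M \<circ> rename_trm \<theta>) ts = map (trm_sort M) ts"
    using Rl by (auto simp: trm_sort_rename)
  moreover have "map (evalt M e \<circ> rename_trm \<theta>) ts = map (evalt M (e \<circ> \<theta>)) ts" for e
    by (auto simp: evalt_rename)
  ultimately show ?case
    by (intro exI[of _ "Rl r (map (rename_trm \<theta>) ts)"])
       (use Rl in \<open>auto simp: fvt_rename wft_rename list_all_iff o_def cong: map_cong\<close>)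
next
  case (Neg \<phi>)
  from Neg.prems have "\<forall>v\<in>fv \<phi>. snd (\<theta> v) = snd v" by simp
  from Neg.IH[OF this] obtain \<phi>' :: "('s, 'f, 'r) fm" where
    "wf_fm M \<phi>' = wf_fm M \<phi>" "fv \<phi>' = \<theta> ` fv \<phi>" "\<forall>e. sat M \<phi>' e = sat M \<phi> (e \<circ> \<theta>)" by blast
  then show ?case by (intro exI[of _ "Neg \<phi>'"]) (auto simp: o_def)
next
  case (And \<phi> \<psi>)
  from And.prems have p: "\<forall>v\<in>fv \<phi>. snd (\<theta> v) = snd v" "\<forall>v\<in>fv \<psi>. snd (\<theta> v) = snd v" by auto
  from And.IH(1)[OF p(1)] obtain \<phi>' :: "('s, 'f, 'r) fm" where
    "wf_fm M \<phi>' = wf_fm M \<phi>" "fv \<phi>' = \<theta> ` fv \<phi>" "\<forall>e. sat M \<phi>' e = sat M \<phi> (e \<circ> \<theta>)" by blast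
  moreover from And.IH(2)[OF p(2)] obtain \<psi>' :: "('s, 'f, 'r) fm" where
    "wf_fm M \<psi>' = wf_fm M \<psi>" "fv \<psi>' = \<theta> ` fv \<psi>" "\<forall>e. sat M \<psi>' e = sat M \<psi> (e \<circ> \<theta>)" by blast
  ultimately show ?case by (intro exI[of _ "And \<phi>' \<psi>'"]) (auto simp: o_def)
next
  case (Ex v \<phi>)
  have "finite (fst ` \<theta> ` (fv \<phi> - {v}))" by simp
  then obtain n where n: "n \<notin> fst ` \<theta> ` (fv \<phi> - {v})" using ex_new_if_finite[OF infinite_UNIV_nat] by blast
  define v' where "v' = (n, snd v)"
  have v': "v' \<notin> \<theta> ` (fv \<phi> - {v})" using n unfolding v'_def by (metis fst_conv imageI)
  have "\<forall>w\<in>fv \<phi>. snd ((\<theta>(v := v')) w) = snd w"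
    using Ex.prems by (auto simp: v'_def)
  from Ex.IH[OF this] obtain \<phi>' :: "('s, 'f, 'r) fm" where
    \<phi>': "wf_fm M \<phi>' = wf_fm M \<phi>" "fv \<phi>' = \<theta>(v := v') ` fv \<phi>" "\<forall>e. sat M \<phi>' e = sat M \<phi> (e \<circ> \<theta>(v := v'))"
    by blast
  have fv': "fv \<phi>' - {v'} = \<theta> ` (fv \<phi> - {v})"
    unfolding \<phi>'(2) using v' by auto
  have "sat M \<phi> (e(v' := x) \<circ> \<theta>(v := v')) = sat M \<phi> ((e \<circ> \<theta>)(v := x))" for e x
    by (rule sat_cong) (use v' in auto)
  then have "sat M (Ex v' \<phi>') e = sat M (Ex v \<phi>) (e \<circ> \<theta>)" for e
    using \<phi>'(3) by (simp add: v'_def)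
  moreover have "wf_fm M (Ex v' \<phi>') = wf_fm M (Ex v \<phi>)" "fv (Ex v' \<phi>') = \<theta> ` fv (Ex v \<phi>)"
    using \<phi>' fv' by simp_all
  ultimately show ?case by blast
qed

section \<open>Invariance of terms and formulas under automorphisms\<close>

lemma Aut_bij: "\<sigma> \<in> Aut M \<Longrightarrow> bij \<sigma>" and Aut_srt: "\<sigma> \<in> Aut M \<Longrightarrow> srt M (\<sigma> x) = srt M x"
  by (auto simp: Aut_def)

text \<open>Sorts and commutation are proved together, because an automorphism respects a function
  symbol only at arguments of the right sorts.\<close>

lemma evalt_Aut:
  assumes "wf_struct M" "\<sigma> \<in> Aut M" "wft M t" "\<forall>v\<in>fvt t. srt M (e v) = snd v"
  shows "srt M (evalt M e t) = trm_sort M t \<and> evalt M (\<sigma> \<circ> e) t = \<sigma> (evalt M e t)"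
  using assms(3,4)
proof (induction t)
  case (Fn f ts)
  have IH: "srt M (evalt M e t) = trm_sort M t" "evalt M (\<sigma> \<circ> e) t = \<sigma> (evalt M e t)" if "t \<in> set ts" for t
    using Fn.IH[OF that] Fn.prems that by (auto simp: list_all_iff o_def)
  have 1: "map (srt M) (map (evalt M e) ts) = fdom M f"
    using Fn.prems IH by (auto simp: o_def cong: map_cong)
  have 2: "map (evalt M (\<sigma> \<circ> e)) ts = map \<sigma> (map (evalt M e) ts)"
    using IH by simp
  have 3: "srt M (fnI M f xs) = fcod M f" "\<sigma> (fnI M f xs) = fnI M f (map \<sigma> xs)"
    if "map (srt M) xs = fdom M f" for xs
    using assms(1,2) that unfolding wf_struct_def Aut_def by blast+
  show ?case
    unfolding evalt.simps trm_sort.simps 2 3[OF 1] by simp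
qed auto

lemma sat_Aut:
  assumes "wf_struct M" "\<sigma> \<in> Aut M" "wf_fm M \<phi>" "\<forall>v\<in>fv \<phi>. srt M (e v) = snd v"
  shows "sat M \<phi> (\<sigma> \<circ> e) = sat M \<phi> e"
  using assms(3,4)
proof (induction \<phi> arbitrary: e)
  case (Eq t u)
  then have "evalt M (\<sigma> \<circ> e) t = \<sigma> (evalt M e t)" "evalt M (\<sigma> \<circ> e) u = \<sigma> (evalt M e u)"
    using evalt_Aut[OF assms(1,2)] by auto
  then show ?case using Aut_bij[OF assms(2)] by (simp add: bij_def inj_eq o_def)
next
  case (Rl r ts)
  have IH: "srt M (evalt M e t) = trm_sort M t" "evalt M (\<sigma> \<circ> e) t = \<sigma> (evalt M e t)" if "t \<in> set ts" for t
    using evalt_Aut[OF assms(1,2)] Rl.prems that by (auto simp: list_all_iff)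
  have 1: "map (srt M) (map (evalt M e) ts) = rdom M r"
    using Rl.prems IH by (auto simp: o_def cong: map_cong)
  have 2: "map (evalt M (\<sigma> \<circ> e)) ts = map \<sigma> (map (evalt M e) ts)"
    using IH by simp
  have 3: "map \<sigma> xs \<in> relI M r \<longleftrightarrow> xs \<in> relI M r" if "map (srt M) xs = rdom M r" for xs
    using assms(2) that unfolding Aut_def by blast
  show ?case
    unfolding sat.simps 2 3[OF 1] by simp
next
  case (Neg \<phi>)
  then show ?case by (metis fv.simps(3) sat.simps(3) wf_fm.simps(3))
next
  case (And \<phi> \<psi>)
  then have "sat M \<phi> (\<sigma> \<circ> e) = sat M \<phi> e" "sat M \<psi> (\<sigma> \<circ> e) = sat M \<psi> e"
    by (auto simp: o_def)
  then show ?case by (simp add: o_def)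
next
  case (Ex v \<phi>)
  have *: "sat M \<phi> ((\<sigma> \<circ> e)(v := \<sigma> x)) = sat M \<phi> (e(v := x))" if "srt M x = snd v" for x
  proof -
    have "sat M \<phi> (\<sigma> \<circ> e(v := x)) = sat M \<phi> (e(v := x))"
      by (rule Ex.IH) (use Ex.prems that in auto)
    moreover have "\<sigma> \<circ> e(v := x) = (\<sigma> \<circ> e)(v := \<sigma> x)" by auto
    ultimately show ?thesis by simp
  qed
  show ?case
  proof
    assume "sat M (Ex v \<phi>) (\<sigma> \<circ> e)"
    then obtain y where y: "srt M y = snd v" "sat M \<phi> ((\<sigma> \<circ> e)(v := y))" by auto
    obtain x where "y = \<sigma> x" using Aut_bij[OF assms(2)] by (metis bij_pointE)
    with y * Aut_srt[OF assms(2)] show "sat M (Ex v \<phi>) e" by auto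
  next
    assume "sat M (Ex v \<phi>) e"
    then obtain x where "srt M x = snd v" "sat M \<phi> (e(v := x))" by auto
    with * have "srt M (\<sigma> x) = snd v \<and> sat M \<phi> ((\<sigma> \<circ> e)(v := \<sigma> x))"
      using Aut_srt[OF assms(2)] by auto
    then show "sat M (Ex v \<phi>) (\<sigma> \<circ> e)" unfolding sat.simps by blast
  qed
qed

lemma holds_Aut:
  assumes "wf_struct M" "\<sigma> \<in> Aut M"
  shows "holds M \<phi> (\<sigma> \<circ> e) = holds M \<phi> e"
  unfolding holds_def using sat_Aut[OF assms] Aut_srt[OF assms(2)] by auto

lemma Aut_id: "id \<in> Aut M"
  by (auto simp: Aut_def)

lemma Aut_comp: "\<sigma> \<in> Aut M \<Longrightarrow> \<tau> \<in> Aut M \<Longrightarrow> \<sigma> \<circ> \<tau> \<in> Aut M"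
proof -
  assume a: "\<sigma> \<in> Aut M" "\<tau> \<in> Aut M"
  then have "map (srt M) (map \<tau> xs) = map (srt M) xs" for xs by (simp add: Aut_srt)
  then show ?thesis using a unfolding Aut_def
    by (auto simp: bij_comp map_map[symmetric] simp del: map_map)
qed

lemma Aut_inv:
  assumes "\<sigma> \<in> Aut M" shows "Hilbert_Choice.inv \<sigma> \<in> Aut M"
proof -
  let ?i = "Hilbert_Choice.inv \<sigma>"
  have b: "bij \<sigma>" using assms by (rule Aut_bij)
  have c: "\<sigma> (?i x) = x" "?i (\<sigma> x) = x" for x using b by (simp_all add: bij_is_surj surj_f_inv_f bij_is_inj)
  have s: "srt M (?i x) = srt M x" for x using Aut_srt[OF assms, of "?i x"] c by simp
  have m: "map \<sigma> (map ?i xs) = xs" for xs by (simp add: o_def c)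
  have t: "map (srt M) (map ?i xs) = map (srt M) xs" for xs using s by simp
  have "?i (fnI M f xs) = fnI M f (map ?i xs)" if "map (srt M) xs = fdom M f" for f xs
  proof -
    have "\<sigma> (fnI M f (map ?i xs)) = fnI M f xs"
      using assms that t[of xs] m[of xs] unfolding Aut_def by auto
    then show ?thesis using c by metis
  qed
  moreover have "map ?i xs \<in> relI M r \<longleftrightarrow> xs \<in> relI M r" if "map (srt M) xs = rdom M r" for r xs
  proof -
    have "\<forall>r xs. map (srt M) xs = rdom M r \<longrightarrow> (map \<sigma> xs \<in> relI M r \<longleftrightarrow> xs \<in> relI M r)"
      using assms unfolding Aut_def by blast
    from this[rule_format, of "map ?i xs" r] show ?thesis using that t[of xs] m[of xs] by simp
  qed
  ultimately show ?thesis using s b unfolding Aut_def by (auto simp: bij_imp_bij_inv)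
qed

lemma AutOver_id [simp]: "id \<in> AutOver M B"
  and AutOver_comp: "\<sigma> \<in> AutOver M B \<Longrightarrow> \<tau> \<in> AutOver M B \<Longrightarrow> \<sigma> \<circ> \<tau> \<in> AutOver M B"
  and AutOver_bij: "\<sigma> \<in> AutOver M B \<Longrightarrow> bij \<sigma>"
  and AutOver_Aut: "\<sigma> \<in> AutOver M B \<Longrightarrow> \<sigma> \<in> Aut M"
  by (auto simp: AutOver_def Aut_id Aut_comp Aut_bij)

lemma AutOver_inv: "\<sigma> \<in> AutOver M B \<Longrightarrow> Hilbert_Choice.inv \<sigma> \<in> AutOver M B"
  by (auto simp: AutOver_def Aut_inv) (metis Aut_bij bij_inv_eq_iff)

lemma AutOver_inv_comp: 
  assumes "\<sigma> \<in> AutOver M B"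
  shows "Hilbert_Choice.inv \<sigma> (\<sigma> x) = x" "\<sigma> (Hilbert_Choice.inv \<sigma> x) = x"
    "Hilbert_Choice.inv \<sigma> \<circ> \<sigma> = id" "\<sigma> \<circ> Hilbert_Choice.inv \<sigma> = id"
  using AutOver_bij[OF assms] by (auto simp: bij_is_inj bij_is_surj surj_f_inv_f fun_eq_iff)

section \<open>Definable sets of tuples\<close>

definition tuples_of :: "('s, 'f, 'r, 'a) fo_struct \<Rightarrow> ('j \<Rightarrow> 's) \<Rightarrow> ('j \<Rightarrow> 'a) set" where
  "tuples_of M s = {f. \<forall>j. srt M (f j) = s j}"

lemma tuples_of_upd [simp]: "f \<in> tuples_of M s \<Longrightarrow> srt M x = s j \<Longrightarrow> f(j := x) \<in> tuples_of M s"
  and tuples_of_srt: "f \<in> tuples_of M s \<Longrightarrow> srt M (f j) = s j"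
  and tuples_of_Aut: "\<sigma> \<in> Aut M \<Longrightarrow> \<sigma> \<circ> f \<in> tuples_of M s \<longleftrightarrow> f \<in> tuples_of M s"
  and tuples_of_mix [simp]: "f \<in> tuples_of M s \<Longrightarrow> g \<in> tuples_of M s \<Longrightarrow> (\<lambda>j. if Q j then g j else f j) \<in> tuples_of M s"
  by (auto simp: tuples_of_def Aut_srt)

text \<open>Definability only concerns the tuples whose coordinates have the sorts \<open>s\<close>; outside of them a
  definable set is arbitrary.\<close>

definition var_ok ::
  "('s, 'f, 'r, 'a) fo_struct \<Rightarrow> ('j \<Rightarrow> 's) \<Rightarrow> 'j set \<Rightarrow> 'a set \<Rightarrow> ('s var \<Rightarrow> 'j + 'a) \<Rightarrow> ('s, 'f, 'r) fm \<Rightarrow> bool" where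
  "var_ok M s J A \<rho> \<phi> \<longleftrightarrow>
     (\<forall>v\<in>fv \<phi>. case \<rho> v of Inl j \<Rightarrow> j \<in> J \<and> s j = snd v | Inr a \<Rightarrow> a \<in> A \<and> srt M a = snd v)"

definition dset :: "('s, 'f, 'r, 'a) fo_struct \<Rightarrow> ('j \<Rightarrow> 's) \<Rightarrow> 'j set \<Rightarrow> 'a set \<Rightarrow> ('j \<Rightarrow> 'a) set \<Rightarrow> bool" where
  "dset M s J A X \<longleftrightarrow> (\<exists>\<phi> \<rho>. wf_fm M \<phi> \<and> var_ok M s J A \<rho> \<phi> \<and>
     (\<forall>f\<in>tuples_of M s. f \<in> X \<longleftrightarrow> sat M \<phi> (case_sum f id \<circ> \<rho>)))"

lemma dsetI:
  assumes "wf_fm M \<phi>" "var_ok M s J A \<rho> \<phi>"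
    "\<And>f. f \<in> tuples_of M s \<Longrightarrow> f \<in> X \<longleftrightarrow> sat M \<phi> (case_sum f id \<circ> \<rho>)"
  shows "dset M s J A X"
  using assms unfolding dset_def by blast

lemma var_ok_srt:
  assumes "var_ok M s J A \<rho> \<phi>" "f \<in> tuples_of M s" "v \<in> fv \<phi>"
  shows "srt M (case_sum f id (\<rho> v)) = snd v"
  using assms unfolding var_ok_def tuples_of_def by (cases "\<rho> v") force+

lemma dset_mono: "dset M s J A X \<Longrightarrow> J \<subseteq> J' \<Longrightarrow> A \<subseteq> A' \<Longrightarrow> dset M s J' A' X"
proof -
  assume a: "dset M s J A X" "J \<subseteq> J'" "A \<subseteq> A'"
  have "var_ok M s J A \<rho> \<phi> \<Longrightarrow> var_ok M s J' A' \<rho> \<phi>" for \<rho> \<phi>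
    using a(2,3) unfolding var_ok_def by (auto split: sum.splits)
  then show "dset M s J' A' X" using a(1) unfolding dset_def by blast
qed

lemma dset_cong: "dset M s J A X \<Longrightarrow> (\<And>f. f \<in> tuples_of M s \<Longrightarrow> f \<in> Y \<longleftrightarrow> f \<in> X) \<Longrightarrow> dset M s J A Y"
  unfolding dset_def by blast

text \<open>A formula has finitely many free variables, hence meets finitely many coordinates and
  parameters. This lets infinite tuples be handled by finite quantification.\<close>

lemma dset_finite:
  assumes "dset M s J A X"
  obtains J0 A0 where "finite J0" "J0 \<subseteq> J" "finite A0" "A0 \<subseteq> A" "dset M s J0 A0 X"
proof -
  from assms obtain \<phi> \<rho> where *: "wf_fm M \<phi>" "var_ok M s J A \<rho> \<phi>"
    "\<forall>f\<in>tuples_of M s. f \<in> X \<longleftrightarrow> sat M \<phi> (case_sum f id \<circ> \<rho>)" unfolding dset_def by blast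
  let ?J = "{j. Inl j \<in> \<rho> ` fv \<phi>}" and ?A = "{a. Inr a \<in> \<rho> ` fv \<phi>}"
  have "finite ?J" "finite ?A"
    by (auto intro!: finite_inverse_image injI)
  moreover have "?J \<subseteq> J" "?A \<subseteq> A"
    using *(2) unfolding var_ok_def by (force split: sum.splits)+
  moreover have "var_ok M s ?J ?A \<rho> \<phi>"
    unfolding var_ok_def
  proof
    fix v assume v: "v \<in> fv \<phi>"
    then show "case \<rho> v of Inl j \<Rightarrow> j \<in> ?J \<and> s j = snd v | Inr a \<Rightarrow> a \<in> ?A \<and> srt M a = snd v"
      using *(2) unfolding var_ok_def by (cases "\<rho> v") (force simp: image_iff)+
  qed
  ultimately show ?thesis using that * by (blast intro: dsetI)
qed

lemma dset_support:
  assumes "dset M s J A X" "f \<in> tuples_of M s" "g \<in> tuples_of M s" "\<And>j. j \<in> J \<Longrightarrow> f j = g j"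
  shows "f \<in> X \<longleftrightarrow> g \<in> X"
proof -
  from assms obtain \<phi> \<rho> where *: "wf_fm M \<phi>" "var_ok M s J A \<rho> \<phi>"
    "\<forall>f\<in>tuples_of M s. f \<in> X \<longleftrightarrow> sat M \<phi> (case_sum f id \<circ> \<rho>)" unfolding dset_def by blast
  have "sat M \<phi> (case_sum f id \<circ> \<rho>) = sat M \<phi> (case_sum g id \<circ> \<rho>)"
    by (rule sat_cong) (use *(2) assms(4) in \<open>auto simp: var_ok_def split: sum.splits\<close>)
  then show ?thesis using * assms by blast
qed

lemma dset_Aut:
  assumes "dset M s J A X" "wf_struct M" "\<sigma> \<in> AutOver M A" "f \<in> tuples_of M s"
  shows "\<sigma> \<circ> f \<in> X \<longleftrightarrow> f \<in> X"
proof -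
  from assms obtain \<phi> \<rho> where *: "wf_fm M \<phi>" "var_ok M s J A \<rho> \<phi>"
    "\<forall>f\<in>tuples_of M s. f \<in> X \<longleftrightarrow> sat M \<phi> (case_sum f id \<circ> \<rho>)" unfolding dset_def by blast
  have \<sigma>: "\<sigma> \<in> Aut M" "\<forall>x\<in>A. \<sigma> x = x" using assms(3) by (auto simp: AutOver_def)
  have "sat M \<phi> (case_sum (\<sigma> \<circ> f) id \<circ> \<rho>) = sat M \<phi> (\<sigma> \<circ> (case_sum f id \<circ> \<rho>))"
    by (rule sat_cong) (use *(2) \<sigma>(2) in \<open>auto simp: var_ok_def split: sum.splits\<close>)
  also have "\<dots> = sat M \<phi> (case_sum f id \<circ> \<rho>)"
    by (rule sat_Aut) (use assms \<sigma> * var_ok_srt[OF *(2) assms(4)] in auto)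
  finally show ?thesis using * assms \<sigma> by (simp add: tuples_of_Aut)
qed

section \<open>Boolean operations, substitution and projection\<close>

lemma dset_Compl:
  assumes "dset M s J A X"
  shows "dset M s J A (- X)"
proof -
  from assms obtain \<phi> \<rho> where 1: "wf_fm M \<phi>" "var_ok M s J A \<rho> \<phi>"
    "\<And>f. f \<in> tuples_of M s \<Longrightarrow> f \<in> X \<longleftrightarrow> sat M \<phi> (case_sum f id \<circ> \<rho>)" unfolding dset_def by blast
  show ?thesis
    by (rule dsetI[of _ "Neg \<phi>" _ _ _ \<rho>]) (use 1 in \<open>auto simp: var_ok_def\<close>)
qed

lemma dset_Int:
  fixes M :: "('s, 'f, 'r, 'a) fo_struct"
  assumes "dset M s J A X" "dset M s J A Y"
  shows "dset M s J A (X \<inter> Y)"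
proof -
  from assms(1) obtain \<phi> \<rho> where 1: "wf_fm M \<phi>" "var_ok M s J A \<rho> \<phi>"
    "\<And>f. f \<in> tuples_of M s \<Longrightarrow> f \<in> X \<longleftrightarrow> sat M \<phi> (case_sum f id \<circ> \<rho>)" unfolding dset_def by blast
  from assms(2) obtain \<psi> \<pi> where 2: "wf_fm M \<psi>" "var_ok M s J A \<pi> \<psi>"
    "\<And>f. f \<in> tuples_of M s \<Longrightarrow> f \<in> Y \<longleftrightarrow> sat M \<psi> (case_sum f id \<circ> \<pi>)" unfolding dset_def by blast
  \<comment> \<open>The two formulas may use one variable for different coordinates. Their variables
    are moved to even and odd indices, and \<open>\<chi>\<close> is glued from the two
    assignments.\<close>
  define a b where "a = (\<lambda>v :: 's var. (2 * fst v, snd v))" and "b = (\<lambda>v :: 's var. (2 * fst v + 1, snd v))"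
  define \<chi> where "\<chi> = (\<lambda>v :: 's var. (if even (fst v) then \<rho> else \<pi>) (fst v div 2, snd v))"
  have \<chi>: "\<chi> \<circ> a = \<rho>" "\<chi> \<circ> b = \<pi>" by (auto simp: \<chi>_def a_def b_def)
  have \<chi>': "\<chi> (a v) = \<rho> v" "\<chi> (b v) = \<pi> v" for v by (auto simp: \<chi>_def a_def b_def)
  obtain \<phi>' where \<phi>': "wf_fm M \<phi>' = wf_fm M \<phi>" "fv \<phi>' = a ` fv \<phi>" "\<And>e. sat M \<phi>' e = sat M \<phi> (e \<circ> a)"
    using rename_fm[of \<phi> a M] by (auto simp: a_def)
  obtain \<psi>' where \<psi>': "wf_fm M \<psi>' = wf_fm M \<psi>" "fv \<psi>' = b ` fv \<psi>" "\<And>e. sat M \<psi>' e = sat M \<psi> (e \<circ> b)"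
    using rename_fm[of \<psi> b M] by (auto simp: b_def)
  show ?thesis
  proof (rule dsetI[of _ "And \<phi>' \<psi>'" _ _ _ \<chi>])
    show "wf_fm M (And \<phi>' \<psi>')" using 1 2 \<phi>' \<psi>' by simp
    have sn: "snd (a v) = snd v" "snd (b v) = snd v" for v by (auto simp: a_def b_def)
    show "var_ok M s J A \<chi> (And \<phi>' \<psi>')"
      using 1(2) 2(2) unfolding var_ok_def fv.simps \<phi>'(2) \<psi>'(2) ball_Un ball_simps \<chi>' sn by blast
    show "f \<in> X \<inter> Y \<longleftrightarrow> sat M (And \<phi>' \<psi>') (case_sum f id \<circ> \<chi>)" if "f \<in> tuples_of M s" for f
      using 1(3)[OF that] 2(3)[OF that] by (simp add: \<phi>' \<psi>' comp_assoc \<chi>)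
  qed
qed

lemma dset_UNIV:
  fixes M :: "('s, 'f, 'r, 'a) fo_struct"
  shows "dset M s J A UNIV"
proof -
  fix v :: "'s var"
  \<comment> \<open>A sentence, so that the claim holds even if \<open>J\<close> and
    \<open>A\<close> are empty.\<close>
  let ?\<chi> = "Ex v (Eq (Var v) (Var v))"
  show ?thesis
    by (rule dsetI[where \<phi> = "Neg (And ?\<chi> (Neg ?\<chi>))" and \<rho> = undefined]) (auto simp: var_ok_def)
qed

lemma dset_empty: "dset M s J A {}"
  using dset_Compl[OF dset_UNIV] by simp

lemma dset_conj:
  assumes "dset M s J A {f. Q f}" "dset M s J A {f. Q' f}"
  shows "dset M s J A {f. Q f \<and> Q' f}"
  using dset_Int[OF assms] by (simp add: Int_def)

lemma dset_not: "dset M s J A {f. Q f} \<Longrightarrow> dset M s J A {f. \<not> Q f}"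
  using dset_Compl[of M s J A "{f. Q f}"] by (simp add: Collect_neg_eq)

lemma dset_imp:
  assumes "dset M s J A {f. Q f}" "dset M s J A {f. Q' f}"
  shows "dset M s J A {f. Q f \<longrightarrow> Q' f}"
  using dset_not[OF dset_conj[OF assms(1) dset_not[OF assms(2)]]] by simp

lemma dset_iff:
  assumes "dset M s J A {f. Q f}" "dset M s J A {f. Q' f}"
  shows "dset M s J A {f. Q f \<longleftrightarrow> Q' f}"
  using dset_conj[OF dset_imp[OF assms] dset_imp[OF assms(2,1)]] by (simp add: iff_conv_conj_imp)

lemma dset_ball_finite:
  assumes "finite I" "\<And>i. i \<in> I \<Longrightarrow> dset M s J A {f. Q i f}"
  shows "dset M s J A {f. \<forall>i\<in>I. Q i f}"
  using assms by (induction I rule: finite_induct) (auto simp: dset_UNIV intro!: dset_conj)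

lemma dset_Inter_finite:
  assumes "finite \<X>" "\<And>X. X \<in> \<X> \<Longrightarrow> dset M s J A X"
  shows "dset M s J A (\<Inter>\<X>)"
  using assms by (induction \<X> rule: finite_induct) (auto simp: dset_UNIV intro!: dset_Int)

lemma dset_eq:
  assumes "j \<in> J" "k \<in> J" "s j = s k"
  shows "dset M s J A {f. f j = f k}"
  by (rule dsetI[where \<phi> = "Eq (Var (0, s j)) (Var (1, s j))" and
        \<rho> = "\<lambda>v. if fst v = 0 then Inl j else Inl k"]) (use assms in \<open>auto simp: var_ok_def\<close>)

lemma dset_eq_param:
  assumes "j \<in> J" "b \<in> A" "s j = srt M b"
  shows "dset M s J A {f. f j = b}"
  by (rule dsetI[where \<phi> = "Eq (Var (0, s j)) (Var (1, s j))" and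
        \<rho> = "\<lambda>v. if fst v = 0 then Inl j else Inr b"]) (use assms in \<open>auto simp: var_ok_def\<close>)

text \<open>The map \<open>h\<close> may identify coordinates, so this covers diagonal substitution
  as well as adding dummy coordinates.\<close>

lemma dset_reindex:
  assumes "dset M s J A X" "\<And>j. s' (h j) = s j" "h ` J \<subseteq> J'"
  shows "dset M s' J' A {f. f \<circ> h \<in> X}"
proof -
  from assms(1) obtain \<phi> \<rho> where *: "wf_fm M \<phi>" "var_ok M s J A \<rho> \<phi>"
    "\<And>f. f \<in> tuples_of M s \<Longrightarrow> f \<in> X \<longleftrightarrow> sat M \<phi> (case_sum f id \<circ> \<rho>)" unfolding dset_def by blast
  have c: "case_sum f id \<circ> (map_sum h id \<circ> \<rho>) = case_sum (f \<circ> h) id \<circ> \<rho>" for f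
    by (auto simp: fun_eq_iff map_sum_def split: sum.splits)
  show ?thesis
  proof (rule dsetI[OF *(1), where \<rho> = "map_sum h id \<circ> \<rho>"])
    show "var_ok M s' J' A (map_sum h id \<circ> \<rho>) \<phi>"
      unfolding var_ok_def
    proof
      fix v assume "v \<in> fv \<phi>"
      then show "case (map_sum h id \<circ> \<rho>) v of Inl j \<Rightarrow> j \<in> J' \<and> s' j = snd v
          | Inr a \<Rightarrow> a \<in> A \<and> srt M a = snd v"
        using *(2) assms(2,3) unfolding var_ok_def by (cases "\<rho> v") force+
    qed
    show "f \<in> {f. f \<circ> h \<in> X} \<longleftrightarrow> sat M \<phi> (case_sum f id \<circ> (map_sum h id \<circ> \<rho>))"
      if "f \<in> tuples_of M s'" for f
    proof -
      have "f \<circ> h \<in> tuples_of M s" using that assms(2) by (simp add: tuples_of_def)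
      from *(3)[OF this] show ?thesis unfolding c by blast
    qed
  qed
qed

text \<open>The new parameters are only the values at \<open>J \<inter> K\<close>. In the coding of
  classes this keeps them inside the base \<open>B\<close>.\<close>

lemma dset_specialize:
  assumes "dset M s J A X" "g \<in> tuples_of M s"
  shows "dset M s (J - K) (A \<union> g ` (J \<inter> K)) {f. (\<lambda>j. if j \<in> K then g j else f j) \<in> X}"
proof -
  from assms(1) obtain \<phi> \<rho> where *: "wf_fm M \<phi>" "var_ok M s J A \<rho> \<phi>"
    "\<And>f. f \<in> tuples_of M s \<Longrightarrow> f \<in> X \<longleftrightarrow> sat M \<phi> (case_sum f id \<circ> \<rho>)" unfolding dset_def by blast
  let ?\<rho> = "case_sum (\<lambda>j. if j \<in> K then Inr (g j) else Inl j) Inr \<circ> \<rho>"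
  have c: "case_sum f id \<circ> ?\<rho> = case_sum (\<lambda>j. if j \<in> K then g j else f j) id \<circ> \<rho>" for f
    by (auto simp: fun_eq_iff split: sum.splits)
  show ?thesis
  proof (rule dsetI[OF *(1), where \<rho> = ?\<rho>])
    show "var_ok M s (J - K) (A \<union> g ` (J \<inter> K)) ?\<rho> \<phi>"
      using *(2) assms(2) unfolding var_ok_def by (auto simp: tuples_of_srt split: sum.splits)
    show "f \<in> {f. (\<lambda>j. if j \<in> K then g j else f j) \<in> X} \<longleftrightarrow> sat M \<phi> (case_sum f id \<circ> ?\<rho>)"
      if "f \<in> tuples_of M s" for f
      using *(3)[OF tuples_of_mix[OF that assms(2), where Q = "\<lambda>j. j \<in> K"]] unfolding c by blast
  qed
qed

text \<open>The inverse of specialization: parameters become coordinates \<open>Inr a\<close>, since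
  imaginaries are available only for relations definable without parameters.\<close>

lemma dset_generalize:
  assumes "dset M s J A X"
  shows "\<exists>Y. dset M (case_sum s (srt M)) (Inl ` J \<union> Inr ` A) {} Y \<and>
    (\<forall>f\<in>tuples_of M s. case_sum f id \<in> Y \<longleftrightarrow> f \<in> X)"
proof -
  from assms(1) obtain \<phi> \<rho> where *: "wf_fm M \<phi>" "var_ok M s J A \<rho> \<phi>"
    "\<And>f. f \<in> tuples_of M s \<Longrightarrow> f \<in> X \<longleftrightarrow> sat M \<phi> (case_sum f id \<circ> \<rho>)" unfolding dset_def by blast
  let ?\<rho> = "Inl \<circ> \<rho>"
  have c: "case_sum g id \<circ> ?\<rho> = g \<circ> \<rho>" for g
    by (auto simp: fun_eq_iff)
  show ?thesis
  proof (intro exI conjI ballI)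
    show "dset M (case_sum s (srt M)) (Inl ` J \<union> Inr ` A) {} {g. sat M \<phi> (g \<circ> \<rho>)}"
    proof (rule dsetI[OF *(1), where \<rho> = ?\<rho>])
      show "var_ok M (case_sum s (srt M)) (Inl ` J \<union> Inr ` A) {} ?\<rho> \<phi>"
        using *(2) by (auto simp: var_ok_def split: sum.splits)
    qed (unfold c, blast)
  qed (simp add: *(3))
qed

lemma dset_one_var:
  assumes "dset M s J A X" "f \<in> tuples_of M s"
  obtains \<phi> e where "e ` (fv \<phi> - {(0, s j)}) \<subseteq> A \<union> f ` (J - {j})"
    "\<And>x. holds M \<phi> (e((0, s j) := x)) \<longleftrightarrow> srt M x = s j \<and> f(j := x) \<in> X"
proof -
  from assms(1) obtain \<phi> \<rho> where *: "wf_fm M \<phi>" "var_ok M s J A \<rho> \<phi>"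
    "\<And>f. f \<in> tuples_of M s \<Longrightarrow> f \<in> X \<longleftrightarrow> sat M \<phi> (case_sum f id \<circ> \<rho>)" unfolding dset_def by blast
  let ?v = "(0, s j) :: nat \<times> 'a"
  \<comment> \<open>Several variables may stand for the coordinate \<open>j\<close>. They are merged
    into index 0, and all others are shifted away from it.\<close>
  define \<theta> where "\<theta> = (\<lambda>v. if \<rho> v = Inl j \<and> v \<in> fv \<phi> then ?v else (Suc (fst v), snd v))"
  have "\<forall>v\<in>fv \<phi>. snd (\<theta> v) = snd v" using *(2) by (auto simp: \<theta>_def var_ok_def)
  from rename_fm[OF this, of M] obtain \<phi>' where \<phi>': "wf_fm M \<phi>' = wf_fm M \<phi>" "fv \<phi>' = \<theta> ` fv \<phi>"
    "\<And>e. sat M \<phi>' e = sat M \<phi> (e \<circ> \<theta>)" by blast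
  define e where "e = (\<lambda>w. case_sum f id (\<rho> (fst w - 1, snd w)))"
  \<comment> \<open>The added conjunct keeps \<open>?v\<close> free even if \<open>j\<close> does
    not occur, so that \<open>holds\<close> enforces the sort of \<open>x\<close>.\<close>
  let ?\<psi> = "And (Eq (Var ?v) (Var ?v)) \<phi>'"
  have e: "(e(?v := x)) (\<theta> v) = case_sum (f(j := x)) id (\<rho> v)" if "v \<in> fv \<phi>" for v x
    using that by (auto simp: \<theta>_def e_def split: sum.splits)
  show thesis
  proof (rule that)
    show "e ` (fv ?\<psi> - {?v}) \<subseteq> A \<union> f ` (J - {j})"
    proof
      fix a assume "a \<in> e ` (fv ?\<psi> - {?v})"
      then obtain w where "w \<in> \<theta> ` fv \<phi>" "w \<noteq> ?v" "a = e w" using \<phi>'(2) by auto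
      then obtain v where v: "v \<in> fv \<phi>" "\<theta> v \<noteq> ?v" "a = e (\<theta> v)" by blast
      then have "\<rho> v \<noteq> Inl j" by (auto simp: \<theta>_def)
      then have "\<theta> v = (Suc (fst v), snd v)" by (simp add: \<theta>_def)
      then have "a = case_sum f id (\<rho> v)" using v(3) by (simp add: e_def)
      then show "a \<in> A \<union> f ` (J - {j})"
        using *(2) v(1) \<open>\<rho> v \<noteq> Inl j\<close> unfolding var_ok_def by (auto split: sum.splits)
    qed
    fix x
    have s: "sat M \<phi>' (e(?v := x)) \<longleftrightarrow> f(j := x) \<in> X" if "srt M x = s j"
    proof -
      have "sat M \<phi>' (e(?v := x)) \<longleftrightarrow> sat M \<phi> (case_sum (f(j := x)) id \<circ> \<rho>)"
        unfolding \<phi>'(3) by (rule sat_cong) (use e in simp)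
      then show ?thesis using *(3)[of "f(j := x)"] assms(2) that by simp
    qed
    have srt: "srt M ((e(?v := x)) w) = snd w" if "srt M x = s j" "w \<in> fv \<phi>'" for w
    proof -
      from that(2) have "w \<in> \<theta> ` fv \<phi>" unfolding \<phi>'(2) .
      then obtain v where v: "v \<in> fv \<phi>" "w = \<theta> v" by blast
      have "srt M (case_sum (f(j := x)) id (\<rho> v)) = snd v"
        by (rule var_ok_srt[OF *(2) _ v(1)]) (use assms(2) that in simp)
      moreover have "snd w = snd v" using v *(2) by (auto simp: \<theta>_def var_ok_def)
      ultimately show ?thesis using e[OF v(1), of x] v by simp
    qed
    show "holds M ?\<psi> (e(?v := x)) \<longleftrightarrow> srt M x = s j \<and> f(j := x) \<in> X"
    proof (cases "srt M x = s j")
      case True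
      then show ?thesis
        using s srt *(1) \<phi>'(1) unfolding holds_def by auto
    next
      case False
      then show ?thesis unfolding holds_def by auto
    qed
  qed
qed

lemma dset_Ex:
  assumes "dset M s J A X"
  shows "dset M s (J - {j}) A {f. \<exists>x. srt M x = s j \<and> f(j := x) \<in> X}"
proof -
  from assms(1) obtain \<phi> \<rho> where *: "wf_fm M \<phi>" "var_ok M s J A \<rho> \<phi>"
    "\<And>f. f \<in> tuples_of M s \<Longrightarrow> f \<in> X \<longleftrightarrow> sat M \<phi> (case_sum f id \<circ> \<rho>)" unfolding dset_def by blast
  let ?v = "(0, s j) :: nat \<times> 'a"
  define \<theta> where "\<theta> = (\<lambda>v. if \<rho> v = Inl j \<and> v \<in> fv \<phi> then ?v else (Suc (fst v), snd v))"
  have sn: "\<forall>v\<in>fv \<phi>. snd (\<theta> v) = snd v" using *(2) by (auto simp: \<theta>_def var_ok_def)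
  from rename_fm[OF this, of M] obtain \<phi>' where \<phi>': "wf_fm M \<phi>' = wf_fm M \<phi>" "fv \<phi>' = \<theta> ` fv \<phi>"
    "\<And>e. sat M \<phi>' e = sat M \<phi> (e \<circ> \<theta>)" by blast
  define \<rho>' where "\<rho>' = (\<lambda>w. \<rho> (fst w - 1, snd w))"
  show ?thesis
  proof (rule dsetI[where \<phi> = "Ex ?v \<phi>'" and \<rho> = \<rho>'])
    show "wf_fm M (Ex ?v \<phi>')" using * \<phi>' by simp
    show "var_ok M s (J - {j}) A \<rho>' (Ex ?v \<phi>')"
      unfolding var_ok_def
    proof
      fix w assume "w \<in> fv (Ex ?v \<phi>')"
      then obtain v where v: "v \<in> fv \<phi>" "w = \<theta> v" "\<theta> v \<noteq> ?v" using \<phi>'(2) by auto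
      then have "\<rho> v \<noteq> Inl j" by (auto simp: \<theta>_def)
      moreover then have "\<theta> v = (Suc (fst v), snd v)" by (simp add: \<theta>_def)
      then have "\<rho>' w = \<rho> v" "snd w = snd v" using v by (auto simp: \<rho>'_def)
      ultimately show "case \<rho>' w of Inl k \<Rightarrow> k \<in> J - {j} \<and> s k = snd w | Inr a \<Rightarrow> a \<in> A \<and> srt M a = snd w"
        using *(2) v(1) unfolding var_ok_def by (auto split: sum.splits)
    qed
    fix f assume f: "f \<in> tuples_of M s"
    have "sat M \<phi>' ((case_sum f id \<circ> \<rho>')(?v := x)) \<longleftrightarrow> f(j := x) \<in> X" if "srt M x = s j" for x
    proof -
      have "sat M \<phi>' ((case_sum f id \<circ> \<rho>')(?v := x)) \<longleftrightarrow> sat M \<phi> (case_sum (f(j := x)) id \<circ> \<rho>)"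
        unfolding \<phi>'(3) by (rule sat_cong) (auto simp: \<rho>'_def \<theta>_def split: sum.splits)
      then show ?thesis using *(3)[of "f(j := x)"] f that by simp
    qed
    then show "f \<in> {f. \<exists>x. srt M x = s j \<and> f(j := x) \<in> X} \<longleftrightarrow> sat M (Ex ?v \<phi>') (case_sum f id \<circ> \<rho>')"
      by auto
  qed
qed

lemma dset_Ex_finite:
  assumes "finite K" "dset M s J A X"
  shows "dset M s (J - K) A {f. \<exists>g\<in>tuples_of M s. (\<lambda>j. if j \<in> K then g j else f j) \<in> X}"
  using assms
proof (induction K arbitrary: J X rule: finite_induct)
  case empty
  then show ?case by (auto intro: dset_cong)
next
  case (insert k K)
  let ?Y = "{f. \<exists>x. srt M x = s k \<and> f(k := x) \<in> X}"
  have "dset M s (J - {k} - K) A {f. \<exists>g\<in>tuples_of M s. (\<lambda>j. if j \<in> K then g j else f j) \<in> ?Y}"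
    by (rule insert.IH[OF dset_Ex[OF insert.prems]])
  moreover have "J - {k} - K = J - insert k K" by auto
  moreover have "(\<exists>g\<in>tuples_of M s. (\<lambda>j. if j \<in> K then g j else f j) \<in> ?Y) \<longleftrightarrow>
      (\<exists>g\<in>tuples_of M s. (\<lambda>j. if j \<in> insert k K then g j else f j) \<in> X)" for f
  proof
    assume "\<exists>g\<in>tuples_of M s. (\<lambda>j. if j \<in> K then g j else f j) \<in> ?Y"
    then obtain g x where g: "g \<in> tuples_of M s" "srt M x = s k" "(\<lambda>j. if j \<in> K then g j else f j)(k := x) \<in> X"
      by blast
    moreover have "(\<lambda>j. if j \<in> K then g j else f j)(k := x) = (\<lambda>j. if j \<in> insert k K then (g(k := x)) j else f j)"
      using insert.hyps by auto
    ultimately show "\<exists>g\<in>tuples_of M s. (\<lambda>j. if j \<in> insert k K then g j else f j) \<in> X"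
      by (intro bexI[of _ "g(k := x)"]) auto
  next
    assume "\<exists>g\<in>tuples_of M s. (\<lambda>j. if j \<in> insert k K then g j else f j) \<in> X"
    then obtain g where g: "g \<in> tuples_of M s" "(\<lambda>j. if j \<in> insert k K then g j else f j) \<in> X" by blast
    have "(\<lambda>j. if j \<in> insert k K then g j else f j) = (\<lambda>j. if j \<in> K then g j else f j)(k := g k)" by auto
    with g show "\<exists>g\<in>tuples_of M s. (\<lambda>j. if j \<in> K then g j else f j) \<in> ?Y"
      by (intro bexI[of _ g]) (auto simp: tuples_of_srt intro!: exI[of _ "g k"])
  qed
  ultimately show ?case by simp
qed

section \<open>Saturation in many variables and homogeneity\<close>

lemma card_of_lists_infinite':
  assumes "infinite A"
  shows "|lists A| \<le>o |A|"
proof -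
  have "|{l \<in> lists A. length l = n}| \<le>o |A|" for n
  proof (induction n)
    case 0
    obtain a where "a \<in> A" using assms by fastforce
    have "{l \<in> lists A. length l = 0} = {[]}" by auto
    then show ?case using \<open>a \<in> A\<close> by (auto intro!: card_of_singl_ordLeq)
  next
    case (Suc n)
    have "{l \<in> lists A. length l = Suc n} = (\<lambda>(x, l). x # l) ` (A \<times> {l \<in> lists A. length l = n})"
      by (auto simp: length_Suc_conv image_iff)
    then have "|{l \<in> lists A. length l = Suc n}| \<le>o |A \<times> {l \<in> lists A. length l = n}|"
      by (simp add: card_of_image)
    also have "|A \<times> {l \<in> lists A. length l = n}| \<le>o |A \<times> A|"
      using card_of_Times_mono2[OF Suc.IH] .
    also have "|A \<times> A| =o |A|" by (rule card_of_Times_same_infinite[OF assms])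
    finally show ?case .
  qed
  then have "|\<Union>n. {l \<in> lists A. length l = n}| \<le>o |A|"
    by (intro card_of_UNION_ordLeq_infinite assms) (use assms infinite_iff_card_of_nat in auto)
  moreover have "(\<Union>n. {l \<in> lists A. length l = n}) = lists A" by auto
  ultimately show ?thesis by metis
qed

context monster
begin

text \<open>There are infinitely many variables, hence infinitely many formulas even in the empty
  language.\<close>

lemma infinite_card: "infinite (Field \<kappa>)"
proof -
  fix s :: 's
  have "inj (\<lambda>n :: nat. Eq (Var (n, s)) (Var (n, s)) :: ('s, 'f, 'r) fm)" by (auto intro!: injI)
  then have "infinite (UNIV :: ('s, 'f, 'r) fm set)"
    by (meson finite_imageD finite_subset infinite_UNIV_nat subset_UNIV)
  then show ?thesis
    using card_of_ordLeq_infinite[of UNIV "Field \<kappa>"] ordLess_imp_ordLeq[OF large]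
      card_of_Field_ordIso[OF card] ordLeq_ordIso_trans ordIso_symmetric by metis
qed

lemma small_mono: "small \<kappa> A \<Longrightarrow> A' \<subseteq> A \<Longrightarrow> small \<kappa> A'"
  unfolding small_def using card_of_mono1 ordLeq_ordLess_trans by blast

lemma small_image: "small \<kappa> A \<Longrightarrow> small \<kappa> (f ` A)"
  unfolding small_def using card_of_image ordLeq_ordLess_trans by blast

lemma small_Un: "small \<kappa> A \<Longrightarrow> small \<kappa> A' \<Longrightarrow> small \<kappa> (A \<union> A')"
  unfolding small_def using card_of_Un_ordLess_infinite_Field[OF infinite_card card] by blast

lemma small_Plus: "small \<kappa> A \<Longrightarrow> small \<kappa> A' \<Longrightarrow> small \<kappa> (A <+> A')"
  unfolding small_def using card_of_Plus_ordLess_infinite_Field[OF infinite_card card] by blast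

lemma small_fm: "small \<kappa> (UNIV :: ('s, 'f, 'r) fm set)"
  using large by (simp add: small_def)

lemma small_nat: "small \<kappa> (UNIV :: nat set)"
proof -
  fix s :: 's
  have "inj (\<lambda>n :: nat. Eq (Var (n, s)) (Var (n, s)) :: ('s, 'f, 'r) fm)" by (auto intro!: injI)
  then have "|UNIV :: nat set| \<le>o |UNIV :: ('s, 'f, 'r) fm set|" by (meson card_of_ordLeqI UNIV_I)
  then show ?thesis using large ordLeq_ordLess_trans unfolding small_def by blast
qed

lemma small_countable: "countable A \<Longrightarrow> small \<kappa> A"
proof -
  assume "countable A"
  then obtain f :: "_ \<Rightarrow> nat" where "inj_on f A" by (auto simp: countable_def)
  then have "|A| \<le>o |UNIV :: nat set|" by (meson card_of_ordLeqI UNIV_I)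
  then show ?thesis using small_nat ordLeq_ordLess_trans unfolding small_def by blast
qed

lemma small_finite: "finite A \<Longrightarrow> small \<kappa> A"
  by (simp add: small_countable countable_finite)

lemma small_infinite_super:
  assumes "small \<kappa> A"
  shows "infinite (A <+> (UNIV :: nat set))" "small \<kappa> (A <+> (UNIV :: nat set))"
    "|A| \<le>o |A <+> (UNIV :: nat set)|" "|UNIV :: nat set| \<le>o |A <+> (UNIV :: nat set)|"
  by (auto simp: small_Plus[OF assms small_nat] card_of_Plus1 card_of_Plus2 finite_Plus_iff)

lemma small_lists: "small \<kappa> A \<Longrightarrow> small \<kappa> (lists A)"
proof -
  assume A: "small \<kappa> A"
  let ?C = "A <+> (UNIV :: nat set)"
  have "inj_on (map Inl) (lists A)" by (auto intro!: inj_onI dest: map_injective simp: inj_def)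
  moreover have "map Inl ` lists A \<subseteq> lists ?C" by auto
  ultimately have "|lists A| \<le>o |lists ?C|" using card_of_ordLeq by blast
  also have "|lists ?C| \<le>o |?C|" by (rule card_of_lists_infinite'[OF small_infinite_super(1)[OF A]])
  finally show ?thesis
    using small_infinite_super(2)[OF A] ordLeq_ordLess_trans unfolding small_def by blast
qed

lemma small_Times: "small \<kappa> A \<Longrightarrow> small \<kappa> A' \<Longrightarrow> small \<kappa> (A \<times> A')"
proof -
  assume A: "small \<kappa> A" "small \<kappa> A'"
  let ?C = "(A <+> A') <+> (UNIV :: nat set)"
  note C = small_infinite_super[OF small_Plus[OF A]]
  have "A \<times> A' \<subseteq> (\<lambda>(x, y). (projl (projl x), projr (projl y))) ` (?C \<times> ?C)" by force
  then have "|A \<times> A'| \<le>o |?C \<times> ?C|"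
    using card_of_mono1 card_of_image ordLeq_transitive by blast
  also have "|?C \<times> ?C| =o |?C|" by (rule card_of_Times_same_infinite[OF C(1)])
  finally show ?thesis
    using C(2) ordLeq_ordLess_trans unfolding small_def by blast
qed

text \<open>The members are finite because \<open>\<kappa>\<close> is not assumed regular: a small
  union of small sets could fail to be small.\<close>

lemma small_UN_finite:
  assumes "small \<kappa> I" "\<And>i. i \<in> I \<Longrightarrow> finite (F i)"
  shows "small \<kappa> (\<Union>i\<in>I. F i)"
proof -
  let ?C = "I <+> (UNIV :: nat set)"
  note C = small_infinite_super[OF assms(1)]
  have "|F i| \<le>o |?C|" if "i \<in> I" for i
    using assms(2)[OF that] C(1) by (meson card_of_ordLeq_finite ordLeq_total card_of_Well_order)
  then have "|\<Union>i\<in>I. F i| \<le>o |?C|"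
    by (intro card_of_UNION_ordLeq_infinite C) auto
  then show ?thesis
    using C(2) ordLeq_ordLess_trans unfolding small_def by blast
qed

section \<open>Saturation for infinite tuples\<close>

lemma saturated_one_var:
  fixes s :: "'j \<Rightarrow> 's"
  assumes "small \<kappa> (UNIV :: 'j set)" "small \<kappa> A" "g \<in> tuples_of M s"
    and "\<And>Y. Y \<in> \<Y> \<Longrightarrow> dset M s UNIV A Y"
    and fip: "\<And>\<Y>0. finite \<Y>0 \<Longrightarrow> \<Y>0 \<subseteq> \<Y> \<Longrightarrow> \<exists>x. srt M x = s j \<and> (\<forall>Y\<in>\<Y>0. g(j := x) \<in> Y)"
  shows "\<exists>x. srt M x = s j \<and> (\<forall>Y\<in>\<Y>. g(j := x) \<in> Y)"
proof -
  let ?v = "(0, s j) :: 's var"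
  \<comment> \<open>\<open>UNIV\<close> is added so that the sort of \<open>x\<close> is enforced
    even for an empty family.\<close>
  have "\<forall>Y\<in>insert UNIV \<Y>. \<exists>p. snd p ` (fv (fst p) - {?v}) \<subseteq> A \<union> range g \<and>
    (\<forall>x. holds M (fst p) ((snd p)(?v := x)) \<longleftrightarrow> srt M x = s j \<and> g(j := x) \<in> Y)"
  proof
    fix Y assume "Y \<in> insert UNIV \<Y>"
    then have "dset M s UNIV A Y" using assms(4) dset_UNIV by blast
    from dset_one_var[OF this assms(3), of j] obtain \<phi> e where
      "e ` (fv \<phi> - {?v}) \<subseteq> A \<union> g ` (UNIV - {j})"
      "\<And>x. holds M \<phi> (e(?v := x)) \<longleftrightarrow> srt M x = s j \<and> g(j := x) \<in> Y" by metis
    then show "\<exists>p. snd p ` (fv (fst p) - {?v}) \<subseteq> A \<union> range g \<and>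
      (\<forall>x. holds M (fst p) ((snd p)(?v := x)) \<longleftrightarrow> srt M x = s j \<and> g(j := x) \<in> Y)"
      by (intro exI[of _ "(\<phi>, e)"]) auto
  qed
  then obtain F where F: "\<And>Y. Y \<in> insert UNIV \<Y> \<Longrightarrow> snd (F Y) ` (fv (fst (F Y)) - {?v}) \<subseteq> A \<union> range g"
    "\<And>Y x. Y \<in> insert UNIV \<Y> \<Longrightarrow> holds M (fst (F Y)) ((snd (F Y))(?v := x)) \<longleftrightarrow> srt M x = s j \<and> g(j := x) \<in> Y"
    by (metis (no_types, lifting))
  have "small \<kappa> (A \<union> range g)" using assms by (auto intro: small_Un small_image)
  moreover have "\<forall>(\<phi>, e)\<in>F ` insert UNIV \<Y>. e ` (fv \<phi> - {?v}) \<subseteq> A \<union> range g"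
    using F(1) by (auto simp: case_prod_beta)
  moreover have "\<forall>\<Phi>0\<subseteq>F ` insert UNIV \<Y>. finite \<Phi>0 \<longrightarrow> (\<exists>x. \<forall>(\<phi>, e)\<in>\<Phi>0. holds M \<phi> (e(?v := x)))"
  proof (intro allI impI)
    fix \<Phi>0 assume "\<Phi>0 \<subseteq> F ` insert UNIV \<Y>" "finite \<Phi>0"
    then obtain \<Y>1 where Y1: "\<Y>1 \<subseteq> insert UNIV \<Y>" "finite \<Y>1" "\<Phi>0 = F ` \<Y>1"
      by (meson finite_subset_image)
    obtain x where "srt M x = s j" "\<forall>Y\<in>\<Y>1 - {UNIV}. g(j := x) \<in> Y"
      using fip[of "\<Y>1 - {UNIV}"] Y1 by blast
    then have x: "srt M x = s j \<and> g(j := x) \<in> Y" if "Y \<in> \<Y>1" for Y using that by (cases "Y = UNIV") auto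
    have "\<forall>Y\<in>\<Y>1. holds M (fst (F Y)) ((snd (F Y))(?v := x))"
    proof
      fix Y assume "Y \<in> \<Y>1"
      then show "holds M (fst (F Y)) ((snd (F Y))(?v := x))"
        unfolding F(2)[OF subsetD[OF Y1(1) \<open>Y \<in> \<Y>1\<close>]] using x by blast
    qed
    then show "\<exists>x. \<forall>(\<phi>, e)\<in>\<Phi>0. holds M \<phi> (e(?v := x))"
      unfolding Y1(3) by (auto simp: case_prod_beta)
  qed
  ultimately obtain x where "\<forall>(\<phi>, e)\<in>F ` insert UNIV \<Y>. holds M \<phi> (e(?v := x))"
    using saturated[of "A \<union> range g" "F ` insert UNIV \<Y>" ?v] by fastforce
  then have "srt M x = s j \<and> g(j := x) \<in> Y" if "Y \<in> insert UNIV \<Y>" for Y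
    using F(2)[OF that, of x] that by (auto simp: case_prod_beta)
  then show ?thesis by blast
qed

text \<open>The graph of a realization is a maximal set of coordinate assignments that keeps the family
  finitely satisfiable.\<close>

lemma compactness:
  fixes s :: "'j \<Rightarrow> 's"
  assumes "small \<kappa> (UNIV :: 'j set)" "small \<kappa> A"
    and def: "\<And>X. X \<in> \<X> \<Longrightarrow> dset M s UNIV A X"
    and fip: "\<And>\<X>0. finite \<X>0 \<Longrightarrow> \<X>0 \<subseteq> \<X> \<Longrightarrow> \<exists>f\<in>tuples_of M s. \<forall>X\<in>\<X>0. f \<in> X"
  shows "\<exists>f\<in>tuples_of M s. \<forall>X\<in>\<X>. f \<in> X"
proof -
  let ?T = "tuples_of M s"
  define \<G> where "\<G> = {G. \<forall>\<X>0 G0. finite \<X>0 \<and> \<X>0 \<subseteq> \<X> \<and> finite G0 \<and> G0 \<subseteq> G \<longrightarrow>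
    (\<exists>f\<in>?T. (\<forall>X\<in>\<X>0. f \<in> X) \<and> (\<forall>(j, x)\<in>G0. f j = x))}"
  have "\<exists>G\<in>\<G>. \<forall>X\<in>\<G>. G \<subseteq> X \<longrightarrow> X = G"
  proof (rule subset_Zorn_nonempty)
    have "{} \<in> \<G>" unfolding \<G>_def using fip by auto
    then show "\<G> \<noteq> {}" by blast
    fix \<C> assume C: "\<C> \<noteq> {}" "subset.chain \<G> \<C>"
    show "\<Union>\<C> \<in> \<G>"
      unfolding \<G>_def
    proof (intro CollectI allI impI, elim conjE)
      fix \<X>0 G0 assume *: "finite \<X>0" "\<X>0 \<subseteq> \<X>" "finite G0" "G0 \<subseteq> \<Union>\<C>"
      obtain G where "G \<in> \<C>" "G0 \<subseteq> G"
        using finite_subset_Union_chain[OF *(3,4) C] by blast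
      moreover then have "G \<in> \<G>" using C(2) by (auto simp: subset.chain_def)
      ultimately show "\<exists>f\<in>?T. (\<forall>X\<in>\<X>0. f \<in> X) \<and> (\<forall>(j, x)\<in>G0. f j = x)"
        using * unfolding \<G>_def by blast
    qed
  qed
  then obtain G where G: "G \<in> \<G>" and maximal: "\<And>X. X \<in> \<G> \<Longrightarrow> G \<subseteq> X \<Longrightarrow> X = G" by blast
  have GD: "\<exists>f\<in>?T. (\<forall>X\<in>\<X>0. f \<in> X) \<and> (\<forall>(j, x)\<in>G0. f j = x)"
    if "finite \<X>0" "\<X>0 \<subseteq> \<X>" "finite G0" "G0 \<subseteq> G" for \<X>0 G0
    using G that unfolding \<G>_def by blast
  have sv: "x = y" if "(j, x) \<in> G" "(j, y) \<in> G" for j x y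
    using GD[of "{}" "{(j, x), (j, y)}"] that by auto
  have srt: "srt M x = s j" if "(j, x) \<in> G" for j x
    using GD[of "{}" "{(j, x)}"] that by (auto simp: tuples_of_def)
  obtain f0 where f0: "f0 \<in> ?T" using GD[of "{}" "{}"] by auto
  \<comment> \<open>Where \<open>G\<close> assigns nothing, \<open>f0\<close> provides a placeholder
    of the right sort.\<close>
  define g where "g = (\<lambda>j. if \<exists>x. (j, x) \<in> G then THE x. (j, x) \<in> G else f0 j)"
  have g: "g j = x" if "(j, x) \<in> G" for j x
    unfolding g_def using that sv by (auto intro!: the_equality)
  have gT: "g \<in> ?T"
  proof -
    have "srt M (g j) = s j" for j
    proof (cases "\<exists>x. (j, x) \<in> G")
      case True
      then show ?thesis using g srt by blast
    next
      case False
      then show ?thesis using f0 by (simp add: g_def tuples_of_srt)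
    qed
    then show ?thesis by (simp add: tuples_of_def)
  qed
  have "\<forall>\<X>0. finite \<X>0 \<and> \<X>0 \<subseteq> \<X> \<longrightarrow> (\<exists>J. finite J \<and> dset M s J A (\<Inter>\<X>0))"
  proof (intro allI impI, elim conjE)
    fix \<X>0 assume "finite \<X>0" "\<X>0 \<subseteq> \<X>"
    then have "dset M s UNIV A (\<Inter>\<X>0)" using def by (blast intro: dset_Inter_finite)
    then obtain J A0 where "finite J" "A0 \<subseteq> A" "dset M s J A0 (\<Inter>\<X>0)" by (rule dset_finite)
    then show "\<exists>J. finite J \<and> dset M s J A (\<Inter>\<X>0)" by (blast intro: dset_mono)
  qed
  then obtain supp where supp: "\<And>\<X>0. finite \<X>0 \<Longrightarrow> \<X>0 \<subseteq> \<X> \<Longrightarrow> finite (supp \<X>0)"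
    "\<And>\<X>0. finite \<X>0 \<Longrightarrow> \<X>0 \<subseteq> \<X> \<Longrightarrow> dset M s (supp \<X>0) A (\<Inter>\<X>0)" by metis
  have total: "\<exists>x. (j, x) \<in> G" for j
  proof (rule ccontr)
    assume no: "\<nexists>x. (j, x) \<in> G"
    define K where "K = (\<lambda>\<X>0. supp \<X>0 - Domain G - {j})"
    \<comment> \<open>A condition on the value at \<open>j\<close>: one finite part of the family
      stays satisfiable once the other unassigned coordinates are quantified away. The assigned ones
      enter as parameters through \<open>g\<close>.\<close>
    define Y where "Y = (\<lambda>\<X>0. {h. \<exists>f\<in>?T. (\<lambda>i. if i \<in> K \<X>0 then f i else h i) \<in> \<Inter>\<X>0})"
    let ?\<Y> = "Y ` {\<X>0. finite \<X>0 \<and> \<X>0 \<subseteq> \<X>}"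
    have "dset M s UNIV A (Y \<X>0)" if "finite \<X>0" "\<X>0 \<subseteq> \<X>" for \<X>0
      unfolding Y_def
      by (rule dset_mono[OF dset_Ex_finite[OF _ supp(2)[OF that]]]) (auto simp: K_def supp(1)[OF that])
    moreover have "\<exists>x. srt M x = s j \<and> (\<forall>Y\<in>\<Y>0. g(j := x) \<in> Y)" if Y0: "finite \<Y>0" "\<Y>0 \<subseteq> ?\<Y>" for \<Y>0
    proof -
      obtain \<D> where D: "\<D> \<subseteq> {\<X>0. finite \<X>0 \<and> \<X>0 \<subseteq> \<X>}" "finite \<D>" "\<Y>0 = Y ` \<D>"
        using finite_subset_image[OF Y0] by blast
      let ?G0 = "(\<lambda>i. (i, g i)) ` ((\<Union>\<X>0\<in>\<D>. supp \<X>0) \<inter> Domain G)"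
      have "finite (supp \<X>0)" if "\<X>0 \<in> \<D>" for \<X>0 using D supp(1) that by blast
      then have "finite ?G0" using D(2) by auto
      moreover have "?G0 \<subseteq> G" using g by auto
      moreover have "finite (\<Union>\<D>)" "\<Union>\<D> \<subseteq> \<X>" using D by auto
      ultimately obtain f where f: "f \<in> ?T" "\<forall>X\<in>\<Union>\<D>. f \<in> X" "\<forall>(i, x)\<in>?G0. f i = x"
        using GD by meson
      have "g(j := f j) \<in> Y \<X>0" if X0: "\<X>0 \<in> \<D>" for \<X>0
      proof -
        have X0': "finite \<X>0" "\<X>0 \<subseteq> \<X>" using D X0 by auto
        let ?f = "\<lambda>i. if i \<in> K \<X>0 then f i else (g(j := f j)) i"
        have "?f \<in> ?T" using f(1) gT by (auto simp: tuples_of_def)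
        moreover have "?f i = f i" if "i \<in> supp \<X>0" for i
        proof (cases "i \<in> K \<X>0 \<or> i = j")
          case False
          then have "(i, g i) \<in> ?G0" using that X0 by (auto simp: K_def)
          then have "f i = g i" using f(3) by (auto dest: bspec)
          then show ?thesis using False by simp
        qed auto
        ultimately have "?f \<in> \<Inter>\<X>0 \<longleftrightarrow> f \<in> \<Inter>\<X>0"
          by (intro dset_support[OF supp(2)[OF X0'] _ f(1)])
        moreover have "f \<in> \<Inter>\<X>0" using f(2) X0 by auto
        ultimately show ?thesis unfolding Y_def using f(1) by blast
      qed
      then show ?thesis
        using D(3) f(1) by (intro exI[of _ "f j"]) (auto simp: tuples_of_def)
    qed
    ultimately obtain x where x: "srt M x = s j" "\<forall>Y\<in>?\<Y>. g(j := x) \<in> Y"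
      using saturated_one_var[OF assms(1,2) gT, of ?\<Y> j] by blast
    have "insert (j, x) G \<in> \<G>"
      unfolding \<G>_def
    proof (intro CollectI allI impI, elim conjE)
      fix \<X>0 G0 assume *: "finite \<X>0" "\<X>0 \<subseteq> \<X>" "finite G0" "G0 \<subseteq> insert (j, x) G"
      then have "g(j := x) \<in> Y \<X>0" using x(2) by blast
      then obtain f where f: "f \<in> ?T" "(\<lambda>i. if i \<in> K \<X>0 then f i else (g(j := x)) i) \<in> \<Inter>\<X>0"
        unfolding Y_def by blast
      let ?f = "\<lambda>i. if i \<in> K \<X>0 then f i else (g(j := x)) i"
      have "?f \<in> ?T" using f(1) gT x(1) by (auto simp: tuples_of_def)
      moreover have "?f i = y" if "(i, y) \<in> G0" for i y
      proof (cases "(i, y) \<in> G")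
        case True
        then have "i \<notin> K \<X>0" "i \<noteq> j" using no by (auto simp: K_def)
        then show ?thesis using g[OF True] by simp
      next
        case False
        then show ?thesis using that *(4) by (auto simp: K_def)
      qed
      ultimately show "\<exists>f\<in>?T. (\<forall>X\<in>\<X>0. f \<in> X) \<and> (\<forall>(j, x)\<in>G0. f j = x)"
        using f(2) by (intro bexI[of _ ?f]) auto
    qed
    from maximal[OF this] no show False by blast
  qed
  have "g \<in> X" if X: "X \<in> \<X>" for X
  proof -
    obtain J where J: "finite J" "dset M s J A X"
      using dset_finite[OF def[OF X]] dset_mono by (metis order_refl)
    have "(\<lambda>i. (i, g i)) ` J \<subseteq> G" using total g by (metis image_subsetI)
    then obtain f where f: "f \<in> ?T" "f \<in> X" "\<forall>i\<in>J. f i = g i"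
      using GD[of "{X}" "(\<lambda>i. (i, g i)) ` J"] X J(1) by auto
    then show ?thesis using dset_support[OF J(2) f(1) gT] by auto
  qed
  then show ?thesis using gT by blast
qed

text \<open>Agreement on definable sets gives an elementary map from one tuple to the other over
  \<open>B\<close>, and strong homogeneity extends it. That it is a map at all is part of the type,
  through equations between coordinates and with elements of \<open>B\<close>.\<close>

lemma conjugate_if_same_dsets:
  fixes s :: "'j \<Rightarrow> 's"
  assumes "small \<kappa> (UNIV :: 'j set)" "small \<kappa> B"
    and f: "f \<in> tuples_of M s" and g: "g \<in> tuples_of M s"
    and same: "\<And>X. dset M s UNIV B X \<Longrightarrow> f \<in> X \<Longrightarrow> g \<in> X"
  shows "\<exists>\<sigma>\<in>AutOver M B. g = \<sigma> \<circ> f"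
proof -
  have 1: "g i = g j" if "f i = f j" for i j
  proof -
    have "s i = s j" using f that by (metis tuples_of_srt)
    then have "dset M s UNIV B {f. f i = f j}" by (intro dset_eq) auto
    from same[OF this] that show ?thesis by auto
  qed
  have 2: "g j = f j" if "f j \<in> B" for j
    using same[OF dset_eq_param[of j UNIV "f j" B s M]] that f by (auto simp: tuples_of_srt)
  define h where "h = (\<lambda>x. if x \<in> B then x else g (SOME j. f j = x))"
  have hf: "h (f j) = g j" for j
  proof (cases "f j \<in> B")
    case False
    have "f (SOME i. f i = f j) = f j" by (rule someI) simp
    then have "g (SOME i. f i = f j) = g j" by (rule 1)
    then show ?thesis using False by (simp add: h_def)
  qed (simp add: h_def 2)
  have hB: "h x = x" if "x \<in> B" for x using that by (simp add: h_def)
  have hs: "srt M (h x) = srt M x" if "x \<in> B \<union> range f" for x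
    using that hB hf f g by (auto simp: tuples_of_srt)
  have "elementary_on M (B \<union> range f) h"
    unfolding elementary_on_def
  proof (intro allI impI)
    fix \<phi> :: "('s, 'f, 'r) fm" and e
    assume e: "e ` fv \<phi> \<subseteq> B \<union> range f"
    define \<rho> where "\<rho> = (\<lambda>v. if e v \<in> B then Inr (e v) else Inl (SOME j. f j = e v))"
    have ef: "case_sum f id (\<rho> v) = e v" if "v \<in> fv \<phi>" for v
    proof (cases "e v \<in> B")
      case False
      moreover have "e v \<in> B \<union> range f" using e that by blast
      ultimately obtain j where "f j = e v" by auto
      then have "f (SOME j. f j = e v) = e v" by (rule someI)
      then show ?thesis using False by (simp add: \<rho>_def)
    qed (simp add: \<rho>_def)
    have eg: "case_sum g id (\<rho> v) = h (e v)" if "v \<in> fv \<phi>" for v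
    proof (cases "e v \<in> B")
      case False
      moreover have "e v \<in> B \<union> range f" using e that by blast
      ultimately obtain j where "f j = e v" by auto
      then have "f (SOME j. f j = e v) = e v" by (rule someI)
      then have "g (SOME j. f j = e v) = h (e v)" using hf by metis
      then show ?thesis using False by (simp add: \<rho>_def)
    qed (simp add: \<rho>_def hB)
    have sh: "srt M (h (e v)) = srt M (e v)" if "v \<in> fv \<phi>" for v using hs e that by blast
    show "holds M \<phi> e \<longleftrightarrow> holds M \<phi> (h \<circ> e)"
    proof (cases "wf_fm M \<phi> \<and> (\<forall>v\<in>fv \<phi>. srt M (e v) = snd v)")
      case True
      have ok: "var_ok M s UNIV B \<rho> \<phi>"
        unfolding var_ok_def
      proof
        fix v assume v: "v \<in> fv \<phi>"
        then show "case \<rho> v of Inl j \<Rightarrow> j \<in> UNIV \<and> s j = snd v | Inr a \<Rightarrow> a \<in> B \<and> srt M a = snd v"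
          using ef[OF v] True tuples_of_srt[OF f, of "SOME j. f j = e v"]
          by (cases "e v \<in> B") (auto simp: \<rho>_def)
      qed
      let ?X = "{f. sat M \<phi> (case_sum f id \<circ> \<rho>)}"
      have X: "dset M s UNIV B ?X" by (rule dsetI[OF _ ok]) (use True in auto)
      have "f \<in> ?X \<longleftrightarrow> g \<in> ?X" using same[OF X] same[OF dset_Compl[OF X]] by blast
      moreover have "sat M \<phi> (case_sum f id \<circ> \<rho>) = sat M \<phi> e"
        by (rule sat_cong) (simp add: ef)
      moreover have "sat M \<phi> (case_sum g id \<circ> \<rho>) = sat M \<phi> (h \<circ> e)"
        by (rule sat_cong) (simp add: eg)
      ultimately show ?thesis unfolding holds_def using sh by auto
    next
      case False
      then show ?thesis unfolding holds_def using sh by auto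
    qed
  qed
  moreover have "small \<kappa> (B \<union> range f)" using assms by (auto intro: small_Un small_image)
  ultimately obtain \<sigma> where \<sigma>: "\<sigma> \<in> Aut M" "\<forall>x\<in>B \<union> range f. \<sigma> x = h x" using homogeneous by blast
  then have "\<sigma> \<in> AutOver M B" "g = \<sigma> \<circ> f"
    using hB hf by (auto simp: AutOver_def)
  then show ?thesis by blast
qed

section \<open>Types and orbits\<close>

lemma pholds_Aut:
  assumes "params_in B \<xi>" "\<sigma> \<in> AutOver M B"
  shows "pholds M \<xi> (\<sigma> \<circ> a) \<longleftrightarrow> pholds M \<xi> a"
proof -
  obtain \<phi> \<rho> where \<xi>: "\<xi> = (\<phi>, \<rho>)" by (cases \<xi>)
  have "holds M \<phi> (case_sum (\<sigma> \<circ> a) id \<circ> \<rho>) = holds M \<phi> (\<sigma> \<circ> (case_sum a id \<circ> \<rho>))"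
    by (rule holds_cong) (use assms in \<open>force simp: \<xi> params_in_def AutOver_def split: sum.splits\<close>)
  then show ?thesis
    using holds_Aut[OF wf AutOver_Aut[OF assms(2)]] unfolding pholds_def \<xi> by simp
qed

lemma tp_eq_iff:
  fixes a b :: "'i \<Rightarrow> 'a"
  assumes "small \<kappa> (UNIV :: 'i set)" "small \<kappa> B"
  shows "tp M B a = tp M B b \<longleftrightarrow> (\<exists>\<sigma>\<in>AutOver M B. b = \<sigma> \<circ> a)"
proof
  assume "\<exists>\<sigma>\<in>AutOver M B. b = \<sigma> \<circ> a"
  then obtain \<sigma> where \<sigma>: "\<sigma> \<in> AutOver M B" and b: "b = \<sigma> \<circ> a" by blast
  show "tp M B a = tp M B b"
    unfolding tp_def b using pholds_Aut[OF _ \<sigma>] by blast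
next
  assume eq: "tp M B a = tp M B b"
  let ?s = "srt M \<circ> a"
  have P: "pholds M \<xi> b" if "params_in B \<xi>" "pholds M \<xi> a" for \<xi>
    using eq that unfolding tp_def by auto
  have srt: "srt M (b i) = srt M (a i)" for i
  proof -
    let ?v = "(0, srt M (a i))"
    \<comment> \<open>A reflexive equation holds only at a value of the right sort, so the type
      determines the sorts.\<close>
    have "pholds M (Eq (Var ?v) (Var ?v), \<lambda>_. Inl i) b"
      by (rule P) (auto simp: pholds_def holds_def params_in_def)
    then show ?thesis by (simp add: pholds_def holds_def)
  qed
  have a: "a \<in> tuples_of M ?s" and b: "b \<in> tuples_of M ?s" using srt by (auto simp: tuples_of_def)
  have "b \<in> X" if X: "dset M ?s UNIV B X" "a \<in> X" for X
  proof -
    from X(1) obtain \<phi> \<rho> where *: "wf_fm M \<phi>" "var_ok M ?s UNIV B \<rho> \<phi>"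
      "\<And>f. f \<in> tuples_of M ?s \<Longrightarrow> f \<in> X \<longleftrightarrow> sat M \<phi> (case_sum f id \<circ> \<rho>)" unfolding dset_def by blast
    have "params_in B (\<phi>, \<rho>)"
      using *(2) unfolding params_in_def var_ok_def by (auto split: sum.splits) (metis obj_sumE rangeI image_eqI)
    moreover have "pholds M (\<phi>, \<rho>) a"
      using * a X(2) var_ok_srt[OF *(2) a] by (auto simp: pholds_def holds_def)
    ultimately have "pholds M (\<phi>, \<rho>) b" by (rule P)
    then have "sat M \<phi> (case_sum b id \<circ> \<rho>)" by (simp add: pholds_def holds_def)
    with *(3)[OF b] show "b \<in> X" by blast
  qed
  from conjugate_if_same_dsets[OF assms a b this] show "\<exists>\<sigma>\<in>AutOver M B. b = \<sigma> \<circ> a" .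
qed

end

section \<open>Definable sets of sequences of realizations\<close>

locale monster_type = monster T M \<kappa>
  for T :: "('s, 'f, 'r) fm set" and M :: "('s, 'f, 'r, 'a) fo_struct" and \<kappa> :: "'k rel" +
  fixes B :: "'a set" and p :: "('s, 'f, 'r, 'i, 'a) pfm set"
  assumes strong: "strong_type M \<kappa> B p"
begin

abbreviation "P \<equiv> realizations M B p"
abbreviation "G \<equiv> AutOver M B"

text \<open>All realizations are conjugate, so the sorts of one of them are the sorts of
  all.\<close>

definition sorts :: "'i \<Rightarrow> 's" where "sorts = srt M \<circ> (SOME a. a \<in> P)"

abbreviation "T1 \<equiv> tuples_of M sorts"

lemma small_B: "small \<kappa> B" and acl_B: "acl M B = B" and small_I: "small \<kappa> (UNIV :: 'i set)"
  and P_nonempty: "\<exists>a. a \<in> P"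
  using strong by (auto simp: strong_type_def realizations_def)

lemma P_trans: "a \<in> P \<Longrightarrow> b \<in> P \<longleftrightarrow> (\<exists>\<sigma>\<in>G. b = \<sigma> \<circ> a)"
  using tp_eq_iff[OF small_I small_B, of a b] by (auto simp: realizations_def)

lemma P_Aut: "a \<in> P \<Longrightarrow> \<sigma> \<in> G \<Longrightarrow> \<sigma> \<circ> a \<in> P"
  using P_trans by blast

lemma P_T1: "a \<in> P \<Longrightarrow> a \<in> T1"
proof -
  assume a: "a \<in> P"
  have "(SOME a. a \<in> P) \<in> P" using P_nonempty by (rule someI_ex)
  then obtain \<sigma> where "\<sigma> \<in> G" "a = \<sigma> \<circ> (SOME a. a \<in> P)" using P_trans a by blast
  then show ?thesis by (simp add: sorts_def tuples_of_def Aut_srt AutOver_Aut)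
qed

text \<open>The sequence \<open>f :: nat \<Rightarrow> 'i \<Rightarrow> 'a\<close> is read as one tuple indexed by \<open>nat \<times> 'i\<close>.\<close>

definition tdef :: "'a set \<Rightarrow> (nat \<Rightarrow> 'i \<Rightarrow> 'a) set \<Rightarrow> bool" where
  "tdef A X \<longleftrightarrow> dset M (\<lambda>(n, i). sorts i) UNIV A {g. curry g \<in> X}"

abbreviation "rdef A \<delta> \<equiv> tdef A {f. (f 0, f 1) \<in> \<delta>}"
abbreviation "udef A S \<equiv> tdef A {f. f 0 \<in> S}"

lemma tuples_of_curry: "g \<in> tuples_of M (\<lambda>(n :: nat, i). sorts i) \<longleftrightarrow> (\<forall>n. curry g n \<in> T1)"
  by (auto simp: tuples_of_def)

lemma tuples_of_case_prod: "(\<forall>n. f n \<in> T1) \<longleftrightarrow> case_prod f \<in> tuples_of M (\<lambda>(n :: nat, i). sorts i)"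
  by (auto simp: tuples_of_def)

lemma tdef_cong:
  assumes "tdef A X" "\<And>f. (\<And>n. f n \<in> T1) \<Longrightarrow> f \<in> Y \<longleftrightarrow> f \<in> X"
  shows "tdef A Y"
  unfolding tdef_def
proof (rule dset_cong[OF assms(1)[unfolded tdef_def]])
  fix g :: "nat \<times> 'i \<Rightarrow> 'a" assume "g \<in> tuples_of M (\<lambda>(n, i). sorts i)"
  then have g: "curry g n \<in> T1" for n by (simp add: tuples_of_curry)
  have "curry g \<in> Y \<longleftrightarrow> curry g \<in> X" by (rule assms(2)) (rule g)
  then show "g \<in> {g. curry g \<in> Y} \<longleftrightarrow> g \<in> {g. curry g \<in> X}" by blast
qed

lemma tdef_mono: "tdef A X \<Longrightarrow> A \<subseteq> A' \<Longrightarrow> tdef A' X"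
  unfolding tdef_def by (rule dset_mono) auto

lemma tdef_finite: "tdef A X \<Longrightarrow> \<exists>A0. finite A0 \<and> A0 \<subseteq> A \<and> tdef A0 X"
proof -
  assume "tdef A X"
  then obtain J0 A0 where *: "finite A0" "A0 \<subseteq> A" "dset M (\<lambda>(n, i). sorts i) J0 A0 {g. curry g \<in> X}"
    unfolding tdef_def by (rule dset_finite)
  have "dset M (\<lambda>(n, i). sorts i) UNIV A0 {g. curry g \<in> X}" by (rule dset_mono[OF *(3)]) auto
  with * show ?thesis unfolding tdef_def by blast
qed

lemma tdef_const: "tdef A {f. Q}"
  unfolding tdef_def by (cases Q) (auto simp: dset_UNIV dset_empty)

lemma tdef_not: "tdef A {f. Q f} \<Longrightarrow> tdef A {f. \<not> Q f}"
  unfolding tdef_def mem_Collect_eq by (rule dset_not)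

lemma tdef_conj: "tdef A {f. Q f} \<Longrightarrow> tdef A {f. Q' f} \<Longrightarrow> tdef A {f. Q f \<and> Q' f}"
  unfolding tdef_def mem_Collect_eq by (rule dset_conj)

lemma tdef_iff: "tdef A {f. Q f} \<Longrightarrow> tdef A {f. Q' f} \<Longrightarrow> tdef A {f. Q f \<longleftrightarrow> Q' f}"
  unfolding tdef_def mem_Collect_eq by (rule dset_iff)

lemma tdef_coord: "tdef A {f. f m i = f n i}"
  unfolding tdef_def mem_Collect_eq curry_def by (rule dset_eq) auto

lemma tdef_ball_finite:
  assumes "finite I" "\<And>i. i \<in> I \<Longrightarrow> tdef A {f. Q i f}"
  shows "tdef A {f. \<forall>i\<in>I. Q i f}"
  using assms by (induction I rule: finite_induct) (use tdef_const[of A True] in \<open>auto intro!: tdef_conj\<close>)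

lemma tdef_reindex: "tdef A {f. Q f} \<Longrightarrow> tdef A {f. Q (\<lambda>n. f (h n))}"
proof -
  assume "tdef A {f. Q f}"
  then have "dset M (\<lambda>(n, i). sorts i) UNIV A {g. g \<circ> (\<lambda>(n, i). (h n, i)) \<in> {g. curry g \<in> {f. Q f}}}"
    unfolding tdef_def by (rule dset_reindex) auto
  moreover have "curry (g \<circ> (\<lambda>(n, i). (h n, i))) = (\<lambda>n. curry g (h n))" for g :: "nat \<times> 'i \<Rightarrow> 'a"
    by (auto simp: fun_eq_iff)
  ultimately show ?thesis unfolding tdef_def by simp
qed

lemma tdef_param:
  assumes "tdef A {f. Q f}" "c \<in> T1"
  shows "tdef (A \<union> range c) {f. Q (f(k := c))}"
proof -
  have c: "(\<lambda>(n :: nat, i). c i) \<in> tuples_of M (\<lambda>(n, i). sorts i)" using assms(2) by (auto simp: tuples_of_def)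
  have "dset M (\<lambda>(n, i). sorts i) UNIV (A \<union> range c)
    {g. (\<lambda>j. if j \<in> {k} \<times> UNIV then (\<lambda>(n :: nat, i). c i) j else g j) \<in> {g. curry g \<in> {f. Q f}}}"
    by (rule dset_mono[OF dset_specialize[OF assms(1)[unfolded tdef_def] c]]) auto
  moreover have "curry (\<lambda>j. if j \<in> {k} \<times> UNIV then (\<lambda>(n :: nat, i). c i) j else g j) = (curry g)(k := c)" for g :: "nat \<times> 'i \<Rightarrow> 'a"
    by (auto simp: fun_eq_iff)
  ultimately show ?thesis unfolding tdef_def by simp
qed

lemma tdef_Aut:
  assumes "tdef B X" "\<sigma> \<in> G" "\<And>n. f n \<in> T1"
  shows "(\<lambda>n. \<sigma> \<circ> f n) \<in> X \<longleftrightarrow> f \<in> X"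
proof -
  have "case_prod f \<in> tuples_of M (\<lambda>(n, i). sorts i)" using assms(3) tuples_of_case_prod by blast
  from dset_Aut[OF assms(1)[unfolded tdef_def] wf assms(2) this]
  have "curry (\<sigma> \<circ> case_prod f) \<in> X \<longleftrightarrow> f \<in> X" by simp
  moreover have "curry (\<sigma> \<circ> case_prod f) = (\<lambda>n. \<sigma> \<circ> f n)" by (auto simp: fun_eq_iff)
  ultimately show ?thesis by simp
qed

lemma rdef_at: "rdef A \<delta> \<Longrightarrow> tdef A {f. (f m, f n) \<in> \<delta>}"
  using tdef_reindex[of A "\<lambda>f. (f 0, f 1) \<in> \<delta>" "\<lambda>k. if k = 0 then m else n"] by simp

lemma udef_at: "udef A S \<Longrightarrow> tdef A {f. f n \<in> S}"
  using tdef_reindex[of A "\<lambda>f. f 0 \<in> S" "\<lambda>k. n"] by simp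

lemma rdef_left: "rdef A \<delta> \<Longrightarrow> c \<in> T1 \<Longrightarrow> tdef (A \<union> range c) {f. (c, f n) \<in> \<delta>}"
  using tdef_param[OF rdef_at[of A \<delta> "Suc n" n], of c "Suc n"] by simp

lemma rdef_Int: "rdef A \<delta> \<Longrightarrow> rdef A \<epsilon> \<Longrightarrow> rdef A (\<delta> \<inter> \<epsilon>)"
  using tdef_conj[of A "\<lambda>f. (f 0, f 1) \<in> \<delta>" "\<lambda>f. (f 0, f 1) \<in> \<epsilon>"] by simp

lemma rdef_INT:
  "finite I \<Longrightarrow> (\<And>i. i \<in> I \<Longrightarrow> rdef A (\<delta> i)) \<Longrightarrow> rdef A (\<Inter>i\<in>I. \<delta> i)"
  using tdef_ball_finite[of I A "\<lambda>i f. (f 0, f 1) \<in> \<delta> i"] by simp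

lemma rdef_UNIV: "rdef A UNIV"
  using tdef_const[of A True] by simp

lemma rdef_Aut:
  assumes "rdef B \<delta>" "\<sigma> \<in> G" "a \<in> T1" "b \<in> T1"
  shows "(\<sigma> \<circ> a, \<sigma> \<circ> b) \<in> \<delta> \<longleftrightarrow> (a, b) \<in> \<delta>"
  using tdef_Aut[OF assms(1,2), of "\<lambda>n. if n = 0 then a else b"] assms by simp

lemma small_seq: "small \<kappa> (UNIV :: (nat \<times> 'i) set)"
  using small_Times[OF small_nat small_I] by simp

lemma tuple_compactness:
  assumes "small \<kappa> A" "\<And>X. X \<in> \<X> \<Longrightarrow> tdef A X"
    and fip: "\<And>\<X>0. finite \<X>0 \<Longrightarrow> \<X>0 \<subseteq> \<X> \<Longrightarrow> \<exists>f. (\<forall>n. f n \<in> T1) \<and> (\<forall>X\<in>\<X>0. f \<in> X)"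
  shows "\<exists>f. (\<forall>n. f n \<in> T1) \<and> (\<forall>X\<in>\<X>. f \<in> X)"
proof -
  let ?C = "\<lambda>X. {g :: nat \<times> 'i \<Rightarrow> 'a. curry g \<in> X}"
  have "\<exists>g\<in>tuples_of M (\<lambda>(n, i). sorts i). \<forall>X\<in>?C ` \<X>. g \<in> X"
  proof (rule compactness[OF small_seq assms(1)])
    fix X assume "X \<in> ?C ` \<X>" then show "dset M (\<lambda>(n, i). sorts i) UNIV A X"
      using assms(2) by (auto simp: tdef_def)
  next
    fix \<Y> assume *: "finite \<Y>" "\<Y> \<subseteq> ?C ` \<X>"
    obtain \<X>0 where X0: "\<X>0 \<subseteq> \<X>" "finite \<X>0" "\<Y> = ?C ` \<X>0" using finite_subset_image[OF *] by blast
    from fip[OF X0(2,1)] obtain f where "\<forall>n. f n \<in> T1" "\<forall>X\<in>\<X>0. f \<in> X" by blast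
    then show "\<exists>g\<in>tuples_of M (\<lambda>(n, i). sorts i). \<forall>X\<in>\<Y>. g \<in> X"
      unfolding X0(3) by (intro bexI[of _ "case_prod f"]) (auto simp: tuples_of_case_prod)
  qed
  then obtain g where "g \<in> tuples_of M (\<lambda>(n :: nat, i). sorts i)" "\<forall>X\<in>?C ` \<X>. g \<in> X" by blast
  then show ?thesis by (intro exI[of _ "curry g"]) (auto simp: tuples_of_curry)
qed

lemma udef_if_dset: "dset M sorts UNIV A X \<Longrightarrow> udef A X"
proof -
  assume "dset M sorts UNIV A X"
  then have "dset M (\<lambda>(n :: nat, i). sorts i) UNIV A {f. f \<circ> (\<lambda>i. (0, i)) \<in> X}"
    by (rule dset_reindex) auto
  then show ?thesis by (simp add: tdef_def curry_def comp_def)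
qed

text \<open>By conjugacy, a \<open>B\<close>-definable set containing one realization contains all
  of them, so the supersets of \<open>P\<close> already express the whole type.\<close>

lemma P_closed:
  assumes "a \<in> T1" "\<And>S. udef B S \<Longrightarrow> P \<subseteq> S \<Longrightarrow> a \<in> S"
  shows "a \<in> P"
proof -
  obtain b where b: "b \<in> P" using P_nonempty by blast
  have "a \<in> X" if X: "dset M sorts UNIV B X" "b \<in> X" for X
  proof (rule assms(2)[OF udef_if_dset[OF X(1)]])
    show "P \<subseteq> X"
    proof
      fix c assume "c \<in> P"
      then obtain \<sigma> where \<sigma>: "\<sigma> \<in> G" and c: "c = \<sigma> \<circ> b" using P_trans[OF b] by blast
      show "c \<in> X" unfolding c using dset_Aut[OF X(1) wf \<sigma> P_T1[OF b]] X(2) by blast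
    qed
  qed
  from conjugate_if_same_dsets[OF small_I small_B P_T1[OF b] assms(1) this]
  show ?thesis using P_trans[OF b] by blast
qed

text \<open>The conditions that every entry realizes the type are added to the family; all of them
  hold at any sequence of realizations, so finite satisfiability is preserved.\<close>

lemma P_compactness:
  assumes "small \<kappa> A" "\<And>X. X \<in> \<X> \<Longrightarrow> tdef A X"
    and fip: "\<And>\<X>0. finite \<X>0 \<Longrightarrow> \<X>0 \<subseteq> \<X> \<Longrightarrow> \<exists>f. (\<forall>n. f n \<in> P) \<and> (\<forall>X\<in>\<X>0. f \<in> X)"
  shows "\<exists>f. (\<forall>n. f n \<in> P) \<and> (\<forall>X\<in>\<X>. f \<in> X)"
proof -
  let ?\<P> = "{{f. f n \<in> S} | n S. udef B S \<and> P \<subseteq> S}"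
  have "\<exists>f. (\<forall>n. f n \<in> T1) \<and> (\<forall>X\<in>\<X> \<union> ?\<P>. f \<in> X)"
  proof (rule tuple_compactness[of "A \<union> B"])
    show "small \<kappa> (A \<union> B)" using assms(1) small_B by (rule small_Un)
    show "tdef (A \<union> B) X" if "X \<in> \<X> \<union> ?\<P>" for X
      using that
    proof
      assume "X \<in> \<X>"
      then show ?thesis by (rule tdef_mono[OF assms(2)]) auto
    next
      assume "X \<in> ?\<P>"
      then obtain n S where "udef B S" "X = {f. f n \<in> S}" by blast
      then show ?thesis using tdef_mono[OF udef_at, of B S] by auto
    qed
    fix \<X>0 assume *: "finite \<X>0" "\<X>0 \<subseteq> \<X> \<union> ?\<P>"
    then obtain f where f: "\<forall>n. f n \<in> P" "\<forall>X\<in>\<X>0 \<inter> \<X>. f \<in> X" using fip[of "\<X>0 \<inter> \<X>"] by auto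
    moreover have "f \<in> X" if "X \<in> \<X>0" for X using that * f by blast
    ultimately show "\<exists>f. (\<forall>n. f n \<in> T1) \<and> (\<forall>X\<in>\<X>0. f \<in> X)" using P_T1 by blast
  qed
  then obtain f where f: "\<forall>n. f n \<in> T1" "\<forall>X\<in>\<X> \<union> ?\<P>. f \<in> X" by blast
  moreover have "f n \<in> P" for n
  proof (rule P_closed)
    show "f n \<in> T1" using f(1) by blast
    fix S assume "udef B S" "P \<subseteq> S"
    then have "{f. f n \<in> S} \<in> ?\<P>" by blast
    then have "f \<in> {f. f n \<in> S}" using f(2) by blast
    then show "f n \<in> S" by simp
  qed
  ultimately show ?thesis by blast
qed

lemma P_compactness_directed:
  assumes "small \<kappa> A" "\<And>i. i \<in> I \<Longrightarrow> tdef A (X i)" "I \<noteq> {}"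
    and dir: "\<And>i j. i \<in> I \<Longrightarrow> j \<in> I \<Longrightarrow> \<exists>k\<in>I. X k \<subseteq> X i \<inter> X j"
    and sat: "\<And>i. i \<in> I \<Longrightarrow> \<exists>f. (\<forall>n. f n \<in> P) \<and> f \<in> X i"
  shows "\<exists>f. (\<forall>n. f n \<in> P) \<and> (\<forall>i\<in>I. f \<in> X i)"
proof -
  have *: "\<exists>k\<in>I. X k \<subseteq> (\<Inter>i\<in>I0. X i)" if "finite I0" "I0 \<subseteq> I" for I0
    using that
  proof (induction I0 rule: finite_induct)
    case (insert i I0)
    then obtain k where k: "k \<in> I" "X k \<subseteq> (\<Inter>i\<in>I0. X i)" by blast
    from k(1) insert.prems obtain k' where "k' \<in> I" "X k' \<subseteq> X k \<inter> X i" using dir by blast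
    with k show ?case by blast
  qed (use assms(3) in auto)
  have "\<exists>f. (\<forall>n. f n \<in> P) \<and> (\<forall>Y\<in>\<X>0. f \<in> Y)" if X0: "finite \<X>0" "\<X>0 \<subseteq> X ` I" for \<X>0
  proof -
    obtain I0 where I0: "I0 \<subseteq> I" "finite I0" "\<X>0 = X ` I0" using finite_subset_image[OF X0] by blast
    from *[OF I0(2,1)] obtain k where "k \<in> I" "X k \<subseteq> (\<Inter>i\<in>I0. X i)" by blast
    with sat[of k] show ?thesis unfolding I0(3) by blast
  qed
  then show ?thesis using P_compactness[OF assms(1), of "X ` I"] assms(2) by auto
qed

lemma pair_conjugate:
  assumes "a \<in> T1" "b \<in> T1" "a' \<in> T1" "b' \<in> T1"
    and "\<And>\<delta>. rdef B \<delta> \<Longrightarrow> (a, b) \<in> \<delta> \<Longrightarrow> (a', b') \<in> \<delta>"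
  shows "\<exists>\<sigma>\<in>G. a' = \<sigma> \<circ> a \<and> b' = \<sigma> \<circ> b"
proof -
  \<comment> \<open>All positions from 1 on repeat \<open>b\<close>, which fits a pair into the
    format of sequences.\<close>
  define F where "F = (\<lambda>(a :: 'i \<Rightarrow> 'a, b) (n :: nat, i). if n = 0 then a i else b i)"
  have T: "F (a, b) \<in> tuples_of M (\<lambda>(n, i). sorts i)" "F (a', b') \<in> tuples_of M (\<lambda>(n, i). sorts i)"
    using assms by (auto simp: F_def tuples_of_def)
  have "F (a', b') \<in> X" if X: "dset M (\<lambda>(n, i). sorts i) UNIV B X" "F (a, b) \<in> X" for X
  proof -
    have X': "dset M (\<lambda>(n :: nat, i). sorts i) UNIV B {f. f \<circ> (\<lambda>(n :: nat, i). (if n = 0 then 0 else 1 :: nat, i)) \<in> X}"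
      by (rule dset_reindex[OF X(1)]) auto
    have eq: "f \<circ> (\<lambda>(n :: nat, i). (if n = 0 then 0 else 1 :: nat, i)) = F (curry f 0, curry f 1)" for f
      by (auto simp: F_def fun_eq_iff)
    have "rdef B {ab. F ab \<in> X}" using X'[unfolded eq] unfolding tdef_def mem_Collect_eq .
    from assms(5)[OF this] X(2) show ?thesis by simp
  qed
  from conjugate_if_same_dsets[OF small_seq small_B T this]
  obtain \<sigma> where "\<sigma> \<in> G" and eq: "F (a', b') = \<sigma> \<circ> F (a, b)" by blast
  moreover have "a' = \<sigma> \<circ> a" using fun_cong[OF eq, of "(0, _)"] by (auto simp: F_def)
  moreover have "b' = \<sigma> \<circ> b" using fun_cong[OF eq, of "(1, _)"] by (auto simp: F_def)
  ultimately show ?thesis by blast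
qed

section \<open>Type-definable relations on the realizations\<close>

text \<open>Type-definability over \<open>B\<close> inside \<open>P\<close>: a pair belongs to
  \<open>Q\<close> as soon as no \<open>B\<close>-definable superset of \<open>Q\<close> excludes
  it.\<close>

definition tclosed :: "('i \<Rightarrow> 'a) rel \<Rightarrow> bool" where
  "tclosed Q \<longleftrightarrow> (\<forall>a\<in>P. \<forall>b\<in>P. (\<forall>\<delta>. rdef B \<delta> \<and> Q \<subseteq> \<delta> \<longrightarrow> (a, b) \<in> \<delta>) \<longrightarrow> (a, b) \<in> Q)"

text \<open>Projections of type-definable sets are type-definable by compactness: the conditions are
  satisfiable together with the type of \<open>(a, b)\<close>. A solution starts with a conjugate of
  the pair and is moved back to start with the pair itself.\<close>

lemma tclosed_projection:
  assumes "\<And>X. X \<in> \<Theta> \<Longrightarrow> tdef B X"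
  shows "tclosed {(f 0, f 1) | f. (\<forall>n. f n \<in> P) \<and> (\<forall>X\<in>\<Theta>. f \<in> X)}" (is "tclosed ?Q")
  unfolding tclosed_def
proof (intro ballI impI)
  fix a b assume ab: "a \<in> P" "b \<in> P" and *: "\<forall>\<delta>. rdef B \<delta> \<and> ?Q \<subseteq> \<delta> \<longrightarrow> (a, b) \<in> \<delta>"
  let ?\<D> = "{{f. (f 0, f 1) \<in> \<delta>} | \<delta>. rdef B \<delta> \<and> (a, b) \<in> \<delta>}"
  have "\<exists>f. (\<forall>n. f n \<in> P) \<and> (\<forall>X\<in>\<Theta> \<union> ?\<D>. f \<in> X)"
  proof (rule P_compactness[OF small_B])
    show "tdef B X" if "X \<in> \<Theta> \<union> ?\<D>" for X using that assms by auto
    fix \<X>0 assume X0: "finite \<X>0" "\<X>0 \<subseteq> \<Theta> \<union> ?\<D>"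
    show "\<exists>f. (\<forall>n. f n \<in> P) \<and> (\<forall>X\<in>\<X>0. f \<in> X)"
    proof (rule ccontr)
      assume no: "\<nexists>f. (\<forall>n. f n \<in> P) \<and> (\<forall>X\<in>\<X>0. f \<in> X)"
      have "\<forall>X\<in>\<X>0 - \<Theta>. \<exists>\<delta>. X = {f. (f 0, f 1) \<in> \<delta>} \<and> rdef B \<delta> \<and> (a, b) \<in> \<delta>"
        using X0(2) by blast
      from bchoice[OF this] obtain \<delta> where
        "\<forall>X\<in>\<X>0 - \<Theta>. X = {f. (f 0, f 1) \<in> \<delta> X} \<and> rdef B (\<delta> X) \<and> (a, b) \<in> \<delta> X" by blast
      then have \<delta>: "\<And>X. X \<in> \<X>0 - \<Theta> \<Longrightarrow> X = {f. (f 0, f 1) \<in> \<delta> X}"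
        "\<And>X. X \<in> \<X>0 - \<Theta> \<Longrightarrow> rdef B (\<delta> X)" "\<And>X. X \<in> \<X>0 - \<Theta> \<Longrightarrow> (a, b) \<in> \<delta> X"
        by blast+
      let ?\<delta> = "\<Inter>X\<in>\<X>0 - \<Theta>. \<delta> X"
      have "rdef B ?\<delta>" using X0(1) \<delta>(2) by (intro rdef_INT) auto
      \<comment> \<open>If a finite part were unsatisfiable, \<open>- ?\<delta>\<close> would be a
        definable superset of the projection missing \<open>(a, b)\<close>.\<close>
      then have "rdef B (- ?\<delta>)" using tdef_not[of B "\<lambda>f. (f 0, f 1) \<in> ?\<delta>"] by simp
      moreover have "?Q \<subseteq> - ?\<delta>"
      proof safe
        fix f assume f: "\<forall>n. f n \<in> P" "\<forall>X\<in>\<Theta>. f \<in> X" "(f 0, f 1) \<in> ?\<delta>"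
        have "f \<in> X" if "X \<in> \<X>0" for X
        proof (cases "X \<in> \<Theta>")
          case False
          with that have X: "X \<in> \<X>0 - \<Theta>" by blast
          with f(3) have "f \<in> {f. (f 0, f 1) \<in> \<delta> X}" by blast
          then show ?thesis unfolding \<delta>(1)[OF X, symmetric] .
        qed (use f in blast)
        with no f show False by blast
      qed
      ultimately have "(a, b) \<in> - ?\<delta>" using * by blast
      then show False using \<delta>(3) by blast
    qed
  qed
  then obtain f where f: "\<forall>n. f n \<in> P" "\<forall>X\<in>\<Theta> \<union> ?\<D>. f \<in> X" by blast
  have "(f 0, f 1) \<in> \<delta>" if "rdef B \<delta>" "(a, b) \<in> \<delta>" for \<delta>
  proof -
    have "{f. (f 0, f 1) \<in> \<delta>} \<in> ?\<D>" using that by blast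
    then have "f \<in> {f. (f 0, f 1) \<in> \<delta>}" using f(2) by blast
    then show ?thesis by simp
  qed
  from pair_conjugate[OF _ _ _ _ this] ab f(1) P_T1
  obtain \<sigma> where \<sigma>: "\<sigma> \<in> G" "f 0 = \<sigma> \<circ> a" "f 1 = \<sigma> \<circ> b" by blast
  let ?i = "Hilbert_Choice.inv \<sigma>" and ?f = "\<lambda>n. Hilbert_Choice.inv \<sigma> \<circ> f n"
  have "?f 0 = a" "?f 1 = b" using \<sigma> AutOver_inv_comp[OF \<sigma>(1)] by (auto simp: comp_assoc[symmetric])
  moreover have "\<forall>n. ?f n \<in> P" using f(1) P_Aut AutOver_inv[OF \<sigma>(1)] by blast
  moreover have "?f \<in> X" if "X \<in> \<Theta>" for X
  proof -
    have "?f \<in> X \<longleftrightarrow> f \<in> X"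
      by (rule tdef_Aut[OF assms[OF that] AutOver_inv[OF \<sigma>(1)]]) (use f(1) P_T1 in blast)
    with f(2) that show ?thesis by blast
  qed
  ultimately show "(a, b) \<in> ?Q" by (intro CollectI exI[of _ ?f]) auto
qed


section \<open>The commutator relation\<close>

lemma G_cancel: "\<sigma> \<in> G \<Longrightarrow> Hilbert_Choice.inv \<sigma> \<circ> (\<sigma> \<circ> x) = x"
  "\<sigma> \<in> G \<Longrightarrow> \<sigma> \<circ> (Hilbert_Choice.inv \<sigma> \<circ> x) = x"
  by (simp_all add: fun_eq_iff AutOver_inv_comp)

lemma P_inv: "a \<in> P \<Longrightarrow> \<sigma> \<in> G \<Longrightarrow> Hilbert_Choice.inv \<sigma> \<circ> a \<in> P"
  by (rule P_Aut[OF _ AutOver_inv])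

abbreviation "R \<equiv> commutator_rel M B p"

lemma R_sub: "R \<subseteq> P \<times> P"
  by (auto simp: commutator_rel_def)

lemma R_I:
  assumes "a \<in> P" "\<sigma> \<in> G" "\<tau> \<in> G"
  shows "(a, Hilbert_Choice.inv \<sigma> \<circ> Hilbert_Choice.inv \<tau> \<circ> \<sigma> \<circ> \<tau> \<circ> a) \<in> R"
proof -
  have "Hilbert_Choice.inv \<sigma> \<circ> Hilbert_Choice.inv \<tau> \<circ> \<sigma> \<circ> \<tau> \<in> G"
    using assms by (intro AutOver_comp AutOver_inv)
  from P_Aut[OF assms(1) this] show ?thesis using assms unfolding commutator_rel_def by blast
qed

text \<open>With \<open>x2 = \<tau> x0\<close>, \<open>x3 = \<sigma> x2\<close> and \<open>x4 = \<tau>\<^sup>-\<^sup>1 x3\<close>, the pair \<open>(x0, x1)\<close> is in \<open>R\<close> if and only if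
  \<open>\<tau>\<close> takes \<open>(x0, x4)\<close> to \<open>(x2, x3)\<close> and \<open>\<sigma>\<close> takes \<open>(x2, x1)\<close> to \<open>(x3, x4)\<close>, so the relation only
  depends on types of pairs.\<close>

definition commutator_conds :: "('i \<Rightarrow> 'a) rel \<Rightarrow> (nat \<Rightarrow> 'i \<Rightarrow> 'a) set" where
  "commutator_conds \<delta> = {f. ((f 0, f 4) \<in> \<delta> \<longleftrightarrow> (f 2, f 3) \<in> \<delta>) \<and> ((f 2, f 1) \<in> \<delta> \<longleftrightarrow> (f 3, f 4) \<in> \<delta>)}"

lemma tdef_commutator_conds: "rdef A \<delta> \<Longrightarrow> tdef A (commutator_conds \<delta>)"
  unfolding commutator_conds_def by (intro tdef_conj tdef_iff) (rule rdef_at, assumption)+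

lemma R_eq: "R = {(f 0, f 1) | f. (\<forall>n. f n \<in> P) \<and> (\<forall>X\<in>commutator_conds ` {\<delta>. rdef B \<delta>}. f \<in> X)}"
  (is "_ = ?Q")
proof (intro equalityI subrelI)
  fix a b assume "(a, b) \<in> R"
  then obtain \<sigma> \<tau> where a: "a \<in> P" "b \<in> P" and st: "\<sigma> \<in> G" "\<tau> \<in> G"
    and b: "b = Hilbert_Choice.inv \<sigma> \<circ> Hilbert_Choice.inv \<tau> \<circ> \<sigma> \<circ> \<tau> \<circ> a"
    unfolding commutator_rel_def by blast
  define c where "c = \<tau> \<circ> a"
  define d where "d = \<sigma> \<circ> c"
  define e where "e = Hilbert_Choice.inv \<tau> \<circ> d"
  have P: "c \<in> P" "d \<in> P" "e \<in> P"
    unfolding c_def d_def e_def using a st by (blast intro: P_Aut AutOver_inv)+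
  have d: "d = \<tau> \<circ> e" using AutOver_inv_comp[OF st(2)] by (simp add: e_def comp_assoc[symmetric])
  have e: "e = \<sigma> \<circ> b" unfolding b using AutOver_inv_comp[OF st(1)] by (simp add: e_def d_def c_def comp_assoc[symmetric])
  define f where "f = (\<lambda>n :: nat. if n = 0 then a else if n = 1 then b else if n = 2 then c else if n = 3 then d else e)"
  have f: "f 0 = a" "f 1 = b" "f 2 = c" "f 3 = d" "f 4 = e" by (simp_all add: f_def)
  have "f \<in> commutator_conds \<delta>" if \<delta>: "rdef B \<delta>" for \<delta>
  proof -
    have "(c, d) \<in> \<delta> \<longleftrightarrow> (a, e) \<in> \<delta>"
      unfolding d unfolding c_def by (rule rdef_Aut[OF \<delta> st(2)]) (use a P P_T1 in auto)
    moreover have "(d, e) \<in> \<delta> \<longleftrightarrow> (c, b) \<in> \<delta>"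
      unfolding e unfolding d_def by (rule rdef_Aut[OF \<delta> st(1)]) (use a P P_T1 in auto)
    ultimately show ?thesis unfolding commutator_conds_def mem_Collect_eq f by blast
  qed
  moreover have "\<forall>n. f n \<in> P" using a P by (simp add: f_def)
  ultimately show "(a, b) \<in> ?Q" using f(1,2) by (intro CollectI exI[of _ f]) auto
next
  fix a b assume "(a, b) \<in> ?Q"
  then obtain f where ab: "a = f 0" "b = f 1" and P: "\<forall>n. f n \<in> P"
    and f: "\<forall>X\<in>commutator_conds ` {\<delta>. rdef B \<delta>}. f \<in> X" by blast
  have T: "f n \<in> T1" for n using P P_T1 by blast
  have c: "f \<in> commutator_conds \<delta>" if "rdef B \<delta>" for \<delta> using f that by blast
  have "(f 2, f 3) \<in> \<delta>" if "rdef B \<delta>" "(f 0, f 4) \<in> \<delta>" for \<delta>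
    using c[OF that(1)] that(2) by (simp add: commutator_conds_def)
  from pair_conjugate[OF T T T T this]
  obtain \<tau> where \<tau>: "\<tau> \<in> G" "f 2 = \<tau> \<circ> f 0" "f 3 = \<tau> \<circ> f 4" by blast
  have "(f 3, f 4) \<in> \<delta>" if "rdef B \<delta>" "(f 2, f 1) \<in> \<delta>" for \<delta>
    using c[OF that(1)] that(2) by (simp add: commutator_conds_def)
  from pair_conjugate[OF T T T T this]
  obtain \<sigma> where \<sigma>: "\<sigma> \<in> G" "f 3 = \<sigma> \<circ> f 2" "f 4 = \<sigma> \<circ> f 1" by blast
  have "f 1 = Hilbert_Choice.inv \<sigma> \<circ> f 4"
    unfolding \<sigma>(3) using AutOver_inv_comp[OF \<sigma>(1)] by (simp add: comp_assoc[symmetric])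
  also have "f 4 = Hilbert_Choice.inv \<tau> \<circ> f 3"
    unfolding \<tau>(3) using AutOver_inv_comp[OF \<tau>(1)] by (simp add: comp_assoc[symmetric])
  finally have "f 1 = Hilbert_Choice.inv \<sigma> \<circ> Hilbert_Choice.inv \<tau> \<circ> \<sigma> \<circ> \<tau> \<circ> f 0"
    unfolding \<sigma>(2) \<tau>(2) by (simp only: comp_assoc)
  moreover have "f 0 \<in> P" using P by blast
  ultimately show "(a, b) \<in> R"
    unfolding ab using R_I[OF _ \<sigma>(1) \<tau>(1), of "f 0"] by metis
qed

lemma tclosed_R: "tclosed R"
  unfolding R_eq by (rule tclosed_projection) (use tdef_commutator_conds in blast)

lemma R_refl: "a \<in> P \<Longrightarrow> (a, a) \<in> R"
  using R_I[of a id id] by simp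

lemma R_sym: "(a, b) \<in> R \<Longrightarrow> (b, a) \<in> R"
proof -
  assume "(a, b) \<in> R"
  then obtain \<sigma> \<tau> where a: "a \<in> P" "b \<in> P" and st: "\<sigma> \<in> G" "\<tau> \<in> G"
    and b: "b = Hilbert_Choice.inv \<sigma> \<circ> Hilbert_Choice.inv \<tau> \<circ> \<sigma> \<circ> \<tau> \<circ> a"
    unfolding commutator_rel_def by blast
  have "a = Hilbert_Choice.inv \<tau> \<circ> Hilbert_Choice.inv \<sigma> \<circ> \<tau> \<circ> \<sigma> \<circ> b"
    unfolding b fun_eq_iff o_apply using AutOver_inv_comp[OF st(1)] AutOver_inv_comp[OF st(2)] by simp
  with R_I[OF a(2) st(2,1)] show ?thesis by simp
qed

text \<open>Invariance follows from closedness, since the \<open>B\<close>-definable supersets of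
  \<open>R\<close> are invariant.\<close>

lemma R_Aut: "(a, b) \<in> R \<Longrightarrow> \<sigma> \<in> G \<Longrightarrow> (\<sigma> \<circ> a, \<sigma> \<circ> b) \<in> R"
proof -
  assume R: "(a, b) \<in> R" and \<sigma>: "\<sigma> \<in> G"
  from R have ab: "a \<in> P" "b \<in> P" using R_sub by auto
  show ?thesis
  proof (rule tclosed_R[unfolded tclosed_def, rule_format, OF P_Aut[OF ab(1) \<sigma>] P_Aut[OF ab(2) \<sigma>]])
    fix \<delta> assume \<delta>: "rdef B \<delta> \<and> R \<subseteq> \<delta>"
    then show "(\<sigma> \<circ> a, \<sigma> \<circ> b) \<in> \<delta>"
      using rdef_Aut[of \<delta> \<sigma> a b] \<sigma> ab P_T1 R by blast
  qed
qed

text \<open>The intersection matters for \<open>n = 0\<close> alone, where the relational power is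
  equality of all tuples.\<close>

definition Rn :: "nat \<Rightarrow> ('i \<Rightarrow> 'a) rel" where
  "Rn n = (R ^^ n) \<inter> (P \<times> P)"

lemma Rn_P: "(a, b) \<in> Rn n \<Longrightarrow> a \<in> P \<and> b \<in> P"
  by (auto simp: Rn_def)

lemma relpow_P: "(a, b) \<in> R ^^ n \<Longrightarrow> a \<in> P \<longleftrightarrow> b \<in> P"
  by (induction n arbitrary: b) (use R_sub in auto)

lemma Rn_0: "(a, b) \<in> Rn 0 \<longleftrightarrow> a \<in> P \<and> a = b"
  by (auto simp: Rn_def)

lemma Rn_1: "Rn 1 = R"
  using R_sub by (auto simp: Rn_def)

lemma Rn_add: "Rn (m + n) = Rn m O Rn n"
proof (intro equalityI subrelI)
  fix a c assume "(a, c) \<in> Rn (m + n)"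
  then obtain b where "(a, b) \<in> R ^^ m" "(b, c) \<in> R ^^ n" "a \<in> P" "c \<in> P" by (auto simp: Rn_def relpow_add)
  then show "(a, c) \<in> Rn m O Rn n" using relpow_P by (auto simp: Rn_def)
qed (auto simp: Rn_def relpow_add)

lemma Rn_trans: "(a, b) \<in> Rn m \<Longrightarrow> (b, c) \<in> Rn n \<Longrightarrow> (a, c) \<in> Rn (m + n)"
  by (auto simp: Rn_add)

lemma Rn_Suc: "Rn (Suc n) = Rn n O R"
  using Rn_add[of n 1] unfolding Rn_1 by simp

lemma Rn_refl: "a \<in> P \<Longrightarrow> (a, a) \<in> Rn n"
  by (induction n) (auto simp: Rn_0 Rn_Suc intro: R_refl)

lemma Rn_mono: "m \<le> n \<Longrightarrow> Rn m \<subseteq> Rn n"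
proof
  fix x assume "m \<le> n" "x \<in> Rn m"
  then show "x \<in> Rn n"
    using Rn_trans[of "fst x" "snd x" m "snd x" "n - m"] Rn_refl[of "snd x" "n - m"] Rn_P[of "fst x" "snd x" m]
    by simp
qed

lemma Rn_sym: "(a, b) \<in> Rn n \<Longrightarrow> (b, a) \<in> Rn n"
proof (induction n arbitrary: b)
  case (Suc n)
  then obtain c where "(a, c) \<in> Rn n" "(c, b) \<in> R" by (auto simp: Rn_Suc)
  then have "(c, a) \<in> Rn n" "(b, c) \<in> Rn 1" using Suc.IH R_sym by (auto simp: Rn_1[simplified])
  then show ?case using Rn_trans[of b c 1 a n] by simp
qed (auto simp: Rn_0)

lemma Rn_Aut: "(a, b) \<in> Rn n \<Longrightarrow> \<sigma> \<in> G \<Longrightarrow> (\<sigma> \<circ> a, \<sigma> \<circ> b) \<in> Rn n"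
proof (induction n arbitrary: b)
  case 0
  then have "a \<in> P" "a = b" by (auto simp: Rn_0)
  then show ?case using P_Aut[OF _ 0(2)] by (simp only: Rn_0)
next
  case (Suc n)
  then obtain c where c: "(a, c) \<in> Rn n" "(c, b) \<in> R" by (auto simp: Rn_Suc)
  from Suc.IH[OF c(1) Suc.prems(2)] R_Aut[OF c(2) Suc.prems(2)] show ?case
    unfolding Rn_Suc by (rule relcompI)
qed

lemma Rn_Aut_iff: "\<sigma> \<in> G \<Longrightarrow> (\<sigma> \<circ> a, \<sigma> \<circ> b) \<in> Rn n \<longleftrightarrow> (a, b) \<in> Rn n"
proof
  assume \<sigma>: "\<sigma> \<in> G" and "(\<sigma> \<circ> a, \<sigma> \<circ> b) \<in> Rn n"
  from Rn_Aut[OF this(2) AutOver_inv[OF \<sigma>]] show "(a, b) \<in> Rn n"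
    using AutOver_inv_comp[OF \<sigma>] by (simp add: comp_assoc[symmetric])
qed (rule Rn_Aut)

text \<open>\<open>\<tau> \<circ> \<sigma>\<close> is a commutator times
  \<open>\<sigma> \<circ> \<tau>\<close>. In the form used by \<open>R\<close> it is the commutator
  of the two inverse automorphisms, whence the double inverses.\<close>

lemma Rn_commute:
  assumes "a \<in> P" "\<sigma> \<in> G" "\<tau> \<in> G"
  shows "(\<sigma> \<circ> \<tau> \<circ> a, \<tau> \<circ> \<sigma> \<circ> a) \<in> Rn 1"
proof -
  have "(\<sigma> \<circ> \<tau> \<circ> a, Hilbert_Choice.inv (Hilbert_Choice.inv \<tau>) \<circ> Hilbert_Choice.inv (Hilbert_Choice.inv \<sigma>) \<circ>
     Hilbert_Choice.inv \<tau> \<circ> Hilbert_Choice.inv \<sigma> \<circ> (\<sigma> \<circ> \<tau> \<circ> a)) \<in> R"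
    by (rule R_I) (use assms P_Aut AutOver_comp AutOver_inv in \<open>auto simp: comp_assoc\<close>)
  moreover have "Hilbert_Choice.inv (Hilbert_Choice.inv \<tau>) \<circ> Hilbert_Choice.inv (Hilbert_Choice.inv \<sigma>) \<circ>
     Hilbert_Choice.inv \<tau> \<circ> Hilbert_Choice.inv \<sigma> \<circ> (\<sigma> \<circ> \<tau> \<circ> a) = \<tau> \<circ> \<sigma> \<circ> a"
    using AutOver_inv_comp[OF assms(2)] AutOver_inv_comp[OF assms(3)]
    by (simp add: fun_eq_iff AutOver_bij[OF assms(2)] AutOver_bij[OF assms(3)] inv_inv_eq)
  ultimately show ?thesis by (simp add: Rn_1[simplified])
qed

lemma tclosed_comp:
  assumes "tclosed Q1" "tclosed Q2" "Q1 \<subseteq> P \<times> P" "Q2 \<subseteq> P \<times> P"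
  shows "tclosed (Q1 O Q2)"
proof -
  \<comment> \<open>The intermediate point of the composition sits at position 2 and is projected
    away.\<close>
  let ?\<Theta> = "{{f :: nat \<Rightarrow> 'i \<Rightarrow> 'a. (f 0, f 2) \<in> \<delta>} | \<delta>. rdef B \<delta> \<and> Q1 \<subseteq> \<delta>} \<union> {{f. (f 2, f 1) \<in> \<delta>} | \<delta>. rdef B \<delta> \<and> Q2 \<subseteq> \<delta>}"
  have "Q1 O Q2 = {(f 0, f 1) | f :: nat \<Rightarrow> 'i \<Rightarrow> 'a. (\<forall>n. f n \<in> P) \<and> (\<forall>X\<in>?\<Theta>. f \<in> X)}" (is "_ = ?Q")
  proof (intro equalityI subrelI)
    fix a c assume "(a, c) \<in> Q1 O Q2"
    then obtain b where b: "(a, b) \<in> Q1" "(b, c) \<in> Q2" by blast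
    let ?f = "\<lambda>n :: nat. if n = 0 then a else if n = 1 then c else b"
    have "\<forall>n. ?f n \<in> P" using b assms(3,4) by auto
    moreover have "\<forall>X\<in>?\<Theta>. ?f \<in> X" using b by auto
    ultimately show "(a, c) \<in> ?Q" by (intro CollectI exI[of _ ?f]) auto
  next
    fix a c assume "(a, c) \<in> ?Q"
    then obtain f where ac: "a = f 0" "c = f 1" and P: "\<forall>n. f n \<in> P" and f: "\<forall>X\<in>?\<Theta>. f \<in> X" by blast
    have "(f 0, f 2) \<in> Q1"
    proof (rule assms(1)[unfolded tclosed_def, rule_format])
      fix \<delta> assume "rdef B \<delta> \<and> Q1 \<subseteq> \<delta>"
      then have "{f. (f 0, f 2) \<in> \<delta>} \<in> ?\<Theta>" by blast
      then have "f \<in> {f. (f 0, f 2) \<in> \<delta>}" using f by blast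
      then show "(f 0, f 2) \<in> \<delta>" by simp
    qed (use P in auto)
    moreover have "(f 2, f 1) \<in> Q2"
    proof (rule assms(2)[unfolded tclosed_def, rule_format])
      fix \<delta> assume "rdef B \<delta> \<and> Q2 \<subseteq> \<delta>"
      then have "{f. (f 2, f 1) \<in> \<delta>} \<in> ?\<Theta>" by blast
      then have "f \<in> {f. (f 2, f 1) \<in> \<delta>}" using f by blast
      then show "(f 2, f 1) \<in> \<delta>" by simp
    qed (use P in auto)
    ultimately show "(a, c) \<in> Q1 O Q2" unfolding ac by blast
  qed
  moreover have "tclosed ?Q"
  proof (rule tclosed_projection)
    fix X assume "X \<in> ?\<Theta>"
    then consider \<delta> where "rdef B \<delta>" "X = {f. (f 0, f 2) \<in> \<delta>}" | \<delta> where "rdef B \<delta>" "X = {f. (f 2, f 1) \<in> \<delta>}"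
      by blast
    then show "tdef B X" by cases (simp_all only: rdef_at)
  qed
  ultimately show ?thesis by simp
qed

lemma tclosed_Id: "tclosed (Rn 0)"
  unfolding tclosed_def
proof (intro ballI impI)
  fix a b assume ab: "a \<in> P" "b \<in> P" and *: "\<forall>\<delta>. rdef B \<delta> \<and> Rn 0 \<subseteq> \<delta> \<longrightarrow> (a, b) \<in> \<delta>"
  have "a i = b i" for i
  proof -
    let ?\<delta> = "{(x :: 'i \<Rightarrow> 'a, y). x i = y i}"
    have "rdef B ?\<delta>" using tdef_coord[of B 0 i 1] by simp
    moreover have "Rn 0 \<subseteq> ?\<delta>" by (auto simp: Rn_0)
    ultimately have "(a, b) \<in> ?\<delta>" using * by blast
    then show ?thesis by simp
  qed
  then show "(a, b) \<in> Rn 0" using ab by (auto simp: Rn_0)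
qed

lemma tclosed_Rn: "tclosed (Rn n)"
proof (induction n)
  case (Suc n)
  then show ?case unfolding Rn_Suc by (rule tclosed_comp) (use tclosed_R R_sub Rn_def in auto)
qed (rule tclosed_Id)

text \<open>The definable neighbourhoods of \<open>Rn n\<close>. They form a directed family, and
  compactness replaces the closed relation by one of them.\<close>

definition Delta :: "nat \<Rightarrow> ('i \<Rightarrow> 'a) rel set" where
  "Delta n = {\<delta>. rdef B \<delta> \<and> Rn n \<subseteq> \<delta>}"

lemma Delta_Rn: "a \<in> P \<Longrightarrow> b \<in> P \<Longrightarrow> (\<And>\<delta>. \<delta> \<in> Delta n \<Longrightarrow> (a, b) \<in> \<delta>) \<Longrightarrow> (a, b) \<in> Rn n"
  using tclosed_Rn[of n] unfolding tclosed_def Delta_def by blast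

lemma Delta_INT: "finite I \<Longrightarrow> (\<And>i. i \<in> I \<Longrightarrow> \<delta> i \<in> Delta n) \<Longrightarrow> (\<Inter>i\<in>I. \<delta> i) \<in> Delta n"
  unfolding Delta_def using rdef_INT[of I B \<delta>] by blast

lemma Delta_Int: "\<delta> \<in> Delta n \<Longrightarrow> \<epsilon> \<in> Delta n \<Longrightarrow> \<delta> \<inter> \<epsilon> \<in> Delta n"
  unfolding Delta_def using rdef_Int[of B \<delta> \<epsilon>] by blast

lemma Delta_UNIV: "UNIV \<in> Delta n"
  unfolding Delta_def using rdef_UNIV by blast

lemma Delta_Aut:
  assumes "\<delta> \<in> Delta n" "\<sigma> \<in> G" "a \<in> P" "b \<in> P"
  shows "(\<sigma> \<circ> a, \<sigma> \<circ> b) \<in> \<delta> \<longleftrightarrow> (a, b) \<in> \<delta>"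
  using assms by (intro rdef_Aut) (auto simp: Delta_def P_T1)

section \<open>The derived subgroup\<close>

abbreviation "AR \<equiv> AutRestr M B p"

definition res :: "('a \<Rightarrow> 'a) \<Rightarrow> ('i \<Rightarrow> 'a) \<Rightarrow> ('i \<Rightarrow> 'a)" where
  "res \<sigma> = (\<lambda>a\<in>P. \<sigma> \<circ> a)"

lemma res_apply: "a \<in> P \<Longrightarrow> res \<sigma> a = \<sigma> \<circ> a"
  by (simp add: res_def)

lemma carrier_AR: "carrier AR = res ` G"
  by (simp add: AutRestr_def res_def)

lemma res_Bij: "\<sigma> \<in> G \<Longrightarrow> res \<sigma> \<in> Bij P"
proof -
  assume \<sigma>: "\<sigma> \<in> G"
  have "bij_betw (res \<sigma>) P P"
    by (rule bij_betwI[where g = "res (Hilbert_Choice.inv \<sigma>)"])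
       (auto simp: res_apply P_Aut P_inv G_cancel \<sigma>)
  then show ?thesis by (simp add: Bij_def res_def)
qed

lemma mult_AR: "\<sigma> \<in> G \<Longrightarrow> \<tau> \<in> G \<Longrightarrow> res \<sigma> \<otimes>\<^bsub>AR\<^esub> res \<tau> = res (\<sigma> \<circ> \<tau>)"
proof -
  assume st: "\<sigma> \<in> G" "\<tau> \<in> G"
  then have "res \<sigma> \<otimes>\<^bsub>AR\<^esub> res \<tau> = compose P (res \<sigma>) (res \<tau>)"
    using res_Bij by (simp add: AutRestr_def BijGroup_def)
  also have "\<dots> = res (\<sigma> \<circ> \<tau>)"
    using st P_Aut by (auto simp: compose_def res_def fun_eq_iff)
  finally show ?thesis .
qed

lemma one_AR: "\<one>\<^bsub>AR\<^esub> = res id"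
  by (auto simp: AutRestr_def BijGroup_def res_def)

lemma group_AR: "group AR"
proof (rule groupI)
  show "\<one>\<^bsub>AR\<^esub> \<in> carrier AR" by (simp add: one_AR carrier_AR)
  fix x assume x: "x \<in> carrier AR"
  then obtain \<sigma> where \<sigma>: "\<sigma> \<in> G" "x = res \<sigma>" by (auto simp: carrier_AR)
  show "\<one>\<^bsub>AR\<^esub> \<otimes>\<^bsub>AR\<^esub> x = x" using \<sigma> by (simp add: one_AR mult_AR)
  show "\<exists>y\<in>carrier AR. y \<otimes>\<^bsub>AR\<^esub> x = \<one>\<^bsub>AR\<^esub>"
    by (rule bexI[of _ "res (Hilbert_Choice.inv \<sigma>)"])
       (use \<sigma> in \<open>auto simp: one_AR mult_AR carrier_AR AutOver_inv AutOver_inv_comp(3)\<close>)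
  fix y assume "y \<in> carrier AR"
  then obtain \<tau> where \<tau>: "\<tau> \<in> G" "y = res \<tau>" by (auto simp: carrier_AR)
  show "x \<otimes>\<^bsub>AR\<^esub> y \<in> carrier AR"
    unfolding \<sigma>(2) \<tau>(2) mult_AR[OF \<sigma>(1) \<tau>(1)] carrier_AR using AutOver_comp[OF \<sigma>(1) \<tau>(1)] by blast
  fix z assume "z \<in> carrier AR"
  then obtain \<rho> where \<rho>: "\<rho> \<in> G" "z = res \<rho>" by (auto simp: carrier_AR)
  show "x \<otimes>\<^bsub>AR\<^esub> y \<otimes>\<^bsub>AR\<^esub> z = x \<otimes>\<^bsub>AR\<^esub> (y \<otimes>\<^bsub>AR\<^esub> z)"
    unfolding \<sigma>(2) \<tau>(2) \<rho>(2) mult_AR[OF \<sigma>(1) \<tau>(1)] mult_AR[OF \<tau>(1) \<rho>(1)]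
      mult_AR[OF AutOver_comp[OF \<sigma>(1) \<tau>(1)] \<rho>(1)] mult_AR[OF \<sigma>(1) AutOver_comp[OF \<tau>(1) \<rho>(1)]] comp_assoc ..
qed

lemma inv_AR: "\<sigma> \<in> G \<Longrightarrow> inv\<^bsub>AR\<^esub> (res \<sigma>) = res (Hilbert_Choice.inv \<sigma>)"
  by (rule group.inv_equality[OF group_AR])
     (auto simp: one_AR mult_AR carrier_AR AutOver_inv AutOver_inv_comp(3))

abbreviation "AR' \<equiv> derived AR (carrier AR)"

lemma AR'_carrier: "AR' \<subseteq> carrier AR"
  by (rule group.derived_in_carrier[OF group_AR]) simp

lemma commutator_AR:
  assumes "\<sigma> \<in> G" "\<tau> \<in> G"
  shows "res \<sigma> \<otimes>\<^bsub>AR\<^esub> res \<tau> \<otimes>\<^bsub>AR\<^esub> inv\<^bsub>AR\<^esub> (res \<sigma>) \<otimes>\<^bsub>AR\<^esub> inv\<^bsub>AR\<^esub> (res \<tau>) =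
    res (\<sigma> \<circ> \<tau> \<circ> Hilbert_Choice.inv \<sigma> \<circ> Hilbert_Choice.inv \<tau>)"
  using assms by (simp add: mult_AR inv_AR AutOver_inv AutOver_comp)

lemma AR'_Rn: "g \<in> AR' \<Longrightarrow> a \<in> P \<Longrightarrow> \<exists>n. (a, g a) \<in> Rn n"
  unfolding derived_def
proof (induction g arbitrary: a rule: generate.induct)
  case one
  then show ?case using Rn_refl[of a 0] by (auto simp: one_AR res_apply)
next
  case (incl h)
  then obtain \<sigma> \<tau> where st: "\<sigma> \<in> G" "\<tau> \<in> G" "h = res (\<sigma> \<circ> \<tau> \<circ> Hilbert_Choice.inv \<sigma> \<circ> Hilbert_Choice.inv \<tau>)"
    using commutator_AR by (auto simp: carrier_AR)
  \<comment> \<open>Commutators in the derived subgroup carry their inverses on the right, those of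
    \<open>R\<close> on the left; replacing both entries by their inverses matches the two
    forms.\<close>
  have "(a, h a) \<in> R"
    using R_I[OF incl.prems AutOver_inv[OF st(1)] AutOver_inv[OF st(2)]] st incl.prems
    by (simp add: res_apply inv_inv_eq AutOver_bij)
  then show ?case using Rn_1 by blast
next
  case (inv h)
  then obtain \<sigma> \<tau> where st: "\<sigma> \<in> G" "\<tau> \<in> G" "h = res (\<sigma> \<circ> \<tau> \<circ> Hilbert_Choice.inv \<sigma> \<circ> Hilbert_Choice.inv \<tau>)"
    using commutator_AR by (auto simp: carrier_AR)
  let ?s = "\<sigma> \<circ> \<tau> \<circ> Hilbert_Choice.inv \<sigma> \<circ> Hilbert_Choice.inv \<tau>"
  have s: "?s \<in> G" by (intro AutOver_comp AutOver_inv st)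
  define b where "b = Hilbert_Choice.inv ?s \<circ> a"
  have b: "b \<in> P" unfolding b_def using P_Aut[OF inv.prems] AutOver_inv[OF s] by blast
  have "(b, ?s \<circ> b) \<in> R"
    using R_I[OF b AutOver_inv[OF st(1)] AutOver_inv[OF st(2)]] st
    by (simp add: inv_inv_eq AutOver_bij)
  moreover have "?s \<circ> b = a" unfolding b_def comp_assoc[symmetric, of ?s] AutOver_inv_comp(4)[OF s] by simp
  ultimately have "(a, b) \<in> R" using R_sym by simp
  moreover have "(inv\<^bsub>AR\<^esub> h) a = b" unfolding st(3) inv_AR[OF s] res_apply[OF inv.prems] b_def ..
  ultimately show ?case using Rn_1 by metis
next
  case (eng h1 h2)
  obtain n where n: "(a, h2 a) \<in> Rn n" using eng.IH(2) eng.prems by blast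
  then obtain m where m: "(h2 a, h1 (h2 a)) \<in> Rn m" using eng.IH(1) Rn_P by blast
  have "h1 \<in> carrier AR" "h2 \<in> carrier AR" using eng.hyps AR'_carrier unfolding derived_def by auto
  then have "(h1 \<otimes>\<^bsub>AR\<^esub> h2) a = h1 (h2 a)"
    using eng.prems P_Aut by (auto simp: carrier_AR mult_AR res_apply comp_assoc)
  then show ?case using Rn_trans[OF n m] by auto
qed

lemma Rn_AR': "(a, b) \<in> Rn n \<Longrightarrow> \<exists>g\<in>AR'. b = g a"
proof (induction n arbitrary: b)
  case 0
  then show ?case unfolding derived_def
    by (intro bexI[OF _ generate.one]) (auto simp: Rn_0 one_AR res_apply)
next
  case (Suc n)
  then obtain c where c: "(a, c) \<in> Rn n" "(c, b) \<in> R" by (auto simp: Rn_Suc)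
  then obtain g where g: "g \<in> AR'" "c = g a" using Suc.IH by blast
  obtain \<sigma> \<tau> where P: "c \<in> P" "b \<in> P" and st: "\<sigma> \<in> G" "\<tau> \<in> G"
    and b: "b = Hilbert_Choice.inv \<sigma> \<circ> Hilbert_Choice.inv \<tau> \<circ> \<sigma> \<circ> \<tau> \<circ> c"
    using c(2) unfolding commutator_rel_def by blast
  let ?s = "Hilbert_Choice.inv \<sigma> \<circ> Hilbert_Choice.inv \<tau> \<circ> \<sigma> \<circ> \<tau>"
  have s: "?s \<in> G" by (intro AutOver_comp AutOver_inv st)
  have "res (Hilbert_Choice.inv \<sigma>) \<in> carrier AR" "res (Hilbert_Choice.inv \<tau>) \<in> carrier AR"
    using AutOver_inv st by (auto simp: carrier_AR)
  moreover have "res ?s = res (Hilbert_Choice.inv \<sigma>) \<otimes>\<^bsub>AR\<^esub> res (Hilbert_Choice.inv \<tau>) \<otimes>\<^bsub>AR\<^esub>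
      inv\<^bsub>AR\<^esub> (res (Hilbert_Choice.inv \<sigma>)) \<otimes>\<^bsub>AR\<^esub> inv\<^bsub>AR\<^esub> (res (Hilbert_Choice.inv \<tau>))"
    unfolding commutator_AR[OF AutOver_inv[OF st(1)] AutOver_inv[OF st(2)]]
    using st by (simp add: inv_inv_eq AutOver_bij)
  ultimately have "res ?s \<in> derived_set AR (carrier AR)" by blast
  then have "res ?s \<otimes>\<^bsub>AR\<^esub> g \<in> AR'"
    using g(1) unfolding derived_def by (blast intro: generate.eng generate.incl)
  moreover have "(res ?s \<otimes>\<^bsub>AR\<^esub> g) a = b"
  proof -
    obtain \<rho> where \<rho>: "\<rho> \<in> G" "g = res \<rho>" using g(1) AR'_carrier by (auto simp: carrier_AR)
    have a: "a \<in> P" using c(1) Rn_P by blast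
    show ?thesis unfolding \<rho>(2) mult_AR[OF s \<rho>(1)] res_apply[OF a] b g(2) \<rho>(2) by (simp add: comp_assoc)
  qed
  ultimately show ?case by metis
qed

section \<open>The equivalence relation and its diameter\<close>

abbreviation "E \<equiv> H1_equiv M B p"

lemma derived_orbit_eq: "a \<in> P \<Longrightarrow> derived_orbit M B p a = {b. \<exists>n. (a, b) \<in> Rn n}"
  unfolding derived_orbit_def using AR'_Rn Rn_AR' by blast

text \<open>The orbits of the derived subgroup are the classes of an equivalence relation, so fixing
  every orbit amounts to moving each point within its own orbit.\<close>

lemma Kgroup_eq: "Kgroup M B p = {g \<in> carrier AR. \<forall>a\<in>P. \<exists>n. (a, g a) \<in> Rn n}"
proof (intro equalityI subsetI)
  fix g assume g: "g \<in> Kgroup M B p"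
  then have "\<exists>n. (a, g a) \<in> Rn n" if "a \<in> P" for a
    using that Rn_refl[OF that, of 0] derived_orbit_eq[OF that] unfolding Kgroup_def by blast
  with g show "g \<in> {g \<in> carrier AR. \<forall>a\<in>P. \<exists>n. (a, g a) \<in> Rn n}" unfolding Kgroup_def by blast
next
  fix g assume g: "g \<in> {g \<in> carrier AR. \<forall>a\<in>P. \<exists>n. (a, g a) \<in> Rn n}"
  then obtain \<sigma> where \<sigma>: "\<sigma> \<in> G" "g = res \<sigma>" by (auto simp: carrier_AR)
  have "g ` derived_orbit M B p a = derived_orbit M B p a" if a: "a \<in> P" for a
  proof (intro equalityI subsetI)
    fix b assume "b \<in> g ` derived_orbit M B p a"
    then obtain c n where c: "(a, c) \<in> Rn n" "b = g c" using derived_orbit_eq[OF a] by blast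
    then obtain m where "(c, b) \<in> Rn m" using g Rn_P by blast
    then show "b \<in> derived_orbit M B p a" using Rn_trans[OF c(1)] derived_orbit_eq[OF a] by blast
  next
    fix b assume "b \<in> derived_orbit M B p a"
    then obtain n where n: "(a, b) \<in> Rn n" using derived_orbit_eq[OF a] by blast
    define c where "c = Hilbert_Choice.inv \<sigma> \<circ> b"
    have c: "c \<in> P" unfolding c_def using n Rn_P P_Aut AutOver_inv[OF \<sigma>(1)] by blast
    have gc: "g c = b" unfolding \<sigma>(2) res_apply[OF c] unfolding c_def
      using AutOver_inv_comp[OF \<sigma>(1)] by (simp add: comp_assoc[symmetric])
    then obtain m where "(c, b) \<in> Rn m" using g c by blast
    then have "(a, c) \<in> Rn (n + m)" using Rn_trans[OF n] Rn_sym by blast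
    then show "b \<in> g ` derived_orbit M B p a" using gc derived_orbit_eq[OF a] by blast
  qed
  then show "g \<in> Kgroup M B p" using g unfolding Kgroup_def by blast
qed

text \<open>The members of the derived subgroup already realize every chain of commutator steps and
  lie in \<open>Kgroup M B p\<close>, so both groups have the same orbits.\<close>

lemma E_iff: "(a, b) \<in> E \<longleftrightarrow> (\<exists>n. (a, b) \<in> Rn n)"
proof
  assume "(a, b) \<in> E"
  then show "\<exists>n. (a, b) \<in> Rn n" unfolding H1_equiv_def Kgroup_eq by blast
next
  assume "\<exists>n. (a, b) \<in> Rn n"
  then obtain n where n: "(a, b) \<in> Rn n" by blast
  then obtain g where g: "g \<in> AR'" "b = g a" using Rn_AR' by blast
  then have "g \<in> Kgroup M B p" unfolding Kgroup_eq using AR'_carrier AR'_Rn by blast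
  then show "(a, b) \<in> E" using g n Rn_P unfolding H1_equiv_def by blast
qed

lemma E_P: "(a, b) \<in> E \<Longrightarrow> a \<in> P \<and> b \<in> P"
  using E_iff Rn_P by blast

lemma E_refl: "a \<in> P \<Longrightarrow> (a, a) \<in> E"
  using E_iff Rn_refl by blast

lemma E_sym: "(a, b) \<in> E \<Longrightarrow> (b, a) \<in> E"
  using E_iff Rn_sym by blast

lemma E_trans: "(a, b) \<in> E \<Longrightarrow> (b, c) \<in> E \<Longrightarrow> (a, c) \<in> E"
  using E_iff Rn_trans by blast

lemma E_Aut: "(a, b) \<in> E \<Longrightarrow> \<sigma> \<in> G \<Longrightarrow> (\<sigma> \<circ> a, \<sigma> \<circ> b) \<in> E"
  using E_iff Rn_Aut by blast

lemma E_commute: "a \<in> P \<Longrightarrow> \<sigma> \<in> G \<Longrightarrow> \<tau> \<in> G \<Longrightarrow> (\<sigma> \<circ> \<tau> \<circ> a, \<tau> \<circ> \<sigma> \<circ> a) \<in> E"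
  using E_iff Rn_commute by blast

text \<open>Reflexivity of \<open>R\<close> makes the powers increasing, so the least exponent is at
  most \<open>N\<close> exactly for the pairs in \<open>Rn N\<close>.\<close>

lemma diam_finite_iff: "H1_diam M B p \<noteq> \<infinity> \<longleftrightarrow> (\<exists>N. E \<subseteq> Rn N)"
proof -
  have dist: "H1_dist M B p a b \<le> enat N \<longleftrightarrow> (a, b) \<in> Rn N" if E: "(a, b) \<in> E" for a b N
  proof -
    obtain n where n: "(a, b) \<in> Rn n" using E E_iff by blast
    define l where "l = (LEAST n. (a, b) \<in> R ^^ n)"
    have l: "(a, b) \<in> R ^^ l" unfolding l_def using n by (intro LeastI) (auto simp: Rn_def)
    have "l \<le> N \<longleftrightarrow> (a, b) \<in> Rn N"
    proof
      assume "l \<le> N"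
      moreover have "(a, b) \<in> Rn l" using l E_P[OF E] by (simp add: Rn_def)
      ultimately show "(a, b) \<in> Rn N" using Rn_mono by blast
    next
      assume "(a, b) \<in> Rn N"
      then show "l \<le> N" unfolding l_def by (intro Least_le) (simp add: Rn_def)
    qed
    then show ?thesis using E by (simp add: H1_dist_def l_def)
  qed
  show ?thesis
  proof
    assume "H1_diam M B p \<noteq> \<infinity>"
    then obtain N where N: "H1_diam M B p = enat N" by auto
    have "H1_dist M B p a b \<le> enat N" if "(a, b) \<in> E" for a b
      unfolding N[symmetric] H1_diam_def using that by (intro SUP_upper2[of "(a, b)"]) auto
    then have "E \<subseteq> Rn N" using dist by (intro subrelI) blast
    then show "\<exists>N. E \<subseteq> Rn N" ..
  next
    assume "\<exists>N. E \<subseteq> Rn N"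
    then obtain N where "E \<subseteq> Rn N" by blast
    then have "H1_diam M B p \<le> enat N"
      unfolding H1_diam_def by (intro SUP_least) (use dist in auto)
    then show "H1_diam M B p \<noteq> \<infinity>" by (metis enat_ord_simps(5) infinity_ne_i0 not_infinity_eq)
  qed
qed

end

section \<open>Maximal invariant filters\<close>

definition inv_filter :: "'x set \<Rightarrow> ('x \<Rightarrow> 'x) set \<Rightarrow> 'x set set \<Rightarrow> bool" where
  "inv_filter X H \<F> \<longleftrightarrow> X \<in> \<F> \<and> {} \<notin> \<F> \<and> \<F> \<subseteq> Pow X \<and> (\<forall>A\<in>\<F>. \<forall>A'\<in>\<F>. A \<inter> A' \<in> \<F>) \<and>
     (\<forall>A\<in>\<F>. \<forall>A'. A \<subseteq> A' \<and> A' \<subseteq> X \<longrightarrow> A' \<in> \<F>) \<and> (\<forall>h\<in>H. \<forall>A\<in>\<F>. h ` A \<in> \<F>)"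

lemma inv_filterD:
  assumes "inv_filter X H \<F>"
  shows "X \<in> \<F>" "{} \<notin> \<F>" "\<F> \<subseteq> Pow X" "A \<in> \<F> \<Longrightarrow> A' \<in> \<F> \<Longrightarrow> A \<inter> A' \<in> \<F>"
    "A \<in> \<F> \<Longrightarrow> A \<subseteq> A' \<Longrightarrow> A' \<subseteq> X \<Longrightarrow> A' \<in> \<F>" "h \<in> H \<Longrightarrow> A \<in> \<F> \<Longrightarrow> h ` A \<in> \<F>"
  using assms by (simp_all add: inv_filter_def)

text \<open>The second alternative for \<open>S\<close> says that \<open>S\<close> is syndetic modulo \<open>\<F>\<close>: a maximal invariant filter
  plays the role of a minimal subflow of the compactification of \<open>X\<close>.\<close>

lemma maximal_inv_filter:
  assumes \<F>0: "inv_filter X H \<F>0" and "id \<in> H" "\<And>g h. g \<in> H \<Longrightarrow> h \<in> H \<Longrightarrow> g \<circ> h \<in> H"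
    and X: "\<And>h. h \<in> H \<Longrightarrow> h ` X \<subseteq> X"
  shows "\<exists>\<F>. inv_filter X H \<F> \<and> \<F>0 \<subseteq> \<F> \<and>
    (\<forall>S\<subseteq>X. X - S \<in> \<F> \<or> (\<exists>F\<in>\<F>. \<exists>H0\<subseteq>H. finite H0 \<and> F \<subseteq> (\<Union>h\<in>H0. h ` S)))"
proof -
  have "\<exists>\<F>\<in>{\<F>. inv_filter X H \<F> \<and> \<F>0 \<subseteq> \<F>}. \<forall>\<F>'\<in>{\<F>. inv_filter X H \<F> \<and> \<F>0 \<subseteq> \<F>}. \<F> \<subseteq> \<F>' \<longrightarrow> \<F>' = \<F>"
  proof (rule subset_Zorn_nonempty)
    show "{\<F>. inv_filter X H \<F> \<and> \<F>0 \<subseteq> \<F>} \<noteq> {}" using \<F>0 by blast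
    fix \<C> assume C: "\<C> \<noteq> {}" "subset.chain {\<F>. inv_filter X H \<F> \<and> \<F>0 \<subseteq> \<F>} \<C>"
    then have C': "inv_filter X H \<F>" "\<F>0 \<subseteq> \<F>" if "\<F> \<in> \<C>" for \<F>
      using that by (auto simp: subset.chain_def)
    have 1: "A \<inter> A' \<in> \<Union>\<C>" if A: "A \<in> \<Union>\<C>" "A' \<in> \<Union>\<C>" for A A'
    proof -
      obtain \<F> where "\<F> \<in> \<C>" "{A, A'} \<subseteq> \<F>"
        using finite_subset_Union_chain[of "{A, A'}" \<C>, OF _ _ C] A by auto
      moreover then have "A \<inter> A' \<in> \<F>" using C'(1)[of \<F>] by (auto simp: inv_filter_def)
      ultimately show ?thesis by blast
    qed
    have 2: "A' \<in> \<Union>\<C>" if A: "A \<in> \<Union>\<C>" "A \<subseteq> A'" "A' \<subseteq> X" for A A'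
    proof -
      obtain \<F> where F: "\<F> \<in> \<C>" "A \<in> \<F>" using A by blast
      then have "A' \<in> \<F>" using C'(1)[OF F(1)] A(2,3) by (auto simp: inv_filter_def)
      with F show ?thesis by blast
    qed
    have 3: "h ` A \<in> \<Union>\<C>" if A: "A \<in> \<Union>\<C>" "h \<in> H" for A h
    proof -
      obtain \<F> where F: "\<F> \<in> \<C>" "A \<in> \<F>" using A by blast
      then have "h ` A \<in> \<F>" using C'(1)[OF F(1)] A(2) by (auto simp: inv_filter_def)
      with F show ?thesis by blast
    qed
    have 4: "X \<in> \<F> \<and> {} \<notin> \<F> \<and> \<F> \<subseteq> Pow X" if "\<F> \<in> \<C>" for \<F>
      using C'(1)[OF that] by (simp add: inv_filter_def)
    obtain \<F>1 where F1: "\<F>1 \<in> \<C>" using C(1) by blast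
    have 5: "X \<in> \<Union>\<C>" "{} \<notin> \<Union>\<C>" "\<Union>\<C> \<subseteq> Pow X" "\<F>0 \<subseteq> \<Union>\<C>"
      using 4 4[OF F1] C'(2)[OF F1] F1 by blast+
    have "inv_filter X H (\<Union>\<C>)"
      unfolding inv_filter_def
    proof (intro conjI ballI allI impI)
      show "\<And>A A'. A \<in> \<Union>\<C> \<Longrightarrow> A' \<in> \<Union>\<C> \<Longrightarrow> A \<inter> A' \<in> \<Union>\<C>" by (rule 1)
      show "\<And>A A'. A \<in> \<Union>\<C> \<Longrightarrow> A \<subseteq> A' \<and> A' \<subseteq> X \<Longrightarrow> A' \<in> \<Union>\<C>" using 2 by blast
      show "\<And>h A. h \<in> H \<Longrightarrow> A \<in> \<Union>\<C> \<Longrightarrow> h ` A \<in> \<Union>\<C>" by (rule 3)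
    qed (rule 5)+
    then show "\<Union>\<C> \<in> {\<F>. inv_filter X H \<F> \<and> \<F>0 \<subseteq> \<F>}"
      using 5(4) by blast
  qed
  then obtain \<F> where F\<C>: "\<F> \<in> {\<F>. inv_filter X H \<F> \<and> \<F>0 \<subseteq> \<F>}"
    and max: "\<forall>\<F>'\<in>{\<F>. inv_filter X H \<F> \<and> \<F>0 \<subseteq> \<F>}. \<F> \<subseteq> \<F>' \<longrightarrow> \<F>' = \<F>" by (rule bexE)
  then have F: "inv_filter X H \<F>" "\<F>0 \<subseteq> \<F>" by simp_all
  have maximal: "\<F>' = \<F>" if "inv_filter X H \<F>'" "\<F> \<subseteq> \<F>'" for \<F>'
    using bspec[OF max, of \<F>'] that F(2) by simp
  note FX = inv_filterD(1,3)[OF F(1)] and Fi = inv_filterD(4)[OF F(1)] and Fh = inv_filterD(6)[OF F(1)]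
  show ?thesis
  proof (intro exI[of _ \<F>] conjI allI impI F)
    fix S assume S: "S \<subseteq> X"
    show "X - S \<in> \<F> \<or> (\<exists>F\<in>\<F>. \<exists>H0\<subseteq>H. finite H0 \<and> F \<subseteq> (\<Union>h\<in>H0. h ` S))"
    proof (rule ccontr, unfold de_Morgan_disj, elim conjE)
      assume no: "X - S \<notin> \<F>" "\<not> (\<exists>F\<in>\<F>. \<exists>H0\<subseteq>H. finite H0 \<and> F \<subseteq> (\<Union>h\<in>H0. h ` S))"
      \<comment> \<open>The filter generated by \<open>\<F>\<close> and the complements of all
        translates of \<open>S\<close>. It is proper because no finite union of translates covers a
        member of \<open>\<F>\<close>.\<close>
      define \<F>' where "\<F>' = {A. A \<subseteq> X \<and> (\<exists>F H0. F \<in> \<F> \<and> H0 \<subseteq> H \<and> finite H0 \<and> F - (\<Union>h\<in>H0. h ` S) \<subseteq> A)}"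
      have I: "A \<in> \<F>'" if "A \<subseteq> X" "F \<in> \<F>" "H0 \<subseteq> H" "finite H0" "F - (\<Union>h\<in>H0. h ` S) \<subseteq> A" for A F H0
        unfolding \<F>'_def by (rule CollectI, intro conjI exI[of _ F] exI[of _ H0]) (fact that)+
      have D: "\<exists>F H0. F \<in> \<F> \<and> H0 \<subseteq> H \<and> finite H0 \<and> F - (\<Union>h\<in>H0. h ` S) \<subseteq> A" if "A \<in> \<F>'" for A
        using that unfolding \<F>'_def by simp
      have "inv_filter X H \<F>'"
        unfolding inv_filter_def
      proof (intro conjI ballI allI impI)
        show "X \<in> \<F>'" by (rule I[OF _ FX(1), of _ "{}"]) auto
        show "{} \<notin> \<F>'"
        proof
          assume "{} \<in> \<F>'"
          from D[OF this] obtain F H0 where 0: "F \<in> \<F>" "H0 \<subseteq> H" "finite H0" "F - (\<Union>h\<in>H0. h ` S) \<subseteq> {}" by blast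
          then have "F \<subseteq> (\<Union>h\<in>H0. h ` S)" by blast
          with 0(1-3) have "\<exists>F\<in>\<F>. \<exists>H0\<subseteq>H. finite H0 \<and> F \<subseteq> (\<Union>h\<in>H0. h ` S)"
            by (intro bexI[of _ F] exI[of _ H0] conjI)
          with no(2) show False by (rule notE)
        qed
        show "\<F>' \<subseteq> Pow X" unfolding \<F>'_def by blast
        fix A assume A: "A \<in> \<F>'"
        then have AX: "A \<subseteq> X" unfolding \<F>'_def by blast
        obtain F H0 where 1: "F \<in> \<F>" "H0 \<subseteq> H" "finite H0" "F - (\<Union>h\<in>H0. h ` S) \<subseteq> A" using D[OF A] by blast
        show "A' \<in> \<F>'" if "A \<subseteq> A' \<and> A' \<subseteq> X" for A'
          by (rule I[OF _ 1(1-3)]) (use 1(4) that in blast)+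
        show "A \<inter> A' \<in> \<F>'" if A': "A' \<in> \<F>'" for A'
        proof -
          obtain F' H0' where 2: "F' \<in> \<F>" "H0' \<subseteq> H" "finite H0'" "F' - (\<Union>h\<in>H0'. h ` S) \<subseteq> A'" using D[OF A'] by blast
          show ?thesis
            by (rule I[OF _ Fi[OF 1(1) 2(1)], of _ "H0 \<union> H0'"]) (use 1 2 AX in auto)
        qed
        fix h assume h: "h \<in> H"
        show "h ` A \<in> \<F>'"
        proof (rule I[OF _ Fh[OF h 1(1)], of _ "(\<circ>) h ` H0"])
          show "h ` A \<subseteq> X" using AX X[OF h] by blast
          show "(\<circ>) h ` H0 \<subseteq> H" using 1(2) assms(3) h by blast
          show "finite ((\<circ>) h ` H0)" using 1(3) by blast
          show "h ` F - (\<Union>g\<in>(\<circ>) h ` H0. g ` S) \<subseteq> h ` A"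
          proof
            fix y assume y: "y \<in> h ` F - (\<Union>g\<in>(\<circ>) h ` H0. g ` S)"
            then obtain x where x: "x \<in> F" "y = h x" by blast
            have "x \<notin> g ` S" if "g \<in> H0" for g
            proof
              assume "x \<in> g ` S"
              then have "y \<in> (h \<circ> g) ` S" using x(2) by (auto simp: image_comp[symmetric])
              with y that show False by blast
            qed
            then show "y \<in> h ` A" using x 1(4) by blast
          qed
        qed
      qed
      moreover have "\<F> \<subseteq> \<F>'"
      proof
        fix A assume "A \<in> \<F>"
        then show "A \<in> \<F>'" using FX(2) by (intro I[of _ A "{}"]) auto
      qed
      ultimately have "\<F>' = \<F>" by (rule maximal)
      moreover have "X - S \<in> \<F>'" by (rule I[OF _ FX(1), of _ "{id}"]) (use assms(2) in auto)
      ultimately show False using no(1) by blast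
    qed
  qed
qed

context monster_type
begin

section \<open>Coverings by neighbourhoods of the diagonal\<close>

text \<open>\<open>R\<close> is a projection of infinitely many conditions; by compactness finitely
  many of them already force membership in \<open>\<delta>\<close>. This makes the Ramsey colouring
  below finite.\<close>

lemma Delta_1_finite_conds:
  assumes "\<delta> \<in> Delta 1"
  obtains \<Theta> where "finite \<Theta>"
    "\<And>f. (\<And>n. f n \<in> P) \<Longrightarrow> (\<And>\<theta>. \<theta> \<in> \<Theta> \<Longrightarrow> f \<in> commutator_conds \<theta>) \<Longrightarrow> (f 0, f 1) \<in> \<delta>"
proof -
  let ?C = "commutator_conds ` {\<delta>. rdef B \<delta>}"
  have \<delta>: "rdef B \<delta>" "R \<subseteq> \<delta>" using assms Rn_1 unfolding Delta_def by auto
  have "\<exists>\<X>0. finite \<X>0 \<and> \<X>0 \<subseteq> insert {f. (f 0, f 1) \<notin> \<delta>} ?C \<and> \<not> (\<exists>f. (\<forall>n. f n \<in> P) \<and> (\<forall>X\<in>\<X>0. f \<in> X))"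
  proof (rule ccontr)
    assume *: "\<not> ?thesis"
    have "\<exists>f. (\<forall>n. f n \<in> P) \<and> (\<forall>X\<in>insert {f. (f 0, f 1) \<notin> \<delta>} ?C. f \<in> X)"
    proof (rule P_compactness[OF small_B])
      show "tdef B X" if "X \<in> insert {f. (f 0, f 1) \<notin> \<delta>} ?C" for X
        using that tdef_not[OF \<delta>(1)] tdef_commutator_conds by blast
      show "\<exists>f. (\<forall>n. f n \<in> P) \<and> (\<forall>X\<in>\<X>0. f \<in> X)"
        if "finite \<X>0" "\<X>0 \<subseteq> insert {f. (f 0, f 1) \<notin> \<delta>} ?C" for \<X>0
        using * that by blast
    qed
    then obtain f where f: "\<forall>n. f n \<in> P" "(f 0, f 1) \<notin> \<delta>" "\<forall>X\<in>?C. f \<in> X"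
      unfolding ball_simps by blast
    from f(1,3) have "(f 0, f 1) \<in> R" unfolding R_eq by (intro CollectI exI[of _ f]) auto
    then show False using f(2) \<delta>(2) by blast
  qed
  then obtain \<X>0 where X0: "finite \<X>0" "\<X>0 \<subseteq> insert {f. (f 0, f 1) \<notin> \<delta>} ?C"
    "\<not> (\<exists>f. (\<forall>n. f n \<in> P) \<and> (\<forall>X\<in>\<X>0. f \<in> X))" by blast
  have "finite (\<X>0 - {{f. (f 0, f 1) \<notin> \<delta>}})" "\<X>0 - {{f. (f 0, f 1) \<notin> \<delta>}} \<subseteq> ?C" using X0(1,2) by auto
  from finite_subset_image[OF this] obtain \<Theta> where \<Theta>: "finite \<Theta>" "\<X>0 - {{f. (f 0, f 1) \<notin> \<delta>}} = commutator_conds ` \<Theta>"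
    by blast
  show thesis
  proof (rule that[OF \<Theta>(1)])
    fix f assume f: "\<And>n. f n \<in> P" "\<And>\<theta>. \<theta> \<in> \<Theta> \<Longrightarrow> f \<in> commutator_conds \<theta>"
    show "(f 0, f 1) \<in> \<delta>"
    proof (rule ccontr)
      assume no: "(f 0, f 1) \<notin> \<delta>"
      have "f \<in> X" if "X \<in> \<X>0" for X
      proof (cases "X = {f. (f 0, f 1) \<notin> \<delta>}")
        case True
        then show ?thesis using no by simp
      next
        case False
        then have "X \<in> commutator_conds ` \<Theta>" using that \<Theta>(2) by blast
        then show ?thesis using f(2) by blast
      qed
      then show False using X0(3) f(1) by blast
    qed
  qed
qed

text \<open>By Ramsey's theorem an infinite sequence contains five terms all of whose increasing pairs look
  alike, and these witness that a pair of them is a commutator pair up to \<open>\<delta>\<close>.\<close>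

lemma Delta_1_finite_cover:
  assumes "\<delta> \<in> Delta 1" "X \<subseteq> P"
  shows "\<exists>C\<subseteq>X. finite C \<and> X \<subseteq> (\<Union>c\<in>C. \<delta> `` {c})"
proof (rule ccontr)
  assume no: "\<not> ?thesis"
  \<comment> \<open>Without a finite cover, each new point can be taken outside the balls around all
    earlier ones.\<close>
  have "\<exists>x :: nat \<Rightarrow> 'i \<Rightarrow> 'a. \<forall>n. x n \<in> X \<and> (\<forall>i<n. (x i, x n) \<notin> \<delta>)"
  proof -
    show ?thesis
    proof (rule dependent_wellorder_choice[where P = "\<lambda>x n y. y \<in> X \<and> (\<forall>i<n. (x i, y) \<notin> \<delta>)"])
      fix n :: nat and x :: "nat \<Rightarrow> 'i \<Rightarrow> 'a"
      assume "\<And>i. i < n \<Longrightarrow> x i \<in> X \<and> (\<forall>j<i. (x j, x i) \<notin> \<delta>)"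
      then have "x ` {..<n} \<subseteq> X" "finite (x ` {..<n})" by auto
      then have "\<not> X \<subseteq> (\<Union>c\<in>x ` {..<n}. \<delta> `` {c})" using no by blast
      then obtain y where "y \<in> X" "y \<notin> (\<Union>c\<in>x ` {..<n}. \<delta> `` {c})" by blast
      then show "\<exists>y. y \<in> X \<and> (\<forall>i<n. (x i, y) \<notin> \<delta>)" by (intro exI[of _ y]) auto
    qed auto
  qed
  then obtain x :: "nat \<Rightarrow> 'i \<Rightarrow> 'a" where x: "\<And>n. x n \<in> P" "\<And>i j. i < j \<Longrightarrow> (x i, x j) \<notin> \<delta>"
    using assms(2) by blast
  obtain \<Theta> where \<Theta>: "finite \<Theta>"
    "\<And>f. (\<And>n. f n \<in> P) \<Longrightarrow> (\<And>\<theta>. \<theta> \<in> \<Theta> \<Longrightarrow> f \<in> commutator_conds \<theta>) \<Longrightarrow> (f 0, f 1) \<in> \<delta>"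
    using Delta_1_finite_conds[OF assms(1)] by blast
  have "finite (Pow \<Theta>)" using \<Theta>(1) by simp
  from ex_bij_betw_finite_nat[OF this] obtain h where h: "bij_betw h (Pow \<Theta>) {0..<card (Pow \<Theta>)}" by blast
  \<comment> \<open>The colour of a pair is the set of conditions it meets, coded as a number by
    \<open>h\<close>. Pairs are unordered sets here, so \<open>Min\<close> and \<open>Max\<close>
    restore their order.\<close>
  define col where "col = (\<lambda>A. h {\<theta> \<in> \<Theta>. (x (Min A), x (Max A)) \<in> \<theta>})"
  have "\<forall>i\<in>UNIV. \<forall>j\<in>UNIV. i \<noteq> j \<longrightarrow> col {i, j} < card (Pow \<Theta>)"
    unfolding col_def using bij_betwE[OF h] by auto
  from Ramsey2[OF infinite_UNIV_nat this] obtain Y t where Y: "infinite Y"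
    "\<forall>i\<in>Y. \<forall>j\<in>Y. i \<noteq> j \<longrightarrow> col {i, j} = t" by blast
  define y where "y = (\<lambda>k. x (enumerate Y k))"
  have same: "(y k, y l) \<in> \<theta> \<longleftrightarrow> (y k', y l') \<in> \<theta>" if kl: "k < l" "k' < l'" and \<theta>: "\<theta> \<in> \<Theta>" for k l k' l' \<theta>
  proof -
    have e: "enumerate Y k < enumerate Y l" "enumerate Y k' < enumerate Y l'"
      using kl Y(1) by (simp_all add: enumerate_mono)
    have Yt: "col {m, m'} = t" if "m < m'" "m \<in> Y" "m' \<in> Y" for m m'
      using Y(2)[rule_format, of m m'] that by simp
    have "col {enumerate Y k, enumerate Y l} = t" "col {enumerate Y k', enumerate Y l'} = t"
      by (rule Yt[OF e(1) enumerate_in_set[OF Y(1)] enumerate_in_set[OF Y(1)]],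
          rule Yt[OF e(2) enumerate_in_set[OF Y(1)] enumerate_in_set[OF Y(1)]])
    then have "h {\<theta> \<in> \<Theta>. (y k, y l) \<in> \<theta>} = h {\<theta> \<in> \<Theta>. (y k', y l') \<in> \<theta>}"
      using e by (simp add: col_def y_def)
    then have "{\<theta> \<in> \<Theta>. (y k, y l) \<in> \<theta>} = {\<theta> \<in> \<Theta>. (y k', y l') \<in> \<theta>}"
      using h by (auto simp: bij_betw_def dest!: inj_onD)
    then show ?thesis using \<theta> by blast
  qed
  \<comment> \<open>The order is chosen so that the comparisons in \<open>commutator_conds\<close>
    involve only increasing pairs: \<open>(1, 4)\<close> with \<open>(0, 3)\<close>, and
    \<open>(0, 2)\<close> with \<open>(3, 4)\<close>. The conclusion then concerns the increasing
    pair \<open>(1, 2)\<close>.\<close>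
  define f where "f = (\<lambda>n :: nat. if n = 0 then y 1 else if n = 1 then y 2 else if n = 2 then y 0
    else if n = 3 then y 3 else y 4)"
  have f: "f 0 = y 1" "f 1 = y 2" "f 2 = y 0" "f 3 = y 3" "f 4 = y 4" by (simp_all add: f_def)
  have "(f 0, f 1) \<in> \<delta>"
  proof (rule \<Theta>(2))
    show "f n \<in> P" for n using x(1) by (auto simp: f_def y_def)
    show "f \<in> commutator_conds \<theta>" if "\<theta> \<in> \<Theta>" for \<theta>
      unfolding commutator_conds_def mem_Collect_eq f
      using same[of 1 4 0 3, OF _ _ that] same[of 0 2 3 4, OF _ _ that] by simp
  qed
  moreover have "enumerate Y 1 < enumerate Y 2" by (rule enumerate_mono[OF _ Y(1)]) simp
  ultimately show False using x(2) unfolding f y_def by blast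
qed

section \<open>Separation\<close>


text \<open>If all neighbourhoods around \<open>a\<close> and \<open>b\<close> overlapped,
  compactness would give a common point within \<open>Rn n\<close> of both. Hence the factor
  2.\<close>

lemma Delta_separate:
  assumes "a \<in> P" "b \<in> P" "(a, b) \<notin> Rn (2 * n)"
  obtains \<delta> where "\<delta> \<in> Delta n" "\<And>y. y \<in> P \<Longrightarrow> (a, y) \<in> \<delta> \<Longrightarrow> (b, y) \<notin> \<delta>"
proof (rule ccontr)
  assume no: "\<not> thesis"
  note sep = that
  let ?X = "\<lambda>\<delta>. {f :: nat \<Rightarrow> 'i \<Rightarrow> 'a. (a, f 0) \<in> \<delta> \<and> (b, f 0) \<in> \<delta>}"
  have "\<exists>f :: nat \<Rightarrow> 'i \<Rightarrow> 'a. (\<forall>n. f n \<in> P) \<and> (\<forall>\<delta>\<in>Delta n. f \<in> ?X \<delta>)"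
  proof (rule P_compactness_directed[where A = "B \<union> range a \<union> range b" and X = ?X])
    show "small \<kappa> (B \<union> range a \<union> range b)" by (intro small_Un small_B small_image small_I)
    show "tdef (B \<union> range a \<union> range b) (?X \<delta>)" if "\<delta> \<in> Delta n" for \<delta>
    proof -
      have "rdef B \<delta>" using that unfolding Delta_def by blast
      from rdef_left[OF this P_T1[OF assms(1)], of 0] rdef_left[OF this P_T1[OF assms(2)], of 0]
      show ?thesis by (intro tdef_conj) (auto elim: tdef_mono)
    qed
    show "Delta n \<noteq> {}" using Delta_UNIV by blast
    show "\<exists>k\<in>Delta n. ?X k \<subseteq> ?X i \<inter> ?X j" if "i \<in> Delta n" "j \<in> Delta n" for i j
      using Delta_Int[OF that] by (intro bexI[of _ "i \<inter> j"]) auto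
    show "\<exists>f. (\<forall>n. f n \<in> P) \<and> f \<in> ?X \<delta>" if \<delta>: "\<delta> \<in> Delta n" for \<delta>
    proof -
      obtain y where "y \<in> P" "(a, y) \<in> \<delta>" "(b, y) \<in> \<delta>" using no sep[OF \<delta>] by blast
      then show ?thesis by (intro exI[of _ "\<lambda>_. y"]) auto
    qed
  qed
  then obtain f where f: "\<forall>n. f n \<in> P" "\<forall>\<delta>\<in>Delta n. f \<in> ?X \<delta>" by blast
  have "(a, f 0) \<in> Rn n" "(b, f 0) \<in> Rn n"
    by (rule Delta_Rn; use assms f in blast)+
  then have "(a, b) \<in> Rn (n + n)" using Rn_trans Rn_sym by blast
  then show False using assms(3) by (simp add: mult_2)
qed

abbreviation act :: "('a \<Rightarrow> 'a) \<Rightarrow> ('i \<Rightarrow> 'a) \<Rightarrow> ('i \<Rightarrow> 'a)" where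
  "act \<sigma> \<equiv> (\<lambda>a. \<sigma> \<circ> a)"

text \<open>If a ball around \<open>c\<close> has nonempty interior in the minimal flow, then finitely many of its translates
  cover the flow, and an element of the flow common to two coverings bounds distances in the orbit of \<open>c\<close>.\<close>

lemma orbit_finite_distance:
  assumes X: "X \<subseteq> P" and \<Gamma>: "\<Gamma> \<subseteq> G" "\<And>\<sigma> \<tau>. \<sigma> \<in> \<Gamma> \<Longrightarrow> \<tau> \<in> \<Gamma> \<Longrightarrow> \<sigma> \<circ> \<tau> \<in> \<Gamma>"
    "\<And>\<sigma> x. \<sigma> \<in> \<Gamma> \<Longrightarrow> x \<in> X \<Longrightarrow> \<sigma> \<circ> x \<in> X"
    and F: "inv_filter X (act ` \<Gamma>) \<F>"
    and max: "\<forall>S\<subseteq>X. X - S \<in> \<F> \<or> (\<exists>F\<in>\<F>. \<exists>H0\<subseteq>act ` \<Gamma>. finite H0 \<and> F \<subseteq> (\<Union>h\<in>H0. h ` S))"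
    and c: "c \<in> X" and S: "S \<subseteq> X" "X - S \<notin> \<F>"
    and int: "\<And>\<delta>. \<delta> \<in> Delta n \<Longrightarrow> X - (S - \<delta> `` {c}) \<in> \<F>"
  obtains \<Gamma>0 where "\<Gamma>0 \<subseteq> \<Gamma>" "finite \<Gamma>0"
    "\<And>\<sigma>. \<sigma> \<in> \<Gamma> \<Longrightarrow> \<exists>h\<in>\<Gamma>0. \<exists>k\<in>\<Gamma>0. (h \<circ> c, \<sigma> \<circ> (k \<circ> c)) \<in> Rn (2 * n)"
proof -
  note FX = inv_filterD(1,2)[OF F] and Fi = inv_filterD(4)[OF F]
  have Fh: "act \<sigma> ` A \<in> \<F>" if "\<sigma> \<in> \<Gamma>" "A \<in> \<F>" for \<sigma> A
    using inv_filterD(6)[OF F] that by blast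
  from max[rule_format, OF S(1)] S(2) obtain F H0 where H0: "F \<in> \<F>" "H0 \<subseteq> act ` \<Gamma>" "finite H0" "F \<subseteq> (\<Union>h\<in>H0. h ` S)" by blast
  obtain \<Gamma>0 where \<Gamma>0: "\<Gamma>0 \<subseteq> \<Gamma>" "finite \<Gamma>0" "H0 = act ` \<Gamma>0" using finite_subset_image[OF H0(3,2)] by blast
  show thesis
  proof (rule that[OF \<Gamma>0(1,2)])
    fix \<sigma> assume \<sigma>: "\<sigma> \<in> \<Gamma>"
    show "\<exists>h\<in>\<Gamma>0. \<exists>k\<in>\<Gamma>0. (h \<circ> c, \<sigma> \<circ> (k \<circ> c)) \<in> Rn (2 * n)"
    proof (rule ccontr)
      assume no: "\<not> ?thesis"
      have cP: "h \<circ> c \<in> P" "\<sigma> \<circ> (h \<circ> c) \<in> P" if "h \<in> \<Gamma>0" for h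
      proof -
        have "h \<circ> c \<in> X" using that \<Gamma>0(1) \<Gamma>(3) c by blast
        with X \<Gamma>(3)[OF \<sigma>] show "h \<circ> c \<in> P" "\<sigma> \<circ> (h \<circ> c) \<in> P" by blast+
      qed
      have "\<forall>q\<in>\<Gamma>0 \<times> \<Gamma>0. \<exists>\<delta>\<in>Delta n. \<forall>y\<in>P. (fst q \<circ> c, y) \<in> \<delta> \<longrightarrow> (\<sigma> \<circ> (snd q \<circ> c), y) \<notin> \<delta>"
      proof
        fix q assume q: "q \<in> \<Gamma>0 \<times> \<Gamma>0"
        then have "(fst q \<circ> c, \<sigma> \<circ> (snd q \<circ> c)) \<notin> Rn (2 * n)" using no by auto
        moreover have "fst q \<circ> c \<in> P" "\<sigma> \<circ> (snd q \<circ> c) \<in> P" using q cP by auto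
        ultimately obtain \<delta> where "\<delta> \<in> Delta n" "\<And>y. y \<in> P \<Longrightarrow> (fst q \<circ> c, y) \<in> \<delta> \<Longrightarrow> (\<sigma> \<circ> (snd q \<circ> c), y) \<notin> \<delta>"
          using Delta_separate by metis
        then show "\<exists>\<delta>\<in>Delta n. \<forall>y\<in>P. (fst q \<circ> c, y) \<in> \<delta> \<longrightarrow> (\<sigma> \<circ> (snd q \<circ> c), y) \<notin> \<delta>" by blast
      qed
      from bchoice[OF this[unfolded Bex_def]] obtain D where
        "\<forall>q\<in>\<Gamma>0 \<times> \<Gamma>0. D q \<in> Delta n \<and> (\<forall>y\<in>P. (fst q \<circ> c, y) \<in> D q \<longrightarrow> (\<sigma> \<circ> (snd q \<circ> c), y) \<notin> D q)" ..
      note D' = this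
      have D: "D q \<in> Delta n" "y \<in> P \<Longrightarrow> (fst q \<circ> c, y) \<in> D q \<Longrightarrow> (\<sigma> \<circ> (snd q \<circ> c), y) \<notin> D q"
        if "q \<in> \<Gamma>0 \<times> \<Gamma>0" for q y
        using bspec[OF D' that] by simp_all
      \<comment> \<open>One neighbourhood that separates all pairs of translates at once.\<close>
      let ?\<delta> = "\<Inter>q\<in>\<Gamma>0 \<times> \<Gamma>0. D q"
      have \<delta>: "?\<delta> \<in> Delta n" using \<Gamma>0(2) D(1) by (intro Delta_INT) auto
      define F' where "F' = X - (S - ?\<delta> `` {c})"
      have F': "F' \<in> \<F>" unfolding F'_def by (rule int[OF \<delta>])
      \<comment> \<open>For a point \<open>h \<circ> x\<close> of \<open>W\<close> with
        \<open>x \<in> S\<close>, membership in the translate of \<open>F'\<close> forces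
        \<open>(c, x) \<in> ?\<delta>\<close>. So every point of \<open>W\<close> is near some
        \<open>h \<circ> c\<close> with \<open>h \<in> \<Gamma>0\<close>.\<close>
      define W where "W = F \<inter> (X \<inter> (\<Inter>h\<in>\<Gamma>0. act h ` F'))"
      have XI: "X \<inter> (\<Inter>h\<in>\<Gamma>1. act h ` F') \<in> \<F>" if "\<Gamma>1 \<subseteq> \<Gamma>0" "finite \<Gamma>1" for \<Gamma>1
        using that(2,1)
      proof (induction \<Gamma>1 rule: finite_induct)
        case (insert h \<Gamma>1)
        have 1: "h \<in> \<Gamma>" using insert.prems \<Gamma>0(1) by blast
        have 2: "X \<inter> (\<Inter>h\<in>\<Gamma>1. act h ` F') \<in> \<F>" by (rule insert.IH) (use insert.prems in blast)
        from Fi[OF 2 Fh[OF 1 F']] show ?case by (simp only: INT_insert Int_ac)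
      qed (simp add: FX)
      have W: "W \<in> \<F>" unfolding W_def by (rule Fi[OF H0(1) XI[OF order_refl \<Gamma>0(2)]])
      have near: "\<exists>h\<in>\<Gamma>0. (h \<circ> c, w) \<in> ?\<delta> \<and> w \<in> P" if w: "w \<in> W" for w
      proof -
        obtain h x where h: "h \<in> \<Gamma>0" "x \<in> S" "w = h \<circ> x" using w H0(4) \<Gamma>0(3) unfolding W_def by blast
        obtain x' where x': "x' \<in> F'" "w = h \<circ> x'" using w h(1) unfolding W_def by blast
        have hG: "h \<in> G" using h(1) \<Gamma>0(1) \<Gamma>(1) by blast
        have "x = x'" using G_cancel(1)[OF hG, of x] G_cancel(1)[OF hG, of x'] h(3) x'(2) by simp
        then have "(c, x) \<in> ?\<delta>" using x'(1) h(2) unfolding F'_def by blast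
        moreover have "c \<in> P" "x \<in> P" using c h(2) S(1) X by auto
        ultimately have "(h \<circ> c, h \<circ> x) \<in> ?\<delta>" using Delta_Aut[OF \<delta> hG] by blast
        with h \<open>x \<in> P\<close> P_Aut[OF _ hG] show ?thesis by blast
      qed
      have "W \<inter> act \<sigma> ` W \<in> \<F>" using W Fi Fh[OF \<sigma>] by blast
      then obtain w where w: "w \<in> W" "w \<in> act \<sigma> ` W" using FX(2) by (metis Int_iff ex_in_conv)
      then obtain w' where w': "w' \<in> W" "w = \<sigma> \<circ> w'" by blast
      obtain h where h: "h \<in> \<Gamma>0" "(h \<circ> c, w) \<in> ?\<delta>" "w \<in> P" using near[OF w(1)] by blast
      obtain k where k: "k \<in> \<Gamma>0" "(k \<circ> c, w') \<in> ?\<delta>" "w' \<in> P" using near[OF w'(1)] by blast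
      have "\<sigma> \<in> G" using \<sigma> \<Gamma>(1) by blast
      from Delta_Aut[OF \<delta> this cP(1)[OF k(1)] k(3)] have "(\<sigma> \<circ> (k \<circ> c), w) \<in> ?\<delta>" using k(2) w'(2) by blast
      then show False using D(2)[of "(h, k)" w] h k(1) by auto
    qed
  qed
qed

section \<open>Type-definability and finite diameter\<close>

lemma rdef_pholds:
  fixes \<xi> :: "('s, 'f, 'r, 'i + 'i, 'a) pfm"
  assumes "params_in A \<xi>"
  shows "rdef A {(a, b). pholds M \<xi> (case_sum a b)}"
proof -
  obtain \<phi> \<rho> where \<xi>: "\<xi> = (\<phi>, \<rho>)" by (cases \<xi>)
  define \<rho>' where "\<rho>' = map_sum (case_sum (\<lambda>i. (0 :: nat, i)) (\<lambda>i. (1, i))) id \<circ> \<rho>"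
  let ?s = "\<lambda>(n :: nat, i). sorts i"
  have eq: "case_sum g id (\<rho>' v) = case_sum (case_sum (curry g 0) (curry g 1)) id (\<rho> v)" for g v
    by (auto simp: \<rho>'_def map_sum_def split: sum.splits)
  show ?thesis
  proof (cases "wf_fm M \<phi> \<and> var_ok M ?s UNIV A \<rho>' \<phi>")
    case True
    have "dset M ?s UNIV A {g. curry g \<in> {f. (f 0, f 1) \<in> {(a, b). pholds M \<xi> (case_sum a b)}}}"
    proof (rule dsetI[of _ \<phi> _ _ _ \<rho>'])
      fix g assume g: "g \<in> tuples_of M ?s"
      have "srt M (case_sum (case_sum (curry g 0) (curry g 1)) id (\<rho> v)) = snd v" if "v \<in> fv \<phi>" for v
        using var_ok_srt[OF conjunct2[OF True] g that] unfolding eq .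
      moreover have "sat M \<phi> (case_sum (case_sum (curry g 0) (curry g 1)) id \<circ> \<rho>) = sat M \<phi> (case_sum g id \<circ> \<rho>')"
        by (rule sat_cong) (simp only: eq comp_apply)
      ultimately show "g \<in> {g. curry g \<in> {f. (f 0, f 1) \<in> {(a, b). pholds M \<xi> (case_sum a b)}}} \<longleftrightarrow>
          sat M \<phi> (case_sum g id \<circ> \<rho>')"
        using True by (simp add: \<xi> pholds_def holds_def del: One_nat_def)
    qed (use True in auto)
    then show ?thesis unfolding tdef_def .
  next
    case False
    \<comment> \<open>If the sorts do not fit, \<open>holds\<close> fails everywhere and the
      relation is empty on tuples of the right sorts.\<close>
    have "\<not> pholds M \<xi> (case_sum (f 0) (f 1))" if f: "\<And>n. f n \<in> T1" for f :: "nat \<Rightarrow> 'i \<Rightarrow> 'a"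
    proof
      assume "pholds M \<xi> (case_sum (f 0) (f 1))"
      then have h: "wf_fm M \<phi>" "\<And>v. v \<in> fv \<phi> \<Longrightarrow> srt M (case_sum (case_sum (f 0) (f 1)) id (\<rho> v)) = snd v"
        by (auto simp: \<xi> pholds_def holds_def simp del: One_nat_def)
      have "var_ok M ?s UNIV A \<rho>' \<phi>"
        unfolding var_ok_def
      proof
        fix v assume v: "v \<in> fv \<phi>"
        have "\<rho> v \<in> range Inl \<union> Inr ` A" using assms v by (auto simp: \<xi> params_in_def)
        then show "case \<rho>' v of Inl j \<Rightarrow> j \<in> UNIV \<and> ?s j = snd v | Inr a \<Rightarrow> a \<in> A \<and> srt M a = snd v"
          using h(2)[OF v] tuples_of_srt[OF f]
          by (auto simp: \<rho>'_def split: sum.splits)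
      qed
      with False h(1) show False by blast
    qed
    then show ?thesis by (intro tdef_cong[OF tdef_const[of A False]]) auto
  qed
qed

lemma pholds_rdef:
  assumes "rdef A \<delta>"
  obtains \<xi> :: "('s, 'f, 'r, 'i + 'i, 'a) pfm" where "params_in A \<xi>"
    "\<And>a b. a \<in> T1 \<Longrightarrow> b \<in> T1 \<Longrightarrow> pholds M \<xi> (case_sum a b) \<longleftrightarrow> (a, b) \<in> \<delta>"
proof -
  let ?s = "\<lambda>(n :: nat, i). sorts i"
  from assms obtain \<phi> \<rho> where *: "wf_fm M \<phi>" "var_ok M ?s UNIV A \<rho> \<phi>"
    "\<And>g. g \<in> tuples_of M ?s \<Longrightarrow> g \<in> {g. curry g \<in> {f. (f 0, f 1) \<in> \<delta>}} \<longleftrightarrow> sat M \<phi> (case_sum g id \<circ> \<rho>)"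
    unfolding tdef_def dset_def by blast
  \<comment> \<open>The formula may mention any position of the sequence, though membership depends
    on the first two only; every position other than 1 is read off the first tuple.\<close>
  define \<rho>' where "\<rho>' = map_sum (\<lambda>(n, i). if n = 1 then Inr i else Inl i) id \<circ> \<rho>"
  show thesis
  proof (rule that[of "(\<phi>, \<rho>')"])
    show "params_in A (\<phi>, \<rho>')"
      unfolding params_in_def case_prod_conv
    proof
      fix y assume "y \<in> \<rho>' ` fv \<phi>"
      then obtain v where v: "v \<in> fv \<phi>" "y = \<rho>' v" by blast
      then show "y \<in> range Inl \<union> Inr ` A"
        using *(2) unfolding var_ok_def by (cases "\<rho> v") (force simp: \<rho>'_def)+
    qed
    fix a b assume ab: "a \<in> T1" "b \<in> T1"
    define g where "g = (\<lambda>(n :: nat, i). if n = 1 then b i else a i)"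
    have g: "g \<in> tuples_of M ?s" using ab by (auto simp: g_def tuples_of_def)
    have c: "curry g 0 = a" "curry g 1 = b" by (auto simp: g_def)
    have eq: "case_sum (case_sum a b) id (\<rho>' v) = case_sum g id (\<rho> v)" for v
      by (cases "\<rho> v") (auto simp: \<rho>'_def g_def split: prod.splits)
    have "sat M \<phi> (case_sum (case_sum a b) id \<circ> \<rho>') = sat M \<phi> (case_sum g id \<circ> \<rho>)"
      by (rule sat_cong) (simp add: eq)
    moreover have "srt M (case_sum (case_sum a b) id (\<rho>' v)) = snd v" if "v \<in> fv \<phi>" for v
      unfolding eq by (rule var_ok_srt[OF *(2) g that])
    moreover have "g \<in> {g. curry g \<in> {f. (f 0, f 1) \<in> \<delta>}} \<longleftrightarrow> (a, b) \<in> \<delta>" by (simp only: mem_Collect_eq c)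
    ultimately show "pholds M (\<phi>, \<rho>') (case_sum a b) \<longleftrightarrow> (a, b) \<in> \<delta>"
      using *(1) *(3)[OF g] by (auto simp: pholds_def holds_def)
  qed
qed

text \<open>A finite diameter makes \<open>E\<close> equal to one closed power, which its definable
  neighbourhoods cut out.\<close>

lemma type_definable_if_finite_diam:
  assumes "E \<subseteq> Rn N"
  shows "type_definable_on M \<kappa> P E"
proof -
  have E: "E = Rn N" using assms E_iff by auto
  let ?\<Phi> = "{\<xi> :: ('s, 'f, 'r, 'i + 'i, 'a) pfm. params_in B \<xi> \<and> (\<forall>(a, b)\<in>Rn N. pholds M \<xi> (case_sum a b))}"
  have "(a, b) \<in> E \<longleftrightarrow> (\<forall>\<xi>\<in>?\<Phi>. pholds M \<xi> (case_sum a b))" if ab: "a \<in> P" "b \<in> P" for a b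
  proof
    assume *: "\<forall>\<xi>\<in>?\<Phi>. pholds M \<xi> (case_sum a b)"
    show "(a, b) \<in> E"
      unfolding E
    proof (rule Delta_Rn[OF ab])
      fix \<delta> assume "\<delta> \<in> Delta N"
      then have \<delta>: "rdef B \<delta>" "Rn N \<subseteq> \<delta>" unfolding Delta_def by auto
      from pholds_rdef[OF \<delta>(1)] obtain \<xi> :: "('s, 'f, 'r, 'i + 'i, 'a) pfm" where \<xi>: "params_in B \<xi>"
        "\<And>a b. a \<in> T1 \<Longrightarrow> b \<in> T1 \<Longrightarrow> pholds M \<xi> (case_sum a b) \<longleftrightarrow> (a, b) \<in> \<delta>" by blast
      have "pholds M \<xi> (case_sum c d)" if "(c, d) \<in> Rn N" for c d
        using \<xi>(2)[of c d] that \<delta>(2) Rn_P[OF that] P_T1 by blast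
      then have "\<xi> \<in> ?\<Phi>" using \<xi>(1) by blast
      then show "(a, b) \<in> \<delta>" using * \<xi>(2)[OF P_T1[OF ab(1)] P_T1[OF ab(2)]] by blast
    qed
  qed (use E in blast)
  then show ?thesis
    unfolding type_definable_on_def using small_B by (intro exI[of _ B] exI[of _ ?\<Phi>]) blast
qed

lemma singleton_inv_filter:
  assumes "X \<noteq> {}" "\<And>h. h \<in> H \<Longrightarrow> h ` X = X"
  shows "inv_filter X H {X}"
  using assms unfolding inv_filter_def by auto

text \<open>The space is one class \<open>X\<close>, acted on by its setwise stabilizer
  \<open>\<Gamma>\<close>. The balls around \<open>a\<close> exhaust the class, so one of them must
  be thick for the maximal filter. The resulting bound is carried to the other classes by
  automorphisms.\<close>

lemma finite_diam_if_type_definable: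
  assumes "type_definable_on M \<kappa> P E"
  shows "\<exists>N. E \<subseteq> Rn N"
proof -
  from assms[unfolded type_definable_on_def] obtain A and \<Phi> :: "('s, 'f, 'r, 'i + 'i, 'a) pfm set" where
    *: "small \<kappa> A \<and> (\<forall>\<xi>\<in>\<Phi>. params_in A \<xi>) \<and>
      (\<forall>a\<in>P. \<forall>b\<in>P. (a, b) \<in> E \<longleftrightarrow> (\<forall>\<xi>\<in>\<Phi>. pholds M \<xi> (case_sum a b)))" by (elim exE)
  then have A: "small \<kappa> A" "\<And>\<xi>. \<xi> \<in> \<Phi> \<Longrightarrow> params_in A \<xi>" by auto
  note \<Phi>' = conjunct2[OF conjunct2[OF *]]
  have \<Phi>: "(a, b) \<in> E \<longleftrightarrow> (\<forall>\<xi>\<in>\<Phi>. pholds M \<xi> (case_sum a b))" if "a \<in> P" "b \<in> P" for a b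
    using \<Phi>' that by simp
  obtain a where a: "a \<in> P" using P_nonempty by blast
  define X where "X = E `` {a}"
  define \<Gamma> where "\<Gamma> = {\<sigma> \<in> G. (a, \<sigma> \<circ> a) \<in> E}"
  have aX: "a \<in> X" unfolding X_def using E_refl[OF a] by blast
  have XP: "X \<subseteq> P" unfolding X_def using E_P by blast
  have \<Gamma>G: "\<Gamma> \<subseteq> G" unfolding \<Gamma>_def by blast
  have \<Gamma>X: "\<sigma> \<circ> x \<in> X" if "\<sigma> \<in> \<Gamma>" "x \<in> X" for \<sigma> x
    using that E_Aut E_trans unfolding \<Gamma>_def X_def by blast
  have \<Gamma>comp: "\<sigma> \<circ> \<tau> \<in> \<Gamma>" if "\<sigma> \<in> \<Gamma>" "\<tau> \<in> \<Gamma>" for \<sigma> \<tau>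
  proof -
    have "\<sigma> \<circ> (\<tau> \<circ> a) \<in> X" using that \<Gamma>X aX by blast
    moreover have "\<sigma> \<circ> \<tau> \<in> G" using that AutOver_comp \<Gamma>G by blast
    ultimately show ?thesis unfolding \<Gamma>_def X_def by (simp add: comp_assoc)
  qed
  have \<Gamma>inv: "Hilbert_Choice.inv \<sigma> \<in> \<Gamma>" if "\<sigma> \<in> \<Gamma>" for \<sigma>
  proof -
    have \<sigma>: "\<sigma> \<in> G" "(a, \<sigma> \<circ> a) \<in> E" using that unfolding \<Gamma>_def by auto
    from E_Aut[OF \<sigma>(2) AutOver_inv[OF \<sigma>(1)]] have "(Hilbert_Choice.inv \<sigma> \<circ> a, a) \<in> E"
      unfolding G_cancel(1)[OF \<sigma>(1)] .
    then show ?thesis unfolding \<Gamma>_def using AutOver_inv[OF \<sigma>(1)] E_sym by blast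
  qed
  have "act \<sigma> ` X = X" if "\<sigma> \<in> \<Gamma>" for \<sigma>
  proof
    show "act \<sigma> ` X \<subseteq> X" using \<Gamma>X that by blast
    show "X \<subseteq> act \<sigma> ` X"
    proof
      fix x assume "x \<in> X"
      then have "Hilbert_Choice.inv \<sigma> \<circ> x \<in> X" using \<Gamma>X \<Gamma>inv[OF that] by blast
      moreover have "x = \<sigma> \<circ> (Hilbert_Choice.inv \<sigma> \<circ> x)"
        by (rule G_cancel(2)[OF subsetD[OF \<Gamma>G that], symmetric])
      ultimately show "x \<in> act \<sigma> ` X" by blast
    qed
  qed
  then have "inv_filter X (act ` \<Gamma>) {X}" using aX by (intro singleton_inv_filter) auto
  moreover have "id \<in> act ` \<Gamma>"
    by (rule image_eqI[of _ _ id]) (use E_refl[OF a] in \<open>auto simp: \<Gamma>_def fun_eq_iff\<close>)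
  moreover have "g \<circ> h \<in> act ` \<Gamma>" if "g \<in> act ` \<Gamma>" "h \<in> act ` \<Gamma>" for g h
  proof -
    obtain \<sigma> \<tau> where "\<sigma> \<in> \<Gamma>" "\<tau> \<in> \<Gamma>" "g = act \<sigma>" "h = act \<tau>" using \<open>g \<in> act ` \<Gamma>\<close> \<open>h \<in> act ` \<Gamma>\<close> by blast
    then show ?thesis using \<Gamma>comp by (intro image_eqI[of _ _ "\<sigma> \<circ> \<tau>"]) (auto simp: fun_eq_iff)
  qed
  moreover have "h ` X \<subseteq> X" if "h \<in> act ` \<Gamma>" for h using that \<Gamma>X by blast
  ultimately have "\<exists>\<F>. inv_filter X (act ` \<Gamma>) \<F> \<and> {X} \<subseteq> \<F> \<and>
    (\<forall>S\<subseteq>X. X - S \<in> \<F> \<or> (\<exists>F\<in>\<F>. \<exists>H0\<subseteq>act ` \<Gamma>. finite H0 \<and> F \<subseteq> (\<Union>h\<in>H0. h ` S)))"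
    by (rule maximal_inv_filter)
  then obtain \<F> where F: "inv_filter X (act ` \<Gamma>) \<F>"
    and max: "\<forall>S\<subseteq>X. X - S \<in> \<F> \<or> (\<exists>F\<in>\<F>. \<exists>H0\<subseteq>act ` \<Gamma>. finite H0 \<and> F \<subseteq> (\<Union>h\<in>H0. h ` S))"
    by (elim exE conjE)
  note FX = inv_filterD(1,2)[OF F]
  have "\<exists>n S. S \<subseteq> X \<and> X - S \<notin> \<F> \<and> (\<forall>\<delta>\<in>Delta n. X - (S - \<delta> `` {a}) \<in> \<F>)"
  proof (rule ccontr)
    assume no: "\<not> ?thesis"
    \<comment> \<open>If no ball is thick, a positive set can be shrunk forever, losing at stage
      \<open>n\<close> a neighbourhood of the \<open>Rn n\<close>-ball around
      \<open>a\<close>.\<close>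
    have "\<exists>S. \<forall>n. (S n \<subseteq> X \<and> X - S n \<notin> \<F>) \<and> (\<exists>\<delta>\<in>Delta n. S (Suc n) = S n - \<delta> `` {a})"
    proof (rule dependent_nat_choice)
      show "\<exists>S. S \<subseteq> X \<and> X - S \<notin> \<F>" using FX by (intro exI[of _ X]) simp
      fix S n assume S: "S \<subseteq> X \<and> X - S \<notin> \<F>"
      then obtain \<delta> where "\<delta> \<in> Delta n" "X - (S - \<delta> `` {a}) \<notin> \<F>" using no by blast
      with S show "\<exists>S'. (S' \<subseteq> X \<and> X - S' \<notin> \<F>) \<and> (\<exists>\<delta>\<in>Delta n. S' = S - \<delta> `` {a})"
        by (intro exI[of _ "S - \<delta> `` {a}"]) blast
    qed
    then obtain S where S: "\<And>n. S n \<subseteq> X" "\<And>n. X - S n \<notin> \<F>"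
      "\<forall>n. \<exists>\<delta>\<in>Delta n. S (Suc n) = S n - \<delta> `` {a}" by blast
    from choice[OF S(3)[unfolded Bex_def]] obtain \<delta> where \<delta>: "\<And>n. \<delta> n \<in> Delta n" "\<And>n. S (Suc n) = S n - \<delta> n `` {a}" by blast
    have anti: "S n \<subseteq> S m" if "m \<le> n" for m n
      using that by (induction n rule: dec_induct) (auto simp: \<delta>(2))
    let ?X = "\<lambda>n. {f :: nat \<Rightarrow> 'i \<Rightarrow> 'a. (a, f 0) \<notin> \<delta> n}" and ?Y = "\<lambda>\<xi>. {f :: nat \<Rightarrow> 'i \<Rightarrow> 'a. (a, f 0) \<in> {(a, b). pholds M \<xi> (case_sum a b)}}"
    \<comment> \<open>Here type-definability enters: the formulas in \<open>\<Phi>\<close> keep the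
      limit point in the class of \<open>a\<close>, although it avoids every ball around
      \<open>a\<close>.\<close>
    have "\<exists>f :: nat \<Rightarrow> 'i \<Rightarrow> 'a. (\<forall>n. f n \<in> P) \<and> (\<forall>Z\<in>range ?X \<union> ?Y ` \<Phi>. f \<in> Z)"
    proof (rule P_compactness)
      show "small \<kappa> (A \<union> B \<union> range a)" using A(1) by (intro small_Un small_B small_image small_I)
      show "tdef (A \<union> B \<union> range a) Z" if Z: "Z \<in> range ?X \<union> ?Y ` \<Phi>" for Z
        using Z
      proof
        assume "Z \<in> range ?X"
        then obtain n where Z: "Z = ?X n" by blast
        have "rdef B (\<delta> n)" using \<delta>(1) unfolding Delta_def by blast
        from tdef_not[OF rdef_left[OF this P_T1[OF a], of 0]] show ?thesis unfolding Z by (rule tdef_mono) auto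
      next
        assume "Z \<in> ?Y ` \<Phi>"
        then obtain \<xi> where Z: "\<xi> \<in> \<Phi>" "Z = ?Y \<xi>" by blast
        from rdef_left[OF rdef_pholds[OF A(2)[OF Z(1)]] P_T1[OF a], of 0] show ?thesis unfolding Z by (rule tdef_mono) auto
      qed
      fix \<Z> assume Z: "finite \<Z>" "\<Z> \<subseteq> range ?X \<union> ?Y ` \<Phi>"
      have "finite (\<Z> \<inter> range ?X)" using Z(1) by blast
      from finite_subset_image[OF this, of ?X UNIV] obtain I where I: "finite I" "\<Z> \<inter> range ?X = ?X ` I" by blast
      obtain N where N: "\<forall>n\<in>I. n < N" using finite_nat_set_iff_bounded I(1) by blast
      have "S N \<noteq> {}" using S(2)[of N] FX(1) by auto
      then obtain x where x: "x \<in> S N" by blast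
      then have xX: "x \<in> X" using S(1) by blast
      have "(a, x) \<notin> \<delta> n" if "n \<in> I" for n
        using anti[of "Suc n" N] N that x \<delta>(2)[of n] by (auto simp: Suc_le_eq)
      moreover have "pholds M \<xi> (case_sum a x)" if "\<xi> \<in> \<Phi>" for \<xi>
        using \<Phi>[OF a, of x] xX XP that unfolding X_def by blast
      ultimately have x': "\<And>n. n \<in> I \<Longrightarrow> (a, x) \<notin> \<delta> n" "\<And>\<xi>. \<xi> \<in> \<Phi> \<Longrightarrow> pholds M \<xi> (case_sum a x)"
        by blast+
      have "(\<lambda>_. x) \<in> Z" if ZZ: "Z \<in> \<Z>" for Z
      proof (cases "Z \<in> range ?X")
        case True
        then have "Z \<in> ?X ` I" using ZZ I(2) by blast
        then show ?thesis using x'(1) by auto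
      next
        case False
        then have "Z \<in> ?Y ` \<Phi>" using ZZ Z(2) by blast
        then show ?thesis using x'(2) by auto
      qed
      then show "\<exists>f. (\<forall>n. f n \<in> P) \<and> (\<forall>Z\<in>\<Z>. f \<in> Z)"
        using xX XP by (intro exI[of _ "\<lambda>_. x"]) auto
    qed
    then obtain f where f: "\<forall>n. f n \<in> P" "\<forall>Z\<in>range ?X \<union> ?Y ` \<Phi>. f \<in> Z" by (elim exE conjE)
    have f': "(a, f 0) \<notin> \<delta> n" for n using bspec[OF f(2), of "?X n"] by blast
    have "pholds M \<xi> (case_sum a (f 0))" if "\<xi> \<in> \<Phi>" for \<xi>
      using bspec[OF f(2), of "?Y \<xi>"] that by blast
    then have "(a, f 0) \<in> E" using \<Phi>[OF a, of "f 0"] f(1) by simp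
    then obtain n where "(a, f 0) \<in> Rn n" using E_iff by blast
    then show False using f'[of n] \<delta>(1)[of n] unfolding Delta_def by blast
  qed
  then obtain n S where S: "S \<subseteq> X" "X - S \<notin> \<F>" "\<And>\<delta>. \<delta> \<in> Delta n \<Longrightarrow> X - (S - \<delta> `` {a}) \<in> \<F>" by blast
  obtain \<Gamma>0 where \<Gamma>0: "\<Gamma>0 \<subseteq> \<Gamma>" "finite \<Gamma>0"
    "\<And>\<sigma>. \<sigma> \<in> \<Gamma> \<Longrightarrow> \<exists>h\<in>\<Gamma>0. \<exists>k\<in>\<Gamma>0. (h \<circ> a, \<sigma> \<circ> (k \<circ> a)) \<in> Rn (2 * n)"
    using orbit_finite_distance[OF XP \<Gamma>G \<Gamma>comp \<Gamma>X F max aX S] by blast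
  have "\<forall>h\<in>\<Gamma>0. \<exists>m. (a, h \<circ> a) \<in> Rn m" using \<Gamma>0(1) E_iff unfolding \<Gamma>_def by blast
  from bchoice[OF this] obtain m where m: "\<And>h. h \<in> \<Gamma>0 \<Longrightarrow> (a, h \<circ> a) \<in> Rn (m h)" by blast
  define m0 where "m0 = Max (m ` \<Gamma>0)"
  have m0: "(a, h \<circ> a) \<in> Rn m0" if "h \<in> \<Gamma>0" for h
    using m[OF that] Rn_mono[of "m h" m0] that \<Gamma>0(2) by (auto simp: m0_def)
  \<comment> \<open>The path goes from \<open>a\<close> to \<open>h \<circ> a\<close>, on to
    \<open>\<sigma> \<circ> (k \<circ> a)\<close>, and back to
    \<open>\<sigma> \<circ> a\<close>.\<close>
  have *: "(a, b) \<in> Rn (m0 + 2 * n + m0)" if "(a, b) \<in> E" for b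
  proof -
    have "b \<in> P" using E_P[OF that] by simp
    then obtain \<sigma> where \<sigma>: "\<sigma> \<in> G" "b = \<sigma> \<circ> a" using P_trans[OF a] by blast
    then have "\<sigma> \<in> \<Gamma>" using that unfolding \<Gamma>_def by blast
    then obtain h k where hk: "h \<in> \<Gamma>0" "k \<in> \<Gamma>0" "(h \<circ> a, \<sigma> \<circ> (k \<circ> a)) \<in> Rn (2 * n)" using \<Gamma>0(3) by blast
    have "(\<sigma> \<circ> (k \<circ> a), b) \<in> Rn m0" unfolding \<sigma>(2) using Rn_Aut[OF Rn_sym[OF m0[OF hk(2)]] \<sigma>(1)] .
    then show ?thesis using Rn_trans[OF Rn_trans[OF m0[OF hk(1)] hk(3)]] by blast
  qed
  have "(a', b') \<in> Rn (m0 + 2 * n + m0)" if E: "(a', b') \<in> E" for a' b'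
  proof -
    have "a' \<in> P" using E_P[OF E] by simp
    then obtain \<sigma> where \<sigma>: "\<sigma> \<in> G" "a' = \<sigma> \<circ> a" using P_trans[OF a] by blast
    have "(a, Hilbert_Choice.inv \<sigma> \<circ> b') \<in> E"
      using E_Aut[OF E AutOver_inv[OF \<sigma>(1)]] unfolding \<sigma>(2) G_cancel(1)[OF \<sigma>(1)] .
    from Rn_Aut[OF *[OF this] \<sigma>(1)] show ?thesis unfolding \<sigma>(2) G_cancel(2)[OF \<sigma>(1)] .
  qed
  then show ?thesis by (intro exI[of _ "m0 + 2 * n + m0"] subrelI)
qed

theorem type_definable_iff: "type_definable_on M \<kappa> P E \<longleftrightarrow> H1_diam M B p \<noteq> \<infinity>"
  using diam_finite_iff type_definable_if_finite_diam finite_diam_if_type_definable by blast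


section \<open>Few classes or a perfect set of classes\<close>

text \<open>A formula and a finite list of coordinates and parameters determine the set. Only
  subsets of \<open>tuples_of M s\<close> are counted, because \<open>dset\<close> leaves the rest
  of a set arbitrary.\<close>

lemma small_dsets:
  fixes s :: "'j \<Rightarrow> 's"
  assumes "small \<kappa> (UNIV :: 'j set)" "small \<kappa> A"
  shows "small \<kappa> {X. X \<subseteq> tuples_of M s \<and> dset M s UNIV A X}"
proof -
  define L :: "('s, 'f, 'r) fm \<Rightarrow> 's var list" where "L = (\<lambda>\<phi>. SOME xs. set xs = fv \<phi>)"
  have L: "set (L \<phi>) = fv \<phi>" for \<phi> :: "('s, 'f, 'r) fm"
    unfolding L_def by (rule someI_ex) (simp add: finite_list)
  define F where "F = (\<lambda>(\<phi> :: ('s, 'f, 'r) fm, l :: ('j + 'a) list).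
    {f \<in> tuples_of M s. sat M \<phi> (case_sum f id \<circ> (\<lambda>v. the (map_of (zip (L \<phi>) l) v)))})"
  have "{X. X \<subseteq> tuples_of M s \<and> dset M s UNIV A X} \<subseteq> F ` (UNIV \<times> lists (UNIV <+> A))"
  proof
    fix X assume "X \<in> {X. X \<subseteq> tuples_of M s \<and> dset M s UNIV A X}"
    then have X: "X \<subseteq> tuples_of M s" "dset M s UNIV A X" by simp_all
    then obtain \<phi> \<rho> where *: "wf_fm M \<phi>" "var_ok M s UNIV A \<rho> \<phi>"
      "\<And>f. f \<in> tuples_of M s \<Longrightarrow> f \<in> X \<longleftrightarrow> sat M \<phi> (case_sum f id \<circ> \<rho>)" unfolding dset_def by blast
    have \<rho>: "the (map_of (zip (L \<phi>) (map \<rho> (L \<phi>))) v) = \<rho> v" if "v \<in> fv \<phi>" for v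
      using that by (simp add: map_of_zip_map L)
    have "sat M \<phi> (case_sum f id \<circ> (\<lambda>v. the (map_of (zip (L \<phi>) (map \<rho> (L \<phi>))) v))) = sat M \<phi> (case_sum f id \<circ> \<rho>)" for f
      by (rule sat_cong) (simp only: comp_apply \<rho>)
    then have "X = F (\<phi>, map \<rho> (L \<phi>))" using X(1) *(3) by (auto simp: F_def)
    moreover have "\<rho> v \<in> UNIV <+> A" if "v \<in> fv \<phi>" for v
      using *(2) that unfolding var_ok_def by (cases "\<rho> v") force+
    then have "map \<rho> (L \<phi>) \<in> lists (UNIV <+> A)" using L by auto
    ultimately show "X \<in> F ` (UNIV \<times> lists (UNIV <+> A))" by blast
  qed
  then show ?thesis
    by (rule small_mono[rotated]) (intro small_image small_Times small_fm small_lists small_Plus assms)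
qed

lemma small_rdefs: "small \<kappa> {\<delta>. \<delta> \<subseteq> T1 \<times> T1 \<and> rdef B \<delta>}"
proof -
  let ?s = "\<lambda>(n :: nat, i). sorts i"
  let ?h = "\<lambda>X. (\<lambda>g. (curry g (0 :: nat), curry g 1)) ` X"
  have "{\<delta>. \<delta> \<subseteq> T1 \<times> T1 \<and> rdef B \<delta>} \<subseteq> ?h ` {X. X \<subseteq> tuples_of M ?s \<and> dset M ?s UNIV B X}"
  proof
    fix \<delta> assume "\<delta> \<in> {\<delta>. \<delta> \<subseteq> T1 \<times> T1 \<and> rdef B \<delta>}"
    then have \<delta>: "\<delta> \<subseteq> T1 \<times> T1" "rdef B \<delta>" by simp_all
    let ?X = "{g \<in> tuples_of M ?s. (curry g 0, curry g 1) \<in> \<delta>}"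
    have "dset M ?s UNIV B ?X" using \<delta>(2) unfolding tdef_def by (rule dset_cong) simp
    moreover have "\<delta> = ?h ?X"
    proof (intro equalityI subrelI)
      fix a b assume ab: "(a, b) \<in> \<delta>"
      let ?g = "\<lambda>(n :: nat, i). if n = 0 then a i else b i"
      have "?g \<in> tuples_of M ?s" using ab \<delta>(1) by (auto simp: tuples_of_def)
      moreover have "curry ?g 0 = a" "curry ?g 1 = b" by auto
      ultimately show "(a, b) \<in> ?h ?X" using ab by (intro image_eqI[of _ _ ?g]) simp_all
    qed auto
    moreover have "?X \<subseteq> tuples_of M ?s" by blast
    ultimately show "\<delta> \<in> ?h ` {X. X \<subseteq> tuples_of M ?s \<and> dset M ?s UNIV B X}" by blast
  qed
  then show ?thesis
    by (rule small_mono[rotated]) (intro small_image small_dsets small_seq small_B)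
qed

section \<open>Finitely many parameters and separated sets\<close>

lemma P_compactness_one:
  assumes "small \<kappa> A" "\<And>i. i \<in> I \<Longrightarrow> udef A (S i)"
    and fip: "\<And>I0. finite I0 \<Longrightarrow> I0 \<subseteq> I \<Longrightarrow> \<exists>x\<in>P. \<forall>i\<in>I0. x \<in> S i"
  shows "\<exists>x\<in>P. \<forall>i\<in>I. x \<in> S i"
proof -
  let ?X = "\<lambda>i. {f :: nat \<Rightarrow> 'i \<Rightarrow> 'a. f 0 \<in> S i}"
  have "\<exists>f :: nat \<Rightarrow> 'i \<Rightarrow> 'a. (\<forall>n. f n \<in> P) \<and> (\<forall>X\<in>?X ` I. f \<in> X)"
  proof (rule P_compactness[OF assms(1)])
    show "tdef A X" if "X \<in> ?X ` I" for X using assms(2) that by blast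
    fix \<X>0 assume *: "finite \<X>0" "\<X>0 \<subseteq> ?X ` I"
    from finite_subset_image[OF *] obtain I0 where I0: "I0 \<subseteq> I" "finite I0" "\<X>0 = ?X ` I0" by blast
    from fip[OF I0(2,1)] obtain x where "x \<in> P" "\<forall>i\<in>I0. x \<in> S i" by blast
    then show "\<exists>f :: nat \<Rightarrow> 'i \<Rightarrow> 'a. (\<forall>n. f n \<in> P) \<and> (\<forall>X\<in>\<X>0. f \<in> X)"
      unfolding I0(3) by (intro exI[of _ "\<lambda>_. x"]) auto
  qed
  then obtain f :: "nat \<Rightarrow> 'i \<Rightarrow> 'a" where "\<forall>n. f n \<in> P" "\<forall>X\<in>?X ` I. f \<in> X" by (elim exE conjE)
  then show ?thesis by (intro bexI[of _ "f 0"]) auto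
qed

lemma udef_left: "rdef B \<delta> \<Longrightarrow> c \<in> P \<Longrightarrow> \<exists>A. finite A \<and> udef A (\<delta> `` {c})"
  using tdef_finite[OF rdef_left[of B \<delta> c 0]] P_T1[of c] by auto

lemma udef_Int: "udef A S \<Longrightarrow> udef A S' \<Longrightarrow> udef A (S \<inter> S')"
  using tdef_conj[of A "\<lambda>f. f 0 \<in> S" "\<lambda>f. f 0 \<in> S'"] by simp

lemma udef_Compl: "udef A S \<Longrightarrow> udef A (- S)"
  using tdef_not[of A "\<lambda>f. f 0 \<in> S"] by simp

text \<open>With finitely many parameters per set, a small family of such sets has a small set of
  parameters in total, although \<open>\<kappa>\<close> need not be regular.\<close>

definition fdef :: "('i \<Rightarrow> 'a) set \<Rightarrow> bool" where
  "fdef S \<longleftrightarrow> (\<exists>A. finite A \<and> udef A S)"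

lemma fdef_Int: "fdef S \<Longrightarrow> fdef S' \<Longrightarrow> fdef (S \<inter> S')"
proof -
  assume "fdef S" "fdef S'"
  then obtain A A' where A: "finite A" "udef A S" "finite A'" "udef A' S'" unfolding fdef_def by blast
  have "udef (A \<union> A') (S \<inter> S')"
    by (rule udef_Int[OF tdef_mono[OF A(2)] tdef_mono[OF A(4)]]) auto
  then show ?thesis using A unfolding fdef_def by blast
qed

lemma fdef_Compl: "fdef S \<Longrightarrow> fdef (- S)"
  unfolding fdef_def using udef_Compl by blast

lemma fdef_UNIV: "fdef UNIV"
  unfolding fdef_def using tdef_const[of "{}" True] by auto

text \<open>One neighbourhood serves for all points of both sets. In particular no realization in
  one is \<open>Rn n\<close>-related to one in the other.\<close>

definition separated :: "nat \<Rightarrow> ('i \<Rightarrow> 'a) set \<Rightarrow> ('i \<Rightarrow> 'a) set \<Rightarrow> bool" where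
  "separated n S S' \<longleftrightarrow> (\<exists>\<delta>\<in>Delta n. \<forall>x\<in>S \<inter> P. \<forall>y\<in>S' \<inter> P. (x, y) \<notin> \<delta>)"

lemma separated_mono: "separated n S S' \<Longrightarrow> U \<subseteq> S \<Longrightarrow> U' \<subseteq> S' \<Longrightarrow> separated n U U'"
  unfolding separated_def by blast

text \<open>This is the maximality principle for \<open>H = {id}\<close>: having finitely many
  translates that cover a filter set then just means belonging to the filter.\<close>

lemma ultrafilter_refinement:
  assumes F: "inv_filter P H \<F>" and S: "P - S \<notin> \<F>"
  obtains \<U> where "inv_filter P {id} \<U>" "\<F> \<subseteq> \<U>" "S \<inter> P \<in> \<U>" "\<And>V. V \<subseteq> P \<Longrightarrow> P - V \<in> \<U> \<or> V \<in> \<U>"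
proof -
  note FD = inv_filterD[OF F]
  let ?\<F> = "{A. A \<subseteq> P \<and> (\<exists>F\<in>\<F>. F \<inter> S \<subseteq> A)}"
  have "inv_filter P {id} ?\<F>"
    unfolding inv_filter_def
  proof (intro conjI ballI allI impI)
    show "P \<in> ?\<F>" using FD(1) by blast
    show "{} \<notin> ?\<F>"
    proof
      assume "{} \<in> ?\<F>"
      then obtain F where F: "F \<in> \<F>" "F \<inter> S \<subseteq> {}" by blast
      then have "F \<subseteq> P - S" using FD(3) by blast
      with FD(5)[OF F(1) this] S show False by blast
    qed
    show "?\<F> \<subseteq> Pow P" by blast
    fix A assume A: "A \<in> ?\<F>"
    then obtain F where F: "F \<in> \<F>" "F \<inter> S \<subseteq> A" by blast
    show "A \<inter> A' \<in> ?\<F>" if A': "A' \<in> ?\<F>" for A'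
    proof -
      obtain F' where F': "F' \<in> \<F>" "F' \<inter> S \<subseteq> A'" using A' by blast
      have "F \<inter> F' \<in> \<F>" using FD(4) F F' by blast
      moreover have "F \<inter> F' \<inter> S \<subseteq> A \<inter> A'" using F F' by blast
      ultimately show ?thesis using A by blast
    qed
    show "A' \<in> ?\<F>" if "A \<subseteq> A' \<and> A' \<subseteq> P" for A' using that F by blast
    show "h ` A \<in> ?\<F>" if "h \<in> {id}" for h using that A by simp
  qed
  then have "\<exists>\<U>. inv_filter P {id} \<U> \<and> ?\<F> \<subseteq> \<U> \<and>
    (\<forall>V\<subseteq>P. P - V \<in> \<U> \<or> (\<exists>F\<in>\<U>. \<exists>H0\<subseteq>{id}. finite H0 \<and> F \<subseteq> (\<Union>h\<in>H0. h ` V)))"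
    by (rule maximal_inv_filter) auto
  then obtain \<U> where U: "inv_filter P {id} \<U>" "?\<F> \<subseteq> \<U>"
    and max: "\<forall>V\<subseteq>P. P - V \<in> \<U> \<or> (\<exists>F\<in>\<U>. \<exists>H0\<subseteq>{id}. finite H0 \<and> F \<subseteq> (\<Union>h\<in>H0. h ` V))"
    by (elim exE conjE)
  show thesis
  proof (rule that[OF U(1)])
    show "\<F> \<subseteq> \<U>" using U(2) FD(3) by blast
    show "S \<inter> P \<in> \<U>" using U(2) FD(1) by blast
    fix V assume V: "V \<subseteq> P"
    show "P - V \<in> \<U> \<or> V \<in> \<U>"
    proof (cases "P - V \<in> \<U>")
      case False
      then obtain F H0 where F: "F \<in> \<U>" "H0 \<subseteq> {id}" "F \<subseteq> (\<Union>h\<in>H0. h ` V)"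
        using max[rule_format, OF V] by blast
      have "F \<subseteq> V"
      proof
        fix x assume "x \<in> F"
        then obtain h where "h \<in> H0" "x \<in> h ` V" using F(3) by blast
        moreover then have "h = id" using F(2) by blast
        ultimately show "x \<in> V" by simp
      qed
      then show ?thesis using inv_filterD(5)[OF U(1) F(1) _ V] by blast
    qed blast
  qed
qed

text \<open>Here \<open>c\<close> is a realization at distance at most \<open>2\<close> from a point of the flow inside \<open>S0\<close>; a part of \<open>S1\<close>
  far from \<open>c\<close> is then separated from a neighbourhood of that point.\<close>

lemma separate_positive:
  assumes F: "inv_filter P H \<F>"
    and thin: "\<And>c n S. c \<in> P \<Longrightarrow> S \<subseteq> P \<Longrightarrow> P - S \<notin> \<F> \<Longrightarrow> \<exists>\<delta>\<in>Delta n. P - (S - \<delta> `` {c}) \<notin> \<F>"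
    and S: "fdef S0" "P - S0 \<notin> \<F>" "fdef S1" "P - S1 \<notin> \<F>"
  obtains S0' S1' where "S0' \<subseteq> S0" "fdef S0'" "P - S0' \<notin> \<F>" "S1' \<subseteq> S1" "fdef S1'" "P - S1' \<notin> \<F>"
    "separated n S0' S1'"
proof -
  obtain \<U> where U: "inv_filter P {id} \<U>" "\<F> \<subseteq> \<U>" "S0 \<inter> P \<in> \<U>"
    and ultra: "\<And>V. V \<subseteq> P \<Longrightarrow> P - V \<in> \<U> \<or> V \<in> \<U>"
    using ultrafilter_refinement[OF F S(2)] by blast
  note UD = inv_filterD[OF U(1)]
  have pos: "P - V \<notin> \<F>" if "V \<inter> P \<in> \<U>" for V
  proof
    assume "P - V \<in> \<F>"
    then have "(P - V) \<inter> (V \<inter> P) \<in> \<U>" using U(2) UD(4) that by blast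
    moreover have "(P - V) \<inter> (V \<inter> P) = {}" by blast
    ultimately show False using UD(2) by simp
  qed
  have fin: "P \<inter> (\<Inter>i\<in>I. V i) \<in> \<U>" if "finite I" "\<And>i. i \<in> I \<Longrightarrow> P \<inter> V i \<in> \<U>" for I and V :: "('i \<Rightarrow> 'a) rel \<Rightarrow> _"
    using that
  proof (induction I rule: finite_induct)
    case (insert i I)
    have "(P \<inter> (\<Inter>i\<in>I. V i)) \<inter> (P \<inter> V i) \<in> \<U>" by (rule UD(4)) (use insert in auto)
    moreover have "(P \<inter> (\<Inter>i\<in>I. V i)) \<inter> (P \<inter> V i) = P \<inter> (\<Inter>i\<in>insert i I. V i)" by blast
    ultimately show ?case by simp
  qed (simp add: UD(1))
  have fin': "P \<inter> (\<Inter>c\<in>C. V c) \<in> \<U>" if "finite C" "\<And>c. c \<in> C \<Longrightarrow> P \<inter> V c \<in> \<U>" for C and V :: "('i \<Rightarrow> 'a) \<Rightarrow> _"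
    using that
  proof (induction C rule: finite_induct)
    case (insert i I)
    have "(P \<inter> (\<Inter>i\<in>I. V i)) \<inter> (P \<inter> V i) \<in> \<U>" by (rule UD(4)) (use insert in auto)
    moreover have "(P \<inter> (\<Inter>i\<in>I. V i)) \<inter> (P \<inter> V i) = P \<inter> (\<Inter>i\<in>insert i I. V i)" by blast
    ultimately show ?case by simp
  qed (simp add: UD(1))
  \<comment> \<open>Cutting the neighbourhoods down to the right sorts makes the family
    small.\<close>
  let ?\<Delta> = "{\<delta> \<in> Delta 1. \<delta> \<subseteq> T1 \<times> T1}"
  have "\<forall>\<delta>\<in>?\<Delta>. \<exists>c. c \<in> P \<and> P \<inter> \<delta> `` {c} \<in> \<U>"
  proof
    fix \<delta> assume \<delta>: "\<delta> \<in> ?\<Delta>"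
    then obtain C where C: "C \<subseteq> P" "finite C" "P \<subseteq> (\<Union>c\<in>C. \<delta> `` {c})"
      using Delta_1_finite_cover[of \<delta> P] by blast
    show "\<exists>c. c \<in> P \<and> P \<inter> \<delta> `` {c} \<in> \<U>"
    proof (rule ccontr)
      assume no: "\<not> ?thesis"
      have "P \<inter> (- (\<delta> `` {c})) \<in> \<U>" if "c \<in> C" for c
      proof -
        have "P \<inter> \<delta> `` {c} \<notin> \<U>" using no that C(1) by blast
        then have "P - (P \<inter> \<delta> `` {c}) \<in> \<U>" using ultra[of "P \<inter> \<delta> `` {c}"] by blast
        moreover have "P - (P \<inter> \<delta> `` {c}) = P \<inter> (- (\<delta> `` {c}))" by blast
        ultimately show ?thesis by simp
      qed
      then have "P \<inter> (\<Inter>c\<in>C. - (\<delta> `` {c})) \<in> \<U>" by (rule fin'[OF C(2)])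
      moreover have "P \<inter> (\<Inter>c\<in>C. - (\<delta> `` {c})) = {}" using C(3) by blast
      ultimately show False using UD(2) by simp
    qed
  qed
  from bchoice[OF this] obtain d where "\<forall>\<delta>\<in>?\<Delta>. d \<delta> \<in> P \<and> P \<inter> \<delta> `` {d \<delta>} \<in> \<U>" by (elim exE)
  then have d: "d \<delta> \<in> P" "P \<inter> \<delta> `` {d \<delta>} \<in> \<U>" if "\<delta> \<in> ?\<Delta>" for \<delta> using that by simp_all
  have "\<forall>\<delta>\<in>?\<Delta>. \<exists>A. finite A \<and> udef A (\<delta> `` {d \<delta>})"
    using udef_left d(1) unfolding Delta_def by blast
  from bchoice[OF this] obtain A where "\<forall>\<delta>\<in>?\<Delta>. finite (A \<delta>) \<and> udef (A \<delta>) (\<delta> `` {d \<delta>})" by (elim exE)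
  then have A: "finite (A \<delta>)" "udef (A \<delta>) (\<delta> `` {d \<delta>})" if "\<delta> \<in> ?\<Delta>" for \<delta> using that by simp_all
  \<comment> \<open>For each neighbourhood a finite covering yields a ball in the ultrafilter. These
    balls have the finite intersection property, so compactness gives a common point.\<close>
  have "\<exists>c\<in>P. \<forall>\<delta>\<in>?\<Delta>. c \<in> \<delta> `` {d \<delta>}"
  proof (rule P_compactness_one)
    show "small \<kappa> (\<Union>\<delta>\<in>?\<Delta>. A \<delta>)"
      by (rule small_UN_finite[OF small_mono[OF small_rdefs]]) (use A(1) in \<open>auto simp: Delta_def\<close>)
    show "udef (\<Union>\<delta>\<in>?\<Delta>. A \<delta>) (\<delta> `` {d \<delta>})" if "\<delta> \<in> ?\<Delta>" for \<delta>
      by (rule tdef_mono[OF A(2)[OF that]]) (use that in blast)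
    fix I0 assume I0: "finite I0" "I0 \<subseteq> ?\<Delta>"
    have "P \<inter> (\<Inter>\<delta>\<in>I0. \<delta> `` {d \<delta>}) \<in> \<U>"
      by (rule fin[OF I0(1)]) (use d(2) I0(2) in blast)
    then have "P \<inter> (\<Inter>\<delta>\<in>I0. \<delta> `` {d \<delta>}) \<noteq> {}" using UD(2) by metis
    then show "\<exists>x\<in>P. \<forall>\<delta>\<in>I0. x \<in> \<delta> `` {d \<delta>}" by blast
  qed
  then obtain c where c: "c \<in> P" "\<And>\<delta>. \<delta> \<in> ?\<Delta> \<Longrightarrow> (d \<delta>, c) \<in> \<delta>" by blast
  have "P - (S1 \<inter> P) = P - S1" by blast
  \<comment> \<open>Two steps are lost in going from \<open>c\<close> through a centre
    \<open>d \<delta>\<close> to a point of \<open>S0\<close>; the remaining \<open>n\<close>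
    provide the separation.\<close>
  then have "\<exists>\<delta>\<in>Delta (1 + 1 + n). P - ((S1 \<inter> P) - \<delta> `` {c}) \<notin> \<F>"
    using thin[OF c(1), of "S1 \<inter> P"] S(4) by simp
  then obtain \<delta>' where \<delta>': "\<delta>' \<in> Delta (1 + 1 + n)" "P - ((S1 \<inter> P) - \<delta>' `` {c}) \<notin> \<F>" by blast
  \<comment> \<open>A triangle inequality for neighbourhoods: the way from \<open>w\<close> through
    \<open>y\<close> to \<open>x\<close> costs two steps, that from \<open>x\<close> to
    \<open>z\<close> costs \<open>n\<close>.\<close>
  have "\<exists>\<delta>\<in>Delta 1. \<exists>\<epsilon>\<in>Delta n. \<forall>y\<in>P. \<forall>w\<in>P. \<forall>x\<in>P. \<forall>z\<in>P.
    (y, w) \<in> \<delta> \<longrightarrow> (y, x) \<in> \<delta> \<longrightarrow> (x, z) \<in> \<epsilon> \<longrightarrow> (w, z) \<in> \<delta>'"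
  proof (rule ccontr)
    assume no: "\<not> ?thesis"
    let ?X = "\<lambda>(\<delta>, \<epsilon>). {f :: nat \<Rightarrow> 'i \<Rightarrow> 'a. (f 0, f 1) \<in> \<delta> \<and> (f 0, f 2) \<in> \<delta> \<and> (f 2, f 3) \<in> \<epsilon> \<and> (f 1, f 3) \<notin> \<delta>'}"
    have "\<exists>f :: nat \<Rightarrow> 'i \<Rightarrow> 'a. (\<forall>n. f n \<in> P) \<and> (\<forall>i\<in>Delta 1 \<times> Delta n. f \<in> ?X i)"
    proof (rule P_compactness_directed[OF small_B])
      show "tdef B (?X i)" if iI: "i \<in> Delta 1 \<times> Delta n" for i
      proof -
        obtain \<delta> \<epsilon> where i: "i = (\<delta>, \<epsilon>)" "rdef B \<delta>" "rdef B \<epsilon>" using iI unfolding Delta_def by blast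
        have "rdef B \<delta>'" using \<delta>'(1) unfolding Delta_def by blast
        then show ?thesis unfolding i(1) case_prod_conv
          using i(2,3) by (intro tdef_conj tdef_not) (rule rdef_at, assumption)+
      qed
      show "Delta 1 \<times> Delta n \<noteq> {}" using Delta_UNIV by blast
      show "\<exists>k\<in>Delta 1 \<times> Delta n. ?X k \<subseteq> ?X i \<inter> ?X j" if "i \<in> Delta 1 \<times> Delta n" "j \<in> Delta 1 \<times> Delta n" for i j
        by (rule bexI[of _ "(fst i \<inter> fst j, snd i \<inter> snd j)"]) (use that in \<open>auto intro: Delta_Int\<close>)
      show "\<exists>f :: nat \<Rightarrow> 'i \<Rightarrow> 'a. (\<forall>n. f n \<in> P) \<and> f \<in> ?X i" if i: "i \<in> Delta 1 \<times> Delta n" for i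
      proof -
        obtain \<delta> \<epsilon> where i': "i = (\<delta>, \<epsilon>)" "\<delta> \<in> Delta 1" "\<epsilon> \<in> Delta n" using i by blast
        obtain y w x z where "y \<in> P" "w \<in> P" "x \<in> P" "z \<in> P" "(y, w) \<in> \<delta>" "(y, x) \<in> \<delta>" "(x, z) \<in> \<epsilon>" "(w, z) \<notin> \<delta>'"
          using no i'(2,3) by blast
        then show ?thesis unfolding i'(1)
          by (intro exI[of _ "\<lambda>n. if n = 0 then y else if n = 1 then w else if n = 2 then x else z"]) auto
      qed
    qed
    then obtain f :: "nat \<Rightarrow> 'i \<Rightarrow> 'a" where f: "\<forall>n. f n \<in> P" "\<forall>i\<in>Delta 1 \<times> Delta n. f \<in> ?X i" by (elim exE conjE)
    have f2: "(f 0, f 1) \<in> \<delta>" "(f 0, f 2) \<in> \<delta>" "(f 2, f 3) \<in> \<epsilon>" "(f 1, f 3) \<notin> \<delta>'" if "\<delta> \<in> Delta 1" "\<epsilon> \<in> Delta n" for \<delta> \<epsilon>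
      using bspec[OF f(2), of "(\<delta>, \<epsilon>)"] that by simp_all
    have "(f 0, f 1) \<in> Rn 1" using f(1) by (intro Delta_Rn) (simp_all only: f2(1)[OF _ Delta_UNIV])
    moreover have "(f 0, f 2) \<in> Rn 1" using f(1) by (intro Delta_Rn) (simp_all only: f2(2)[OF _ Delta_UNIV])
    moreover have "(f 2, f 3) \<in> Rn n" using f(1) by (intro Delta_Rn) (simp_all only: f2(3)[OF Delta_UNIV])
    ultimately have "(f 1, f 3) \<in> Rn (1 + 1 + n)" using Rn_trans Rn_sym by blast
    then show False using f2(4)[OF Delta_UNIV Delta_UNIV] \<delta>'(1) unfolding Delta_def by blast
  qed
  then obtain \<delta>1 \<epsilon> where \<delta>1: "\<delta>1 \<in> Delta 1" and \<epsilon>: "\<epsilon> \<in> Delta n" and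
    chain: "\<forall>y\<in>P. \<forall>w\<in>P. \<forall>x\<in>P. \<forall>z\<in>P. (y, w) \<in> \<delta>1 \<longrightarrow> (y, x) \<in> \<delta>1 \<longrightarrow> (x, z) \<in> \<epsilon> \<longrightarrow> (w, z) \<in> \<delta>'" by blast
  define \<delta> where "\<delta> = \<delta>1 \<inter> T1 \<times> T1"
  have "rdef B \<delta>"
    by (rule tdef_cong[of B "{f. (f 0, f 1) \<in> \<delta>1}"]) (use \<delta>1 in \<open>auto simp: Delta_def \<delta>_def\<close>)
  moreover have "Rn 1 \<subseteq> \<delta>"
  proof (rule subrelI)
    fix a b assume ab: "(a, b) \<in> Rn 1"
    then have "(a, b) \<in> \<delta>1" using \<delta>1 unfolding Delta_def by blast
    then show "(a, b) \<in> \<delta>" using Rn_P[OF ab] P_T1 unfolding \<delta>_def by simp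
  qed
  ultimately have \<delta>: "\<delta> \<in> ?\<Delta>" by (simp add: Delta_def \<delta>_def)
  define S0' where "S0' = S0 \<inter> \<delta> `` {d \<delta>}"
  define S1' where "S1' = S1 \<inter> - (\<delta>' `` {c})"
  show thesis
  proof (rule that)
    show "S0' \<subseteq> S0" "S1' \<subseteq> S1" by (auto simp: S0'_def S1'_def)
    show "fdef S0'" unfolding S0'_def
      by (rule fdef_Int[OF S(1)]) (use A[OF \<delta>] in \<open>auto simp: fdef_def\<close>)
    show "fdef S1'" unfolding S1'_def
      by (rule fdef_Int[OF S(3) fdef_Compl])
         (use udef_left[of \<delta>' c] \<delta>'(1) c(1) in \<open>auto simp: fdef_def Delta_def\<close>)
    have "(S0 \<inter> P) \<inter> (P \<inter> \<delta> `` {d \<delta>}) \<in> \<U>" by (rule UD(4)[OF U(3) d(2)[OF \<delta>]])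
    moreover have "(S0 \<inter> P) \<inter> (P \<inter> \<delta> `` {d \<delta>}) = S0' \<inter> P" unfolding S0'_def by blast
    ultimately show "P - S0' \<notin> \<F>" using pos by simp
    have "P - S1' = P - ((S1 \<inter> P) - \<delta>' `` {c})" unfolding S1'_def by blast
    then show "P - S1' \<notin> \<F>" using \<delta>'(2) by simp
    show "separated n S0' S1'"
      unfolding separated_def
    proof (intro bexI[OF _ \<epsilon>] ballI)
      fix x z assume xz: "x \<in> S0' \<inter> P" "z \<in> S1' \<inter> P"
      have 1: "(d \<delta>, x) \<in> \<delta>1" using xz(1) unfolding S0'_def \<delta>_def by blast
      have 2: "(d \<delta>, c) \<in> \<delta>1" using c(2)[OF \<delta>] unfolding \<delta>_def by blast
      have 3: "(c, z) \<notin> \<delta>'" using xz(2) unfolding S1'_def by blast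
      show "(x, z) \<notin> \<epsilon>"
        using chain[rule_format, of "d \<delta>" c x z] d(1)[OF \<delta>] c(1) xz 1 2 3 by blast
    qed
  qed
qed

text \<open>The pairs are treated one at a time; sets only shrink, so earlier separations
  survive.\<close>

lemma separate_family:
  assumes F: "inv_filter P H \<F>"
    and thin: "\<And>c n S. c \<in> P \<Longrightarrow> S \<subseteq> P \<Longrightarrow> P - S \<notin> \<F> \<Longrightarrow> \<exists>\<delta>\<in>Delta n. P - (S - \<delta> `` {c}) \<notin> \<F>"
    and "finite Q" "\<And>j. j \<in> J \<Longrightarrow> fdef (S j) \<and> P - S j \<notin> \<F>" "Q \<subseteq> J \<times> J"
  shows "\<exists>S'. (\<forall>j\<in>J. S' j \<subseteq> S j \<and> fdef (S' j) \<and> P - S' j \<notin> \<F>) \<and>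
    (\<forall>(i, j)\<in>Q. i \<noteq> j \<longrightarrow> separated n (S' i) (S' j))"
  using assms(3,5)
proof (induction Q rule: finite_induct)
  case empty
  then show ?case using assms(4) by (intro exI[of _ S]) auto
next
  case (insert q Q)
  obtain i j where q: "q = (i, j)" "i \<in> J" "j \<in> J" using insert.prems by auto
  obtain S' where S': "\<forall>j\<in>J. S' j \<subseteq> S j \<and> fdef (S' j) \<and> P - S' j \<notin> \<F>"
    "\<forall>(i, j)\<in>Q. i \<noteq> j \<longrightarrow> separated n (S' i) (S' j)" using insert by auto
  show ?case
  proof (cases "i = j")
    case True
    then show ?thesis using S' q by (intro exI[of _ S']) auto
  next
    case False
    have S'i: "fdef (S' i)" "P - S' i \<notin> \<F>" "fdef (S' j)" "P - S' j \<notin> \<F>" using S'(1) q by auto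
    obtain U U' where U: "U \<subseteq> S' i" "fdef U" "P - U \<notin> \<F>" "U' \<subseteq> S' j" "fdef U'" "P - U' \<notin> \<F>" "separated n U U'"
      by (rule separate_positive[OF F thin S'i])
    let ?S = "S'(i := U, j := U')"
    have sub: "?S k \<subseteq> S' k" for k using U by auto
    have "?S k \<subseteq> S k \<and> fdef (?S k) \<and> P - ?S k \<notin> \<F>" if "k \<in> J" for k
      using that S'(1) U sub[of k] by auto
    moreover have "separated n (?S k) (?S l)" if "(k, l) \<in> insert q Q" "k \<noteq> l" for k l
    proof (cases "(k, l) = q")
      case True
      then show ?thesis using q False U(7) by simp
    next
      case False
      then have "separated n (S' k) (S' l)" using that S'(2) by auto
      then show ?thesis by (rule separated_mono) (rule sub)+
    qed
    ultimately show ?thesis by (intro exI[of _ ?S]) blast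
  qed
qed

text \<open>The sets at level \<open>n + 1\<close> are pairwise separated for \<open>Rn n\<close>.
  Two branches stay on different nodes after they split, so no power relates their points.\<close>

lemma perfect_set_of_classes:
  assumes F: "inv_filter P H \<F>"
    and thin: "\<And>c n S. c \<in> P \<Longrightarrow> S \<subseteq> P \<Longrightarrow> P - S \<notin> \<F> \<Longrightarrow> \<exists>\<delta>\<in>Delta n. P - (S - \<delta> `` {c}) \<notin> \<F>"
  shows "\<exists>a :: (nat \<Rightarrow> bool) \<Rightarrow> 'i \<Rightarrow> 'a. (\<forall>\<eta>. a \<eta> \<in> P) \<and> (\<forall>\<eta> \<eta>'. \<eta> \<noteq> \<eta>' \<longrightarrow> (a \<eta>, a \<eta>') \<notin> E)"
proof -
  note FD = inv_filterD[OF F]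
  define ok where "ok = (\<lambda>S. fdef S \<and> P - S \<notin> \<F>)"
  have "\<exists>S. \<forall>n. (\<forall>\<tau> :: bool list. length \<tau> = n \<longrightarrow> ok (S n \<tau>)) \<and>
    ((\<forall>\<tau>. length \<tau> = Suc n \<longrightarrow> S (Suc n) \<tau> \<subseteq> S n (take n \<tau>)) \<and>
     (\<forall>\<tau> \<tau>'. length \<tau> = Suc n \<and> length \<tau>' = Suc n \<and> \<tau> \<noteq> \<tau>' \<longrightarrow> separated n (S (Suc n) \<tau>) (S (Suc n) \<tau>')))"
  proof (rule dependent_nat_choice)
    show "\<exists>S. \<forall>\<tau> :: bool list. length \<tau> = 0 \<longrightarrow> ok (S \<tau>)"
      using FD(2) fdef_UNIV by (intro exI[of _ "\<lambda>_. UNIV"]) (simp add: ok_def)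
    fix S :: "bool list \<Rightarrow> ('i \<Rightarrow> 'a) set" and n
    assume S: "\<forall>\<tau>. length \<tau> = n \<longrightarrow> ok (S \<tau>)"
    let ?J = "{\<tau> :: bool list. length \<tau> = Suc n}"
    have "finite ?J" using finite_lists_length_eq[of "UNIV :: bool set" "Suc n"] by simp
    then have fin: "finite (?J \<times> ?J)" by simp
    have "\<exists>S'. (\<forall>\<tau>\<in>?J. S' \<tau> \<subseteq> S (take n \<tau>) \<and> fdef (S' \<tau>) \<and> P - S' \<tau> \<notin> \<F>) \<and>
      (\<forall>(i, j)\<in>?J \<times> ?J. i \<noteq> j \<longrightarrow> separated n (S' i) (S' j))"
    proof (rule separate_family[where S = "\<lambda>\<tau>. S (take n \<tau>)" and J = ?J and Q = "?J \<times> ?J", OF F _ fin])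
      show "\<exists>\<delta>\<in>Delta n. P - (S - \<delta> `` {c}) \<notin> \<F>" if "c \<in> P" "S \<subseteq> P" "P - S \<notin> \<F>" for c n S
        by (rule thin[OF that])
      show "fdef (S (take n \<tau>)) \<and> P - S (take n \<tau>) \<notin> \<F>" if "\<tau> \<in> ?J" for \<tau>
        using S that unfolding ok_def by simp
    qed simp
    then obtain S' where S': "\<forall>\<tau>\<in>?J. S' \<tau> \<subseteq> S (take n \<tau>) \<and> fdef (S' \<tau>) \<and> P - S' \<tau> \<notin> \<F>"
      "\<forall>(i, j)\<in>?J \<times> ?J. i \<noteq> j \<longrightarrow> separated n (S' i) (S' j)" by (elim exE conjE)
    show "\<exists>S'. (\<forall>\<tau> :: bool list. length \<tau> = Suc n \<longrightarrow> ok (S' \<tau>)) \<and>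
      (\<forall>\<tau>. length \<tau> = Suc n \<longrightarrow> S' \<tau> \<subseteq> S (take n \<tau>)) \<and>
      (\<forall>\<tau> \<tau>'. length \<tau> = Suc n \<and> length \<tau>' = Suc n \<and> \<tau> \<noteq> \<tau>' \<longrightarrow> separated n (S' \<tau>) (S' \<tau>'))"
      using S' unfolding ok_def by (intro exI[of _ S']) auto
  qed
  then obtain S where S: "\<forall>n. (\<forall>\<tau> :: bool list. length \<tau> = n \<longrightarrow> ok (S n \<tau>)) \<and>
    ((\<forall>\<tau>. length \<tau> = Suc n \<longrightarrow> S (Suc n) \<tau> \<subseteq> S n (take n \<tau>)) \<and>
     (\<forall>\<tau> \<tau>'. length \<tau> = Suc n \<and> length \<tau>' = Suc n \<and> \<tau> \<noteq> \<tau>' \<longrightarrow> separated n (S (Suc n) \<tau>) (S (Suc n) \<tau>')))"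
    by (elim exE)
  have S1: "ok (S n \<tau>)" if "length \<tau> = n" for n and \<tau> :: "bool list" using S that by blast
  have S2: "S (Suc n) \<tau> \<subseteq> S n (take n \<tau>)" if "length \<tau> = Suc n" for n and \<tau> :: "bool list" using S that by blast
  have S3: "separated n (S (Suc n) \<tau>) (S (Suc n) \<tau>')" if "length \<tau> = Suc n" "length \<tau>' = Suc n" "\<tau> \<noteq> \<tau>'" for n and \<tau> \<tau>' :: "bool list"
    using S that by blast
  define br where "br = (\<lambda>\<eta> n. S n (map \<eta> [0..<n]))"
  have br: "br \<eta> n \<subseteq> br \<eta> m" if "m \<le> n" for \<eta> m n
    using that
  proof (induction n rule: dec_induct)
    case (step n)
    have "br \<eta> (Suc n) \<subseteq> br \<eta> n"
      using S2[of "map \<eta> [0..<Suc n]" n] by (simp add: br_def)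
    with step show ?case by blast
  qed blast
  have "\<exists>x\<in>P. \<forall>n\<in>UNIV. x \<in> br \<eta> n" for \<eta>
  proof -
    have okb: "ok (br \<eta> n)" for n unfolding br_def by (rule S1) simp
    then have "\<forall>n. \<exists>A. finite A \<and> udef A (br \<eta> n)" unfolding ok_def fdef_def by blast
    from choice[OF this] obtain A where A: "\<forall>n. finite (A n) \<and> udef (A n) (br \<eta> n)" by (elim exE)
    show ?thesis
    proof (rule P_compactness_one)
      show "small \<kappa> (\<Union>n. A n)"
        by (rule small_countable) (use A in \<open>auto intro: countable_finite\<close>)
      show "udef (\<Union>n. A n) (br \<eta> n)" for n
        by (rule tdef_mono[of "A n"]) (use A in auto)
      fix I0 :: "nat set" assume "finite I0"
      then obtain N where N: "\<forall>n\<in>I0. n \<le> N" using finite_nat_set_iff_bounded_le by blast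
      have "P - br \<eta> N \<notin> \<F>" using okb unfolding ok_def by blast
      then have "P - br \<eta> N \<noteq> P" using FD(1) by metis
      then obtain x where "x \<in> P" "x \<in> br \<eta> N" by blast
      then show "\<exists>x\<in>P. \<forall>n\<in>I0. x \<in> br \<eta> n" using br N by blast
    qed
  qed
  then have "\<forall>\<eta>. \<exists>x. x \<in> P \<and> (\<forall>n. x \<in> br \<eta> n)" by blast
  from choice[OF this] obtain a where a: "\<forall>\<eta>. a \<eta> \<in> P \<and> (\<forall>n. a \<eta> \<in> br \<eta> n)" by (elim exE)
  have "(a \<eta>, a \<eta>') \<notin> E" if ne: "\<eta> \<noteq> \<eta>'" for \<eta> \<eta>'
  proof
    assume "(a \<eta>, a \<eta>') \<in> E"
    then obtain m where m: "(a \<eta>, a \<eta>') \<in> Rn m" using E_iff by blast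
    obtain k where k: "\<eta> k \<noteq> \<eta>' k" using ne by blast
    \<comment> \<open>The level must exceed the branching point \<open>k\<close> and dominate the
      power \<open>m\<close>.\<close>
    define n where "n = max m k"
    have "map \<eta> [0..<Suc n] \<noteq> map \<eta>' [0..<Suc n]"
    proof
      assume "map \<eta> [0..<Suc n] = map \<eta>' [0..<Suc n]"
      then have "\<forall>x\<in>set [0..<Suc n]. \<eta> x = \<eta>' x" by (simp only: map_eq_conv)
      moreover have "k < Suc n" by (simp add: n_def)
      ultimately show False using k by (simp del: upt_Suc)
    qed
    then have "separated n (br \<eta> (Suc n)) (br \<eta>' (Suc n))" unfolding br_def by (intro S3) simp_all
    then obtain \<delta> where \<delta>: "\<delta> \<in> Delta n" "\<forall>x\<in>br \<eta> (Suc n) \<inter> P. \<forall>y\<in>br \<eta>' (Suc n) \<inter> P. (x, y) \<notin> \<delta>"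
      unfolding separated_def by blast
    then have "(a \<eta>, a \<eta>') \<notin> \<delta>" using a by blast
    moreover have "(a \<eta>, a \<eta>') \<in> \<delta>" using m Rn_mono[of m n] \<delta>(1) unfolding Delta_def n_def by auto
    ultimately show False by blast
  qed
  with a show ?thesis by (intro exI[of _ a]) blast
qed

text \<open>Commuting \<open>\<sigma>\<close> with \<open>k\<close> turns nearness of
  \<open>h \<circ> c\<close> and \<open>\<sigma> \<circ> (k \<circ> c)\<close> into equivalence of
  \<open>\<sigma> \<circ> c\<close> with the image of \<open>h \<circ> c\<close> under the inverse
  of \<open>k\<close>. There are finitely many such images.\<close>

lemma finitely_many_classes:
  assumes c: "c \<in> P" and \<Gamma>0: "\<Gamma>0 \<subseteq> G" "finite \<Gamma>0"
    and near: "\<And>\<sigma>. \<sigma> \<in> G \<Longrightarrow> \<exists>h\<in>\<Gamma>0. \<exists>k\<in>\<Gamma>0. (h \<circ> c, \<sigma> \<circ> (k \<circ> c)) \<in> Rn n"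
  shows "\<exists>C\<subseteq>P. finite C \<and> (\<forall>b\<in>P. \<exists>x\<in>C. (x, b) \<in> E)" "\<exists>N. E \<subseteq> Rn N"
proof -
  let ?C = "(\<lambda>(h, k). Hilbert_Choice.inv k \<circ> (h \<circ> c)) ` (\<Gamma>0 \<times> \<Gamma>0)"
  have "?C \<subseteq> P"
  proof
    fix x assume "x \<in> ?C"
    then obtain h k where hk: "h \<in> \<Gamma>0" "k \<in> \<Gamma>0" "x = Hilbert_Choice.inv k \<circ> (h \<circ> c)" by auto
    then have "h \<in> G" "k \<in> G" using \<Gamma>0(1) by auto
    from P_inv[OF P_Aut[OF c this(1)] this(2)] show "x \<in> P" unfolding hk(3) .
  qed
  moreover have "finite ?C" using \<Gamma>0(2) by simp
  moreover have "\<exists>x\<in>?C. (x, b) \<in> E" if b: "b \<in> P" for b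
  proof -
    obtain \<sigma> where \<sigma>: "\<sigma> \<in> G" "b = \<sigma> \<circ> c" using P_trans[OF c] b by blast
    obtain h k where hk: "h \<in> \<Gamma>0" "k \<in> \<Gamma>0" "(h \<circ> c, \<sigma> \<circ> (k \<circ> c)) \<in> Rn n" using near[OF \<sigma>(1)] by blast
    have kG: "k \<in> G" using hk(2) \<Gamma>0(1) by blast
    have 1: "(h \<circ> c, \<sigma> \<circ> (k \<circ> c)) \<in> E" using hk(3) unfolding E_iff by (rule exI)
    have 2: "(\<sigma> \<circ> (k \<circ> c), k \<circ> (\<sigma> \<circ> c)) \<in> E" using E_commute[OF c \<sigma>(1) kG] by (simp only: comp_assoc)
    have "(h \<circ> c, k \<circ> (\<sigma> \<circ> c)) \<in> E" by (rule E_trans[OF 1 2])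
    from E_Aut[OF this AutOver_inv[OF kG]] have "(Hilbert_Choice.inv k \<circ> (h \<circ> c), b) \<in> E"
      unfolding G_cancel(1)[OF kG] \<sigma>(2) .
    moreover have "Hilbert_Choice.inv k \<circ> (h \<circ> c) \<in> ?C" using hk(1,2) by (intro image_eqI[of _ _ "(h, k)"]) auto
    ultimately show ?thesis by (rule bexI)
  qed
  ultimately show "\<exists>C\<subseteq>P. finite C \<and> (\<forall>b\<in>P. \<exists>x\<in>C. (x, b) \<in> E)" by blast
next
  have "\<forall>q\<in>{q \<in> \<Gamma>0 \<times> \<Gamma>0. (fst q \<circ> c, snd q \<circ> c) \<in> E}. \<exists>m. (fst q \<circ> c, snd q \<circ> c) \<in> Rn m"
    using E_iff by blast
  from bchoice[OF this] obtain m where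
    m: "\<forall>q\<in>{q \<in> \<Gamma>0 \<times> \<Gamma>0. (fst q \<circ> c, snd q \<circ> c) \<in> E}. (fst q \<circ> c, snd q \<circ> c) \<in> Rn (m q)" by (elim exE)
  define m0 where "m0 = Max (m ` {q \<in> \<Gamma>0 \<times> \<Gamma>0. (fst q \<circ> c, snd q \<circ> c) \<in> E})"
  have m0: "(h \<circ> c, k \<circ> c) \<in> Rn m0" if "h \<in> \<Gamma>0" "k \<in> \<Gamma>0" "(h \<circ> c, k \<circ> c) \<in> E" for h k
  proof -
    have q: "(h, k) \<in> {q \<in> \<Gamma>0 \<times> \<Gamma>0. (fst q \<circ> c, snd q \<circ> c) \<in> E}" using that by simp
    have "m (h, k) \<le> m0" unfolding m0_def using q \<Gamma>0(2) by (intro Max_ge finite_imageI imageI) auto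
    then show ?thesis using bspec[OF m q] Rn_mono[of "m (h, k)" m0] by auto
  qed
  \<comment> \<open>The path from \<open>k \<circ> c\<close> to \<open>h \<circ> c\<close> costs
    \<open>m0\<close>, that to \<open>\<sigma> \<circ> (k \<circ> c)\<close> costs \<open>n\<close>,
    and exchanging \<open>\<sigma>\<close> and \<open>k\<close> costs one commutator. Then
    \<open>k\<close> is cancelled.\<close>
  have *: "(c, \<sigma> \<circ> c) \<in> Rn (m0 + n + 1)" if \<sigma>: "\<sigma> \<in> G" and E: "(c, \<sigma> \<circ> c) \<in> E" for \<sigma>
  proof -
    obtain h k where hk: "h \<in> \<Gamma>0" "k \<in> \<Gamma>0" "(h \<circ> c, \<sigma> \<circ> (k \<circ> c)) \<in> Rn n" using near[OF \<sigma>] by blast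
    have kG: "k \<in> G" using hk(2) \<Gamma>0(1) by blast
    have com: "(\<sigma> \<circ> (k \<circ> c), k \<circ> (\<sigma> \<circ> c)) \<in> Rn 1" using Rn_commute[OF c \<sigma> kG] by (simp only: comp_assoc)
    have "(k \<circ> c, k \<circ> (\<sigma> \<circ> c)) \<in> E" by (rule E_Aut[OF E kG])
    moreover have 1: "(h \<circ> c, k \<circ> (\<sigma> \<circ> c)) \<in> Rn (n + 1)" by (rule Rn_trans[OF hk(3) com])
    moreover from 1 have "(h \<circ> c, k \<circ> (\<sigma> \<circ> c)) \<in> E" unfolding E_iff by (rule exI)
    ultimately have "(k \<circ> c, h \<circ> c) \<in> E" using E_trans E_sym by blast
    then have "(k \<circ> c, h \<circ> c) \<in> Rn m0" by (rule m0[OF hk(2,1)])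
    from Rn_trans[OF this 1] have "(k \<circ> c, k \<circ> (\<sigma> \<circ> c)) \<in> Rn (m0 + n + 1)" by (simp only: add.assoc)
    then show ?thesis using Rn_Aut_iff[OF kG] by blast
  qed
  have "(a, b) \<in> Rn (m0 + n + 1)" if E: "(a, b) \<in> E" for a b
  proof -
    have ab: "a \<in> P" "b \<in> P" using E_P[OF E] by auto
    obtain h where h: "h \<in> G" "a = h \<circ> c" using P_trans[OF c] ab(1) by blast
    obtain g where g: "g \<in> G" "Hilbert_Choice.inv h \<circ> b = g \<circ> c" using P_trans[OF c] P_inv[OF ab(2) h(1)] by blast
    have "(c, g \<circ> c) \<in> E"
      using E_Aut[OF E AutOver_inv[OF h(1)]] unfolding h(2) G_cancel(1)[OF h(1)] g(2) .
    from Rn_Aut[OF *[OF g(1) this] h(1)] show ?thesis unfolding g(2)[symmetric] G_cancel(2)[OF h(1)] h(2)[symmetric] .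
  qed
  then show "\<exists>N. E \<subseteq> Rn N" by (intro exI[of _ "m0 + n + 1"] subrelI)
qed

theorem few_or_many_classes:
  "(\<exists>a :: (nat \<Rightarrow> bool) \<Rightarrow> 'i \<Rightarrow> 'a. (\<forall>\<eta>. a \<eta> \<in> P) \<and> (\<forall>\<eta> \<eta>'. \<eta> \<noteq> \<eta>' \<longrightarrow> (a \<eta>, a \<eta>') \<notin> E)) \<or>
   ((\<exists>C\<subseteq>P. finite C \<and> (\<forall>b\<in>P. \<exists>x\<in>C. (x, b) \<in> E)) \<and> (\<exists>N. E \<subseteq> Rn N))"
proof -
  have actP: "act \<sigma> ` P = P" if \<sigma>: "\<sigma> \<in> G" for \<sigma>
  proof
    show "act \<sigma> ` P \<subseteq> P" using P_Aut \<sigma> by blast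
    show "P \<subseteq> act \<sigma> ` P"
    proof
      fix x assume "x \<in> P"
      then have "Hilbert_Choice.inv \<sigma> \<circ> x \<in> P" by (rule P_inv[OF _ \<sigma>])
      moreover have "x = \<sigma> \<circ> (Hilbert_Choice.inv \<sigma> \<circ> x)" by (rule G_cancel(2)[OF \<sigma>, symmetric])
      ultimately show "x \<in> act \<sigma> ` P" by blast
    qed
  qed
  have "inv_filter P (act ` G) {P}"
    by (rule singleton_inv_filter) (use P_nonempty actP in auto)
  moreover have "id \<in> act ` G"
    by (rule image_eqI[of _ _ id]) (auto simp: fun_eq_iff)
  moreover have "g \<circ> h \<in> act ` G" if "g \<in> act ` G" "h \<in> act ` G" for g h
  proof -
    obtain \<sigma> \<tau> where "\<sigma> \<in> G" "\<tau> \<in> G" "g = act \<sigma>" "h = act \<tau>" using \<open>g \<in> act ` G\<close> \<open>h \<in> act ` G\<close> by blast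
    then show ?thesis using AutOver_comp by (intro image_eqI[of _ _ "\<sigma> \<circ> \<tau>"]) (auto simp: fun_eq_iff)
  qed
  moreover have "h ` P \<subseteq> P" if "h \<in> act ` G" for h using that actP by blast
  ultimately have "\<exists>\<F>. inv_filter P (act ` G) \<F> \<and> {P} \<subseteq> \<F> \<and>
    (\<forall>S\<subseteq>P. P - S \<in> \<F> \<or> (\<exists>F\<in>\<F>. \<exists>H0\<subseteq>act ` G. finite H0 \<and> F \<subseteq> (\<Union>h\<in>H0. h ` S)))"
    by (rule maximal_inv_filter)
  then obtain \<F> where F: "inv_filter P (act ` G) \<F>"
    and max: "\<forall>S\<subseteq>P. P - S \<in> \<F> \<or> (\<exists>F\<in>\<F>. \<exists>H0\<subseteq>act ` G. finite H0 \<and> F \<subseteq> (\<Union>h\<in>H0. h ` S))"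
    by (elim exE conjE)
  show ?thesis
  proof (cases "\<exists>c\<in>P. \<exists>n. \<exists>S\<subseteq>P. P - S \<notin> \<F> \<and> (\<forall>\<delta>\<in>Delta n. P - (S - \<delta> `` {c}) \<in> \<F>)")
    case True
    then obtain c n S where c: "c \<in> P" and S: "S \<subseteq> P" "P - S \<notin> \<F>" "\<And>\<delta>. \<delta> \<in> Delta n \<Longrightarrow> P - (S - \<delta> `` {c}) \<in> \<F>"
      by blast
    obtain \<Gamma>0 where \<Gamma>0: "\<Gamma>0 \<subseteq> G" "finite \<Gamma>0"
      "\<And>\<sigma>. \<sigma> \<in> G \<Longrightarrow> \<exists>h\<in>\<Gamma>0. \<exists>k\<in>\<Gamma>0. (h \<circ> c, \<sigma> \<circ> (k \<circ> c)) \<in> Rn (2 * n)"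
      using orbit_finite_distance[OF order_refl order_refl AutOver_comp P_Aut[rotated] F max c S] by blast
    show ?thesis using finitely_many_classes[OF c \<Gamma>0] by blast
  next
    case False
    then have "\<exists>\<delta>\<in>Delta n. P - (S - \<delta> `` {c}) \<notin> \<F>" if "c \<in> P" "S \<subseteq> P" "P - S \<notin> \<F>" for c n S
      using that by blast
    from perfect_set_of_classes[OF F this] show ?thesis by blast
  qed
qed

end

section \<open>Finitely many classes: elimination of imaginaries\<close>

lemma acl_if_dset:
  assumes "dset M s J A X" "J \<subseteq> {j}" "f \<in> tuples_of M s" "f \<in> X"
    and fin: "finite {y. srt M y = s j \<and> f(j := y) \<in> X}"
  shows "f j \<in> acl M A"
proof -
  obtain \<phi> e where e: "e ` (fv \<phi> - {(0, s j)}) \<subseteq> A \<union> f ` (J - {j})"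
    "\<And>x. holds M \<phi> (e((0, s j) := x)) \<longleftrightarrow> srt M x = s j \<and> f(j := x) \<in> X"
    using dset_one_var[OF assms(1,3), of j] by metis
  have 0: "f ` (J - {j}) = {}" using assms(2) by auto
  have "e ` (fv \<phi> - {(0, s j)}) \<subseteq> A" using e(1) by (simp only: 0 Un_empty_right)
  moreover have "holds M \<phi> (e((0, s j) := f j))" unfolding e(2) using assms(3,4) by (simp add: tuples_of_srt)
  moreover have "finite {y. holds M \<phi> (e((0, s j) := y))}" unfolding e(2) by (rule fin)
  ultimately show ?thesis unfolding acl_def by (intro CollectI exI[of _ \<phi>] exI[of _ "(0, s j)"] exI[of _ e] conjI)
qed

text \<open>Links functions on an index set with the lists of \<open>is_eq_closed\<close>. The tuple
  \<open>u\<close> fills the coordinates outside \<open>L\<close>, on which \<open>X\<close> does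
  not depend.\<close>

lemma definable_if_dset:
  assumes "dset M s J {} X" "distinct L" "J \<subseteq> set L" "u \<in> tuples_of M s"
  shows "definable M (map s L) {map f L | f. f \<in> tuples_of M s \<and> f \<in> X}"
proof -
  from assms(1) obtain \<phi> \<rho> where *: "wf_fm M \<phi>" "var_ok M s J {} \<rho> \<phi>"
    "\<And>f. f \<in> tuples_of M s \<Longrightarrow> f \<in> X \<longleftrightarrow> sat M \<phi> (case_sum f id \<circ> \<rho>)" unfolding dset_def by blast
  define idx where "idx = inv_into {..<length L} ((!) L)"
  have inj: "inj_on ((!) L) {..<length L}" using assms(2) by (simp add: inj_on_nth)
  have idx1: "idx (L ! k) = k" if "k < length L" for k
    unfolding idx_def by (rule inv_into_f_f[OF inj]) (use that in simp)
  have idx2: "idx j < length L" "L ! idx j = j" if "j \<in> set L" for j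
  proof -
    have "j \<in> (!) L ` {..<length L}" using that by (auto simp: in_set_conv_nth)
    from inv_into_into[OF this] f_inv_into_f[OF this] show "idx j < length L" "L ! idx j = j"
      by (auto simp: idx_def)
  qed
  have ok: "\<exists>j\<in>set L. \<rho> v = Inl j \<and> s j = snd v" if "v \<in> fv \<phi>" for v
    using *(2) that assms(3) unfolding var_ok_def by (cases "\<rho> v") force+
  define \<theta> where "\<theta> = (\<lambda>v. (idx (projl (\<rho> v)), snd v))"
  have "\<forall>v\<in>fv \<phi>. snd (\<theta> v) = snd v" by (simp add: \<theta>_def)
  from rename_fm[OF this, of M] obtain \<phi>' where \<phi>': "wf_fm M \<phi>' = wf_fm M \<phi>" "fv \<phi>' = \<theta> ` fv \<phi>"
    "\<And>e. sat M \<phi>' e = sat M \<phi> (e \<circ> \<theta>)" by blast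
  define vs where "vs = map (\<lambda>k. (k, s (L ! k))) [0..<length L]"
  have set_vs: "set vs = (\<lambda>k. (k, s (L ! k))) ` {..<length L}" by (auto simp: vs_def)
  have \<theta>: "\<theta> v = (idx j, s (L ! idx j))" if "v \<in> fv \<phi>" "\<rho> v = Inl j" for v j
    using ok[OF that(1)] that(2) idx2 by (auto simp: \<theta>_def)
  show ?thesis
    unfolding definable_def
  proof (intro exI[of _ \<phi>'] exI[of _ vs] conjI)
    show "wf_fm M \<phi>'" using *(1) \<phi>'(1) by simp
    show "distinct vs" by (auto simp: vs_def distinct_map intro!: inj_onI)
    show "map snd vs = map s L" unfolding vs_def by (auto intro!: nth_equalityI)
    show "fv \<phi>' \<subseteq> set vs"
    proof
      fix w assume "w \<in> fv \<phi>'"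
      then obtain v where v: "v \<in> fv \<phi>" "w = \<theta> v" unfolding \<phi>'(2) by blast
      then obtain j where "j \<in> set L" "\<rho> v = Inl j" using ok by blast
      then show "w \<in> set vs" using \<theta>[OF v(1)] v(2) idx2(1) unfolding set_vs by blast
    qed
    show "{map f L | f. f \<in> tuples_of M s \<and> f \<in> X} =
      {map e vs | e. (\<forall>v\<in>set vs. srt M (e v) = snd v) \<and> sat M \<phi>' e}"
    proof (intro equalityI subsetI)
      fix xs assume "xs \<in> {map f L | f. f \<in> tuples_of M s \<and> f \<in> X}"
      then obtain f where f: "f \<in> tuples_of M s" "f \<in> X" "xs = map f L" by blast
      let ?e = "\<lambda>v. f (L ! fst v)"
      have "sat M \<phi> (?e \<circ> \<theta>) = sat M \<phi> (case_sum f id \<circ> \<rho>)"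
        by (rule sat_cong) (use ok \<theta> idx2 in force)
      then have "sat M \<phi>' ?e" using *(3)[OF f(1)] f(2) \<phi>'(3) by blast
      moreover have "\<forall>v\<in>set vs. srt M (?e v) = snd v" using f(1) by (auto simp: set_vs tuples_of_srt)
      moreover have "xs = map ?e vs" unfolding f(3) vs_def by (auto intro!: nth_equalityI)
      ultimately show "xs \<in> {map e vs | e. (\<forall>v\<in>set vs. srt M (e v) = snd v) \<and> sat M \<phi>' e}"
        by (intro CollectI exI[of _ ?e]) blast
    next
      fix xs assume "xs \<in> {map e vs | e. (\<forall>v\<in>set vs. srt M (e v) = snd v) \<and> sat M \<phi>' e}"
      then obtain e where e: "\<forall>v\<in>set vs. srt M (e v) = snd v" "sat M \<phi>' e" "xs = map e vs" by blast
      define f where "f = (\<lambda>j. if j \<in> set L then e (idx j, s j) else u j)"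
      have "srt M (f j) = s j" for j
      proof (cases "j \<in> set L")
        case True
        then have "(idx j, s j) \<in> set vs" unfolding set_vs using idx2[OF True] by force
        then show ?thesis using e(1) True by (auto simp: f_def)
      qed (use assms(4) in \<open>simp add: f_def tuples_of_srt\<close>)
      then have f: "f \<in> tuples_of M s" by (simp add: tuples_of_def)
      have "sat M \<phi> (e \<circ> \<theta>) = sat M \<phi> (case_sum f id \<circ> \<rho>)"
        by (rule sat_cong) (use ok \<theta> idx2 in \<open>force simp: f_def\<close>)
      then have "f \<in> X" using *(3)[OF f] e(2) \<phi>'(3) by blast
      moreover have "xs = map f L" unfolding e(3) vs_def by (auto intro!: nth_equalityI simp: f_def idx1)
      ultimately show "xs \<in> {map f L | f. f \<in> tuples_of M s \<and> f \<in> X}" using f by blast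
    qed
  qed
qed

lemma dset_if_definable:
  fixes M :: "('s, 'f, 'r, 'a) fo_struct" and s :: "'j \<Rightarrow> 's"
  assumes "definable M (map s L) X" "distinct L"
  shows "dset M s (set L) {} {f. map f L \<in> X}"
proof -
  from assms(1) obtain \<phi> vs where *: "wf_fm M \<phi>" "distinct vs" "map snd vs = map s L" "fv \<phi> \<subseteq> set vs"
    "X = {map e vs | e. (\<forall>v\<in>set vs. srt M (e v) = snd v) \<and> sat M \<phi> e}" unfolding definable_def by (elim exE conjE)
  have len: "length vs = length L" using arg_cong[OF *(3), of length] by simp
  define \<rho> :: "'s var \<Rightarrow> 'j + 'a" where "\<rho> = (\<lambda>v. Inl (L ! inv_into {..<length vs} ((!) vs) v))"
  have inj: "inj_on ((!) vs) {..<length vs}" using *(2) by (simp add: inj_on_nth)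
  have \<rho>: "\<rho> (vs ! k) = Inl (L ! k)" if "k < length vs" for k
    unfolding \<rho>_def using inv_into_f_f[OF inj] that by simp
  have snd_vs: "snd (vs ! k) = s (L ! k)" if "k < length vs" for k
    using *(3) that len by (metis nth_map)
  have vsk: "\<exists>k<length vs. v = vs ! k" if "v \<in> set vs" for v using that by (auto simp: in_set_conv_nth)
  show ?thesis
  proof (rule dsetI[OF *(1), of _ _ _ \<rho>])
    show "var_ok M s (set L) {} \<rho> \<phi>"
      unfolding var_ok_def
    proof
      fix v assume "v \<in> fv \<phi>"
      then obtain k where "k < length vs" "v = vs ! k" using vsk *(4) by blast
      then show "case \<rho> v of Inl j \<Rightarrow> j \<in> set L \<and> s j = snd v | Inr a \<Rightarrow> a \<in> {} \<and> srt M a = snd v"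
        using \<rho> snd_vs len by simp
    qed
    fix f assume f: "f \<in> tuples_of M s"
    have map: "map (case_sum f id \<circ> \<rho>) vs = map f L"
      using \<rho> len by (auto intro!: nth_equalityI)
    show "f \<in> {f. map f L \<in> X} \<longleftrightarrow> sat M \<phi> (case_sum f id \<circ> \<rho>)"
    proof
      assume "f \<in> {f. map f L \<in> X}"
      then obtain e where e: "map f L = map e vs" "sat M \<phi> e" using *(5) by blast
      have "sat M \<phi> (case_sum f id \<circ> \<rho>) = sat M \<phi> e"
      proof (rule sat_cong)
        fix v assume "v \<in> fv \<phi>"
        then have "v \<in> set vs" using *(4) by blast
        then show "(case_sum f id \<circ> \<rho>) v = e v"
          using trans[OF map e(1)] by (simp only: map_eq_conv)
      qed
      then show "sat M \<phi> (case_sum f id \<circ> \<rho>)" using e(2) by simp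
    next
      assume sat: "sat M \<phi> (case_sum f id \<circ> \<rho>)"
      have "srt M ((case_sum f id \<circ> \<rho>) v) = snd v" if v: "v \<in> set vs" for v
      proof -
        obtain k where "k < length vs" "v = vs ! k" using vsk[OF v] by blast
        then show ?thesis using \<rho> snd_vs f by (simp add: tuples_of_srt)
      qed
      then have "map (case_sum f id \<circ> \<rho>) vs \<in> X"
        unfolding *(5) using sat by (intro CollectI exI[of _ "case_sum f id \<circ> \<rho>"]) blast
      then show "f \<in> {f. map f L \<in> X}" unfolding map by blast
    qed
  qed
qed

lemma definable_Aut:
  assumes "definable M ss X" "wf_struct M" "\<sigma> \<in> Aut M" "xs \<in> X"
  shows "map \<sigma> xs \<in> X"
proof -
  from assms(1) obtain \<phi> vs where *: "wf_fm M \<phi>" "fv \<phi> \<subseteq> set vs"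
    "X = {map e vs | e. (\<forall>v\<in>set vs. srt M (e v) = snd v) \<and> sat M \<phi> e}" unfolding definable_def by (elim exE conjE)
  then obtain e where e: "xs = map e vs" "\<forall>v\<in>set vs. srt M (e v) = snd v" "sat M \<phi> e" using assms(4) by blast
  have "sat M \<phi> (\<sigma> \<circ> e)" using sat_Aut[OF assms(2,3) *(1), of e] e(2,3) *(2) by blast
  moreover have "\<forall>v\<in>set vs. srt M ((\<sigma> \<circ> e) v) = snd v" using e(2) Aut_srt[OF assms(3)] by simp
  moreover have "map \<sigma> xs = map (\<sigma> \<circ> e) vs" by (simp add: e(1))
  ultimately show ?thesis unfolding *(3) by (intro CollectI exI[of _ "\<sigma> \<circ> e"]) blast
qed

context monster_type
begin

text \<open>The complement of \<open>E\<close> is a finite union of products of classes. Every class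
  is closed, so \<open>E\<close> is clopen in \<open>P \<times> P\<close>.\<close>

lemma definable_on_P_if_finite:
  assumes C: "C \<subseteq> P" "finite C" "\<And>b. b \<in> P \<Longrightarrow> \<exists>x\<in>C. (x, b) \<in> E" and N: "E \<subseteq> Rn N"
  obtains \<delta> where "\<delta> \<in> Delta N" "\<And>x y. x \<in> P \<Longrightarrow> y \<in> P \<Longrightarrow> (x, y) \<in> \<delta> \<longleftrightarrow> (x, y) \<in> E"
proof -
  have E: "E = Rn N" using N E_iff by auto
  have "\<exists>\<delta>\<in>Delta N. \<forall>x\<in>P. \<forall>y\<in>P. (x, y) \<in> \<delta> \<longrightarrow> (x, y) \<in> E"
  proof (rule ccontr)
    assume no: "\<not> ?thesis"
    let ?Q = "{q \<in> C \<times> C. q \<notin> E}"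
    \<comment> \<open>Neighbourhoods are closed under finite intersections, so among the finitely
      many pairs of inequivalent representatives one fails for all neighbourhoods.\<close>
    have "\<exists>q\<in>?Q. \<forall>\<delta>\<in>Delta N. \<exists>x\<in>P. \<exists>y\<in>P. (x, y) \<in> \<delta> \<and> (fst q, x) \<in> E \<and> (snd q, y) \<in> E"
    proof (rule ccontr)
      assume "\<not> ?thesis"
      then have "\<forall>q\<in>?Q. \<exists>\<delta>. \<delta> \<in> Delta N \<and> (\<forall>x\<in>P. \<forall>y\<in>P. (x, y) \<in> \<delta> \<longrightarrow> (fst q, x) \<in> E \<longrightarrow> (snd q, y) \<notin> E)"
        by blast
      from bchoice[OF this] obtain D where D: "\<forall>q\<in>?Q. D q \<in> Delta N \<and>
        (\<forall>x\<in>P. \<forall>y\<in>P. (x, y) \<in> D q \<longrightarrow> (fst q, x) \<in> E \<longrightarrow> (snd q, y) \<notin> E)" by (elim exE)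
      have "(\<Inter>q\<in>?Q. D q) \<in> Delta N" by (rule Delta_INT) (use C(2) D in auto)
      then obtain x y where xy: "x \<in> P" "y \<in> P" "(x, y) \<in> (\<Inter>q\<in>?Q. D q)" "(x, y) \<notin> E" using no by blast
      obtain c d where cd: "c \<in> C" "d \<in> C" "(c, x) \<in> E" "(d, y) \<in> E" using C(3) xy(1,2) by blast
      have "(c, d) \<notin> E" using cd(3,4) xy(4) E_trans E_sym by blast
      then have q: "(c, d) \<in> ?Q" using cd by blast
      then have "(x, y) \<in> D (c, d)" using xy(3) by blast
      then show False using bspec[OF D q] xy(1,2) cd(3,4) by auto
    qed
    then obtain c d where cd: "c \<in> C" "d \<in> C" "(c, d) \<notin> E" and
      sat: "\<And>\<delta>. \<delta> \<in> Delta N \<Longrightarrow> \<exists>x\<in>P. \<exists>y\<in>P. (x, y) \<in> \<delta> \<and> (c, x) \<in> E \<and> (d, y) \<in> E" by auto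
    have cP: "c \<in> P" "d \<in> P" using cd C(1) by auto
    let ?X = "\<lambda>\<delta>. {f :: nat \<Rightarrow> 'i \<Rightarrow> 'a. (f 0, f 1) \<in> \<delta> \<and> (c, f 0) \<in> \<delta> \<and> (d, f 1) \<in> \<delta>}"
    have "\<exists>f :: nat \<Rightarrow> 'i \<Rightarrow> 'a. (\<forall>n. f n \<in> P) \<and> (\<forall>\<delta>\<in>Delta N. f \<in> ?X \<delta>)"
    proof (rule P_compactness_directed[where A = "B \<union> range c \<union> range d" and X = ?X])
      show "small \<kappa> (B \<union> range c \<union> range d)" by (intro small_Un small_B small_image small_I)
      show "tdef (B \<union> range c \<union> range d) (?X \<delta>)" if \<delta>: "\<delta> \<in> Delta N" for \<delta>
      proof -
        have r: "rdef B \<delta>" using \<delta> unfolding Delta_def by blast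
        have "tdef (B \<union> range c \<union> range d) {f. (f 0, f 1) \<in> \<delta>}" by (rule tdef_mono[OF r]) blast
        moreover have "tdef (B \<union> range c \<union> range d) {f. (c, f 0) \<in> \<delta>}"
          by (rule tdef_mono[OF rdef_left[OF r P_T1[OF cP(1)]]]) blast
        moreover have "tdef (B \<union> range c \<union> range d) {f. (d, f 1) \<in> \<delta>}"
          by (rule tdef_mono[OF rdef_left[OF r P_T1[OF cP(2)]]]) blast
        ultimately show ?thesis by (intro tdef_conj)
      qed
      show "Delta N \<noteq> {}" using Delta_UNIV by blast
      show "\<exists>k\<in>Delta N. ?X k \<subseteq> ?X i \<inter> ?X j" if "i \<in> Delta N" "j \<in> Delta N" for i j
        using Delta_Int[OF that] by (intro bexI[of _ "i \<inter> j"]) auto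
      show "\<exists>f :: nat \<Rightarrow> 'i \<Rightarrow> 'a. (\<forall>n. f n \<in> P) \<and> f \<in> ?X \<delta>" if \<delta>: "\<delta> \<in> Delta N" for \<delta>
      proof -
        obtain x y where xy: "x \<in> P" "y \<in> P" "(x, y) \<in> \<delta>" "(c, x) \<in> E" "(d, y) \<in> E" using sat[OF \<delta>] by blast
        moreover have "E \<subseteq> \<delta>" using \<delta> unfolding E Delta_def by blast
        ultimately show ?thesis by (intro exI[of _ "\<lambda>n. if n = 0 then x else y"]) auto
      qed
    qed
    then obtain f :: "nat \<Rightarrow> 'i \<Rightarrow> 'a" where f: "\<forall>n. f n \<in> P" "\<forall>\<delta>\<in>Delta N. f \<in> ?X \<delta>" by (elim exE conjE)
    have f2: "(f 0, f 1) \<in> \<delta>" "(c, f 0) \<in> \<delta>" "(d, f 1) \<in> \<delta>" if "\<delta> \<in> Delta N" for \<delta>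
      using bspec[OF f(2) that] by simp_all
    have "(f 0, f 1) \<in> E" unfolding E by (rule Delta_Rn) (use f(1) f2(1) in auto)
    moreover have "(c, f 0) \<in> E" unfolding E by (rule Delta_Rn) (use f(1) cP f2(2) in auto)
    moreover have "(d, f 1) \<in> E" unfolding E by (rule Delta_Rn) (use f(1) cP f2(3) in auto)
    ultimately show False using cd(3) E_trans E_sym by blast
  qed
  then obtain \<delta> where \<delta>: "\<delta> \<in> Delta N" "\<forall>x\<in>P. \<forall>y\<in>P. (x, y) \<in> \<delta> \<longrightarrow> (x, y) \<in> E" by blast
  have "E \<subseteq> \<delta>" using \<delta>(1) unfolding E Delta_def by blast
  then show thesis using that[OF \<delta>(1)] \<delta>(2) by blast
qed

text \<open>\<open>P\<close> need not be definable, but the equivalence relation to be coded must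
  be. So the fact that each point has the same \<open>\<delta>\<close>-trace as some representative
  is spread by compactness to a \<open>B\<close>-definable set around \<open>P\<close>.\<close>

lemma finitely_many_fibres:
  assumes C: "C \<subseteq> P" "finite C" "\<And>b. b \<in> P \<Longrightarrow> \<exists>x\<in>C. (x, b) \<in> E"
    and \<delta>: "rdef B \<delta>" "\<And>x y. x \<in> P \<Longrightarrow> y \<in> P \<Longrightarrow> (x, y) \<in> \<delta> \<longleftrightarrow> (x, y) \<in> E"
  obtains S where "udef B S" "P \<subseteq> S"
    "\<And>x. x \<in> T1 \<Longrightarrow> x \<in> S \<Longrightarrow> \<exists>c\<in>C. \<forall>z\<in>T1. z \<in> S \<longrightarrow> (x, z) \<in> \<delta> \<longleftrightarrow> (c, z) \<in> \<delta>"
proof -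
  obtain cs where cs: "set cs = C" using finite_list[OF C(2)] by blast
  let ?m = "length cs"
  let ?\<P> = "{{f :: nat \<Rightarrow> 'i \<Rightarrow> 'a. f n \<in> S} | n S. udef B S \<and> P \<subseteq> S}"
  \<comment> \<open>Position 0 holds the point, position \<open>k + 1\<close> a witness that its
    trace differs from that of the \<open>k\<close>-th representative.\<close>
  let ?D = "\<lambda>k. {f :: nat \<Rightarrow> 'i \<Rightarrow> 'a. \<not> ((f 0, f (Suc k)) \<in> \<delta> \<longleftrightarrow> (cs ! k, f (Suc k)) \<in> \<delta>)}"
  have csP: "cs ! k \<in> P" if "k < ?m" for k using that cs C(1) by (metis nth_mem subsetD)
  have "\<exists>\<X>0. finite \<X>0 \<and> \<X>0 \<subseteq> ?\<P> \<union> ?D ` {..<?m} \<and> \<not> (\<exists>f. (\<forall>n. f n \<in> T1) \<and> (\<forall>X\<in>\<X>0. f \<in> X))"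
  proof (rule ccontr)
    assume no: "\<not> ?thesis"
    let ?A = "B \<union> \<Union> (range ` C)"
    have "\<exists>f. (\<forall>n. f n \<in> T1) \<and> (\<forall>X\<in>?\<P> \<union> ?D ` {..<?m}. f \<in> X)"
    proof (rule tuple_compactness)
      have "small \<kappa> (\<Union> (range ` C'))" if "finite C'" for C' :: "('i \<Rightarrow> 'a) set"
        using that by (induction C' rule: finite_induct) (auto intro: small_finite small_Un small_image small_I)
      then show "small \<kappa> ?A" by (intro small_Un small_B) (use C(2) in blast)
      show "tdef ?A X" if X: "X \<in> ?\<P> \<union> ?D ` {..<?m}" for X
        using X
      proof
        assume "X \<in> ?\<P>"
        then obtain n S where "udef B S" "X = {f. f n \<in> S}" by blast
        then show ?thesis using tdef_mono[OF udef_at, of B S] by auto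
      next
        assume "X \<in> ?D ` {..<?m}"
        then obtain k where k: "k < ?m" "X = ?D k" by blast
        have "range (cs ! k) \<subseteq> ?A" using nth_mem[OF k(1)] cs by blast
        then have "tdef ?A {f. (cs ! k, f (Suc k)) \<in> \<delta>}"
          by (intro tdef_mono[OF rdef_left[OF \<delta>(1) P_T1[OF csP[OF k(1)]]]]) blast
        moreover have "tdef ?A {f. (f 0, f (Suc k)) \<in> \<delta>}" by (rule tdef_mono[OF rdef_at[OF \<delta>(1)]]) blast
        ultimately show ?thesis unfolding k(2) by (intro tdef_not tdef_iff)
      qed
      show "\<exists>f. (\<forall>n. f n \<in> T1) \<and> (\<forall>X\<in>\<X>0. f \<in> X)" if "finite \<X>0" "\<X>0 \<subseteq> ?\<P> \<union> ?D ` {..<?m}" for \<X>0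
        using no that by blast
    qed
    then obtain f where f: "\<forall>n. f n \<in> T1" "\<forall>X\<in>?\<P> \<union> ?D ` {..<?m}. f \<in> X" by (elim exE conjE)
    have P: "f n \<in> P" for n
    proof (rule P_closed)
      show "f n \<in> T1" using f(1) by blast
      fix S assume "udef B S" "P \<subseteq> S"
      then have "{f. f n \<in> S} \<in> ?\<P>" by blast
      then have "f \<in> {f. f n \<in> S}" using f(2) by blast
      then show "f n \<in> S" by simp
    qed
    obtain c where c: "c \<in> C" "(c, f 0) \<in> E" using C(3)[OF P] by blast
    then obtain k where k: "k < ?m" "cs ! k = c" using cs by (metis in_set_conv_nth)
    have "f \<in> ?D k" using bspec[OF f(2), of "?D k"] k(1) by blast
    moreover have "(f 0, f (Suc k)) \<in> E \<longleftrightarrow> (c, f (Suc k)) \<in> E" using c(2) E_trans E_sym by blast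
    ultimately show False using \<delta>(2) P csP[OF k(1)] k(2) by simp
  qed
  then obtain \<X>0 where X0: "finite \<X>0" "\<X>0 \<subseteq> ?\<P> \<union> ?D ` {..<?m}" "\<not> (\<exists>f. (\<forall>n. f n \<in> T1) \<and> (\<forall>X\<in>\<X>0. f \<in> X))"
    by (elim exE conjE)
  have "\<forall>X\<in>\<X>0 \<inter> ?\<P>. \<exists>S. udef B S \<and> P \<subseteq> S \<and> (\<exists>n. X = {f. f n \<in> S})" by blast
  from bchoice[OF this] obtain S where S: "\<forall>X\<in>\<X>0 \<inter> ?\<P>. udef B (S X) \<and> P \<subseteq> S X \<and> (\<exists>n. X = {f. f n \<in> S X})"
    by (elim exE)
  let ?S = "\<Inter>X\<in>\<X>0 \<inter> ?\<P>. S X"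
  have fin: "finite (\<X>0 \<inter> ?\<P>)" using X0(1) by blast
  show thesis
  proof (rule that[of ?S])
    have "tdef B {f. \<forall>X\<in>\<X>0 \<inter> ?\<P>. f 0 \<in> S X}"
      by (rule tdef_ball_finite[OF fin]) (use S in blast)
    then show "udef B ?S" by (rule tdef_cong) blast
    show "P \<subseteq> ?S" using S by blast
    fix x assume x: "x \<in> T1" "x \<in> ?S"
    show "\<exists>c\<in>C. \<forall>z\<in>T1. z \<in> ?S \<longrightarrow> (x, z) \<in> \<delta> \<longleftrightarrow> (c, z) \<in> \<delta>"
    proof (rule ccontr)
      assume no: "\<not> ?thesis"
      have "\<exists>z. z \<in> T1 \<and> z \<in> ?S \<and> \<not> ((x, z) \<in> \<delta> \<longleftrightarrow> (cs ! k, z) \<in> \<delta>)" if "k < ?m" for k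
        using no nth_mem[OF that] cs by blast
      then have "\<forall>k\<in>{..<?m}. \<exists>z. z \<in> T1 \<and> z \<in> ?S \<and> \<not> ((x, z) \<in> \<delta> \<longleftrightarrow> (cs ! k, z) \<in> \<delta>)" by blast
      from bchoice[OF this] obtain z where
        z: "\<forall>k\<in>{..<?m}. z k \<in> T1 \<and> z k \<in> ?S \<and> \<not> ((x, z k) \<in> \<delta> \<longleftrightarrow> (cs ! k, z k) \<in> \<delta>)" by (elim exE)
      define f where "f = (\<lambda>n. case n of 0 \<Rightarrow> x | Suc k \<Rightarrow> if k < ?m then z k else x)"
      have fS: "f n \<in> T1" "f n \<in> ?S" for n
        using x z by (auto simp: f_def split: nat.split)
      have "f \<in> X" if X: "X \<in> \<X>0" for X
      proof (cases "X \<in> ?\<P>")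
        case True
        then have X': "X \<in> \<X>0 \<inter> ?\<P>" using X by blast
        then obtain n where n: "X = {f. f n \<in> S X}" using S by blast
        have "f n \<in> S X" using fS(2)[of n] X' by blast
        then have "f \<in> {f. f n \<in> S X}" by blast
        then show ?thesis unfolding n[symmetric] .
      next
        case False
        then obtain k where k: "k < ?m" "X = ?D k" using X X0(2) by blast
        then show ?thesis using z by (simp add: f_def)
      qed
      then show False using X0(3) fS(1) by blast
    qed
  qed
qed

text \<open>The equivalence relation \<open>x \<sim> y\<close> given by \<open>\<forall>z\<in>S. (x, z) \<in> \<delta> \<longleftrightarrow> (y, z) \<in> \<delta>\<close> has finitely many classes
  on \<open>S\<close>. Its parameters \<open>A \<subseteq> B\<close> are turned into further coordinates \<open>Inr a\<close>, so that its classes get codes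
  in the structure; the code of a realization is algebraic over \<open>B\<close>, hence in \<open>B\<close>, hence fixed by
  automorphisms.\<close>

theorem one_class_if_finite:
  assumes C: "C \<subseteq> P" "finite C" "\<And>b. b \<in> P \<Longrightarrow> \<exists>x\<in>C. (x, b) \<in> E" and N: "E \<subseteq> Rn N"
    and ab: "a \<in> P" "b \<in> P"
  shows "(a, b) \<in> E"
proof -
  obtain \<delta> where \<delta>: "\<delta> \<in> Delta N" "\<And>x y. x \<in> P \<Longrightarrow> y \<in> P \<Longrightarrow> (x, y) \<in> \<delta> \<longleftrightarrow> (x, y) \<in> E"
    using definable_on_P_if_finite[OF C N] by metis
  have r: "rdef B \<delta>" using \<delta>(1) unfolding Delta_def by blast
  obtain S where S: "udef B S" "P \<subseteq> S"
    "\<And>x. x \<in> T1 \<Longrightarrow> x \<in> S \<Longrightarrow> \<exists>c\<in>C. \<forall>z\<in>T1. z \<in> S \<longrightarrow> (x, z) \<in> \<delta> \<longleftrightarrow> (c, z) \<in> \<delta>"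
    using finitely_many_fibres[OF C r \<delta>(2)] by metis
  let ?s2 = "\<lambda>(n :: nat, i). sorts i"
  obtain J1 A1 where 1: "finite J1" "finite A1" "A1 \<subseteq> B"
    "dset M ?s2 J1 A1 {g. curry g \<in> {f. (f 0, f 1) \<in> \<delta>}}"
    using r unfolding tdef_def by (rule dset_finite)
  obtain J2 A2 where 2: "finite J2" "finite A2" "A2 \<subseteq> B"
    "dset M ?s2 J2 A2 {g. curry g \<in> {f. f 0 \<in> S}}"
    using S(1) unfolding tdef_def by (rule dset_finite)
  \<comment> \<open>Only finitely many coordinates and parameters matter, so finite lists of sorts
    suffice for the code.\<close>
  define A where "A = A1 \<union> A2"
  define J where "J = J1 \<union> J2"
  define I where "I = snd ` J"
  have A: "finite A" "A \<subseteq> B" using 1 2 by (auto simp: A_def)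
  have I: "finite I" using 1 2 by (simp add: I_def J_def)
  have J: "snd j \<in> I" if "j \<in> J" for j using that by (simp add: I_def)
  have dD: "dset M ?s2 J A {g. curry g \<in> {f. (f 0, f 1) \<in> \<delta>}}"
    by (rule dset_mono[OF 1(4)]) (auto simp: J_def A_def)
  have dS: "dset M ?s2 J A {g. curry g \<in> {f. f 0 \<in> S}}"
    by (rule dset_mono[OF 2(4)]) (auto simp: J_def A_def)
  let ?s2' = "case_sum ?s2 (srt M)"
  from dset_generalize[OF dD] obtain YD where YD: "dset M ?s2' (Inl ` J \<union> Inr ` A) {} YD"
    "\<forall>g\<in>tuples_of M ?s2. case_sum g id \<in> YD \<longleftrightarrow> g \<in> {g. curry g \<in> {f. (f 0, f 1) \<in> \<delta>}}"
    by (elim exE conjE)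
  from dset_generalize[OF dS] obtain YS where YS: "dset M ?s2' (Inl ` J \<union> Inr ` A) {} YS"
    "\<forall>g\<in>tuples_of M ?s2. case_sum g id \<in> YS \<longleftrightarrow> g \<in> {g. curry g \<in> {f. f 0 \<in> S}}"
    by (elim exE conjE)
  \<comment> \<open>\<open>V\<close> and \<open>W\<close> are \<open>\<delta>\<close> and
    \<open>S\<close> with the parameters made variable; \<open>\<beta> = id\<close> restores the
    original ones.\<close>
  define V where "V = (\<lambda>(x :: 'i \<Rightarrow> 'a) z \<beta>. case_sum (\<lambda>(n :: nat, i). if n = 0 then x i else z i) \<beta> \<in> YD)"
  define W where "W = (\<lambda>(z :: 'i \<Rightarrow> 'a) \<beta>. case_sum (\<lambda>(n :: nat, i). z i) \<beta> \<in> YS)"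
  have V_id: "V x z id \<longleftrightarrow> (x, z) \<in> \<delta>" if "x \<in> T1" "z \<in> T1" for x z
  proof -
    let ?g = "\<lambda>(n :: nat, i). if n = 0 then x i else z i"
    have "?g \<in> tuples_of M ?s2" using that by (auto simp: tuples_of_def)
    moreover have "curry ?g 0 = x" "curry ?g 1 = z" by auto
    ultimately show ?thesis unfolding V_def using bspec[OF YD(2), of ?g] by simp
  qed
  have W_id: "W z id \<longleftrightarrow> z \<in> S" if "z \<in> T1" for z
  proof -
    let ?g = "\<lambda>(n :: nat, i). z i"
    have "?g \<in> tuples_of M ?s2" using that by (auto simp: tuples_of_def)
    moreover have "curry ?g 0 = z" by auto
    ultimately show ?thesis unfolding W_def using bspec[OF YS(2), of ?g] by simp
  qed
  let ?T\<beta> = "tuples_of M (srt M)"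
  have V_cong: "V x z \<beta> \<longleftrightarrow> V x z \<beta>'" if "x \<in> T1" "z \<in> T1" "\<beta> \<in> ?T\<beta>" "\<beta>' \<in> ?T\<beta>" "\<forall>a\<in>A. \<beta> a = \<beta>' a" for x z \<beta> \<beta>'
    unfolding V_def by (rule dset_support[OF YD(1)]) (use that in \<open>auto simp: tuples_of_def split: sum.splits\<close>)
  have W_cong: "W z \<beta> \<longleftrightarrow> W z \<beta>'" if "z \<in> T1" "\<beta> \<in> ?T\<beta>" "\<beta>' \<in> ?T\<beta>" "\<forall>a\<in>A. \<beta> a = \<beta>' a" for z \<beta> \<beta>'
    unfolding W_def by (rule dset_support[OF YS(1)]) (use that in \<open>auto simp: tuples_of_def split: sum.splits\<close>)
  let ?s4 = "case_sum sorts (srt M)"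
  let ?T4 = "tuples_of M ?s4"
  have T4: "u \<circ> Inl \<in> T1" "u \<circ> Inr \<in> ?T\<beta>" if "u \<in> ?T4" for u
    using that by (auto simp: tuples_of_def)
  have T4': "case_sum x id \<in> ?T4" if "x \<in> T1" for x
    using that by (auto simp: tuples_of_def split: sum.splits)
  \<comment> \<open>For other values of the parameters \<open>V\<close> and \<open>W\<close> may
    behave arbitrarily. Comparing traces at equal parameters is an equivalence relation all the
    same, as \<open>is_eq_closed\<close> demands.\<close>
  define rel where "rel = (\<lambda>u w. (\<forall>a\<in>A. u (Inr a) = w (Inr a)) \<and>
    (\<forall>z\<in>T1. W z (u \<circ> Inr) \<longrightarrow> V (u \<circ> Inl) z (u \<circ> Inr) \<longleftrightarrow> V (w \<circ> Inl) z (u \<circ> Inr)))"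
  have rel_refl: "rel u u" for u by (simp add: rel_def)
  have rel_VW: "(\<forall>z\<in>T1. W z (w \<circ> Inr) \<longrightarrow> V (u \<circ> Inl) z (w \<circ> Inr) \<longleftrightarrow> V (w \<circ> Inl) z (w \<circ> Inr))"
    if "rel u w" "u \<in> ?T4" "w \<in> ?T4" for u w
  proof
    fix z assume z: "z \<in> T1"
    have eq: "\<forall>a\<in>A. (w \<circ> Inr) a = (u \<circ> Inr) a" using that(1) by (simp add: rel_def)
    show "W z (w \<circ> Inr) \<longrightarrow> V (u \<circ> Inl) z (w \<circ> Inr) \<longleftrightarrow> V (w \<circ> Inl) z (w \<circ> Inr)"
      unfolding W_cong[OF z T4(2)[OF that(3)] T4(2)[OF that(2)] eq]
        V_cong[OF T4(1)[OF that(2)] z T4(2)[OF that(3)] T4(2)[OF that(2)] eq]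
        V_cong[OF T4(1)[OF that(3)] z T4(2)[OF that(3)] T4(2)[OF that(2)] eq]
      using that(1) z unfolding rel_def by blast
  qed
  have rel_sym: "rel w u" if "rel u w" "u \<in> ?T4" "w \<in> ?T4" for u w
    using rel_VW[OF that] that(1) unfolding rel_def by metis
  have rel_trans: "rel u w" if uv: "rel u v" "rel v w" "u \<in> ?T4" "v \<in> ?T4" "w \<in> ?T4" for u v w
    unfolding rel_def
  proof (intro conjI ballI impI)
    show "u (Inr a) = w (Inr a)" if "a \<in> A" for a using uv(1,2) that unfolding rel_def by simp
    fix z assume z: "z \<in> T1" "W z (u \<circ> Inr)"
    have eq: "\<forall>a\<in>A. (u \<circ> Inr) a = (v \<circ> Inr) a" using uv(1) by (simp add: rel_def)
    have "W z (v \<circ> Inr)" using z W_cong[OF z(1) T4(2)[OF uv(3)] T4(2)[OF uv(4)] eq] by blast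
    then have "V (v \<circ> Inl) z (v \<circ> Inr) \<longleftrightarrow> V (w \<circ> Inl) z (v \<circ> Inr)" using uv(2) z(1) unfolding rel_def by blast
    then have "V (v \<circ> Inl) z (u \<circ> Inr) \<longleftrightarrow> V (w \<circ> Inl) z (u \<circ> Inr)"
      unfolding V_cong[OF T4(1)[OF uv(4)] z(1) T4(2)[OF uv(3)] T4(2)[OF uv(4)] eq]
        V_cong[OF T4(1)[OF uv(5)] z(1) T4(2)[OF uv(3)] T4(2)[OF uv(4)] eq] .
    moreover have "V (u \<circ> Inl) z (u \<circ> Inr) \<longleftrightarrow> V (v \<circ> Inl) z (u \<circ> Inr)" using uv(1) z unfolding rel_def by blast
    ultimately show "V (u \<circ> Inl) z (u \<circ> Inr) \<longleftrightarrow> V (w \<circ> Inl) z (u \<circ> Inr)" by blast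
  qed
  text \<open>Blocks \<open>0\<close> and \<open>1\<close> carry the two tuples with their parameters, block \<open>2\<close> carries \<open>z\<close>.\<close>
  let ?s3 = "\<lambda>(n :: nat, k). ?s4 k"
  let ?T3 = "tuples_of M ?s3"
  define hD where "hD = (\<lambda>m :: nat. case_sum (\<lambda>(n :: nat, i :: 'i). (if n = 0 then m else 2, Inl i)) (\<lambda>a :: 'a. (0 :: nat, Inr a)))"
  define hS where "hS = case_sum (\<lambda>(n :: nat, i :: 'i). (2 :: nat, Inl i)) (\<lambda>a :: 'a. (0 :: nat, Inr a))"
  define ks where "ks = (SOME ks. set ks = Inl ` I \<union> Inr ` A \<and> distinct ks)"
  have "\<exists>ks. set ks = Inl ` I \<union> Inr ` A \<and> distinct ks" using A(1) I by (intro finite_distinct_list) auto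
  then have ks: "set ks = Inl ` I \<union> Inr ` A" "distinct ks" unfolding ks_def by (metis (mono_tags, lifting) someI_ex)+
  define JQ where "JQ = {0 :: nat, 1} \<times> set ks \<union> {2} \<times> Inl ` I"
  \<comment> \<open>Block 2 witnesses that blocks 0 and 1 have different traces, with the parameters
    read off block 0.\<close>
  define Q where "Q = {f. f \<circ> hS \<in> YS \<and> \<not> (f \<circ> hD 0 \<in> YD \<longleftrightarrow> f \<circ> hD 1 \<in> YD)}"
  have hD_sort: "?s3 (hD m j) = ?s2' j" for m j by (auto simp: hD_def split: sum.splits)
  have hS_sort: "?s3 (hS j) = ?s2' j" for j by (auto simp: hS_def split: sum.splits)
  have JQ1: "(m, Inl i) \<in> JQ" if "m \<in> {0, 1, 2}" "i \<in> I" for m i using that by (auto simp: JQ_def ks)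
  have JQ2: "(0, Inr b) \<in> JQ" if "b \<in> A" for b using that by (auto simp: JQ_def ks)
  have hD_J: "hD m ` (Inl ` J \<union> Inr ` A) \<subseteq> JQ" if m: "m \<in> {0, 1}" for m
  proof
    fix q assume "q \<in> hD m ` (Inl ` J \<union> Inr ` A)"
    then consider j where "j \<in> J" "q = hD m (Inl j)" | b where "b \<in> A" "q = hD m (Inr b)" by blast
    then show "q \<in> JQ"
    proof cases
      case 1
      then have "q = (if fst j = 0 then m else 2, Inl (snd j))" by (simp add: hD_def case_prod_beta)
      then show ?thesis using JQ1 J[OF 1(1)] m by auto
    qed (simp add: hD_def JQ2)
  qed
  have hS_J: "hS ` (Inl ` J \<union> Inr ` A) \<subseteq> JQ"
  proof
    fix q assume "q \<in> hS ` (Inl ` J \<union> Inr ` A)"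
    then consider j where "j \<in> J" "q = hS (Inl j)" | b where "b \<in> A" "q = hS (Inr b)" by blast
    then show "q \<in> JQ"
    proof cases
      case 1
      then have "q = (2, Inl (snd j))" by (simp add: hS_def case_prod_beta)
      then show ?thesis using JQ1 J[OF 1(1)] by auto
    qed (simp add: hS_def JQ2)
  qed
  have dQ: "dset M ?s3 JQ {} Q"
    unfolding Q_def
    by (intro dset_conj dset_not dset_iff dset_reindex[OF YS(1) hS_sort hS_J]
        dset_reindex[OF YD(1) hD_sort hD_J]) simp_all
  define K2 where "K2 = {2 :: nat} \<times> (Inl ` I :: ('i + 'a) set)"
  define QE where "QE = {f. \<exists>g\<in>?T3. (\<lambda>j. if j \<in> K2 then g j else f j) \<in> Q}"
  have dQE: "dset M ?s3 (JQ - K2) {} QE"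
    unfolding QE_def by (rule dset_Ex_finite[OF _ dQ]) (simp add: K2_def I)
  define EE where "EE = {f. (\<forall>a\<in>A. f (0 :: nat, Inr a) = f (1, Inr a)) \<and> f \<notin> QE}"
  define L where "L = map (Pair (0 :: nat)) ks @ map (Pair 1) ks"
  have L: "distinct L" "set L = JQ - K2"
    using ks(2) by (auto simp: L_def JQ_def K2_def distinct_map inj_on_def)
  have dEE: "dset M ?s3 (JQ - K2) {} EE"
    unfolding EE_def
  proof (intro dset_conj dset_ball_finite A(1))
    show "dset M ?s3 (JQ - K2) {} {f. f (0, Inr a) = f (1, Inr a)}" if "a \<in> A" for a
      by (rule dset_eq) (use that in \<open>auto simp: JQ_def K2_def ks\<close>)
    show "dset M ?s3 (JQ - K2) {} {f. f \<notin> QE}"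
      using dset_Compl[OF dQE] by (simp add: Compl_eq)
  qed
  define F where "F = (\<lambda>u w (n :: nat, k :: 'i + 'a). if n = 0 then u k else (w k :: 'a))"
  define F3 where "F3 = (\<lambda>u w (z :: 'i \<Rightarrow> 'a) (n :: nat, k :: 'i + 'a). if n = 0 then u k else if n = 1 then w k else case_sum z (u \<circ> Inr) k)"
  have F_T: "F u w \<in> ?T3" if "u \<in> ?T4" "w \<in> ?T4" for u w using that by (auto simp: F_def tuples_of_def)
  have F3_T: "F3 u w z \<in> ?T3" if "u \<in> ?T4" "w \<in> ?T4" "z \<in> T1" for u w z
    using that by (auto simp: F3_def tuples_of_def split: sum.splits)
  have F3_Q: "F3 u w z \<in> Q \<longleftrightarrow> W z (u \<circ> Inr) \<and> \<not> (V (u \<circ> Inl) z (u \<circ> Inr) \<longleftrightarrow> V (w \<circ> Inl) z (u \<circ> Inr))" for u w z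
  proof -
    have "F3 u w z \<circ> hS = case_sum (\<lambda>(n, i). z i) (u \<circ> Inr)"
      by (auto simp: fun_eq_iff F3_def hS_def split: sum.splits)
    moreover have "F3 u w z \<circ> hD 0 = case_sum (\<lambda>(n, i). if n = 0 then (u \<circ> Inl) i else z i) (u \<circ> Inr)"
      by (auto simp: fun_eq_iff F3_def hD_def split: sum.splits)
    moreover have "F3 u w z \<circ> hD 1 = case_sum (\<lambda>(n, i). if n = 0 then (w \<circ> Inl) i else z i) (u \<circ> Inr)"
      by (auto simp: fun_eq_iff F3_def hD_def split: sum.splits)
    ultimately show ?thesis unfolding Q_def V_def W_def by (simp only: mem_Collect_eq)
  qed
  have QE_iff: "F u w \<in> QE \<longleftrightarrow> (\<exists>z\<in>T1. F3 u w z \<in> Q)" if uw: "u \<in> ?T4" "w \<in> ?T4" for u w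
  proof
    assume "F u w \<in> QE"
    then obtain g where g: "g \<in> ?T3" "(\<lambda>j. if j \<in> K2 then g j else F u w j) \<in> Q" unfolding QE_def by blast
    define m where "m = (\<lambda>j. if j \<in> K2 then g j else F u w j)"
    have m: "m \<in> ?T3" unfolding m_def by (rule tuples_of_mix[OF F_T[OF uw] g(1)])
    define z where "z = (\<lambda>i. m (2, Inl i))"
    have z: "z \<in> T1" using m by (auto simp: z_def tuples_of_def)
    have "m \<in> Q \<longleftrightarrow> F3 u w z \<in> Q"
    proof (rule dset_support[OF dQ m F3_T[OF uw z]])
      fix j assume "j \<in> JQ"
      then show "m j = F3 u w z j" by (auto simp: JQ_def F3_def z_def) (auto simp: m_def K2_def F_def)
    qed
    then show "\<exists>z\<in>T1. F3 u w z \<in> Q" using g(2) z unfolding m_def by blast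
  next
    assume "\<exists>z\<in>T1. F3 u w z \<in> Q"
    then obtain z where z: "z \<in> T1" "F3 u w z \<in> Q" by blast
    let ?m = "\<lambda>j. if j \<in> K2 then F3 u w z j else F u w j"
    have "?m \<in> Q \<longleftrightarrow> F3 u w z \<in> Q"
    proof (rule dset_support[OF dQ tuples_of_mix[OF F_T[OF uw] F3_T[OF uw z(1)]] F3_T[OF uw z(1)]])
      fix j assume "j \<in> JQ"
      then show "?m j = F3 u w z j" by (auto simp: JQ_def F3_def K2_def F_def)
    qed
    then show "F u w \<in> QE" unfolding QE_def using z(2) F3_T[OF uw z(1)] by blast
  qed
  have EE_rel: "F u w \<in> EE \<longleftrightarrow> rel u w" if uw: "u \<in> ?T4" "w \<in> ?T4" for u w
  proof -
    have "F u w \<in> EE \<longleftrightarrow> (\<forall>a\<in>A. u (Inr a) = w (Inr a)) \<and> F u w \<notin> QE" by (simp add: EE_def F_def)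
    then show ?thesis unfolding QE_iff[OF uw] F3_Q rel_def by blast
  qed
  let ?ss = "map ?s4 ks"
  let ?u = "\<lambda>x :: 'i \<Rightarrow> 'a. case_sum x id"
  let ?EL = "{map f L | f. f \<in> ?T3 \<and> f \<in> EE}"
  have aT: "?u a \<in> ?T4" using T4' P_T1 ab(1) by blast
  have def_EL: "definable M (?ss @ ?ss) ?EL"
  proof -
    have "definable M (map ?s3 L) ?EL"
      by (rule definable_if_dset[OF dEE L(1) _ F_T[OF aT aT]]) (simp add: L(2))
    moreover have "map ?s3 L = ?ss @ ?ss" by (simp add: L_def)
    ultimately show ?thesis by simp
  qed
  have map_F: "map (F u w) L = map u ks @ map w ks" for u w by (simp add: L_def F_def)
  have tup: "map u ks \<in> tuples M ?ss" if "u \<in> ?T4" for u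
    using that by (simp add: tuples_def tuples_of_srt)
  have tup_ex: "\<exists>u\<in>?T4. map u ks = x" if x: "x \<in> tuples M ?ss" for x
  proof -
    have xm: "map (srt M) x = ?ss" using x by (simp add: tuples_def)
    have len: "length ks = length x" using arg_cong[OF xm, of length] by simp
    \<comment> \<open>Outside \<open>ks\<close> any values of the right sorts do.\<close>
    define u where "u = (\<lambda>k. case map_of (zip ks x) k of Some y \<Rightarrow> y | None \<Rightarrow> ?u a k)"
    have u_nth: "u (ks ! n) = x ! n" if "n < length x" for n
      unfolding u_def using map_of_zip_nth[OF len ks(2) that] by simp
    have "srt M (u k) = ?s4 k" for k
    proof (cases "k \<in> set ks")
      case True
      then obtain n where n: "n < length x" "k = ks ! n" using len by (metis in_set_conv_nth)
      have "srt M (x ! n) = ?s4 (ks ! n)" using xm n(1) len by (metis nth_map)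
      then show ?thesis using u_nth n by simp
    next
      case False
      then have "map_of (zip ks x) k = None" using len by (simp add: map_of_zip_is_None)
      then show ?thesis using aT by (simp add: u_def tuples_of_srt)
    qed
    then have "u \<in> ?T4" by (simp add: tuples_of_def)
    moreover have "map u ks = x" by (rule nth_equalityI) (use len u_nth in auto)
    ultimately show ?thesis by blast
  qed
  have EL_rel: "map u ks @ map w ks \<in> ?EL \<longleftrightarrow> rel u w" if uw: "u \<in> ?T4" "w \<in> ?T4" for u w
  proof
    assume "map u ks @ map w ks \<in> ?EL"
    then obtain f where f: "f \<in> ?T3" "f \<in> EE" "map f L = map (F u w) L" unfolding map_F[symmetric] by (elim CollectE exE conjE) simp
    have "f \<in> EE \<longleftrightarrow> F u w \<in> EE"
      by (rule dset_support[OF dEE f(1) F_T[OF uw]]) (use f(3) in \<open>simp add: L(2)[symmetric]\<close>)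
    then show "rel u w" using f(2) EE_rel[OF uw] by blast
  next
    assume "rel u w"
    then have "F u w \<in> EE" using EE_rel[OF uw] by blast
    then show "map u ks @ map w ks \<in> ?EL" unfolding map_F[symmetric] using F_T[OF uw] by blast
  qed
  let ?rr = "{(x, y). x \<in> tuples M ?ss \<and> y \<in> tuples M ?ss \<and> x @ y \<in> ?EL}"
  have "equiv (tuples M ?ss) ?rr"
  proof (rule equivI)
    show "?rr \<subseteq> tuples M ?ss \<times> tuples M ?ss" by blast
    show "refl_on (tuples M ?ss) ?rr"
    proof (rule refl_onI)
      fix x assume x: "x \<in> tuples M ?ss"
      then obtain u where "u \<in> ?T4" "map u ks = x" using tup_ex by blast
      then show "(x, x) \<in> ?rr" using EL_rel[of u u] rel_refl x by auto
    qed
    show "sym ?rr"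
    proof (rule symI)
      fix x y assume xy: "(x, y) \<in> ?rr"
      then obtain u w where "u \<in> ?T4" "map u ks = x" "w \<in> ?T4" "map w ks = y" using tup_ex by blast
      then show "(y, x) \<in> ?rr" using EL_rel[of u w] EL_rel[of w u] rel_sym[of u w] xy by auto
    qed
    show "trans ?rr"
    proof (rule transI)
      fix x y z assume xy: "(x, y) \<in> ?rr" "(y, z) \<in> ?rr"
      then obtain u v w where "u \<in> ?T4" "map u ks = x" "v \<in> ?T4" "map v ks = y" "w \<in> ?T4" "map w ks = z"
        using tup_ex by (metis (no_types, lifting) mem_Collect_eq case_prodD)
      then show "(x, z) \<in> ?rr" using EL_rel[of u v] EL_rel[of v w] EL_rel[of u w] rel_trans[of u v w] xy by auto
    qed
  qed
  from eq_closed[unfolded is_eq_closed_def, rule_format, OF conjI[OF def_EL this]]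
  obtain s0 Fc where Fc: "\<forall>x\<in>tuples M ?ss. srt M (Fc x) = s0"
    "definable M (?ss @ [s0]) {x @ [Fc x] | x. x \<in> tuples M ?ss}"
    "\<forall>x\<in>tuples M ?ss. \<forall>y\<in>tuples M ?ss. x @ y \<in> ?EL \<longleftrightarrow> Fc x = Fc y" by (elim exE conjE)
  let ?GR = "{x @ [Fc x] | x. x \<in> tuples M ?ss}"
  have Fc_rel: "Fc (map u ks) = Fc (map w ks) \<longleftrightarrow> rel u w" if uw: "u \<in> ?T4" "w \<in> ?T4" for u w
    using Fc(3) tup[OF uw(1)] tup[OF uw(2)] EL_rel[OF uw] by blast
  have Fc_Aut: "Fc (map \<sigma> x) = \<sigma> (Fc x)" if "\<sigma> \<in> Aut M" "x \<in> tuples M ?ss" for \<sigma> x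
  proof -
    have "map \<sigma> (x @ [Fc x]) \<in> ?GR" by (rule definable_Aut[OF Fc(2) wf that(1)]) (use that(2) in blast)
    then show ?thesis by auto
  qed
  define e where "e = Fc (map (?u a) ks)"
  \<comment> \<open>Being the code of some element of \<open>S\<close> is a condition over
    \<open>B\<close>. By the choice of \<open>S\<close>, only codes of members of \<open>C\<close>
    satisfy it.\<close>
  have "e \<in> acl M B"
  proof -
    \<comment> \<open>The extra coordinate \<open>None\<close> carries the code.\<close>
    let ?s5 = "case_option s0 ?s4"
    define L5 where "L5 = map Some ks @ [None]"
    define h5 where "h5 = case_sum (\<lambda>(n :: nat, i :: 'i). Some (Inl i)) (\<lambda>b :: 'a. Some (Inr b))"
    have "dset M ?s5 (set L5) {} {f. map f L5 \<in> ?GR}"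
      by (rule dset_if_definable) (use Fc(2) ks(2) in \<open>auto simp: L5_def comp_def distinct_map\<close>)
    moreover have "dset M ?s5 (set L5) {} {f. f \<circ> h5 \<in> YS}"
    proof (rule dset_reindex[OF YS(1)])
      show "?s5 (h5 j) = ?s2' j" for j by (auto simp: h5_def split: sum.splits)
      have "h5 (Inl j) \<in> set L5" if "j \<in> J" for j using J[OF that] by (simp add: h5_def L5_def ks case_prod_beta)
      moreover have "h5 (Inr b) \<in> set L5" if "b \<in> A" for b using that by (simp add: h5_def L5_def ks)
      ultimately show "h5 ` (Inl ` J \<union> Inr ` A) \<subseteq> set L5" by blast
    qed
    ultimately have d5: "dset M ?s5 (set L5) {} {f. map f L5 \<in> ?GR \<and> f \<circ> h5 \<in> YS}" by (rule dset_conj)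
    define g5 where "g5 = case_option e (?u a)"
    have "srt M e = s0" unfolding e_def using Fc(1) tup[OF aT] by blast
    then have g5: "g5 \<in> tuples_of M ?s5" using aT by (auto simp: g5_def tuples_of_def split: option.splits)
    define K5 where "K5 = Some ` (range Inr :: ('i + 'a) set)"
    define K6 where "K6 = Some ` (Inl ` I :: ('i + 'a) set)"
    \<comment> \<open>The parameters are frozen at their values in \<open>B\<close> by
      \<open>X5\<close>, and \<open>X6\<close> quantifies the coded element away, so that a
      condition on the code alone is left.\<close>
    define X5 where "X5 = {f. (\<lambda>j. if j \<in> K5 then g5 j else f j) \<in> {f. map f L5 \<in> ?GR \<and> f \<circ> h5 \<in> YS}}"
    define X6 where "X6 = {f. \<exists>g\<in>tuples_of M ?s5. (\<lambda>j. if j \<in> K6 then g j else f j) \<in> X5}"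
    have "dset M ?s5 (set L5 - K5) ({} \<union> g5 ` (set L5 \<inter> K5)) X5"
      unfolding X5_def by (rule dset_specialize[OF d5 g5])
    then have "dset M ?s5 (set L5 - K5 - K6) ({} \<union> g5 ` (set L5 \<inter> K5)) X6"
      unfolding X6_def by (rule dset_Ex_finite[rotated]) (simp add: K6_def I)
    then have d6: "dset M ?s5 {None} B X6"
      by (rule dset_mono) (use A(2) in \<open>auto simp: L5_def K5_def K6_def ks g5_def\<close>)
    have "g5 \<in> X6"
    proof -
      have "map g5 L5 = map (?u a) ks @ [Fc (map (?u a) ks)]" by (simp add: L5_def g5_def e_def)
      then have "map g5 L5 \<in> ?GR" using tup[OF aT] by blast
      moreover have "g5 \<circ> h5 = case_sum (\<lambda>(n, i). a i) id"
        by (auto simp: fun_eq_iff g5_def h5_def split: sum.splits)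
      then have "g5 \<circ> h5 \<in> YS" using W_id[of a] ab(1) P_T1 S(2) unfolding W_def by (simp only:) blast
      ultimately have "g5 \<in> {f. map f L5 \<in> ?GR \<and> f \<circ> h5 \<in> YS}" by blast
      then have "g5 \<in> X5" unfolding X5_def by (simp only: if_cancel mem_Collect_eq)
      then show ?thesis unfolding X6_def using g5 by (intro CollectI bexI[of _ g5]) (simp_all only: if_cancel)
    qed
    moreover have "finite {y. srt M y = ?s5 None \<and> g5(None := y) \<in> X6}"
    proof (rule finite_subset)
      show "finite ((\<lambda>c. Fc (map (?u c) ks)) ` C)" using C(2) by blast
      show "{y. srt M y = ?s5 None \<and> g5(None := y) \<in> X6} \<subseteq> (\<lambda>c. Fc (map (?u c) ks)) ` C"
      proof
        fix y assume "y \<in> {y. srt M y = ?s5 None \<and> g5(None := y) \<in> X6}"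
        then have y: "srt M y = s0" "g5(None := y) \<in> X6" by simp_all
        then obtain g where g: "g \<in> tuples_of M ?s5" "(\<lambda>j. if j \<in> K6 then g j else (g5(None := y)) j) \<in> X5"
          unfolding X6_def by blast
        define h where "h = (\<lambda>j. if j \<in> K5 then g5 j else if j \<in> K6 then g j else (g5(None := y)) j)"
        have h: "map h L5 \<in> ?GR" "h \<circ> h5 \<in> YS" using g(2) unfolding X5_def h_def by simp_all
        have hT: "h \<in> tuples_of M ?s5" using g(1) g5 y(1) by (auto simp: h_def tuples_of_def)
        define x where "x = (\<lambda>i. h (Some (Inl i)))"
        have xT: "x \<in> T1" using hT by (auto simp: x_def tuples_of_def)
        have hN: "h None = y" by (auto simp: h_def K5_def K6_def)
        have hR: "h (Some (Inr b)) = b" for b by (auto simp: h_def K5_def g5_def)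
        have hS: "h \<circ> Some = ?u x" by (auto simp: fun_eq_iff x_def hR split: sum.splits)
        have "map h L5 = map (?u x) ks @ [y]" unfolding hS[symmetric] by (simp add: L5_def hN)
        then have yF: "y = Fc (map (?u x) ks)" using h(1) by auto
        have "h \<circ> h5 = case_sum (\<lambda>(n, i). x i) id"
          by (auto simp: fun_eq_iff x_def hR h5_def split: sum.splits)
        then have "W x id" using h(2) unfolding W_def by (simp only:)
        then have "x \<in> S" using W_id[OF xT] by blast
        then obtain c where c: "c \<in> C" "\<forall>z\<in>T1. z \<in> S \<longrightarrow> (x, z) \<in> \<delta> \<longleftrightarrow> (c, z) \<in> \<delta>" using S(3)[OF xT] by blast
        have cT: "c \<in> T1" using c(1) C(1) P_T1 by blast
        have "rel (?u x) (?u c)"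
          unfolding rel_def using c(2) V_id[OF xT] V_id[OF cT] W_id by (auto simp: comp_def id_def)
        then have "Fc (map (?u x) ks) = Fc (map (?u c) ks)" using Fc_rel[OF T4'[OF xT] T4'[OF cT]] by blast
        then show "y \<in> (\<lambda>c. Fc (map (?u c) ks)) ` C" using yF c(1) by blast
      qed
    qed
    ultimately have "g5 None \<in> acl M B" by (intro acl_if_dset[OF d6 _ g5]) auto
    then show ?thesis by (simp add: g5_def)
  qed
  then have eB: "e \<in> B" using acl_B by simp
  obtain \<sigma> where \<sigma>: "\<sigma> \<in> G" "b = \<sigma> \<circ> a" using P_trans[OF ab(1)] ab(2) by blast
  have mapb: "map (?u b) ks = map \<sigma> (map (?u a) ks)"
  proof -
    have "?u b k = \<sigma> (?u a k)" if "k \<in> set ks" for k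
      using that A(2) \<sigma> by (auto simp: ks AutOver_def)
    then show ?thesis by simp
  qed
  have "Fc (map (?u b) ks) = \<sigma> e"
    unfolding mapb e_def by (rule Fc_Aut[OF AutOver_Aut[OF \<sigma>(1)] tup[OF aT]])
  also have "\<dots> = e" using \<sigma>(1) eB by (simp add: AutOver_def)
  finally have "rel (?u a) (?u b)"
    using Fc_rel[OF aT T4'[OF P_T1[OF ab(2)]]] by (simp add: e_def)
  \<comment> \<open>The traces of \<open>a\<close> and \<open>b\<close> are compared at the point
    \<open>a\<close>, which lies in the trace of \<open>a\<close> by reflexivity.\<close>
  then have *: "W a id \<longrightarrow> V a a id \<longleftrightarrow> V b a id"
    using P_T1[OF ab(1)] unfolding rel_def by (auto simp: comp_def id_def)
  have "(b, a) \<in> \<delta>"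
    using * W_id[OF P_T1[OF ab(1)]] V_id[OF P_T1[OF ab(1)] P_T1[OF ab(1)]] V_id[OF P_T1[OF ab(2)] P_T1[OF ab(1)]]
      S(2) ab(1) \<delta>(2)[OF ab(1) ab(1)] E_refl[OF ab(1)] by blast
  then show ?thesis using \<delta>(2)[OF ab(2,1)] E_sym by blast
qed

theorem one_or_continuum_classes:
  "E = P \<times> P \<or>
   (\<exists>a :: (nat \<Rightarrow> bool) \<Rightarrow> 'i \<Rightarrow> 'a. (\<forall>\<eta>. a \<eta> \<in> P) \<and> (\<forall>\<eta> \<eta>'. \<eta> \<noteq> \<eta>' \<longrightarrow> (a \<eta>, a \<eta>') \<notin> E))"
  using few_or_many_classes
proof
  assume "(\<exists>C\<subseteq>P. finite C \<and> (\<forall>b\<in>P. \<exists>x\<in>C. (x, b) \<in> E)) \<and> (\<exists>N. E \<subseteq> Rn N)"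
  then obtain C N where C: "C \<subseteq> P" "finite C" "\<forall>b\<in>P. \<exists>x\<in>C. (x, b) \<in> E" "E \<subseteq> Rn N" by (elim conjE exE)
  have "(a, b) \<in> E" if "a \<in> P" "b \<in> P" for a b
    by (rule one_class_if_finite[OF C(1,2) _ C(4) that]) (use C(3) in blast)
  moreover have "E \<subseteq> P \<times> P" using E_P by auto
  ultimately show ?thesis by blast
qed blast

end

section \<open>Algebraic closure\<close>

context monster
begin

lemma acl_Aut:
  assumes "\<sigma> \<in> Aut M"
  shows "\<sigma> ` acl M A = acl M (\<sigma> ` A)"
proof -
  have sub: "\<sigma> ` acl M A \<subseteq> acl M (\<sigma> ` A)" if \<sigma>: "\<sigma> \<in> Aut M" for \<sigma> A
  proof
    fix y assume "y \<in> \<sigma> ` acl M A"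
    then obtain x \<phi> v e where x: "y = \<sigma> x" "e ` (fv \<phi> - {v}) \<subseteq> A" "holds M \<phi> (e(v := x))" "finite {y. holds M \<phi> (e(v := y))}"
      unfolding acl_def by blast
    have h: "holds M \<phi> ((\<sigma> \<circ> e)(v := \<sigma> z)) \<longleftrightarrow> holds M \<phi> (e(v := z))" for z
    proof -
      have "(\<sigma> \<circ> e)(v := \<sigma> z) = \<sigma> \<circ> e(v := z)" by (auto simp: fun_eq_iff)
      then show ?thesis using holds_Aut[OF wf \<sigma>] by metis
    qed
    have "{z. holds M \<phi> ((\<sigma> \<circ> e)(v := z))} = \<sigma> ` {z. holds M \<phi> (e(v := z))}"
    proof (intro equalityI subsetI)
      fix z assume z: "z \<in> {z. holds M \<phi> ((\<sigma> \<circ> e)(v := z))}"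
      obtain w where "z = \<sigma> w" using Aut_bij[OF \<sigma>] by (metis bij_pointE)
      then show "z \<in> \<sigma> ` {z. holds M \<phi> (e(v := z))}" using z h by blast
    qed (use h in blast)
    then have "finite {z. holds M \<phi> ((\<sigma> \<circ> e)(v := z))}" using x(4) by simp
    moreover have "(\<sigma> \<circ> e) ` (fv \<phi> - {v}) \<subseteq> \<sigma> ` A" using x(2) by auto
    ultimately show "y \<in> acl M (\<sigma> ` A)" unfolding acl_def x(1) using x(3) h by blast
  qed
  have "acl M (\<sigma> ` A) \<subseteq> \<sigma> ` acl M A"
  proof
    fix y assume "y \<in> acl M (\<sigma> ` A)"
    then have "Hilbert_Choice.inv \<sigma> y \<in> acl M (Hilbert_Choice.inv \<sigma> ` \<sigma> ` A)" using sub[OF Aut_inv[OF assms]] by blast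
    moreover have "Hilbert_Choice.inv \<sigma> ` \<sigma> ` A = A" using Aut_bij[OF assms] by (simp add: bij_is_inj image_inv_f_f)
    ultimately have "\<sigma> (Hilbert_Choice.inv \<sigma> y) \<in> \<sigma> ` acl M A" by auto
    then show "y \<in> \<sigma> ` acl M A" using Aut_bij[OF assms] by (simp add: bij_is_surj surj_f_inv_f)
  qed
  with sub[OF assms] show ?thesis by blast
qed

lemma dcl_fixed:
  assumes "\<sigma> \<in> AutOver M A" "x \<in> dcl M A"
  shows "\<sigma> x = x"
proof -
  obtain \<phi> v e where x: "e ` (fv \<phi> - {v}) \<subseteq> A" "{y. holds M \<phi> (e(v := y))} = {x}"
    using assms(2) unfolding dcl_def by blast
  have "holds M \<phi> (e(v := \<sigma> x)) = holds M \<phi> (\<sigma> \<circ> e(v := x))"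
    by (rule holds_cong) (use x(1) assms(1) in \<open>auto simp: AutOver_def\<close>)
  also have "\<dots> = holds M \<phi> (e(v := x))" by (rule holds_Aut[OF wf AutOver_Aut[OF assms(1)]])
  finally show ?thesis using x(2) by blast
qed

lemma acl_mono: "A \<subseteq> A' \<Longrightarrow> acl M A \<subseteq> acl M A'"
  unfolding acl_def by blast

lemma acl_super: "A \<subseteq> acl M A"
proof
  fix x assume x: "x \<in> A"
  let ?v = "(0, srt M x)" and ?w = "(1, srt M x)"
  have "holds M (Eq (Var ?v) (Var ?w)) ((\<lambda>_. x)(?v := y)) \<longleftrightarrow> y = x" for y
    by (auto simp: holds_def)
  then show "x \<in> acl M A"
    unfolding acl_def using x
    by (intro CollectI exI[of _ "Eq (Var ?v) (Var ?w)"] exI[of _ ?v] exI[of _ "\<lambda>_. x"]) auto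
qed

text \<open>Algebraic elements lie in finite solution sets, which are indexed by a formula, a
  variable and a finite list of parameters.\<close>

lemma small_acl:
  assumes "small \<kappa> A"
  shows "small \<kappa> (acl M A)"
proof -
  define L :: "('s, 'f, 'r) fm \<Rightarrow> 's var \<Rightarrow> 's var list" where "L = (\<lambda>\<phi> v. SOME xs. set xs = fv \<phi> - {v})"
  have L: "set (L \<phi> v) = fv \<phi> - {v}" for \<phi> :: "('s, 'f, 'r) fm" and v
    unfolding L_def by (rule someI_ex) (simp add: finite_list)
  define F where "F = (\<lambda>(\<phi> :: ('s, 'f, 'r) fm, v :: 's var, l :: 'a list).
    let Y = {y. holds M \<phi> ((\<lambda>w. the (map_of (zip (L \<phi> v) l) w))(v := y))} in if finite Y then Y else {})"
  have "acl M A \<subseteq> (\<Union>i\<in>UNIV \<times> UNIV \<times> lists A. F i)"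
  proof
    fix x assume "x \<in> acl M A"
    then obtain \<phi> v e where x: "e ` (fv \<phi> - {v}) \<subseteq> A" "holds M \<phi> (e(v := x))" "finite {y. holds M \<phi> (e(v := y))}"
      unfolding acl_def by blast
    have "holds M \<phi> ((\<lambda>w. the (map_of (zip (L \<phi> v) (map e (L \<phi> v))) w))(v := y)) = holds M \<phi> (e(v := y))" for y
      by (rule holds_cong) (simp add: map_of_zip_map L)
    then have "x \<in> F (\<phi>, v, map e (L \<phi> v))" using x(2,3) by (simp add: F_def)
    moreover have "map e (L \<phi> v) \<in> lists A" using x(1) by (simp add: lists_eq_set L)
    ultimately show "x \<in> (\<Union>i\<in>UNIV \<times> UNIV \<times> lists A. F i)" by blast
  qed
  moreover have "small \<kappa> (\<Union>i\<in>UNIV \<times> UNIV \<times> lists A. F i)"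
  proof (rule small_UN_finite)
    have "inj (\<lambda>v. Eq (Var v) (Var v) :: ('s, 'f, 'r) fm)" by (auto intro!: injI)
    then have "|UNIV :: 's var set| \<le>o |UNIV :: ('s, 'f, 'r) fm set|" by (meson card_of_ordLeqI UNIV_I)
    then have "small \<kappa> (UNIV :: 's var set)" using large ordLeq_ordLess_trans unfolding small_def by blast
    then show "small \<kappa> ((UNIV :: ('s, 'f, 'r) fm set) \<times> (UNIV :: 's var set) \<times> lists A)"
      by (intro small_Times small_fm small_lists assms)
    show "finite (F i)" for i by (auto simp: F_def Let_def split: prod.splits)
  qed
  ultimately show ?thesis using small_mono by blast
qed

text \<open>If \<open>x\<close> were not algebraic, every \<open>A\<close>-definable set around it
  would be infinite. Compactness would then give a conjugate of \<open>x\<close> outside its finite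
  orbit.\<close>

lemma acl_if_finite_orbit:
  assumes "small \<kappa> A" "finite {\<sigma> x | \<sigma>. \<sigma> \<in> AutOver M A}"
  shows "x \<in> acl M A"
proof (rule ccontr)
  assume x: "x \<notin> acl M A"
  let ?s = "\<lambda>_ :: unit. srt M x"
  let ?O = "{\<sigma> x | \<sigma>. \<sigma> \<in> AutOver M A}"
  let ?f = "\<lambda>_ :: unit. x"
  have f: "?f \<in> tuples_of M ?s" by (simp add: tuples_of_def)
  have inf: "infinite {y. srt M y = srt M x \<and> (\<lambda>_ :: unit. y) \<in> X}" if X: "dset M ?s UNIV A X" "?f \<in> X" for X
  proof
    assume fin: "finite {y. srt M y = srt M x \<and> (\<lambda>_ :: unit. y) \<in> X}"
    have "?f(() := y) = (\<lambda>_. y)" for y by auto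
    then have "finite {y. srt M y = ?s () \<and> ?f(() := y) \<in> X}" using fin by simp
    from acl_if_dset[OF X(1) _ f X(2) this] x show False by (auto simp: UNIV_unit)
  qed
  let ?\<X> = "{X. dset M ?s UNIV A X \<and> ?f \<in> X} \<union> (\<lambda>e. {f. f () \<noteq> e}) ` ?O"
  have "\<exists>g\<in>tuples_of M ?s. \<forall>X\<in>?\<X>. g \<in> X"
  proof (rule compactness)
    show "small \<kappa> (UNIV :: unit set)" by (rule small_finite) simp
    show "small \<kappa> (A \<union> ?O)" by (rule small_Un[OF assms(1) small_finite[OF assms(2)]])
    show "dset M ?s UNIV (A \<union> ?O) X" if "X \<in> ?\<X>" for X
      using that
    proof
      assume "X \<in> {X. dset M ?s UNIV A X \<and> ?f \<in> X}"
      then have "dset M ?s UNIV A X" by simp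
      then show ?thesis by (rule dset_mono) auto
    next
      assume "X \<in> (\<lambda>e. {f. f () \<noteq> e}) ` ?O"
      then obtain e where e: "e \<in> ?O" "X = {f. f () \<noteq> e}" by blast
      then obtain \<sigma> where "e = \<sigma> x" "\<sigma> \<in> AutOver M A" by blast
      then have "srt M e = srt M x" by (simp add: Aut_srt[OF AutOver_Aut])
      then have "dset M ?s UNIV (A \<union> ?O) {f. f () = e}" using e(1) by (intro dset_eq_param) auto
      then show ?thesis unfolding e(2) by (rule dset_not)
    qed
    fix \<X>0 assume X0: "finite \<X>0" "\<X>0 \<subseteq> ?\<X>"
    let ?D = "{X \<in> \<X>0. dset M ?s UNIV A X \<and> ?f \<in> X}"
    have "dset M ?s UNIV A (\<Inter>?D)" by (rule dset_Inter_finite) (use X0(1) in auto)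
    moreover have "?f \<in> \<Inter>?D" by blast
    ultimately have "infinite {y. srt M y = srt M x \<and> (\<lambda>_ :: unit. y) \<in> \<Inter>?D}" by (rule inf)
    then have "infinite ({y. srt M y = srt M x \<and> (\<lambda>_ :: unit. y) \<in> \<Inter>?D} - ?O)" using assms(2) by (rule Diff_infinite_finite[rotated])
    from infinite_imp_nonempty[OF this] obtain y where y: "srt M y = srt M x" "(\<lambda>_ :: unit. y) \<in> \<Inter>?D" "y \<notin> ?O"
      unfolding ex_in_conv[symmetric] by (elim exE DiffE CollectE conjE)
    have "(\<lambda>_. y) \<in> X" if X: "X \<in> \<X>0" for X
    proof (cases "dset M ?s UNIV A X \<and> ?f \<in> X")
      case True
      then show ?thesis using y(2) X by blast
    next
      case False
      then obtain e where "e \<in> ?O" "X = {f. f () \<noteq> e}" using X X0(2) by blast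
      then show ?thesis using y(3) by auto
    qed
    moreover have "(\<lambda>_. y) \<in> tuples_of M ?s" using y(1) by (simp add: tuples_of_def)
    ultimately show "\<exists>g\<in>tuples_of M ?s. \<forall>X\<in>\<X>0. g \<in> X" by blast
  qed
  then obtain g where g: "g \<in> tuples_of M ?s" "\<forall>X\<in>?\<X>. g \<in> X" by blast
  have "g \<in> X" if "dset M ?s UNIV A X" "?f \<in> X" for X
    by (rule bspec[OF g(2)]) (use that in simp)
  from conjugate_if_same_dsets[OF small_finite[OF finite_UNIV] assms(1) f g(1) this]
  obtain \<sigma> where \<sigma>: "\<sigma> \<in> AutOver M A" "g = \<sigma> \<circ> ?f" by blast
  then have O: "g () \<in> ?O" by auto
  then have "g \<in> {f. f () \<noteq> g ()}" by (intro bspec[OF g(2)] UnI2 imageI)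
  then show False by simp
qed

lemma finite_orbit_if_acl:
  assumes "x \<in> acl M A"
  shows "finite {\<sigma> x | \<sigma>. \<sigma> \<in> AutOver M A}"
proof -
  obtain \<phi> v e where x: "e ` (fv \<phi> - {v}) \<subseteq> A" "holds M \<phi> (e(v := x))" "finite {y. holds M \<phi> (e(v := y))}"
    using assms unfolding acl_def by blast
  have "holds M \<phi> (e(v := \<sigma> x))" if \<sigma>: "\<sigma> \<in> AutOver M A" for \<sigma>
  proof -
    have "holds M \<phi> (e(v := \<sigma> x)) = holds M \<phi> (\<sigma> \<circ> e(v := x))"
      by (rule holds_cong) (use x(1) \<sigma> in \<open>auto simp: AutOver_def\<close>)
    also have "\<dots> = holds M \<phi> (e(v := x))" by (rule holds_Aut[OF wf AutOver_Aut[OF \<sigma>]])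
    finally show ?thesis using x(2) by simp
  qed
  then show ?thesis by (intro finite_subset[OF _ x(3)]) blast
qed

text \<open>Orbits are counted instead of combining formulas: the parameters of a witnessing formula
  have finitely many conjugates over \<open>A\<close>, hence so has its finite solution set.\<close>

lemma acl_idem:
  assumes A: "small \<kappa> A"
  shows "acl M (acl M A) = acl M A"
proof
  show "acl M (acl M A) \<subseteq> acl M A"
  proof
    fix x assume "x \<in> acl M (acl M A)"
    then obtain \<phi> v e where x: "e ` (fv \<phi> - {v}) \<subseteq> acl M A" "holds M \<phi> (e(v := x))" "finite {y. holds M \<phi> (e(v := y))}"
      unfolding acl_def by blast
    define L where "L = (SOME xs. set xs = fv \<phi> - {v})"
    have L: "set L = fv \<phi> - {v}" unfolding L_def by (rule someI_ex) (simp add: finite_list)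
    have fin1: "finite {\<sigma> (e w) | \<sigma>. \<sigma> \<in> AutOver M A}" if "w \<in> set L" for w
      by (rule finite_orbit_if_acl) (use that x(1) L in blast)
    have "finite ((\<lambda>\<sigma>. map (\<lambda>w. \<sigma> (e w)) L) ` AutOver M A)"
    proof (rule finite_subset)
      let ?U = "\<Union>w\<in>set L. {\<sigma> (e w) | \<sigma>. \<sigma> \<in> AutOver M A}"
      show "(\<lambda>\<sigma>. map (\<lambda>w. \<sigma> (e w)) L) ` AutOver M A \<subseteq> {xs. set xs \<subseteq> ?U \<and> length xs = length L}" by force
      show "finite {xs. set xs \<subseteq> ?U \<and> length xs = length L}"
        by (rule finite_lists_length_eq) (use fin1 in blast)
    qed
    \<comment> \<open>One automorphism for each of the finitely many images of the parameter
      list.\<close>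
    then obtain \<Sigma> where \<Sigma>: "\<Sigma> \<subseteq> AutOver M A" "finite \<Sigma>"
      "(\<lambda>\<sigma>. map (\<lambda>w. \<sigma> (e w)) L) ` AutOver M A = (\<lambda>\<sigma>. map (\<lambda>w. \<sigma> (e w)) L) ` \<Sigma>"
      by (metis (no_types, lifting) finite_subset_image subset_refl)
    have "{\<sigma> x | \<sigma>. \<sigma> \<in> AutOver M A} \<subseteq> (\<Union>\<tau>\<in>\<Sigma>. \<tau> ` {y. holds M \<phi> (e(v := y))})"
    proof
      fix y assume "y \<in> {\<sigma> x | \<sigma>. \<sigma> \<in> AutOver M A}"
      then obtain \<sigma> where \<sigma>: "\<sigma> \<in> AutOver M A" "y = \<sigma> x" by blast
      obtain \<tau> where \<tau>: "\<tau> \<in> \<Sigma>" "map (\<lambda>w. \<sigma> (e w)) L = map (\<lambda>w. \<tau> (e w)) L" using \<sigma>(1) \<Sigma>(3) by blast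
      have \<tau>A: "\<tau> \<in> AutOver M A" using \<tau>(1) \<Sigma>(1) by blast
      define \<rho> where "\<rho> = Hilbert_Choice.inv \<tau> \<circ> \<sigma>"
      have \<rho>: "\<rho> \<in> AutOver M A" unfolding \<rho>_def by (rule AutOver_comp[OF AutOver_inv[OF \<tau>A] \<sigma>(1)])
      have fx: "\<rho> (e w) = e w" if "w \<in> fv \<phi> - {v}" for w
        using \<tau>(2) that AutOver_inv_comp[OF \<tau>A] by (simp add: \<rho>_def L)
      have "holds M \<phi> (e(v := \<rho> x)) = holds M \<phi> (\<rho> \<circ> e(v := x))"
        by (rule holds_cong) (use fx in auto)
      also have "\<dots> = holds M \<phi> (e(v := x))" by (rule holds_Aut[OF wf AutOver_Aut[OF \<rho>]])
      finally have "\<rho> x \<in> {y. holds M \<phi> (e(v := y))}" using x(2) by simp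
      moreover have "y = \<tau> (\<rho> x)" using AutOver_inv_comp[OF \<tau>A] by (simp add: \<rho>_def \<sigma>(2))
      ultimately show "y \<in> (\<Union>\<tau>\<in>\<Sigma>. \<tau> ` {y. holds M \<phi> (e(v := y))})" using \<tau>(1) by blast
    qed
    then have "finite {\<sigma> x | \<sigma>. \<sigma> \<in> AutOver M A}"
      by (rule finite_subset) (use \<Sigma>(2) x(3) in blast)
    then show "x \<in> acl M A" by (rule acl_if_finite_orbit[OF A])
  qed
qed (rule acl_super)

end

section \<open>Independence\<close>

locale star_type = monster_type T M \<kappa> B p + star_independence M \<kappa> indep
  for T :: "('s, 'f, 'r) fm set" and M :: "('s, 'f, 'r, 'a) fo_struct" and \<kappa> :: "'k rel"
    and B :: "'a set" and p :: "('s, 'f, 'r, 'i, 'a) pfm set"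
    and indep :: "'a set \<Rightarrow> 'a set \<Rightarrow> 'a set \<Rightarrow> bool"
begin

text \<open>Monotonicity is obtained from finite character, as finite parts of a subset are finite
  parts of the whole.\<close>

lemma indep_mono:
  assumes "indep A C D" "A' \<subseteq> A" "D' \<subseteq> D" "small \<kappa> A" "small \<kappa> C" "small \<kappa> D"
  shows "indep A' C D'"
proof -
  have "\<forall>a d. finite a \<and> a \<subseteq> A \<and> finite d \<and> d \<subseteq> D \<longrightarrow> indep a C d"
    by (rule iffD1[OF finite_character[OF assms(4-6)] assms(1)])
  then have "\<forall>a d. finite a \<and> a \<subseteq> A' \<and> finite d \<and> d \<subseteq> D' \<longrightarrow> indep a C d" using assms(2,3) by (meson order_trans)
  then show ?thesis by (rule iffD2[OF finite_character[OF small_mono[OF assms(4,2)] assms(5) small_mono[OF assms(6,3)]]])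
qed

lemma indep_exists:
  assumes "small \<kappa> A" "small \<kappa> C" "C' \<subseteq> C"
  shows "\<exists>\<sigma>\<in>AutOver M C'. indep (\<sigma> ` A) C' C"
proof -
  obtain A' h where A': "indep A' C' C" "elementary_on M (C' \<union> A) h" "\<forall>x\<in>C'. h x = x" "h ` A = A'"
    using extension[OF assms] unfolding same_type_def by blast
  have "small \<kappa> (C' \<union> A)" by (rule small_Un[OF small_mono[OF assms(2,3)] assms(1)])
  then obtain \<sigma> where \<sigma>: "\<sigma> \<in> Aut M" "\<forall>x\<in>C' \<union> A. \<sigma> x = h x" using homogeneous A'(2) by blast
  then have "\<sigma> \<in> AutOver M C'" using A'(3) by (simp add: AutOver_def)
  moreover have "\<sigma> ` A = A'" using \<sigma>(2) A'(4) by force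
  ultimately show ?thesis using A'(1) by blast
qed

lemma G_image_B: "\<sigma> \<in> G \<Longrightarrow> \<sigma> ` B = B"
  by (auto simp: AutOver_def)

lemma indep_G: "\<sigma> \<in> G \<Longrightarrow> small \<kappa> X \<Longrightarrow> small \<kappa> Y \<Longrightarrow> indep (\<sigma> ` X) B (\<sigma> ` Y) \<longleftrightarrow> indep X B Y"
  using invariant[of X B Y \<sigma>] small_B by (simp add: G_image_B AutOver_Aut)

lemma indep_exists_G:
  assumes "small \<kappa> A" "small \<kappa> C"
  shows "\<exists>\<sigma>\<in>G. indep (\<sigma> ` A) B C"
proof -
  obtain \<sigma> where \<sigma>: "\<sigma> \<in> G" "indep (\<sigma> ` A) B (B \<union> C)"
    using indep_exists[OF assms(1) small_Un[OF small_B assms(2)], of B] by blast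
  then have "indep (\<sigma> ` A) B C"
    by (intro indep_mono[OF \<sigma>(2)]) (use assms in \<open>auto intro: small_image small_Un small_B\<close>)
  with \<sigma>(1) show ?thesis by blast
qed

text \<open>Extension makes a conjugate of \<open>X\<close> independent from the empty set;
  invariance moves it back.\<close>

lemma indep_empty: "small \<kappa> X \<Longrightarrow> indep X B {}"
proof -
  assume X: "small \<kappa> X"
  obtain \<sigma> where \<sigma>: "\<sigma> \<in> G" "indep (\<sigma> ` X) B {}" using indep_exists_G[OF X small_finite[of "{}"]] by blast
  then show ?thesis using indep_G[OF \<sigma>(1) X small_finite[of "{}"]] by simp
qed

lemma indep_sym: "small \<kappa> X \<Longrightarrow> small \<kappa> Y \<Longrightarrow> indep X B Y \<longleftrightarrow> indep Y B X"
  by (rule symmetry[OF _ small_B])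

text \<open>The independence of \<open>Z\<close> is moved to the base \<open>B \<union> Y\<close>,
  turned around by symmetry there, and joined by transitivity with the independence of
  \<open>X\<close> from \<open>Y\<close>.\<close>

lemma indep_three:
  assumes "small \<kappa> X" "small \<kappa> Y" "small \<kappa> Z" "indep X B Y" "indep Z B (X \<union> Y)"
  shows "indep X B (Y \<union> Z)"
proof -
  note s = assms(1-3) small_B
  have "indep Z B (acl M (X \<union> Y \<union> B))" by (rule normality[OF s(3,4) small_Un[OF s(1,2)] assms(5)])
  then have "indep Z B (X \<union> Y \<union> B)"
    by (rule indep_mono) (use acl_super[of "X \<union> Y \<union> B"] in \<open>auto intro: small_acl small_Un s\<close>)
  then have "indep Z (B \<union> Y) (X \<union> Y \<union> B)"
    using transitivity[of Z "X \<union> Y \<union> B" B "B \<union> Y"] by (auto intro: small_Un s)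
  then have "indep (X \<union> Y \<union> B) (B \<union> Y) Z"
    using symmetry[of Z "B \<union> Y" "X \<union> Y \<union> B"] by (auto intro: small_Un s)
  then have "indep X (B \<union> Y) Z" by (rule indep_mono) (auto intro: small_Un s)
  then have "indep X (B \<union> Y) (acl M (Z \<union> (B \<union> Y)))" by (intro normality) (auto intro: small_Un s)
  then have 1: "indep X (B \<union> Y) (B \<union> Y \<union> Z)"
    by (rule indep_mono) (use acl_super[of "Z \<union> (B \<union> Y)"] in \<open>auto intro: small_acl small_Un s\<close>)
  have "indep X B (acl M (Y \<union> B))" by (rule normality[OF s(1,4,2) assms(4)])
  then have 2: "indep X B (B \<union> Y)"
    by (rule indep_mono) (use acl_super[of "Y \<union> B"] in \<open>auto intro: small_acl small_Un s\<close>)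
  have "indep X B (B \<union> Y \<union> Z)"
    using transitivity[of X "B \<union> Y \<union> Z" B "B \<union> Y"] 1 2 by (auto intro: small_Un s)
  then show ?thesis by (rule indep_mono) (auto intro: small_Un s)
qed

section \<open>Simplices\<close>

text \<open>The possible objects of a simplex at a singleton.\<close>

definition VX :: "'a set set" where
  "VX = {acl M (B \<union> range b) | b. b \<in> P}"

lemma VX_small: "X \<in> VX \<Longrightarrow> small \<kappa> X"
  unfolding VX_def by (auto intro!: small_acl small_Un small_B small_image small_I)

lemma VX_acl: "X \<in> VX \<Longrightarrow> acl M X = X"
  unfolding VX_def by (auto simp: acl_idem small_Un small_B small_image small_I)

lemma VX_B: "X \<in> VX \<Longrightarrow> B \<subseteq> X"
  unfolding VX_def using acl_super by blast

lemma VX_nonempty: "\<exists>X. X \<in> VX"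
  unfolding VX_def using P_nonempty by blast

lemma VX_G: "X \<in> VX \<Longrightarrow> \<sigma> \<in> G \<Longrightarrow> \<sigma> ` X \<in> VX"
proof -
  assume "X \<in> VX" and \<sigma>: "\<sigma> \<in> G"
  then obtain b where b: "b \<in> P" "X = acl M (B \<union> range b)" unfolding VX_def by blast
  have "\<sigma> ` X = acl M (\<sigma> ` (B \<union> range b))" unfolding b(2) by (rule acl_Aut[OF AutOver_Aut[OF \<sigma>]])
  also have "\<sigma> ` (B \<union> range b) = B \<union> range (\<sigma> \<circ> b)" using G_image_B[OF \<sigma>] by (auto simp: image_Un image_comp)
  finally show ?thesis unfolding VX_def using P_Aut[OF b(1) \<sigma>] by blast
qed

lemma VX_indep:
  assumes "small \<kappa> C"
  obtains Z where "Z \<in> VX" "indep Z B C"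
proof -
  obtain X where X: "X \<in> VX" using VX_nonempty by blast
  obtain \<sigma> where "\<sigma> \<in> G" "indep (\<sigma> ` X) B C" using indep_exists_G[OF VX_small[OF X] assms] by blast
  then show thesis using that VX_G[OF X] by blast
qed

text \<open>The empty face must have the value \<open>B\<close>, which the closure of an empty union
  need not be.\<close>

definition cl :: "(nat \<Rightarrow> 'a set) \<Rightarrow> nat set \<Rightarrow> 'a set" where
  "cl W u = (if u = {} then B else acl M (\<Union>i\<in>u. W i))"

text \<open>Every simplex is obtained from sets \<open>W i\<close> inside the structure by pulling the closure of
  \<open>\<Union>i\<in>u. W i\<close> back along an automorphism \<open>\<gamma> u\<close>.\<close>

definition mk :: "nat set \<Rightarrow> (nat \<Rightarrow> 'a set) \<Rightarrow> (nat set \<Rightarrow> 'a \<Rightarrow> 'a) \<Rightarrow> 'a simplex" where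
  "mk s W \<gamma> = \<lparr>verts = s, obj = restrict (\<lambda>u. Hilbert_Choice.inv (\<gamma> u) ` cl W u) (Pow s),
     mor = (\<lambda>u v. if u \<subseteq> v \<and> v \<subseteq> s
       then restrict (\<lambda>x. Hilbert_Choice.inv (\<gamma> v) (\<gamma> u x)) (Hilbert_Choice.inv (\<gamma> u) ` cl W u) else undefined)\<rparr>"

definition valid :: "nat set \<Rightarrow> (nat \<Rightarrow> 'a set) \<Rightarrow> (nat set \<Rightarrow> 'a \<Rightarrow> 'a) \<Rightarrow> bool" where
  "valid s W \<gamma> \<longleftrightarrow> finite s \<and> (\<forall>i\<in>s. W i \<in> VX) \<and> indep_family indep B s W \<and> (\<forall>u\<subseteq>s. \<gamma> u \<in> G)"

lemma mk_sel: "verts (mk s W \<gamma>) = s"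
  "u \<subseteq> s \<Longrightarrow> obj (mk s W \<gamma>) u = Hilbert_Choice.inv (\<gamma> u) ` cl W u"
  "u \<subseteq> v \<Longrightarrow> v \<subseteq> s \<Longrightarrow> mor (mk s W \<gamma>) u v =
     restrict (\<lambda>x. Hilbert_Choice.inv (\<gamma> v) (\<gamma> u x)) (Hilbert_Choice.inv (\<gamma> u) ` cl W u)"
  by (simp_all add: mk_def)

lemma cl_one: "W i \<in> VX \<Longrightarrow> cl W {i} = W i"
  by (simp add: cl_def VX_acl)

lemma cl_small: "finite u \<Longrightarrow> (\<And>i. i \<in> u \<Longrightarrow> W i \<in> VX) \<Longrightarrow> small \<kappa> (cl W u)"
proof -
  assume u: "finite u" "\<And>i. i \<in> u \<Longrightarrow> W i \<in> VX"
  have "small \<kappa> (\<Union>i\<in>u. W i)" using u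
    by (induction u rule: finite_induct) (auto intro: small_finite small_Un VX_small)
  then show ?thesis by (simp add: cl_def small_B small_acl)
qed

lemma cl_mono: "u \<subseteq> v \<Longrightarrow> (\<And>i. i \<in> v \<Longrightarrow> W i \<in> VX) \<Longrightarrow> cl W u \<subseteq> cl W v"
proof (cases "u = {}")
  case True
  assume v: "u \<subseteq> v" "\<And>i. i \<in> v \<Longrightarrow> W i \<in> VX"
  show ?thesis
  proof (cases "v = {}")
    case False
    then obtain i where i: "i \<in> v" by blast
    have "B \<subseteq> W i" by (rule VX_B[OF v(2)[OF i]])
    also have "W i \<subseteq> (\<Union>i\<in>v. W i)" using i by blast
    also have "\<dots> \<subseteq> acl M (\<Union>i\<in>v. W i)" by (rule acl_super)
    finally show ?thesis using True False by (simp add: cl_def)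
  qed (simp add: True)
next
  case False
  assume "u \<subseteq> v"
  then have "acl M (\<Union>i\<in>u. W i) \<subseteq> acl M (\<Union>i\<in>v. W i)" by (intro acl_mono) blast
  then show ?thesis using False \<open>u \<subseteq> v\<close> by (auto simp: cl_def)
qed

lemma cl_B: "(\<And>i. i \<in> u \<Longrightarrow> W i \<in> VX) \<Longrightarrow> B \<subseteq> cl W u"
  using cl_mono[of "{}" u W] by (simp add: cl_def)

lemma cl_cong: "(\<And>i. i \<in> u \<Longrightarrow> W i = W' i) \<Longrightarrow> cl W u = cl W' u"
  by (simp add: cl_def)

lemma cl_image: "\<sigma> \<in> G \<Longrightarrow> cl (\<lambda>i. \<sigma> ` W i) u = \<sigma> ` cl W u"
  using acl_Aut[OF AutOver_Aut, of \<sigma> B "\<Union>i\<in>u. W i"] by (auto simp: cl_def G_image_B image_UN)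

section \<open>Simplices as configurations in the structure\<close>

lemma elementary_on_Aut:
  assumes "\<sigma> \<in> Aut M" "\<And>x. x \<in> X \<Longrightarrow> h x = \<sigma> x"
  shows "elementary_on M X h"
  unfolding elementary_on_def
proof (intro allI impI)
  fix \<phi> :: "('s, 'f, 'r) fm" and e assume e: "e ` fv \<phi> \<subseteq> X"
  have "holds M \<phi> (h \<circ> e) = holds M \<phi> (\<sigma> \<circ> e)"
    by (rule holds_cong) (use e assms(2) in auto)
  then show "holds M \<phi> e = holds M \<phi> (h \<circ> e)" using holds_Aut[OF wf assms(1)] by simp
qed

lemma indep_family_image:
  assumes "\<sigma> \<in> G" "finite s" "\<And>i. i \<in> s \<Longrightarrow> small \<kappa> (W i)" "indep_family indep B s W" "u \<subseteq> s"
  shows "indep_family indep B u (\<lambda>i. \<sigma> ` W i)"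
  unfolding indep_family_def
proof
  fix i assume i: "i \<in> u"
  have small: "small \<kappa> (\<Union>j\<in>t. W j)" if "t \<subseteq> s" for t
    using finite_subset[OF that assms(2)] that
    by (induction t rule: finite_induct) (auto intro: small_finite small_Un assms(3))
  have "indep (W i) B (\<Union>j\<in>s - {i}. W j)" using assms(4,5) i unfolding indep_family_def by blast
  then have "indep (W i) B (\<Union>j\<in>u - {i}. W j)"
    by (rule indep_mono) (use assms(3,5) i small small_B in auto)
  then have "indep (\<sigma> ` W i) B (\<sigma> ` (\<Union>j\<in>u - {i}. W j))"
    using indep_G[OF assms(1) assms(3) small[of "u - {i}"]] i assms(5) by blast
  then show "indep (\<sigma> ` W i) B (\<Union>j\<in>u - {i}. \<sigma> ` W j)" by (simp add: image_UN)
qed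

text \<open>The transition maps are quotients of the automorphisms \<open>\<gamma> u\<close>, so
  functoriality is a cancellation, and elementarity is inherited from automorphisms.\<close>

lemma mk_simplex:
  assumes v: "valid s W \<gamma>" and "card s = n + 1"
  shows "mk s W \<gamma> \<in> simplices M \<kappa> indep B p n"
proof -
  let ?f = "mk s W \<gamma>"
  have s: "finite s" and W: "\<And>i. i \<in> s \<Longrightarrow> W i \<in> VX" and ind: "indep_family indep B s W"
    and \<gamma>: "\<And>u. u \<subseteq> s \<Longrightarrow> \<gamma> u \<in> G" using v unfolding valid_def by auto
  have cancel: "\<gamma> u (Hilbert_Choice.inv (\<gamma> u) x) = x" "Hilbert_Choice.inv (\<gamma> u) (\<gamma> u x) = x" if "u \<subseteq> s" for u x
    using AutOver_inv_comp[OF \<gamma>[OF that]] by auto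
  have B\<gamma>: "\<gamma> u x = x" "Hilbert_Choice.inv (\<gamma> u) x = x" if "u \<subseteq> s" "x \<in> B" for u x
    using \<gamma>[OF that(1)] AutOver_inv[OF \<gamma>[OF that(1)]] that(2) by (auto simp: AutOver_def)
  have clB: "B \<subseteq> cl W u" if "u \<subseteq> s" for u by (rule cl_B) (use W that in blast)
  have BO: "B \<subseteq> Hilbert_Choice.inv (\<gamma> u) ` cl W u" if "u \<subseteq> s" for u
    using B\<gamma>(2)[OF that] clB[OF that] by force
  have mor: "mor ?f u v x = Hilbert_Choice.inv (\<gamma> v) (\<gamma> u x)" if "u \<subseteq> v" "v \<subseteq> s" "x \<in> obj ?f u" for u v x
    using that mk_sel(2)[of u s] by (simp add: mk_sel(3))
  have sv: "u \<subseteq> s" if "u \<subseteq> v" "v \<subseteq> s" for u v using that by blast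
  have mor_in: "Hilbert_Choice.inv (\<gamma> v) (\<gamma> u x) \<in> obj ?f v" if uv: "u \<subseteq> v" "v \<subseteq> s" and x: "x \<in> obj ?f u" for u v x
  proof -
    have "\<gamma> u x \<in> cl W u" using x sv[OF uv] cancel by (auto simp: mk_sel(2))
    then have "\<gamma> u x \<in> cl W v" using cl_mono[OF uv(1), of W] W uv(2) by blast
    then show ?thesis using uv(2) by (simp add: mk_sel(2))
  qed
  have vi: "vertex_image ?f u i = Hilbert_Choice.inv (\<gamma> u) ` W i" if "u \<subseteq> s" "i \<in> u" for u i
  proof -
    have i: "{i} \<subseteq> u" "{i} \<subseteq> s" using that by auto
    have "vertex_image ?f u i = (\<lambda>x. Hilbert_Choice.inv (\<gamma> u) (\<gamma> {i} x)) ` Hilbert_Choice.inv (\<gamma> {i}) ` cl W {i}"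
      unfolding vertex_image_def mk_sel(2)[OF i(2)] mk_sel(3)[OF i(1) that(1)] by (rule image_cong) auto
    also have "\<dots> = Hilbert_Choice.inv (\<gamma> u) ` cl W {i}" using cancel(1)[OF i(2)] by (simp add: image_image)
    also have "cl W {i} = W i" using W i(2) by (intro cl_one) auto
    finally show ?thesis .
  qed
  have "is_functor M \<kappa> B ?f"
    unfolding is_functor_def mk_sel(1)
  proof (intro conjI allI impI ballI)
    show "obj ?f \<in> extensional (Pow s)" by (simp add: mk_def)
    show "mor ?f u v = undefined" if "\<not> (u \<subseteq> v \<and> v \<subseteq> s)" for u v unfolding mk_def simplex.simps by (rule if_not_P[OF that])
    show "small \<kappa> (obj ?f u)" if "u \<subseteq> s" for u
      unfolding mk_sel(2)[OF that] by (intro small_image cl_small) (use s W that finite_subset in auto)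
    show "B \<subseteq> obj ?f u" if "u \<subseteq> s" for u unfolding mk_sel(2)[OF that] by (rule BO[OF that])
    show "is_morphism M B (obj ?f u) (obj ?f v) (mor ?f u v)" if "u \<subseteq> v \<and> v \<subseteq> s" for u v
    proof -
      have uv: "u \<subseteq> v" "v \<subseteq> s" "u \<subseteq> s" using that by auto
      show ?thesis
        unfolding is_morphism_def
      proof (intro conjI ballI)
        show "mor ?f u v \<in> extensional (obj ?f u)" using uv by (simp add: mk_sel)
        show "mor ?f u v ` obj ?f u \<subseteq> obj ?f v" using mor[OF uv(1,2)] mor_in[OF uv(1,2)] by auto
        have "Hilbert_Choice.inv (\<gamma> v) \<circ> \<gamma> u \<in> Aut M"
          using AutOver_comp[OF AutOver_inv[OF \<gamma>[OF uv(2)]] \<gamma>[OF uv(3)]] by (rule AutOver_Aut)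
        then show "elementary_on M (obj ?f u) (mor ?f u v)"
          by (rule elementary_on_Aut) (simp add: mor[OF uv(1,2)])
        show "mor ?f u v x = x" if "x \<in> B" for x
          using mor[OF uv(1,2), of x] BO[OF uv(3)] that B\<gamma> uv by (auto simp: mk_sel(2))
      qed
    qed
    show "mor ?f u u x = x" if "u \<subseteq> s" "x \<in> obj ?f u" for u x
      using mor[OF order_refl that] cancel(2)[OF that(1)] by simp
    show "mor ?f u w x = mor ?f v w (mor ?f u v x)" if "u \<subseteq> v \<and> v \<subseteq> w \<and> w \<subseteq> s" "x \<in> obj ?f u" for u v w x
    proof -
      have uv: "u \<subseteq> v" "v \<subseteq> s" "v \<subseteq> w" "w \<subseteq> s" "u \<subseteq> w" using that by auto
      show ?thesis
        unfolding mor[OF uv(1,2) that(2)] mor[OF uv(5,4) that(2)] mor[OF uv(3,4) mor_in[OF uv(1,2) that(2)]]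
        using cancel(1)[OF uv(2)] by simp
    qed
  qed
  moreover have "obj ?f {} = B"
    using B\<gamma>(2)[of "{}"] by (force simp: mk_sel(2) cl_def)
  moreover have "\<exists>b\<in>P. obj ?f {i} = acl M (B \<union> range b)" if "i \<in> s" for i
  proof -
    have i: "{i} \<subseteq> s" using that by simp
    have "Hilbert_Choice.inv (\<gamma> {i}) ` W i \<in> VX" by (rule VX_G[OF W[OF that] AutOver_inv[OF \<gamma>[OF i]]])
    then show ?thesis using cl_one[of W i, OF W[OF that]] i unfolding VX_def by (simp add: mk_sel(2)) blast
  qed
  moreover have "obj ?f u = acl M (\<Union>i\<in>u. vertex_image ?f u i) \<and> indep_family indep B u (vertex_image ?f u)"
    if u: "u \<subseteq> s" "u \<noteq> {}" for u
  proof
    have "(\<Union>i\<in>u. vertex_image ?f u i) = Hilbert_Choice.inv (\<gamma> u) ` (\<Union>i\<in>u. W i)" using vi[OF u(1)] by (simp add: image_UN)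
    then show "obj ?f u = acl M (\<Union>i\<in>u. vertex_image ?f u i)"
      using acl_Aut[OF AutOver_Aut[OF AutOver_inv[OF \<gamma>[OF u(1)]]]] u by (simp add: mk_sel(2) cl_def)
    have "indep_family indep B u (\<lambda>i. Hilbert_Choice.inv (\<gamma> u) ` W i)"
      by (rule indep_family_image[OF AutOver_inv[OF \<gamma>[OF u(1)]] s _ ind u(1)]) (use W VX_small in blast)
    then show "indep_family indep B u (vertex_image ?f u)"
      using vi[OF u(1)] unfolding indep_family_def by simp
  qed
  ultimately show ?thesis
    unfolding simplices_def using s assms(2) by (simp add: mk_sel(1))
qed

text \<open>The maps into the top object extend to automorphisms \<open>\<gamma> u\<close> by
  homogeneity, and the images of the vertices in the top object serve as the sets
  \<open>W i\<close>.\<close>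

lemma simplex_repr:
  assumes f: "f \<in> simplices M \<kappa> indep B p n"
  shows "\<exists>W \<gamma>. valid (verts f) W \<gamma> \<and> f = mk (verts f) W \<gamma>"
proof -
  let ?s = "verts f"
  have s: "finite ?s" "card ?s = n + 1" and F: "is_functor M \<kappa> B f" and f0: "obj f {} = B"
    and f1: "\<And>i. i \<in> ?s \<Longrightarrow> \<exists>b\<in>P. obj f {i} = acl M (B \<union> range b)"
    and fu: "\<And>u. u \<subseteq> ?s \<Longrightarrow> u \<noteq> {} \<Longrightarrow> obj f u = acl M (\<Union>i\<in>u. vertex_image f u i)"
    and fi: "\<And>u. u \<subseteq> ?s \<Longrightarrow> u \<noteq> {} \<Longrightarrow> indep_family indep B u (vertex_image f u)"
    using f unfolding simplices_def by auto
  have smallo: "\<And>u. u \<subseteq> ?s \<Longrightarrow> small \<kappa> (obj f u)" and Bo: "\<And>u. u \<subseteq> ?s \<Longrightarrow> B \<subseteq> obj f u"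
    and mo: "\<And>u v. u \<subseteq> v \<Longrightarrow> v \<subseteq> ?s \<Longrightarrow> is_morphism M B (obj f u) (obj f v) (mor f u v)"
    and ext: "obj f \<in> extensional (Pow ?s)" and und: "\<And>u v. \<not> (u \<subseteq> v \<and> v \<subseteq> ?s) \<Longrightarrow> mor f u v = undefined"
    and comp: "\<And>u v w x. u \<subseteq> v \<Longrightarrow> v \<subseteq> w \<Longrightarrow> w \<subseteq> ?s \<Longrightarrow> x \<in> obj f u \<Longrightarrow> mor f u w x = mor f v w (mor f u v x)"
    using F unfolding is_functor_def by auto
  have "\<forall>u. u \<subseteq> ?s \<longrightarrow> (\<exists>\<sigma>. \<sigma> \<in> G \<and> (\<forall>x\<in>obj f u. \<sigma> x = mor f u ?s x))"
  proof (intro allI impI)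
    fix u assume u: "u \<subseteq> ?s"
    have m: "elementary_on M (obj f u) (mor f u ?s)" "\<forall>x\<in>B. mor f u ?s x = x"
      using mo[OF u order_refl] unfolding is_morphism_def by auto
    obtain \<sigma> where \<sigma>: "\<sigma> \<in> Aut M" "\<forall>x\<in>obj f u. \<sigma> x = mor f u ?s x" using homogeneous[OF smallo[OF u] m(1)] by blast
    then have "\<sigma> \<in> G" using m(2) Bo[OF u] by (auto simp: AutOver_def)
    with \<sigma>(2) show "\<exists>\<sigma>. \<sigma> \<in> G \<and> (\<forall>x\<in>obj f u. \<sigma> x = mor f u ?s x)" by blast
  qed
  then obtain \<gamma> where \<gamma>: "\<And>u. u \<subseteq> ?s \<Longrightarrow> \<gamma> u \<in> G" "\<And>u x. u \<subseteq> ?s \<Longrightarrow> x \<in> obj f u \<Longrightarrow> \<gamma> u x = mor f u ?s x"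
    by metis
  define W where "W = vertex_image f ?s"
  have W_eq: "W i = \<gamma> {i} ` obj f {i}" if "i \<in> ?s" for i
    unfolding W_def vertex_image_def using \<gamma>(2)[of "{i}"] that by (intro image_cong) auto
  have W: "W i \<in> VX" if "i \<in> ?s" for i
  proof -
    have "obj f {i} \<in> VX" using f1[OF that] unfolding VX_def by blast
    then show ?thesis unfolding W_eq[OF that] using \<gamma>(1) that by (intro VX_G) auto
  qed
  have "?s \<noteq> {}" using s(2) by auto
  then have "valid ?s W \<gamma>" unfolding valid_def W_def[symmetric] using s(1) W \<gamma>(1) fi[OF order_refl] by (auto simp: W_def)
  moreover have "f = mk ?s W \<gamma>"
  proof -
    have img: "\<gamma> u ` obj f u = cl W u" if u: "u \<subseteq> ?s" for u
    proof (cases "u = {}")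
      case True
      then show ?thesis using f0 G_image_B[OF \<gamma>(1)[OF u]] by (simp add: cl_def)
    next
      case False
      have "\<gamma> u ` vertex_image f u i = W i" if i: "i \<in> u" for i
      proof -
        have iu: "{i} \<subseteq> u" "{i} \<subseteq> ?s" using i u by auto
        have "\<gamma> u (mor f {i} u x) = mor f {i} ?s x" if x: "x \<in> obj f {i}" for x
        proof -
          have "mor f {i} u x \<in> obj f u" using mo[OF iu(1) u] x unfolding is_morphism_def by blast
          then show ?thesis using \<gamma>(2)[OF u] comp[OF iu(1) u order_refl x] by simp
        qed
        then show ?thesis unfolding W_def vertex_image_def image_image by (intro image_cong) auto
      qed
      then have "\<gamma> u ` (\<Union>i\<in>u. vertex_image f u i) = (\<Union>i\<in>u. W i)" by (simp add: image_UN)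
      then show ?thesis using fu[OF u False] acl_Aut[OF AutOver_Aut[OF \<gamma>(1)[OF u]]] False by (simp add: cl_def)
    qed
    have obj: "obj f u = Hilbert_Choice.inv (\<gamma> u) ` cl W u" if "u \<subseteq> ?s" for u
      unfolding img[OF that, symmetric] using AutOver_inv_comp(1)[OF \<gamma>(1)[OF that]] by (simp add: image_image)
    have "obj f = obj (mk ?s W \<gamma>)"
    proof
      fix u show "obj f u = obj (mk ?s W \<gamma>) u"
        using obj ext by (cases "u \<subseteq> ?s") (auto simp: mk_def extensional_def)
    qed
    moreover have "mor f = mor (mk ?s W \<gamma>)"
    proof (intro HOL.ext)
      fix u v x
      show "mor f u v x = mor (mk ?s W \<gamma>) u v x"
      proof (cases "u \<subseteq> v \<and> v \<subseteq> ?s")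
        case True
        then have uv: "u \<subseteq> v" "v \<subseteq> ?s" "u \<subseteq> ?s" by auto
        show ?thesis
        proof (cases "x \<in> obj f u")
          case True
          have "mor f u v x \<in> obj f v" using mo[OF uv(1,2)] True unfolding is_morphism_def by blast
          then have "\<gamma> v (mor f u v x) = \<gamma> u x" using \<gamma>(2) uv True comp[OF uv(1,2) order_refl True] by simp
          then have "mor f u v x = Hilbert_Choice.inv (\<gamma> v) (\<gamma> u x)" using AutOver_inv_comp(1)[OF \<gamma>(1)[OF uv(2)]] by metis
          then show ?thesis using True obj[OF uv(3)] by (simp add: mk_sel(3)[OF uv(1,2)])
        next
          case False
          then show ?thesis using mo[OF uv(1,2)] obj[OF uv(3)] unfolding is_morphism_def
            by (simp add: mk_sel(3)[OF uv(1,2)] extensional_def)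
        qed
      next
        case False
        show ?thesis unfolding und[OF False] mk_def simplex.simps if_not_P[OF False] ..
      qed
    qed
    ultimately show ?thesis by (intro simplex.equality) (simp_all add: mk_sel(1))
  qed
  ultimately show ?thesis by blast
qed

text \<open>This is why \<open>W\<close> and \<open>\<gamma>\<close> are total functions: all faces
  of a simplex share them unchanged.\<close>

lemma face_mk: "face i (mk s W \<gamma>) = mk (s - {sorted_list_of_set s ! i}) W \<gamma>"
  unfolding face_def Let_def mk_def by (auto simp: fun_eq_iff restrict_def)

lemma valid_subset: "valid s W \<gamma> \<Longrightarrow> t \<subseteq> s \<Longrightarrow> valid t W \<gamma>"
proof -
  assume v: "valid s W \<gamma>" and t: "t \<subseteq> s"
  then have "indep_family indep B t (\<lambda>i. id ` W i)"
    unfolding valid_def by (intro indep_family_image[of id s]) (auto intro: VX_small)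
  then show ?thesis using v t unfolding valid_def by (auto intro: finite_subset)
qed

text \<open>Only quotients of the automorphisms and pulled back closures enter a simplex, so moving
  the whole configuration changes nothing.\<close>

lemma mk_shift:
  assumes "\<tau> \<in> G" "\<And>u. u \<subseteq> s \<Longrightarrow> \<gamma> u \<in> G"
  shows "mk s (\<lambda>i. \<tau> ` W i) (\<lambda>u. \<tau> \<circ> \<gamma> u) = mk s W \<gamma>"
proof -
  have inv: "Hilbert_Choice.inv (\<tau> \<circ> \<gamma> u) (\<tau> y) = Hilbert_Choice.inv (\<gamma> u) y" if "u \<subseteq> s" for u y
    using o_inv_distrib[OF AutOver_bij[OF assms(1)] AutOver_bij[OF assms(2)[OF that]]] AutOver_inv_comp(1)[OF assms(1)] by simp
  have obj: "Hilbert_Choice.inv (\<tau> \<circ> \<gamma> u) ` cl (\<lambda>i. \<tau> ` W i) u = Hilbert_Choice.inv (\<gamma> u) ` cl W u" if "u \<subseteq> s" for u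
    unfolding cl_image[OF assms(1)] image_image inv[OF that] ..
  show ?thesis
    unfolding mk_def simplex.iffs
  proof (intro conjI ext)
    show "restrict (\<lambda>u. Hilbert_Choice.inv (\<tau> \<circ> \<gamma> u) ` cl (\<lambda>i. \<tau> ` W i) u) (Pow s) u =
      restrict (\<lambda>u. Hilbert_Choice.inv (\<gamma> u) ` cl W u) (Pow s) u" for u
      using obj by (simp add: restrict_def)
    fix u v x
    show "(if u \<subseteq> v \<and> v \<subseteq> s then restrict (\<lambda>x. Hilbert_Choice.inv (\<tau> \<circ> \<gamma> v) ((\<tau> \<circ> \<gamma> u) x))
        (Hilbert_Choice.inv (\<tau> \<circ> \<gamma> u) ` cl (\<lambda>i. \<tau> ` W i) u) else undefined) x =
      (if u \<subseteq> v \<and> v \<subseteq> s then restrict (\<lambda>x. Hilbert_Choice.inv (\<gamma> v) (\<gamma> u x)) (Hilbert_Choice.inv (\<gamma> u) ` cl W u)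
        else undefined) x"
    proof (cases "u \<subseteq> v \<and> v \<subseteq> s")
      case True
      then have "u \<subseteq> s" "v \<subseteq> s" by auto
      then show ?thesis using True obj[of u] inv[of v] by simp
    qed (simp only: if_False)
  qed (rule refl)+
qed

text \<open>Outside the object at \<open>u\<close> the automorphism \<open>\<gamma> u\<close> is
  invisible. In this way an automorphism that fixes a vertex pointwise is absorbed.\<close>

lemma mk_cong:
  assumes W: "\<And>i. i \<in> s \<Longrightarrow> W i = W' i" "\<And>i. i \<in> s \<Longrightarrow> W i \<in> VX"
    and \<gamma>: "\<And>u. u \<subseteq> s \<Longrightarrow> \<gamma> u \<in> G" "\<And>u. u \<subseteq> s \<Longrightarrow> \<gamma>' u \<in> G"
    and eq: "\<And>u x. u \<subseteq> s \<Longrightarrow> x \<in> Hilbert_Choice.inv (\<gamma> u) ` cl W u \<Longrightarrow> \<gamma>' u x = \<gamma> u x"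
  shows "mk s W \<gamma> = mk s W' \<gamma>'"
proof -
  have cl: "cl W u = cl W' u" if "u \<subseteq> s" for u using W(1) that by (intro cl_cong) blast
  have inv: "Hilbert_Choice.inv (\<gamma>' u) y = Hilbert_Choice.inv (\<gamma> u) y" if u: "u \<subseteq> s" and y: "y \<in> cl W u" for u y
  proof -
    have "\<gamma>' u (Hilbert_Choice.inv (\<gamma> u) y) = y"
      using eq[OF u, of "Hilbert_Choice.inv (\<gamma> u) y"] y AutOver_inv_comp(2)[OF \<gamma>(1)[OF u]] by simp
    then show ?thesis using AutOver_inv_comp(1)[OF \<gamma>(2)[OF u]] by metis
  qed
  have obj: "Hilbert_Choice.inv (\<gamma> u) ` cl W u = Hilbert_Choice.inv (\<gamma>' u) ` cl W' u" if "u \<subseteq> s" for u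
    unfolding cl[OF that, symmetric] using inv[OF that] by (intro image_cong) auto
  show ?thesis
    unfolding mk_def simplex.iffs
  proof (intro conjI ext)
    show "restrict (\<lambda>u. Hilbert_Choice.inv (\<gamma> u) ` cl W u) (Pow s) u = restrict (\<lambda>u. Hilbert_Choice.inv (\<gamma>' u) ` cl W' u) (Pow s) u" for u
      using obj by (simp add: restrict_def)
    fix u v x
    show "(if u \<subseteq> v \<and> v \<subseteq> s then restrict (\<lambda>x. Hilbert_Choice.inv (\<gamma> v) (\<gamma> u x)) (Hilbert_Choice.inv (\<gamma> u) ` cl W u)
        else undefined) x =
      (if u \<subseteq> v \<and> v \<subseteq> s then restrict (\<lambda>x. Hilbert_Choice.inv (\<gamma>' v) (\<gamma>' u x)) (Hilbert_Choice.inv (\<gamma>' u) ` cl W' u)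
        else undefined) x"
    proof (cases "u \<subseteq> v \<and> v \<subseteq> s")
      case True
      then have uv: "u \<subseteq> v" "u \<subseteq> s" "v \<subseteq> s" by auto
      have "Hilbert_Choice.inv (\<gamma> v) (\<gamma> u x) = Hilbert_Choice.inv (\<gamma>' v) (\<gamma>' u x)"
        if x: "x \<in> Hilbert_Choice.inv (\<gamma> u) ` cl W u"
      proof -
        have "\<gamma> u x \<in> cl W u" using x AutOver_inv_comp(2)[OF \<gamma>(1)[OF uv(2)]] by auto
        then have "\<gamma> u x \<in> cl W v" using cl_mono[OF uv(1), of W] W(2) uv(3) by blast
        then show ?thesis using inv[OF uv(3)] eq[OF uv(2) x] by simp
      qed
      then show ?thesis using True obj[OF uv(2)] by (simp add: restrict_def)
    qed (simp only: if_False)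
  qed (rule refl)+
qed

end

section \<open>Edges and triangles\<close>

context star_type
begin

section \<open>Boundaries in low dimensions\<close>

lemma boundary_two:
  assumes "i < k"
  shows "boundary (frag_of (mk {i, k} W \<gamma>)) = frag_of (mk {k} W \<gamma>) - frag_of (mk {i} W \<gamma>)"
proof -
  have "{i, k} - {i} = {k}" "{i, k} - {k} = {i}" using assms by auto
  then show ?thesis
    using assms by (simp add: boundary_def mk_sel(1) face_mk numeral_2_eq_2)
qed

lemma boundary_three:
  assumes "i < j" "j < k"
  shows "boundary (frag_of (mk {i, j, k} W \<gamma>)) =
    frag_of (mk {j, k} W \<gamma>) - frag_of (mk {i, k} W \<gamma>) + frag_of (mk {i, j} W \<gamma>)"
proof -
  have "{i, j, k} - {i} = {j, k}" "{i, j, k} - {j} = {i, k}" "{i, j, k} - {k} = {i, j}" using assms by auto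
  moreover have "card {i, j, k} = Suc (Suc (Suc 0))" using assms by simp
  ultimately show ?thesis
    using assms by (simp add: boundary_def mk_sel(1) face_mk)
qed

lemma boundary_diff: "boundary (x - y) = boundary x - boundary y"
  by (simp add: boundary_def frag_extend_diff)

definition boundaries :: "('a simplex \<Rightarrow>\<^sub>0 int) set" where
  "boundaries = boundary ` carrier (chain_group M \<kappa> indep B p 2)"

lemma boundaries_0: "0 \<in> boundaries"
  unfolding boundaries_def by (rule image_eqI[of _ _ 0]) (simp_all add: boundary_def chain_group_def)

lemma boundaries_diff: "x \<in> boundaries \<Longrightarrow> y \<in> boundaries \<Longrightarrow> x - y \<in> boundaries"
proof -
  assume "x \<in> boundaries" "y \<in> boundaries"
  then obtain c d where c: "x = boundary c" "c \<in> carrier (chain_group M \<kappa> indep B p 2)"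
    and d: "y = boundary d" "d \<in> carrier (chain_group M \<kappa> indep B p 2)" unfolding boundaries_def by (elim imageE)
  have "x - y = boundary (c - d)" using c(1) d(1) by (simp add: boundary_diff)
  moreover have "c - d \<in> carrier (chain_group M \<kappa> indep B p 2)"
    using c(2) d(2) keys_diff[of c d] by (auto simp: chain_group_def)
  ultimately show ?thesis unfolding boundaries_def by (rule image_eqI)
qed

lemma boundaries_minus: "x \<in> boundaries \<Longrightarrow> - x \<in> boundaries"
  using boundaries_diff[OF boundaries_0] by simp

lemma boundaries_add: "x \<in> boundaries \<Longrightarrow> y \<in> boundaries \<Longrightarrow> x + y \<in> boundaries"
  using boundaries_diff[of x "- y"] boundaries_minus[of y] by simp

lemma mk_simplex_two: "i \<noteq> k \<Longrightarrow> valid {i, k} W \<gamma> \<Longrightarrow> mk {i, k} W \<gamma> \<in> simplices M \<kappa> indep B p 1"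
  by (rule mk_simplex) auto

lemma triangle:
  assumes "i < j" "j < k" "valid {i, j, k} W \<gamma>"
  shows "frag_of (mk {j, k} W \<gamma>) - frag_of (mk {i, k} W \<gamma>) + frag_of (mk {i, j} W \<gamma>) \<in> boundaries"
proof -
  have "mk {i, j, k} W \<gamma> \<in> simplices M \<kappa> indep B p 2" by (rule mk_simplex) (use assms in auto)
  then have "frag_of (mk {i, j, k} W \<gamma>) \<in> carrier (chain_group M \<kappa> indep B p 2)" by (simp add: chain_group_def)
  then show ?thesis unfolding boundaries_def boundary_three[OF assms(1,2), symmetric] by (rule imageI)
qed

text \<open>The value at the empty set is free, since every member of \<open>G\<close> is the
  identity on \<open>B\<close>.\<close>

lemma mk_cong_valid:
  assumes "valid s W \<gamma>" "\<And>i. i \<in> s \<Longrightarrow> W' i = W i" "\<And>u. u \<subseteq> s \<Longrightarrow> u \<noteq> {} \<Longrightarrow> \<gamma>' u = \<gamma> u" "\<gamma>' {} \<in> G"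
  shows "mk s W \<gamma> = mk s W' \<gamma>'"
proof (rule mk_cong)
  show "W i = W' i" if "i \<in> s" for i using assms(2)[OF that] by simp
  show "W i \<in> VX" if "i \<in> s" for i using assms(1) that by (simp add: valid_def)
  show \<gamma>: "\<gamma> u \<in> G" if "u \<subseteq> s" for u using assms(1) that by (simp add: valid_def)
  show "\<gamma>' u \<in> G" if "u \<subseteq> s" for u using assms(3)[OF that] assms(4) \<gamma>[OF that] by (cases "u = {}") auto
  show "\<gamma>' u x = \<gamma> u x" if u: "u \<subseteq> s" and x: "x \<in> Hilbert_Choice.inv (\<gamma> u) ` cl W u" for u x
  proof (cases "u = {}")
    case True
    have "x \<in> B" using x G_image_B[OF AutOver_inv[OF \<gamma>[OF u]]] True by (simp add: cl_def)
    then show ?thesis using \<gamma>[OF u] assms(4) True by (simp add: AutOver_def)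
  qed (simp add: assms(3)[OF u])
qed

section \<open>Normal forms of vertices and edges\<close>

definition pt :: "nat \<Rightarrow> 'a set \<Rightarrow> 'a simplex" where
  "pt i X = mk {i} (\<lambda>_. X) (\<lambda>_. id)"

text \<open>Shifting by the inverse of \<open>\<gamma> {i}\<close> makes the embedding the identity,
  so a vertex is determined by its object.\<close>

lemma mk_one:
  assumes "W i \<in> VX" "\<And>u. u \<subseteq> {i} \<Longrightarrow> \<gamma> u \<in> G"
  shows "mk {i} W \<gamma> = pt i (Hilbert_Choice.inv (\<gamma> {i}) ` W i)"
proof -
  define \<tau> where "\<tau> = Hilbert_Choice.inv (\<gamma> {i})"
  have g: "\<gamma> {i} \<in> G" by (rule assms(2)) simp
  then have \<tau>: "\<tau> \<in> G" unfolding \<tau>_def by (rule AutOver_inv)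
  have "mk {i} W \<gamma> = mk {i} (\<lambda>n. \<tau> ` W n) (\<lambda>u. \<tau> \<circ> \<gamma> u)" by (rule mk_shift[OF \<tau> assms(2), symmetric])
  also have "\<dots> = mk {i} (\<lambda>_. \<tau> ` W i) (\<lambda>_. id)"
  proof (rule mk_cong_valid)
    have V: "\<tau> ` W i \<in> VX" by (rule VX_G[OF assms(1) \<tau>])
    then show "valid {i} (\<lambda>n. \<tau> ` W n) (\<lambda>u. \<tau> \<circ> \<gamma> u)"
      unfolding valid_def indep_family_def
      using indep_empty[OF VX_small[OF V]] AutOver_comp[OF \<tau> assms(2)] by simp
    show "id = \<tau> \<circ> \<gamma> u" if "u \<subseteq> {i}" "u \<noteq> {}" for u
    proof -
      have "u = {i}" using that by auto
      then show ?thesis unfolding \<tau>_def using AutOver_inv_comp(3)[OF g] by simp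
    qed
  qed (simp_all add: AutOver_id)
  finally show ?thesis unfolding pt_def \<tau>_def .
qed

text \<open>\<open>X\<close> is the object at \<open>i\<close>, whereas \<open>Z\<close> is the
  position of the end inside the structure and its preimage under \<open>\<beta>\<close> the object
  at \<open>k\<close>. So \<open>\<alpha>\<close> can vary while both end simplices stay
  fixed.\<close>

definition edge :: "nat \<Rightarrow> 'a set \<Rightarrow> ('a \<Rightarrow> 'a) \<Rightarrow> nat \<Rightarrow> 'a set \<Rightarrow> ('a \<Rightarrow> 'a) \<Rightarrow> ('a \<Rightarrow> 'a) \<Rightarrow> 'a simplex" where
  "edge i X \<alpha> k Z \<beta> \<gamma> = mk {i, k} (\<lambda>n. if n = i then \<alpha> ` X else Z)
     (\<lambda>u. if u = {i} then \<alpha> else if u = {k} then \<beta> else \<gamma>)"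

lemma valid_two:
  assumes "i \<noteq> k" "W i \<in> VX" "W k \<in> VX" "indep (W k) B (W i)" "\<And>u. u \<subseteq> {i, k} \<Longrightarrow> \<gamma> u \<in> G"
  shows "valid {i, k} W \<gamma>"
proof -
  have "{i, k} - {i} = {k}" "{i, k} - {k} = {i}" using assms(1) by auto
  moreover have "indep (W i) B (W k)" using assms(4) indep_sym VX_small assms(2,3) by blast
  ultimately show ?thesis using assms by (simp add: valid_def indep_family_def)
qed

lemma valid_three:
  assumes "i \<noteq> j" "j \<noteq> k" "i \<noteq> k" "W i \<in> VX" "W j \<in> VX" "W k \<in> VX"
    and "indep (W j) B (W i)" "indep (W k) B (W i \<union> W j)" "\<And>u. u \<subseteq> {i, j, k} \<Longrightarrow> \<gamma> u \<in> G"
  shows "valid {i, j, k} W \<gamma>"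
proof -
  note s = VX_small[OF assms(4)] VX_small[OF assms(5)] VX_small[OF assms(6)]
  have "{i, j, k} - {i} = {j, k}" "{i, j, k} - {j} = {i, k}" "{i, j, k} - {k} = {i, j}" using assms(1-3) by auto
  moreover have "indep (W i) B (W j \<union> W k)"
    by (rule indep_three[OF s iffD1[OF indep_sym[OF s(2,1)] assms(7)] assms(8)])
  moreover have "indep (W j) B (W i \<union> W k)"
    by (rule indep_three[OF s(2,1,3) assms(7)]) (use assms(8) in \<open>simp add: Un_commute\<close>)
  ultimately show ?thesis using assms by (simp add: valid_def indep_family_def)
qed

lemma edge_valid:
  assumes "i \<noteq> k" "X \<in> VX" "Z \<in> VX" "\<alpha> \<in> G" "\<beta> \<in> G" "\<gamma> \<in> G" "indep Z B (\<alpha> ` X)"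
  shows "valid {i, k} (\<lambda>n. if n = i then \<alpha> ` X else Z) (\<lambda>u. if u = {i} then \<alpha> else if u = {k} then \<beta> else \<gamma>)"
  by (rule valid_two) (use assms VX_G in auto)

lemma edge_simplex:
  assumes "i \<noteq> k" "X \<in> VX" "Z \<in> VX" "\<alpha> \<in> G" "\<beta> \<in> G" "\<gamma> \<in> G" "indep Z B (\<alpha> ` X)"
  shows "edge i X \<alpha> k Z \<beta> \<gamma> \<in> simplices M \<kappa> indep B p 1"
  unfolding edge_def by (rule mk_simplex_two[OF assms(1) edge_valid[OF assms]])

lemma boundary_edge:
  assumes "i < k" "X \<in> VX" "Z \<in> VX" "\<alpha> \<in> G" "\<beta> \<in> G" "\<gamma> \<in> G"
  shows "boundary (frag_of (edge i X \<alpha> k Z \<beta> \<gamma>)) = frag_of (pt k (Hilbert_Choice.inv \<beta> ` Z)) - frag_of (pt i X)"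
proof -
  let ?W = "\<lambda>n. if n = i then \<alpha> ` X else Z" and ?\<gamma> = "\<lambda>u. if u = {i} then \<alpha> else if u = {k} then \<beta> else \<gamma>"
  have "mk {k} ?W ?\<gamma> = pt k (Hilbert_Choice.inv (?\<gamma> {k}) ` ?W k)" by (rule mk_one) (use assms in auto)
  moreover have "mk {i} ?W ?\<gamma> = pt i (Hilbert_Choice.inv (?\<gamma> {i}) ` ?W i)" by (rule mk_one) (use assms VX_G in auto)
  moreover have "Hilbert_Choice.inv \<alpha> ` \<alpha> ` X = X" using AutOver_inv_comp(1)[OF assms(4)] by (simp add: image_image)
  ultimately show ?thesis unfolding edge_def boundary_two[OF assms(1)] using assms(1) by simp
qed

lemma edge_repr:
  assumes f: "f \<in> simplices M \<kappa> indep B p 1"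
  shows "\<exists>i k X \<alpha> Z \<beta> \<gamma>. i < k \<and> X \<in> VX \<and> Z \<in> VX \<and> \<alpha> \<in> G \<and> \<beta> \<in> G \<and> \<gamma> \<in> G \<and> indep Z B (\<alpha> ` X) \<and>
    verts f = {i, k} \<and> f = edge i X \<alpha> k Z \<beta> \<gamma>"
proof -
  obtain W \<gamma> where W: "valid (verts f) W \<gamma>" "f = mk (verts f) W \<gamma>" using simplex_repr[OF f] by blast
  have "card (verts f) = 2" using f by (simp add: simplices_def)
  then obtain i' k' where ik': "verts f = {i', k'}" "i' \<noteq> k'" by (auto simp: card_2_iff)
  obtain i k where ik: "verts f = {i, k}" "i < k"
  proof (cases "i' < k'")
    case True
    then show thesis using that ik' by blast
  next
    case False
    then show thesis using that[of k' i'] ik' by (simp add: insert_commute)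
  qed
  have G: "\<gamma> {i} \<in> G" "\<gamma> {k} \<in> G" "\<gamma> {i, k} \<in> G" and V: "W i \<in> VX" "W k \<in> VX"
    and ind: "indep_family indep B {i, k} W"
    using W(1) unfolding valid_def ik(1) by auto
  define X where "X = Hilbert_Choice.inv (\<gamma> {i}) ` W i"
  have X: "X \<in> VX" unfolding X_def by (rule VX_G[OF V(1) AutOver_inv[OF G(1)]])
  have aX: "\<gamma> {i} ` X = W i" unfolding X_def using AutOver_inv_comp(2)[OF G(1)] by (simp add: image_image)
  have "{i, k} - {k} = {i}" using ik(2) by auto
  then have ind: "indep (W k) B (\<gamma> {i} ` X)" unfolding aX using ind unfolding indep_family_def by auto
  have "f = edge i X (\<gamma> {i}) k (W k) (\<gamma> {k}) (\<gamma> {i, k})"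
    unfolding edge_def aX
  proof (subst W(2), unfold ik(1), rule mk_cong_valid)
    show "valid {i, k} W \<gamma>" using W(1) ik(1) by simp
    fix u assume u: "u \<subseteq> {i, k}" "u \<noteq> {}"
    then have "u = {i} \<or> u = {k} \<or> u = {i, k}" by auto
    then show "(if u = {i} then \<gamma> {i} else if u = {k} then \<gamma> {k} else \<gamma> {i, k}) = \<gamma> u" by auto
  qed (use G in auto)
  with ik X V(2) G ind show ?thesis by (intro exI conjI) assumption+
qed

abbreviation cone :: "nat \<Rightarrow> 'a set \<Rightarrow> ('a \<Rightarrow> 'a) \<Rightarrow> nat \<Rightarrow> 'a set \<Rightarrow> 'a simplex \<Rightarrow>\<^sub>0 int" where
  "cone i X \<alpha> k Z \<equiv> frag_of (edge i X \<alpha> k Z id id)"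

text \<open>Filling the triangle over an edge whose third vertex is independent of the edge.\<close>

lemma edge_cone:
  assumes k: "i < k" "k < k'" and V: "X \<in> VX" "Z \<in> VX" "Z' \<in> VX" and G: "\<alpha> \<in> G" "\<beta> \<in> G" "\<gamma> \<in> G"
    and ind: "indep Z B (\<alpha> ` X)" "indep Z' B (\<alpha> ` X \<union> Z)"
  shows "frag_of (edge i X \<alpha> k Z \<beta> \<gamma>) - cone i X \<alpha> k' Z' + cone k (Hilbert_Choice.inv \<beta> ` Z) \<beta> k' Z' \<in> boundaries"
proof -
  define W where "W = (\<lambda>n. if n = i then \<alpha> ` X else if n = k then Z else Z')"
  \<comment> \<open>Every face containing \<open>k'\<close> gets the identity, which makes the two
    sides at \<open>k'\<close> cones.\<close>
  define \<Gamma> where "\<Gamma> = (\<lambda>u. if u = {i} then \<alpha> else if u = {k} then \<beta> else if u = {i, k} then \<gamma> else id)"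
  have v: "valid {i, k, k'} W \<Gamma>"
    by (rule valid_three) (use k V G ind VX_G in \<open>auto simp: W_def \<Gamma>_def AutOver_id\<close>)
  have b: "\<beta> ` Hilbert_Choice.inv \<beta> ` Z = Z" using AutOver_inv_comp(2)[OF G(2)] by (simp add: image_image)
  have two: "u = {a} \<or> u = {b} \<or> u = {a, b}" if "u \<subseteq> {a, b}" "u \<noteq> {}" for u and a b :: nat using that by auto
  have 1: "mk {i, k} W \<Gamma> = edge i X \<alpha> k Z \<beta> \<gamma>"
    unfolding edge_def
  proof (rule mk_cong_valid)
    show "valid {i, k} W \<Gamma>" by (rule valid_subset[OF v]) auto
    fix u assume "u \<subseteq> {i, k}" "u \<noteq> {}"
    from two[OF this] show "(if u = {i} then \<alpha> else if u = {k} then \<beta> else \<gamma>) = \<Gamma> u" using k by (auto simp: \<Gamma>_def)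
  qed (use k G in \<open>auto simp: W_def\<close>)
  have 2: "mk {i, k'} W \<Gamma> = edge i X \<alpha> k' Z' id id"
    unfolding edge_def
  proof (rule mk_cong_valid)
    show "valid {i, k'} W \<Gamma>" by (rule valid_subset[OF v]) auto
    fix u assume "u \<subseteq> {i, k'}" "u \<noteq> {}"
    from two[OF this] show "(if u = {i} then \<alpha> else if u = {k'} then id else id) = \<Gamma> u"
      using k by (auto simp: \<Gamma>_def doubleton_eq_iff)
  qed (use k G in \<open>auto simp: W_def AutOver_id\<close>)
  have 3: "mk {k, k'} W \<Gamma> = edge k (Hilbert_Choice.inv \<beta> ` Z) \<beta> k' Z' id id"
    unfolding edge_def b
  proof (rule mk_cong_valid)
    show "valid {k, k'} W \<Gamma>" by (rule valid_subset[OF v]) auto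
    fix u assume "u \<subseteq> {k, k'}" "u \<noteq> {}"
    from two[OF this] show "(if u = {k} then \<beta> else if u = {k'} then id else id) = \<Gamma> u"
      using k by (auto simp: \<Gamma>_def doubleton_eq_iff)
  qed (use k G in \<open>auto simp: W_def AutOver_id\<close>)
  from triangle[OF k v] show ?thesis unfolding 1 2 3 by (simp add: algebra_simps)
qed

end

section \<open>The case of one class\<close>

context star_type
begin

text \<open>All four edges are coned from one vertex independent of everything. The cones over a
  common end cancel within each difference, and those over \<open>X\<close> cancel between the two
  differences.\<close>

lemma edge_diff_move:
  assumes i: "i < k" "i < k1" and V: "X \<in> VX" "Z \<in> VX" "Z1 \<in> VX"
    and G: "\<alpha> \<in> G" "\<alpha>' \<in> G" "\<beta> \<in> G" "\<gamma> \<in> G" "\<gamma>' \<in> G" "\<beta>1 \<in> G" "\<gamma>1 \<in> G" "\<gamma>1' \<in> G"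
    and ind: "indep Z B (\<alpha> ` X)" "indep Z B (\<alpha>' ` X)" "indep Z1 B (\<alpha> ` X)" "indep Z1 B (\<alpha>' ` X)"
  shows "(frag_of (edge i X \<alpha> k Z \<beta> \<gamma>) - frag_of (edge i X \<alpha>' k Z \<beta> \<gamma>')) -
    (frag_of (edge i X \<alpha> k1 Z1 \<beta>1 \<gamma>1) - frag_of (edge i X \<alpha>' k1 Z1 \<beta>1 \<gamma>1')) \<in> boundaries"
proof -
  let ?C = "\<alpha> ` X \<union> \<alpha>' ` X \<union> Z \<union> Z1"
  have C: "small \<kappa> ?C" by (intro small_Un small_image VX_small V)
  obtain Z' where Z': "Z' \<in> VX" "indep Z' B ?C" by (rule VX_indep[OF C])
  have ind': "indep Z' B D" if "D \<subseteq> ?C" for D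
    by (rule indep_mono[OF Z'(2) order_refl that VX_small[OF Z'(1)] small_B C])
  define k' where "k' = Suc (max k k1)"
  have k': "k < k'" "k1 < k'" by (auto simp: k'_def)
  note e = edge_cone[OF i(1) k'(1) V(1,2) Z'(1)] and e1 = edge_cone[OF i(2) k'(2) V(1,3) Z'(1)]
  have ind'': "indep Z' B (\<alpha> ` X \<union> Z)" "indep Z' B (\<alpha>' ` X \<union> Z)" "indep Z' B (\<alpha> ` X \<union> Z1)" "indep Z' B (\<alpha>' ` X \<union> Z1)"
    by (rule ind'; blast)+
  note 1 = e[OF G(1,3,4) ind(1) ind''(1)] and 2 = e[OF G(2,3,5) ind(2) ind''(2)]
    and 3 = e1[OF G(1,6,7) ind(3) ind''(3)] and 4 = e1[OF G(2,6,8) ind(4) ind''(4)]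
  from boundaries_diff[OF boundaries_diff[OF 1 2] boundaries_diff[OF 3 4]]
  show ?thesis by (simp add: algebra_simps)
qed

text \<open>Up to boundaries, the difference of two edges from the same vertex does not depend on their
  common end.\<close>

definition twist :: "nat \<Rightarrow> 'a set \<Rightarrow> ('a \<Rightarrow> 'a) \<Rightarrow> ('a \<Rightarrow> 'a) \<Rightarrow> 'a simplex \<Rightarrow>\<^sub>0 int" where
  "twist i X \<alpha> \<alpha>' = (let Z = SOME Z. Z \<in> VX \<and> indep Z B (\<alpha> ` X \<union> \<alpha>' ` X) in
     cone i X \<alpha> (Suc i) Z - cone i X \<alpha>' (Suc i) Z)"

lemma indep_Un:
  assumes "Z \<in> VX" "small \<kappa> X" "small \<kappa> Y" "indep Z B (X \<union> Y)"
  shows "indep Z B X" "indep Z B Y"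
  by (rule indep_mono[OF assms(4) order_refl _ VX_small[OF assms(1)] small_B small_Un[OF assms(2,3)]]; simp)+

text \<open>Allows a twist to be computed with any convenient end vertex and any labels
  there.\<close>

lemma twist_edge:
  assumes "i < k" "X \<in> VX" "Z \<in> VX" "\<alpha> \<in> G" "\<alpha>' \<in> G" "\<beta> \<in> G" "\<gamma> \<in> G" "\<gamma>' \<in> G"
    and "indep Z B (\<alpha> ` X)" "indep Z B (\<alpha>' ` X)"
  shows "twist i X \<alpha> \<alpha>' - (frag_of (edge i X \<alpha> k Z \<beta> \<gamma>) - frag_of (edge i X \<alpha>' k Z \<beta> \<gamma>')) \<in> boundaries"
proof -
  have s: "small \<kappa> (\<alpha> ` X)" "small \<kappa> (\<alpha>' ` X)" by (intro small_image VX_small assms)+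
  obtain Z0 where "Z0 \<in> VX" "indep Z0 B (\<alpha> ` X \<union> \<alpha>' ` X)" by (rule VX_indep[OF small_Un[OF s]])
  then have "\<exists>Z. Z \<in> VX \<and> indep Z B (\<alpha> ` X \<union> \<alpha>' ` X)" by blast
  from someI_ex[OF this] obtain Z' where Z': "Z' \<in> VX" "indep Z' B (\<alpha> ` X \<union> \<alpha>' ` X)"
    "twist i X \<alpha> \<alpha>' = cone i X \<alpha> (Suc i) Z' - cone i X \<alpha>' (Suc i) Z'"
    unfolding twist_def Let_def by blast
  note I = indep_Un[OF Z'(1) s Z'(2)]
  show ?thesis unfolding Z'(3)
    by (rule edge_diff_move[OF lessI assms(1,2) Z'(1) assms(3-5) AutOver_id AutOver_id AutOver_id assms(6-8) I assms(9,10)])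
qed

lemma twist_trans:
  assumes "X \<in> VX" "\<alpha> \<in> G" "\<beta> \<in> G" "\<gamma> \<in> G"
  shows "twist i X \<alpha> \<beta> + twist i X \<beta> \<gamma> - twist i X \<alpha> \<gamma> \<in> boundaries"
proof -
  have s: "small \<kappa> (\<alpha> ` X)" "small \<kappa> (\<beta> ` X)" "small \<kappa> (\<gamma> ` X)" by (intro small_image VX_small assms)+
  obtain Z where Z: "Z \<in> VX" "indep Z B (\<alpha> ` X \<union> \<beta> ` X \<union> \<gamma> ` X)" by (rule VX_indep[OF small_Un[OF small_Un[OF s(1,2)] s(3)]])
  note I' = indep_Un[OF Z(1) small_Un[OF s(1,2)] s(3) Z(2)]
  note I = indep_Un[OF Z(1) s(1,2) I'(1)] I'(2)
  note id3 = AutOver_id AutOver_id AutOver_id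
  note t = twist_edge[OF lessI[of i] assms(1) Z(1)]
  from boundaries_diff[OF boundaries_add[OF t[OF assms(2,3) id3 I(1,2)] t[OF assms(3,4) id3 I(2,3)]] t[OF assms(2,4) id3 I(1,3)]]
  show ?thesis by (simp add: algebra_simps)
qed

text \<open>Moving the configuration by \<open>\<gamma>\<close> leaves the simplices unchanged;
  expressed in the new position, only the labels at the common end differ, and
  \<open>twist_edge\<close> ignores them.\<close>

lemma twist_G:
  assumes "X \<in> VX" "\<alpha> \<in> G" "\<beta> \<in> G" "\<gamma> \<in> G"
  shows "twist i X (\<gamma> \<circ> \<alpha>) (\<gamma> \<circ> \<beta>) - twist i X \<alpha> \<beta> \<in> boundaries"
proof -
  have s: "small \<kappa> (\<alpha> ` X)" "small \<kappa> (\<beta> ` X)" by (intro small_image VX_small assms)+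
  obtain Z where Z: "Z \<in> VX" "indep Z B (\<alpha> ` X \<union> \<beta> ` X)" by (rule VX_indep[OF small_Un[OF s]])
  note I = indep_Un[OF Z(1) s Z(2)]
  let ?\<gamma> = "Hilbert_Choice.inv \<gamma>"
  have g: "?\<gamma> \<in> G" by (rule AutOver_inv[OF assms(4)])
  have shift: "cone i X (\<gamma> \<circ> \<delta>) (Suc i) (\<gamma> ` Z) = frag_of (edge i X \<delta> (Suc i) Z ?\<gamma> ?\<gamma>)" if \<delta>: "\<delta> \<in> G" for \<delta>
  proof -
    let ?W = "\<lambda>n. if n = i then \<delta> ` X else Z"
      and ?\<Gamma> = "\<lambda>u. if u = {i} then \<delta> else if u = {Suc i} then ?\<gamma> else ?\<gamma>"
    have "mk {i, Suc i} (\<lambda>n. \<gamma> ` ?W n) (\<lambda>u. \<gamma> \<circ> ?\<Gamma> u) = mk {i, Suc i} ?W ?\<Gamma>"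
      by (rule mk_shift[OF assms(4)]) (use \<delta> g in simp)
    moreover have "(\<lambda>n. \<gamma> ` ?W n) = (\<lambda>n. if n = i then (\<gamma> \<circ> \<delta>) ` X else \<gamma> ` Z)" by (auto simp: fun_eq_iff)
    moreover have "(\<lambda>u. \<gamma> \<circ> ?\<Gamma> u) = (\<lambda>u. if u = {i} then \<gamma> \<circ> \<delta> else if u = {Suc i} then id else id)"
      using AutOver_inv_comp(4)[OF assms(4)] by (auto simp: fun_eq_iff)
    ultimately show ?thesis unfolding edge_def by simp
  qed
  have J: "indep (\<gamma> ` Z) B ((\<gamma> \<circ> \<alpha>) ` X)" "indep (\<gamma> ` Z) B ((\<gamma> \<circ> \<beta>) ` X)"
    unfolding image_comp[symmetric] using I indep_G[OF assms(4) VX_small[OF Z(1)]] s by simp_all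
  note t1 = twist_edge[OF lessI[of i] assms(1) VX_G[OF Z(1) assms(4)] AutOver_comp[OF assms(4,2)] AutOver_comp[OF assms(4,3)]
      AutOver_id AutOver_id AutOver_id J]
  note t2 = twist_edge[OF lessI[of i] assms(1) Z(1) assms(2,3) g g g I]
  from boundaries_diff[OF t1 t2] show ?thesis unfolding shift[OF assms(2)] shift[OF assms(3)] by simp
qed

text \<open>An automorphism fixing \<open>X\<close> pointwise is invisible in the edge, so both
  edges of the twist are the same simplex.\<close>

lemma twist_fixed:
  assumes "X \<in> VX" "g \<in> G" "\<And>x. x \<in> X \<Longrightarrow> g x = x"
  shows "twist i X id g \<in> boundaries"
proof -
  obtain Z where Z: "Z \<in> VX" "indep Z B X" by (rule VX_indep[OF VX_small[OF assms(1)]])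
  have gX: "g ` X = X" using assms(3) by simp
  have "edge i X id (Suc i) Z id id = edge i X g (Suc i) Z id id"
    unfolding edge_def
  proof (rule mk_cong)
    show "(if u = {i} then g else if u = {Suc i} then id else id) x = (if u = {i} then id else if u = {Suc i} then id else id) x"
      if x: "x \<in> Hilbert_Choice.inv (if u = {i} then id else if u = {Suc i} then id else id) ` cl (\<lambda>n. if n = i then id ` X else Z) u" for u x
    proof (cases "u = {i}")
      case True
      have "x \<in> cl (\<lambda>n. if n = i then id ` X else Z) {i}" using x True by simp
      then have "x \<in> X" using VX_acl[OF assms(1)] by (simp add: cl_def)
      then show ?thesis using assms(3) True by simp
    qed simp
  qed (use gX assms Z AutOver_id in auto)
  moreover have "twist i X id g - (frag_of (edge i X id (Suc i) Z id id) - frag_of (edge i X g (Suc i) Z id id)) \<in> boundaries"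
    by (rule twist_edge[OF lessI assms(1) Z(1) AutOver_id assms(2) AutOver_id AutOver_id AutOver_id])
       (use Z(2) gX in simp_all)
  ultimately show ?thesis by simp
qed

text \<open>Splitting at \<open>g\<close> and moving the second part back by \<open>g\<close> shows
  that twists from the identity form a homomorphism modulo boundaries.\<close>

lemma twist_comp:
  assumes "X \<in> VX" "g \<in> G" "h \<in> G"
  shows "twist i X id g + twist i X id h - twist i X id (g \<circ> h) \<in> boundaries"
proof -
  have "twist i X g (g \<circ> h) - twist i X id h \<in> boundaries"
    using twist_G[OF assms(1) AutOver_id assms(3,2), of i] by simp
  from boundaries_diff[OF twist_trans[OF assms(1) AutOver_id assms(2) AutOver_comp[OF assms(2,3)], of i] this]
  show ?thesis by (simp add: algebra_simps)
qed

lemma twist_inv: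
  assumes "X \<in> VX" "g \<in> G"
  shows "twist i X id g + twist i X id (Hilbert_Choice.inv g) \<in> boundaries"
proof -
  have "twist i X id id \<in> boundaries" by (rule twist_fixed[OF assms(1) AutOver_id]) simp
  with twist_comp[OF assms AutOver_inv[OF assms(2)], of i] show ?thesis
    using AutOver_inv_comp(4)[OF assms(2)] boundaries_add by fastforce
qed

text \<open>The values of this homomorphism lie in an abelian group.\<close>

lemma twist_commutator:
  assumes X: "X \<in> VX" and st: "\<sigma> \<in> G" "\<tau> \<in> G"
  shows "twist i X id (Hilbert_Choice.inv \<sigma> \<circ> Hilbert_Choice.inv \<tau> \<circ> \<sigma> \<circ> \<tau>) \<in> boundaries"
proof -
  note inv = AutOver_inv[OF st(1)] AutOver_inv[OF st(2)]
  note 1 = twist_comp[OF X inv, of i]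
    and 2 = twist_comp[OF X AutOver_comp[OF inv] st(1), of i]
    and 3 = twist_comp[OF X AutOver_comp[OF AutOver_comp[OF inv] st(1)] st(2), of i]
  from boundaries_diff[OF boundaries_add[OF twist_inv[OF X st(1), of i] twist_inv[OF X st(2), of i]]
      boundaries_add[OF 1 boundaries_add[OF 2 3]]]
  show ?thesis by (simp add: algebra_simps)
qed

text \<open>The commutators along a chain are composed to a single automorphism, whose twist
  vanishes.\<close>

lemma twist_Rn:
  assumes X: "X \<in> VX" and R: "(a, b) \<in> Rn n"
  shows "\<exists>h\<in>G. twist i X id h \<in> boundaries \<and> b = h \<circ> a"
  using R
proof (induction n arbitrary: b)
  case 0
  have "twist i X id id \<in> boundaries" by (rule twist_fixed[OF X AutOver_id]) simp
  moreover have "b = id \<circ> a" using 0 by (simp add: Rn_0)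
  ultimately show ?case using AutOver_id by blast
next
  case (Suc n)
  from Suc.prems obtain c where c: "(a, c) \<in> Rn n" "(c, b) \<in> R" unfolding Rn_Suc by (elim relcompE) simp
  obtain h where h: "h \<in> G" "twist i X id h \<in> boundaries" "c = h \<circ> a" using Suc.IH[OF c(1)] by blast
  obtain \<sigma> \<tau> where st: "\<sigma> \<in> G" "\<tau> \<in> G" and b: "b = Hilbert_Choice.inv \<sigma> \<circ> Hilbert_Choice.inv \<tau> \<circ> \<sigma> \<circ> \<tau> \<circ> c"
    using c(2) unfolding commutator_rel_def by blast
  define g where "g = Hilbert_Choice.inv \<sigma> \<circ> Hilbert_Choice.inv \<tau> \<circ> \<sigma> \<circ> \<tau>"
  have g: "g \<in> G" "twist i X id g \<in> boundaries"
    unfolding g_def using st twist_commutator[OF X st] by (auto intro!: AutOver_comp AutOver_inv)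
  from boundaries_diff[OF boundaries_add[OF g(2) h(2)] twist_comp[OF X g(1) h(1), of i]]
  have "twist i X id (g \<circ> h) \<in> boundaries" by (simp add: algebra_simps)
  moreover have "b = (g \<circ> h) \<circ> a" unfolding b h(3) g_def by (simp only: comp_assoc)
  ultimately show ?case using AutOver_comp[OF g(1) h(1)] by blast
qed

text \<open>Here the hypothesis on \<open>p\<close> is used: the closure of a realization consists
  of its own coordinates, or of elements definable from it and \<open>B\<close>.\<close>

lemma fixes_acl:
  assumes "type_of_acl_set M B p \<or> acl_eq_dcl M B p" "a \<in> P" "\<sigma> \<in> G" "\<sigma> \<circ> a = a" "x \<in> acl M (B \<union> range a)"
  shows "\<sigma> x = x"
proof -
  have \<sigma>: "\<sigma> \<in> AutOver M (B \<union> range a)"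
    using assms(3) fun_cong[OF assms(4)] by (auto simp: AutOver_def)
  from assms(1) show ?thesis
  proof
    assume "type_of_acl_set M B p"
    then have "x \<in> range a" using assms(2,5) by (auto simp: type_of_acl_set_def)
    then show ?thesis using \<sigma> by (auto simp: AutOver_def)
  next
    assume "acl_eq_dcl M B p"
    then have "x \<in> dcl M (B \<union> range a)" using assms(2,5) by (auto simp: acl_eq_dcl_def)
    then show ?thesis by (rule dcl_fixed[OF \<sigma>])
  qed
qed

context
  assumes one_class: "E = P \<times> P" and pact: "type_of_acl_set M B p \<or> acl_eq_dcl M B p"
begin

lemma twist_boundary:
  assumes X: "X \<in> VX" and G: "\<alpha> \<in> G" "\<beta> \<in> G"
  shows "twist i X \<alpha> \<beta> \<in> boundaries"
proof -
  obtain a where a: "a \<in> P" "X = acl M (B \<union> range a)" using X unfolding VX_def by blast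
  have id: "twist i X id g \<in> boundaries" if g: "g \<in> G" for g
  proof -
    have "(a, g \<circ> a) \<in> E" unfolding one_class using a(1) P_Aut[OF a(1) g] by simp
    then obtain n where "(a, g \<circ> a) \<in> Rn n" using E_iff by blast
    from twist_Rn[OF X this] obtain h where h: "h \<in> G" "twist i X id h \<in> boundaries" "g \<circ> a = h \<circ> a" by blast
    \<comment> \<open>With one class, \<open>g\<close> agrees at \<open>a\<close> with some
      \<open>h\<close> of vanishing twist. What remains is \<open>f\<close>, which fixes
      \<open>a\<close> and hence all of \<open>X\<close>.\<close>
    define f where "f = Hilbert_Choice.inv h \<circ> g"
    have f: "f \<in> G" unfolding f_def by (rule AutOver_comp[OF AutOver_inv[OF h(1)] g])
    have "f \<circ> a = a" unfolding f_def comp_assoc h(3) by (rule G_cancel(1)[OF h(1)])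
    then have fb: "twist i X id f \<in> boundaries"
      using fixes_acl[OF pact a(1) f] by (intro twist_fixed[OF X f]) (simp add: a(2))
    have "h \<circ> f = g" unfolding f_def by (rule G_cancel(2)[OF h(1)])
    then show ?thesis
      using boundaries_diff[OF boundaries_add[OF h(2) fb] twist_comp[OF X h(1) f, of i]] by (simp add: algebra_simps)
  qed
  from boundaries_diff[OF twist_trans[OF X AutOver_id G, of i] boundaries_diff[OF id[OF G(1)] id[OF G(2)]]]
  show ?thesis by (simp add: algebra_simps)
qed

lemma cone_diff:
  assumes "i < k" "X \<in> VX" "Z \<in> VX" "\<alpha> \<in> G" "\<beta> \<in> G" "indep Z B (\<alpha> ` X)" "indep Z B (\<beta> ` X)"
  shows "cone i X \<alpha> k Z - cone i X \<beta> k Z \<in> boundaries"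
  using boundaries_diff[OF twist_boundary[OF assms(2,4,5)]
      twist_edge[OF assms(1-5) AutOver_id AutOver_id AutOver_id assms(6,7)], of i] by simp

text \<open>All edges are coned from one vertex independent of them. With one class the side over a
  vertex depends, up to boundaries, on that vertex simplex only. So the sides add up to a function
  of the boundary of \<open>c\<close>, which is zero.\<close>

lemma cycle_boundary:
  assumes c: "Poly_Mapping.keys c \<subseteq> simplices M \<kappa> indep B p 1" and bd: "boundary c = 0"
  shows "c \<in> boundaries"
proof -
  let ?S = "Poly_Mapping.keys c"
  have "\<forall>f\<in>?S. \<exists>t. case t of (i, k, X, \<alpha>, Z, \<beta>, \<gamma>) \<Rightarrow> i < k \<and> X \<in> VX \<and> Z \<in> VX \<and> \<alpha> \<in> G \<and> \<beta> \<in> G \<and> \<gamma> \<in> G \<and>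
    indep Z B (\<alpha> ` X) \<and> f = edge i X \<alpha> k Z \<beta> \<gamma>"
  proof
    fix f assume "f \<in> ?S"
    then have "f \<in> simplices M \<kappa> indep B p 1" using c by blast
    from edge_repr[OF this] obtain i k X \<alpha> Z \<beta> \<gamma> where
      "i < k \<and> X \<in> VX \<and> Z \<in> VX \<and> \<alpha> \<in> G \<and> \<beta> \<in> G \<and> \<gamma> \<in> G \<and> indep Z B (\<alpha> ` X) \<and> verts f = {i, k} \<and> f = edge i X \<alpha> k Z \<beta> \<gamma>"
      by (elim exE)
    then show "\<exists>t. case t of (i, k, X, \<alpha>, Z, \<beta>, \<gamma>) \<Rightarrow> i < k \<and> X \<in> VX \<and> Z \<in> VX \<and> \<alpha> \<in> G \<and> \<beta> \<in> G \<and> \<gamma> \<in> G \<and>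
      indep Z B (\<alpha> ` X) \<and> f = edge i X \<alpha> k Z \<beta> \<gamma>" by (intro exI[of _ "(i, k, X, \<alpha>, Z, \<beta>, \<gamma>)"]) simp
  qed
  from bchoice[OF this] obtain t where t: "\<forall>f\<in>?S. case t f of (i, k, X, \<alpha>, Z, \<beta>, \<gamma>) \<Rightarrow> i < k \<and> X \<in> VX \<and> Z \<in> VX \<and>
    \<alpha> \<in> G \<and> \<beta> \<in> G \<and> \<gamma> \<in> G \<and> indep Z B (\<alpha> ` X) \<and> f = edge i X \<alpha> k Z \<beta> \<gamma>" by (elim exE)
  define S where "S f = (case t f of (i, k, X, \<alpha>, Z, \<beta>, \<gamma>) \<Rightarrow> \<alpha> ` X \<union> Z)" for f
  define N where "N f = (case t f of (i :: nat, k, X, \<alpha>, Z, \<beta>, \<gamma>) \<Rightarrow> k)" for f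
  have sS: "small \<kappa> (S f)" if "f \<in> ?S" for f
  proof -
    obtain i k X \<alpha> Z \<beta> \<gamma> where tf: "t f = (i, k, X, \<alpha>, Z, \<beta>, \<gamma>)" by (cases "t f")
    have "X \<in> VX" "Z \<in> VX" using bspec[OF t that] unfolding tf by auto
    then show ?thesis unfolding S_def tf by (simp add: small_Un small_image VX_small)
  qed
  have "small \<kappa> (\<Union>f\<in>S'. S f)" if "finite S'" "S' \<subseteq> ?S" for S'
    using that by (induction S' rule: finite_induct) (simp_all add: small_finite small_Un sS)
  from this[OF finite_keys order_refl] have small: "small \<kappa> (\<Union>f\<in>?S. S f)" .
  obtain Z' where Z': "Z' \<in> VX" "indep Z' B (\<Union>f\<in>?S. S f)" by (rule VX_indep[OF small])
  have ind: "indep Z' B D" if "D \<subseteq> S f" "f \<in> ?S" for D f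
    by (rule indep_mono[OF Z'(2) order_refl _ VX_small[OF Z'(1)] small_B small]) (use that in blast)
  define k' where "k' = Suc (Max (N ` ?S))"
  have k': "N f < k'" if "f \<in> ?S" for f
    unfolding k'_def using that by (simp add: le_imp_less_Suc)
  \<comment> \<open>The side must be a function of the vertex simplex alone, so its embedding is
    chosen; by \<open>cone_diff\<close> another one changes it by a boundary. \<open>Min\<close>
    extracts the only vertex.\<close>
  define \<epsilon> where "\<epsilon> f = cone (Min (verts f)) (obj f {Min (verts f)})
    (SOME \<alpha>. \<alpha> \<in> G \<and> indep Z' B (\<alpha> ` obj f {Min (verts f)})) k' Z'" for f :: "'a simplex"
  have \<epsilon>: "cone i X \<alpha> k' Z' - \<epsilon> (pt i X) \<in> boundaries" if "i < k'" "X \<in> VX" "\<alpha> \<in> G" "indep Z' B (\<alpha> ` X)" for i X \<alpha>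
  proof -
    have "\<exists>\<alpha>. \<alpha> \<in> G \<and> indep Z' B (\<alpha> ` X)" using that by blast
    from someI_ex[OF this] have *: "(SOME \<alpha>. \<alpha> \<in> G \<and> indep Z' B (\<alpha> ` X)) \<in> G"
      "indep Z' B ((SOME \<alpha>. \<alpha> \<in> G \<and> indep Z' B (\<alpha> ` X)) ` X)" by auto
    have "verts (pt i X) = {i}" "obj (pt i X) {i} = X"
      using VX_acl[OF that(2)] by (simp_all add: pt_def mk_sel cl_def)
    then have "\<epsilon> (pt i X) = cone i X (SOME \<alpha>. \<alpha> \<in> G \<and> indep Z' B (\<alpha> ` X)) k' Z'" by (simp add: \<epsilon>_def)
    then show ?thesis using cone_diff[OF that(1,2) Z'(1) that(3) *(1) that(4) *(2)] by simp
  qed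
  define \<psi> where "\<psi> c = c + frag_extend \<epsilon> (boundary c)" for c
  have "\<psi> c \<in> boundaries" if "Poly_Mapping.keys c \<subseteq> ?S" for c
    using that
  proof (induction c rule: frag_induction[of _ ?S])
    case (one f)
    obtain i k X \<alpha> Z \<beta> \<gamma> where tf: "t f = (i, k, X, \<alpha>, Z, \<beta>, \<gamma>)" by (cases "t f") 
    from bspec[OF t one] have f: "i < k" "X \<in> VX" "Z \<in> VX" "\<alpha> \<in> G" "\<beta> \<in> G" "\<gamma> \<in> G" "indep Z B (\<alpha> ` X)" "f = edge i X \<alpha> k Z \<beta> \<gamma>"
      unfolding tf by auto
    have k: "k < k'" using k'[OF one] by (simp add: N_def tf)
    have J: "indep Z' B (\<alpha> ` X \<union> Z)" "indep Z' B (\<alpha> ` X)" "indep Z' B Z" by (rule ind[OF _ one]; simp add: S_def tf)+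
    let ?Y = "Hilbert_Choice.inv \<beta> ` Z"
    have Y: "?Y \<in> VX" by (rule VX_G[OF f(3) AutOver_inv[OF f(5)]])
    have "\<beta> ` ?Y = Z" using AutOver_inv_comp(2)[OF f(5)] by (simp add: image_image)
    then have JY: "indep Z' B (\<beta> ` ?Y)" using J(3) by simp
    have \<psi>f: "\<psi> (frag_of f) = frag_of f + \<epsilon> (pt k ?Y) - \<epsilon> (pt i X)"
      unfolding \<psi>_def f(8) boundary_edge[OF f(1-6)] by (simp add: frag_extend_diff)
    have "frag_of f - cone i X \<alpha> k' Z' + cone k ?Y \<beta> k' Z' \<in> boundaries"
      unfolding f(8) by (rule edge_cone[OF f(1) k f(2,3) Z'(1) f(4-7) J(1)])
    from boundaries_diff[OF boundaries_add[OF this \<epsilon>[OF less_trans[OF f(1) k] f(2,4) J(2)]] \<epsilon>[OF k Y f(5) JY]]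
    show ?case unfolding \<psi>f by (simp add: algebra_simps)
  next
    case zero
    show ?case using boundaries_0 by (simp add: \<psi>_def boundary_def)
  next
    case (diff a b)
    have "\<psi> (a - b) = \<psi> a - \<psi> b" by (simp add: \<psi>_def boundary_diff frag_extend_diff)
    then show ?case using boundaries_diff[OF diff] by simp
  qed
  from this[OF order_refl] show ?thesis by (simp add: \<psi>_def bd)
qed

end

end

section \<open>Differences modulo the equivalence relation\<close>

context monster_type
begin

abbreviation "K \<equiv> Kgroup M B p"
abbreviation "Q \<equiv> AR Mod K"

lemma res_K: "\<sigma> \<in> G \<Longrightarrow> res \<sigma> \<in> K \<longleftrightarrow> (\<forall>a\<in>P. (a, \<sigma> \<circ> a) \<in> E)"
  by (simp add: Kgroup_eq carrier_AR E_iff res_apply)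

lemma K_normal: "K \<lhd> AR"
proof -
  interpret group AR by (rule group_AR)
  show ?thesis
    unfolding normal_inv_iff
  proof (intro conjI ballI)
    show "subgroup K AR"
    proof (rule subgroupI)
      show "K \<subseteq> carrier AR" by (auto simp: Kgroup_eq)
      have "res id \<in> K" using res_K[OF AutOver_id] E_refl by simp
      then show "K \<noteq> {}" by blast
      fix g assume g: "g \<in> K"
      then obtain \<sigma> where \<sigma>: "\<sigma> \<in> G" "g = res \<sigma>" by (auto simp: Kgroup_eq carrier_AR)
      have "(a, Hilbert_Choice.inv \<sigma> \<circ> a) \<in> E" if a: "a \<in> P" for a
      proof -
        have "(a, \<sigma> \<circ> a) \<in> E" using g \<sigma> res_K a by blast
        from E_Aut[OF E_sym[OF this] AutOver_inv[OF \<sigma>(1)]] show ?thesis unfolding G_cancel(1)[OF \<sigma>(1)] .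
      qed
      then show "inv\<^bsub>AR\<^esub> g \<in> K" using res_K[OF AutOver_inv[OF \<sigma>(1)]] \<sigma> by (simp add: inv_AR)
      fix h assume h: "h \<in> K"
      then obtain \<tau> where \<tau>: "\<tau> \<in> G" "h = res \<tau>" by (auto simp: Kgroup_eq carrier_AR)
      have "(a, \<sigma> \<circ> \<tau> \<circ> a) \<in> E" if a: "a \<in> P" for a
      proof -
        have 1: "(\<tau> \<circ> a, \<sigma> \<circ> (\<tau> \<circ> a)) \<in> E" using g \<sigma> res_K P_Aut[OF a \<tau>(1)] by blast
        have "(a, \<tau> \<circ> a) \<in> E" using h \<tau> res_K a by blast
        from E_trans[OF this 1] show ?thesis unfolding comp_assoc .
      qed
      then show "g \<otimes>\<^bsub>AR\<^esub> h \<in> K" using res_K[OF AutOver_comp[OF \<sigma>(1) \<tau>(1)]] \<sigma> \<tau> by (simp add: mult_AR)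
    qed
    fix x h assume "x \<in> carrier AR" and h: "h \<in> K"
    then obtain \<sigma> where \<sigma>: "\<sigma> \<in> G" "x = res \<sigma>" by (auto simp: carrier_AR)
    obtain \<tau> where \<tau>: "\<tau> \<in> G" "h = res \<tau>" using h by (auto simp: Kgroup_eq carrier_AR)
    have "(a, \<sigma> \<circ> \<tau> \<circ> Hilbert_Choice.inv \<sigma> \<circ> a) \<in> E" if a: "a \<in> P" for a
    proof -
      have "(Hilbert_Choice.inv \<sigma> \<circ> a, \<tau> \<circ> (Hilbert_Choice.inv \<sigma> \<circ> a)) \<in> E"
        using h \<tau> res_K P_inv[OF a \<sigma>(1)] by blast
      from E_Aut[OF this \<sigma>(1)] show ?thesis unfolding G_cancel(2)[OF \<sigma>(1)] comp_assoc .
    qed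
    then show "x \<otimes>\<^bsub>AR\<^esub> h \<otimes>\<^bsub>AR\<^esub> inv\<^bsub>AR\<^esub> x \<in> K"
      using res_K[OF AutOver_comp[OF AutOver_comp[OF \<sigma>(1) \<tau>(1)] AutOver_inv[OF \<sigma>(1)]]] \<sigma> \<tau>
      by (simp add: mult_AR inv_AR AutOver_inv AutOver_comp)
  qed
qed

definition qcls :: "('a \<Rightarrow> 'a) \<Rightarrow> (('i \<Rightarrow> 'a) \<Rightarrow> ('i \<Rightarrow> 'a)) set" where
  "qcls \<sigma> = K #>\<^bsub>AR\<^esub> res \<sigma>"

lemma carrier_Q: "carrier Q = qcls ` G"
  by (auto simp: FactGroup_def RCOSETS_def carrier_AR qcls_def)

lemma qcls_mult: "\<sigma> \<in> G \<Longrightarrow> \<tau> \<in> G \<Longrightarrow> qcls \<sigma> \<otimes>\<^bsub>Q\<^esub> qcls \<tau> = qcls (\<sigma> \<circ> \<tau>)"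
  unfolding qcls_def using normal.rcos_sum[OF K_normal, of "res \<sigma>" "res \<tau>"]
  by (simp add: FactGroup_def carrier_AR mult_AR)

text \<open>A single realization decides the coset: automorphisms commute up to \<open>E\<close>, so
  a relation between \<open>\<sigma>\<close> and \<open>\<tau>\<close> at \<open>a\<close> passes to
  every conjugate of \<open>a\<close>.\<close>

lemma qcls_eq_iff:
  assumes st: "\<sigma> \<in> G" "\<tau> \<in> G" and a: "a \<in> P"
  shows "qcls \<sigma> = qcls \<tau> \<longleftrightarrow> (\<sigma> \<circ> a, \<tau> \<circ> a) \<in> E"
proof -
  interpret group AR by (rule group_AR)
  let ?\<rho> = "\<sigma> \<circ> Hilbert_Choice.inv \<tau>"
  have K: "subgroup K AR" by (rule normal_imp_subgroup[OF K_normal])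
  have c: "res \<sigma> \<in> carrier AR" "res \<tau> \<in> carrier AR" using st by (auto simp: carrier_AR)
  have \<rho>: "?\<rho> \<in> G" "res ?\<rho> = res \<sigma> \<otimes>\<^bsub>AR\<^esub> inv\<^bsub>AR\<^esub> res \<tau>"
    using st by (auto simp: mult_AR inv_AR AutOver_inv intro: AutOver_comp)
  have "qcls \<sigma> = qcls \<tau> \<longleftrightarrow> res ?\<rho> \<in> K"
    unfolding qcls_def \<rho>(2)
    using coset_mult_inv1[OF _ c subgroup.subset[OF K]] coset_mult_inv2[OF _ c subgroup.subset[OF K]]
      coset_join1[OF _ _ K] coset_join2[OF _ K] c by (meson inv_closed m_closed)
  also have "\<dots> \<longleftrightarrow> (\<sigma> \<circ> a, \<tau> \<circ> a) \<in> E"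
    unfolding res_K[OF \<rho>(1)]
  proof
    assume "\<forall>b\<in>P. (b, ?\<rho> \<circ> b) \<in> E"
    from bspec[OF this P_Aut[OF a st(2)]] have "(\<tau> \<circ> a, \<sigma> \<circ> a) \<in> E" unfolding comp_assoc G_cancel(1)[OF st(2)] .
    then show "(\<sigma> \<circ> a, \<tau> \<circ> a) \<in> E" by (rule E_sym)
  next
    assume E: "(\<sigma> \<circ> a, \<tau> \<circ> a) \<in> E"
    show "\<forall>b\<in>P. (b, ?\<rho> \<circ> b) \<in> E"
    proof
      fix b assume b: "b \<in> P"
      have c: "Hilbert_Choice.inv \<tau> \<circ> b \<in> P" by (rule P_inv[OF b st(2)])
      obtain \<gamma> where \<gamma>: "\<gamma> \<in> G" "Hilbert_Choice.inv \<tau> \<circ> b = \<gamma> \<circ> a" using P_trans[OF a] c by blast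
      have "(\<gamma> \<circ> \<sigma> \<circ> a, \<gamma> \<circ> \<tau> \<circ> a) \<in> E" using E_Aut[OF E \<gamma>(1)] by (simp only: comp_assoc)
      then have "(\<gamma> \<circ> \<tau> \<circ> a, \<gamma> \<circ> \<sigma> \<circ> a) \<in> E" by (rule E_sym)
      from E_trans[OF E_trans[OF E_commute[OF a st(2) \<gamma>(1)] this] E_commute[OF a \<gamma>(1) st(1)]]
      have "(\<tau> \<circ> (\<gamma> \<circ> a), \<sigma> \<circ> (\<gamma> \<circ> a)) \<in> E" unfolding comp_assoc .
      then show "(b, ?\<rho> \<circ> b) \<in> E" unfolding \<gamma>(2)[symmetric] G_cancel(2)[OF st(2)] comp_assoc .
    qed
  qed
  finally show ?thesis .
qed

lemma comm_group_Q: "comm_group Q"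
proof (rule group.group_comm_groupI[OF normal.factorgroup_is_group[OF K_normal]])
  fix x y assume "x \<in> carrier Q" "y \<in> carrier Q"
  then obtain \<sigma> \<tau> where st: "\<sigma> \<in> G" "\<tau> \<in> G" "x = qcls \<sigma>" "y = qcls \<tau>" by (auto simp: carrier_Q)
  obtain a where a: "a \<in> P" using P_nonempty by blast
  show "x \<otimes>\<^bsub>Q\<^esub> y = y \<otimes>\<^bsub>Q\<^esub> x"
    unfolding st(3,4) qcls_mult[OF st(1,2)] qcls_mult[OF st(2,1)]
      qcls_eq_iff[OF AutOver_comp[OF st(1,2)] AutOver_comp[OF st(2,1)] a]
    by (rule E_commute[OF a st(1,2)])
qed

text \<open>The classes of \<open>E\<close> form a torsor under the abelian group \<open>Q\<close>,
  and this is its difference map; \<open>qdiff_eq\<close> shows independence of the choice.\<close>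

definition qdiff :: "('i \<Rightarrow> 'a) \<Rightarrow> ('i \<Rightarrow> 'a) \<Rightarrow> (('i \<Rightarrow> 'a) \<Rightarrow> ('i \<Rightarrow> 'a)) set" where
  "qdiff a b = qcls (SOME \<sigma>. \<sigma> \<in> G \<and> b = \<sigma> \<circ> a)"

lemma qdiff_eq:
  assumes a: "a \<in> P" and \<sigma>: "\<sigma> \<in> G"
  shows "qdiff a (\<sigma> \<circ> a) = qcls \<sigma>"
proof -
  have "\<exists>\<tau>. \<tau> \<in> G \<and> \<sigma> \<circ> a = \<tau> \<circ> a" using \<sigma> by blast
  from someI_ex[OF this] obtain \<tau> where \<tau>: "\<tau> \<in> G" "\<sigma> \<circ> a = \<tau> \<circ> a" "qdiff a (\<sigma> \<circ> a) = qcls \<tau>"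
    unfolding qdiff_def by blast
  have "(\<tau> \<circ> a, \<sigma> \<circ> a) \<in> E" unfolding \<tau>(2) by (rule E_refl[OF P_Aut[OF a \<tau>(1)]])
  then show ?thesis unfolding \<tau>(3) qcls_eq_iff[OF \<tau>(1) \<sigma> a] .
qed

lemma qdiff_closed: "a \<in> P \<Longrightarrow> b \<in> P \<Longrightarrow> qdiff a b \<in> carrier Q"
  using P_trans[of a b] qdiff_eq[of a] by (auto simp: carrier_Q)

lemma qdiff_add:
  assumes "a \<in> P" "b \<in> P" "c \<in> P"
  shows "qdiff a b \<otimes>\<^bsub>Q\<^esub> qdiff b c = qdiff a c"
proof -
  obtain \<sigma> where \<sigma>: "\<sigma> \<in> G" "b = \<sigma> \<circ> a" using P_trans[OF assms(1)] assms(2) by blast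
  obtain \<tau> where \<tau>: "\<tau> \<in> G" "c = \<tau> \<circ> b" using P_trans[OF assms(2)] assms(3) by blast
  have "qdiff b c = qcls \<tau>" unfolding \<tau>(2) by (rule qdiff_eq[OF assms(2) \<tau>(1)])
  moreover have "qdiff a b = qcls \<sigma>" unfolding \<sigma>(2) by (rule qdiff_eq[OF assms(1) \<sigma>(1)])
  moreover have "qdiff a c = qcls (\<tau> \<circ> \<sigma>)"
    unfolding \<tau>(2) \<sigma>(2) comp_assoc[symmetric] by (rule qdiff_eq[OF assms(1) AutOver_comp[OF \<tau>(1) \<sigma>(1)]])
  moreover have "qcls \<sigma> \<otimes>\<^bsub>Q\<^esub> qcls \<tau> = qcls \<tau> \<otimes>\<^bsub>Q\<^esub> qcls \<sigma>"
    by (rule comm_monoid.m_comm[OF comm_group.axioms(1)[OF comm_group_Q]]) (use \<sigma> \<tau> carrier_Q in auto)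
  ultimately show ?thesis using qcls_mult[OF \<tau>(1) \<sigma>(1)] by simp
qed

text \<open>Conjugation by \<open>\<gamma>\<close> acts trivially on the abelian quotient.\<close>

lemma qdiff_G:
  assumes "a \<in> P" "b \<in> P" "\<gamma> \<in> G"
  shows "qdiff (\<gamma> \<circ> a) (\<gamma> \<circ> b) = qdiff a b"
proof -
  obtain \<sigma> where \<sigma>: "\<sigma> \<in> G" "b = \<sigma> \<circ> a" using P_trans[OF assms(1)] assms(2) by blast
  let ?\<rho> = "\<gamma> \<circ> \<sigma> \<circ> Hilbert_Choice.inv \<gamma>"
  have \<rho>: "?\<rho> \<in> G" by (intro AutOver_comp AutOver_inv assms(3) \<sigma>(1))
  have eq: "\<gamma> \<circ> b = ?\<rho> \<circ> (\<gamma> \<circ> a)" unfolding \<sigma>(2) comp_assoc G_cancel(1)[OF assms(3)] ..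
  have "qdiff (\<gamma> \<circ> a) (\<gamma> \<circ> b) = qcls ?\<rho>" unfolding eq by (rule qdiff_eq[OF P_Aut[OF assms(1,3)] \<rho>])
  also have "\<dots> = qcls \<sigma>"
    unfolding qcls_eq_iff[OF \<rho> \<sigma>(1) P_Aut[OF assms(1,3)]] eq[symmetric] \<sigma>(2)
    using E_commute[OF assms(1,3) \<sigma>(1)] by (simp only: comp_assoc)
  also have "\<dots> = qdiff a b" unfolding \<sigma>(2) by (rule qdiff_eq[OF assms(1) \<sigma>(1), symmetric])
  finally show ?thesis .
qed

end

section \<open>A homomorphism on the homology group\<close>

context star_type
begin

text \<open>A vertex is a set that does not remember a generating realization, so one is fixed for
  each set.\<close>

definition rep :: "'a set \<Rightarrow> 'i \<Rightarrow> 'a" where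
  "rep X = (SOME b. b \<in> P \<and> X = acl M (B \<union> range b))"

lemma rep:
  assumes "X \<in> VX"
  shows "rep X \<in> P" "range (rep X) \<subseteq> X"
proof -
  have "\<exists>b. b \<in> P \<and> X = acl M (B \<union> range b)" using assms unfolding VX_def by blast
  from someI_ex[OF this] have *: "rep X \<in> P" "X = acl M (B \<union> range (rep X))" unfolding rep_def by auto
  show "rep X \<in> P" by (rule *(1))
  have "range (rep X) \<subseteq> acl M (B \<union> range (rep X))" using acl_super[of "B \<union> range (rep X)"] by blast
  then show "range (rep X) \<subseteq> X" using *(2) by simp
qed

text \<open>The generator is chosen in the object at \<open>{i}\<close> and then moved into
  position, so all edges of a configuration see the same corner at \<open>i\<close>.\<close>

definition corner :: "(nat \<Rightarrow> 'a set) \<Rightarrow> (nat set \<Rightarrow> 'a \<Rightarrow> 'a) \<Rightarrow> nat \<Rightarrow> 'i \<Rightarrow> 'a" where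
  "corner W \<gamma> i = \<gamma> {i} \<circ> rep (Hilbert_Choice.inv (\<gamma> {i}) ` W i)"

text \<open>Read off from the functor itself, without a choice of configuration, so that it is a
  function on the free generators.\<close>

definition edge_val :: "'a simplex \<Rightarrow> (('i \<Rightarrow> 'a) \<Rightarrow> ('i \<Rightarrow> 'a)) set" where
  "edge_val f = (let v = \<lambda>i. mor f {i} (verts f) \<circ> rep (obj f {i}) in qdiff (v (Min (verts f))) (v (Max (verts f))))"

lemma corner_P:
  assumes "valid s W \<gamma>" "i \<in> s"
  shows "corner W \<gamma> i \<in> P"
proof -
  have g: "\<gamma> {i} \<in> G" and W: "W i \<in> VX" using assms unfolding valid_def by auto
  show ?thesis unfolding corner_def by (rule P_Aut[OF rep(1)[OF VX_G[OF W AutOver_inv[OF g]]] g])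
qed

text \<open>Pulling both corners back by \<open>\<gamma> {i, k}\<close> does not change their
  difference.\<close>

lemma edge_val_mk:
  assumes "i < k" "valid {i, k} W \<gamma>"
  shows "edge_val (mk {i, k} W \<gamma>) = qdiff (corner W \<gamma> i) (corner W \<gamma> k)"
proof -
  let ?f = "mk {i, k} W \<gamma>" and ?\<tau> = "Hilbert_Choice.inv (\<gamma> {i, k})"
  have v: "mor ?f {j} {i, k} \<circ> rep (obj ?f {j}) = ?\<tau> \<circ> corner W \<gamma> j" if j: "j \<in> {i, k}" for j
  proof -
    have g: "\<gamma> {j} \<in> G" and W: "W j \<in> VX" using assms(2) j unfolding valid_def by auto
    have jj: "{j} \<subseteq> {i, k}" using j by blast
    have obj: "obj ?f {j} = Hilbert_Choice.inv (\<gamma> {j}) ` W j"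
      using mk_sel(2)[OF jj, of W \<gamma>] cl_one[of W j, OF W] by simp
    have "mor ?f {j} {i, k} x = ?\<tau> (\<gamma> {j} x)" if "x \<in> obj ?f {j}" for x
      using that mk_sel(3)[OF jj order_refl, of W \<gamma>] cl_one[of W j, OF W] obj by simp
    moreover have "range (rep (obj ?f {j})) \<subseteq> obj ?f {j}"
      unfolding obj by (rule rep(2)[OF VX_G[OF W AutOver_inv[OF g]]])
    ultimately show ?thesis unfolding corner_def obj[symmetric] by (auto simp: fun_eq_iff)
  qed
  have m: "Min {i, k} = i" "Max {i, k} = k" using assms(1) by auto
  have \<tau>: "?\<tau> \<in> G" using assms(2) by (intro AutOver_inv) (simp add: valid_def)
  have "edge_val ?f = qdiff (?\<tau> \<circ> corner W \<gamma> i) (?\<tau> \<circ> corner W \<gamma> k)"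
    unfolding edge_val_def Let_def mk_sel(1) m by (subst (1 2) v) simp_all
  also have "\<dots> = qdiff (corner W \<gamma> i) (corner W \<gamma> k)"
    by (rule qdiff_G[OF corner_P[OF assms(2)] corner_P[OF assms(2)] \<tau>]) auto
  finally show ?thesis .
qed

abbreviation "S1 \<equiv> simplices M \<kappa> indep B p 1"

lemma edge_val_closed: "f \<in> S1 \<Longrightarrow> edge_val f \<in> carrier Q"
proof -
  assume "f \<in> S1"
  from edge_repr[OF this] obtain i k X \<alpha> Z \<beta> \<gamma> where
    f: "i < k" "X \<in> VX" "Z \<in> VX" "\<alpha> \<in> G" "\<beta> \<in> G" "\<gamma> \<in> G" "indep Z B (\<alpha> ` X)" "f = edge i X \<alpha> k Z \<beta> \<gamma>"
    by (elim exE conjE)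
  have "i \<noteq> k" using f(1) by simp
  note v = edge_valid[OF this f(2-7)]
  show ?thesis unfolding f(8) edge_def edge_val_mk[OF f(1) v]
    by (intro qdiff_closed corner_P[OF v]) auto
qed

lemma triangle_repr:
  assumes f: "f \<in> simplices M \<kappa> indep B p 2"
  shows "\<exists>i j k W \<gamma>. i < j \<and> j < k \<and> valid {i, j, k} W \<gamma> \<and> f = mk {i, j, k} W \<gamma>"
proof -
  obtain W \<gamma> where W: "valid (verts f) W \<gamma>" "f = mk (verts f) W \<gamma>" using simplex_repr[OF f] by blast
  define l where "l = sorted_list_of_set (verts f)"
  have fin: "finite (verts f)" "card (verts f) = 3" using f by (auto simp: simplices_def)
  then have "length l = 3" by (simp add: l_def)
  then obtain i j k where l: "l = [i, j, k]" by (auto simp: numeral_3_eq_3 length_Suc_conv)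
  have "set l = verts f" "sorted_wrt (<) l" using fin by (simp_all add: l_def)
  then have "verts f = {i, j, k}" "i < j" "j < k" unfolding l by auto
  then show ?thesis using W by metis
qed

text \<open>The three edges of a triangle share its corners, so their values cancel in the
  alternating sum by additivity of differences.\<close>

lemma homology_invariant:
  "\<exists>h. h \<in> hom (free_Abelian_group S1) Q \<and> (\<forall>b\<in>boundaries. Poly_Mapping.keys b \<subseteq> S1 \<and> h b = \<one>\<^bsub>Q\<^esub>) \<and> (\<forall>f\<in>S1. h (frag_of f) = edge_val f)"
proof -
  interpret Q: comm_group Q by (rule comm_group_Q)
  obtain h where h: "h \<in> hom (free_Abelian_group S1) Q" and hf: "\<And>f. f \<in> S1 \<Longrightarrow> h (frag_of f) = edge_val f"
    using Q.free_Abelian_group_universal[of edge_val S1] edge_val_closed by blast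
  interpret h: group_hom "free_Abelian_group S1" Q h by (rule group_hom.intro[OF group_free_Abelian_group Q.is_group group_hom_axioms.intro[OF h]])
  have add: "h (x + y) = h x \<otimes>\<^bsub>Q\<^esub> h y" if "Poly_Mapping.keys x \<subseteq> S1" "Poly_Mapping.keys y \<subseteq> S1" for x y
    using h.hom_mult[of x y] that by simp
  have keys_d: "Poly_Mapping.keys (x - y) \<subseteq> S1" if "Poly_Mapping.keys x \<subseteq> S1" "Poly_Mapping.keys y \<subseteq> S1" for x y
    using keys_diff[of x y] that by blast
  have cl: "h x \<in> carrier Q" if "Poly_Mapping.keys x \<subseteq> S1" for x using h.hom_closed[of x] that by simp
  have hdiff: "h (x - y) = h x \<otimes>\<^bsub>Q\<^esub> inv\<^bsub>Q\<^esub> h y" if k: "Poly_Mapping.keys x \<subseteq> S1" "Poly_Mapping.keys y \<subseteq> S1" for x y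
    by (rule iffD2[OF Q.inv_solve_right[OF cl[OF keys_d[OF k]] cl[OF k(1)] cl[OF k(2)]]])
       (use add[OF keys_d[OF k] k(2)] in simp)
  have "Poly_Mapping.keys (boundary c) \<subseteq> S1 \<and> h (boundary c) = \<one>\<^bsub>Q\<^esub>"
    if "Poly_Mapping.keys c \<subseteq> simplices M \<kappa> indep B p 2" for c
    using that
  proof (induction c rule: frag_induction[of _ "simplices M \<kappa> indep B p 2"])
    case zero
    show ?case using h.hom_one by (simp add: boundary_def)
  next
    case (diff a b)
    then show ?case unfolding boundary_diff
      using keys_d[of "boundary a" "boundary b"] hdiff[of "boundary a" "boundary b"] Q.r_inv[OF Q.one_closed] by (metis Q.inv_one)
  next
    case (one f)
    from triangle_repr[OF one] obtain i j k W \<gamma> where f: "i < j" "j < k" "valid {i, j, k} W \<gamma>" "f = mk {i, j, k} W \<gamma>"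
      by (elim exE conjE)
    have ik: "i < k" using f(1,2) by simp
    have v: "valid {j, k} W \<gamma>" "valid {i, k} W \<gamma>" "valid {i, j} W \<gamma>" by (rule valid_subset[OF f(3)]; blast)+
    have s: "mk {j, k} W \<gamma> \<in> S1" "mk {i, k} W \<gamma> \<in> S1" "mk {i, j} W \<gamma> \<in> S1"
      using f(1,2) ik mk_simplex_two[OF _ v(1)] mk_simplex_two[OF _ v(2)] mk_simplex_two[OF _ v(3)] by simp_all
    have c: "corner W \<gamma> i \<in> P" "corner W \<gamma> j \<in> P" "corner W \<gamma> k \<in> P" by (rule corner_P[OF f(3)]; simp)+
    let ?b = "frag_of (mk {j, k} W \<gamma>) - frag_of (mk {i, k} W \<gamma>) + frag_of (mk {i, j} W \<gamma>)"
    have kd: "Poly_Mapping.keys (frag_of (mk {j, k} W \<gamma>) - frag_of (mk {i, k} W \<gamma>)) \<subseteq> S1" by (rule keys_d) (use s in auto)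
    then have kb: "Poly_Mapping.keys ?b \<subseteq> S1" using keys_add[of "frag_of (mk {j, k} W \<gamma>) - frag_of (mk {i, k} W \<gamma>)" "frag_of (mk {i, j} W \<gamma>)"] s by auto
    have "h ?b = (qdiff (corner W \<gamma> j) (corner W \<gamma> k) \<otimes>\<^bsub>Q\<^esub> inv\<^bsub>Q\<^esub> qdiff (corner W \<gamma> i) (corner W \<gamma> k)) \<otimes>\<^bsub>Q\<^esub>
      qdiff (corner W \<gamma> i) (corner W \<gamma> j)"
      using add[OF kd] hdiff hf s edge_val_mk[OF f(2) v(1)] edge_val_mk[OF ik v(2)] edge_val_mk[OF f(1) v(3)]
      by simp
    also have "\<dots> = (qdiff (corner W \<gamma> i) (corner W \<gamma> j) \<otimes>\<^bsub>Q\<^esub> qdiff (corner W \<gamma> j) (corner W \<gamma> k)) \<otimes>\<^bsub>Q\<^esub>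
      inv\<^bsub>Q\<^esub> qdiff (corner W \<gamma> i) (corner W \<gamma> k)"
      using c by (simp add: qdiff_closed Q.m_ac del: mult_FactGroup)
    also have "\<dots> = \<one>\<^bsub>Q\<^esub>" unfolding qdiff_add[OF c] by (rule Q.r_inv[OF qdiff_closed[OF c(1,3)]])
    finally show ?case unfolding f(4) boundary_three[OF f(1,2)] using kb by simp
  qed
  then have "\<forall>b\<in>boundaries. Poly_Mapping.keys b \<subseteq> S1 \<and> h b = \<one>\<^bsub>Q\<^esub>"
    unfolding boundaries_def by (auto simp: chain_group_def)
  with h hf show ?thesis by blast
qed

section \<open>The first homology group\<close>

abbreviation "cycles \<equiv> {c. Poly_Mapping.keys c \<subseteq> S1 \<and> boundary c = 0}"

lemma homology_carrier:
  "carrier (homology M \<kappa> indep B p 1) = (\<lambda>c. (\<lambda>b. b + c) ` boundaries) ` cycles"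
  by (auto simp: homology_def chain_group_def kernel_def FactGroup_def RCOSETS_def r_coset_def boundaries_def
      numeral_2_eq_2)

lemma homology_one_class:
  assumes "E = P \<times> P" "type_of_acl_set M B p \<or> acl_eq_dcl M B p"
  shows "card (carrier (homology M \<kappa> indep B p 1)) = 1"
proof -
  have "(\<lambda>b. b + c) ` boundaries = boundaries" if "c \<in> cycles" for c
  proof -
    have c: "c \<in> boundaries" using cycle_boundary[OF assms] that by blast
    have "b \<in> (\<lambda>b. b + c) ` boundaries" if b: "b \<in> boundaries" for b
      by (rule image_eqI[OF _ boundaries_diff[OF b c]]) simp
    with boundaries_add[OF _ c] show ?thesis by blast
  qed
  moreover have "0 \<in> cycles" by (simp add: boundary_def)
  ultimately have "(\<lambda>c. (\<lambda>b. b + c) ` boundaries) ` cycles = {boundaries}"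
    by (intro equalityI subsetI) (auto simp: image_iff)
  then show ?thesis unfolding homology_carrier by simp
qed

text \<open>The homomorphism of \<open>homology_invariant\<close> is constant on cosets of the
  boundaries and takes every value \<open>qcls g\<close> on cycles, while inequivalent realizations
  give different values.\<close>

lemma homology_many_classes:
  fixes a :: "'j \<Rightarrow> 'i \<Rightarrow> 'a"
  assumes aP: "\<And>\<eta>. a \<eta> \<in> P" and aE: "\<And>\<eta> \<eta>'. \<eta> \<noteq> \<eta>' \<Longrightarrow> (a \<eta>, a \<eta>') \<notin> E"
  shows "|UNIV :: 'j set| \<le>o |carrier (homology M \<kappa> indep B p 1)|"
proof -
  interpret Q: comm_group Q by (rule comm_group_Q)
  obtain h where h: "h \<in> hom (free_Abelian_group S1) Q"
    and hb: "\<forall>b\<in>boundaries. Poly_Mapping.keys b \<subseteq> S1 \<and> h b = \<one>\<^bsub>Q\<^esub>" and hf: "\<forall>f\<in>S1. h (frag_of f) = edge_val f"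
    using homology_invariant by (elim exE conjE)
  interpret h: group_hom "free_Abelian_group S1" Q h by (rule group_hom.intro[OF group_free_Abelian_group Q.is_group group_hom_axioms.intro[OF h]])
  have add: "h (x + y) = h x \<otimes>\<^bsub>Q\<^esub> h y" if "Poly_Mapping.keys x \<subseteq> S1" "Poly_Mapping.keys y \<subseteq> S1" for x y
    using h.hom_mult[of x y] that by simp
  obtain X where X: "X \<in> VX" using VX_nonempty by blast
  have "\<exists>z. z \<in> cycles \<and> h z = qcls g" if g: "g \<in> G" for g
  proof -
    have s: "small \<kappa> X" "small \<kappa> (g ` X)" by (intro small_image VX_small[OF X])+
    obtain Z where Z: "Z \<in> VX" "indep Z B (X \<union> g ` X)" by (rule VX_indep[OF small_Un[OF s]])
    note I = indep_Un[OF Z(1) s Z(2)]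
    \<comment> \<open>Two edges with the same end simplices, one of them with \<open>X\<close> moved
      by \<open>g\<close>. Their difference is a cycle on which the homomorphism takes the value
      \<open>qcls g\<close>.\<close>
    let ?e = "\<lambda>\<alpha>. edge 0 X \<alpha> 1 Z id id" and ?z = "cone 0 X id 1 Z - cone 0 X g 1 Z"
    have *: "?e \<alpha> \<in> S1" "boundary (frag_of (?e \<alpha>)) = frag_of (pt 1 Z) - frag_of (pt 0 X)"
      "edge_val (?e \<alpha>) = qdiff (\<alpha> \<circ> rep X) (rep Z)" if \<alpha>: "\<alpha> \<in> G" "indep Z B (\<alpha> ` X)" for \<alpha>
    proof -
      have ne: "(0::nat) \<noteq> 1" and lt: "(0::nat) < 1" by auto
      note v = edge_valid[OF ne X Z(1) \<alpha>(1) AutOver_id AutOver_id \<alpha>(2)]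
      show "?e \<alpha> \<in> S1" by (rule edge_simplex[OF ne X Z(1) \<alpha>(1) AutOver_id AutOver_id \<alpha>(2)])
      show "boundary (frag_of (?e \<alpha>)) = frag_of (pt 1 Z) - frag_of (pt 0 X)"
        using boundary_edge[OF lt X Z(1) \<alpha>(1) AutOver_id AutOver_id] by simp
      have "Hilbert_Choice.inv \<alpha> ` \<alpha> ` X = X" using AutOver_inv_comp(1)[OF \<alpha>(1)] by (simp add: image_image)
      then show "edge_val (?e \<alpha>) = qdiff (\<alpha> \<circ> rep X) (rep Z)"
        unfolding edge_def edge_val_mk[OF lt v] by (simp add: corner_def)
    qed
    have I0: "indep Z B (id ` X)" using I(1) by simp
    note e0 = *[OF AutOver_id I0] and eg = *[OF g I(2)]
    have k: "Poly_Mapping.keys ?z \<subseteq> S1" using keys_diff[of "frag_of (?e id)" "frag_of (?e g)"] e0(1) eg(1) by auto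
    have "boundary ?z = 0" unfolding boundary_diff e0(2) eg(2) by simp
    note P = rep(1)[OF X] P_Aut[OF rep(1)[OF X] g] rep(1)[OF Z(1)]
    have "h ?z \<otimes>\<^bsub>Q\<^esub> qdiff (g \<circ> rep X) (rep Z) = h (?z + frag_of (?e g))"
      using add[OF k, of "frag_of (?e g)"] eg hf by simp
    also have "\<dots> = qdiff (rep X) (rep Z)" using hf e0(1,3) by simp
    also have "\<dots> = qdiff (rep X) (g \<circ> rep X) \<otimes>\<^bsub>Q\<^esub> qdiff (g \<circ> rep X) (rep Z)" by (rule qdiff_add[OF P, symmetric])
    finally have "h ?z = qdiff (rep X) (g \<circ> rep X)"
      by (rule iffD1[OF Q.right_cancel, rotated -1]) (use h.hom_closed[of ?z] k qdiff_closed P in simp_all)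
    also have "\<dots> = qcls g" by (rule qdiff_eq[OF P(1) g])
    finally show ?thesis using k \<open>boundary ?z = 0\<close> by blast
  qed
  then have "\<forall>g\<in>G. \<exists>z. z \<in> cycles \<and> h z = qcls g" by blast
  from bchoice[OF this] obtain z where z: "\<forall>g\<in>G. z g \<in> cycles \<and> h (z g) = qcls g" by (elim exE)
  have "\<forall>\<eta>. \<exists>g. g \<in> G \<and> a \<eta> = g \<circ> rep X" using P_trans[OF rep(1)[OF X]] aP by blast
  from choice[OF this] obtain g where g: "\<forall>\<eta>. g \<eta> \<in> G \<and> a \<eta> = g \<eta> \<circ> rep X" by (elim exE)
  let ?F = "\<lambda>\<eta>. (\<lambda>b. b + z (g \<eta>)) ` boundaries"
  have "inj ?F"
  proof (rule injI)
    fix \<eta> \<eta>' assume eq: "?F \<eta> = ?F \<eta>'"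
    have G: "g \<eta> \<in> G" "g \<eta>' \<in> G" using g by auto
    note zz = bspec[OF z G(1)] bspec[OF z G(2)]
    have "z (g \<eta>) \<in> ?F \<eta>" by (rule image_eqI[OF _ boundaries_0]) simp
    then obtain b where b: "b \<in> boundaries" "z (g \<eta>) = b + z (g \<eta>')" unfolding eq by (elim imageE)
    have "qcls (g \<eta>) = qcls (g \<eta>')"
      using add[of b "z (g \<eta>')"] bspec[OF hb b(1)] zz b(2) Q.l_one[of "qcls (g \<eta>')"] G carrier_Q by simp
    then have "(a \<eta>, a \<eta>') \<in> E" using qcls_eq_iff[OF G rep(1)[OF X]] g by simp
    then show "\<eta> = \<eta>'" using aE by blast
  qed
  moreover have "range ?F \<subseteq> carrier (homology M \<kappa> indep B p 1)"
  proof
    fix c assume "c \<in> range ?F"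
    then obtain \<eta> where c: "c = ?F \<eta>" by (elim rangeE)
    have "z (g \<eta>) \<in> cycles" using z g by blast
    then show "c \<in> carrier (homology M \<kappa> indep B p 1)" unfolding homology_carrier c by (rule imageI)
  qed
  ultimately show ?thesis by (intro iffD1[OF card_of_ordLeq] exI conjI)
qed

lemma homology_dichotomy:
  assumes "type_of_acl_set M B p \<or> acl_eq_dcl M B p"
  shows "card (carrier (homology M \<kappa> indep B p 1)) = 1 \<or> ctwo ^c natLeq \<le>o |carrier (homology M \<kappa> indep B p 1)|"
  using one_or_continuum_classes
proof (elim disjE exE conjE)
  assume "E = P \<times> P"
  then show ?thesis using homology_one_class assms by blast
next
  fix a :: "(nat \<Rightarrow> bool) \<Rightarrow> 'i \<Rightarrow> 'a"
  assume a: "\<forall>\<eta>. a \<eta> \<in> P" "\<forall>\<eta> \<eta>'. \<eta> \<noteq> \<eta>' \<longrightarrow> (a \<eta>, a \<eta>') \<notin> E"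
  have "|UNIV :: (nat \<Rightarrow> bool) set| \<le>o |carrier (homology M \<kappa> indep B p 1)|"
    by (rule homology_many_classes[of a]) (use a in auto)
  moreover have "ctwo ^c natLeq \<le>o |UNIV :: (nat \<Rightarrow> bool) set|"
    unfolding cexp_def ctwo_def Field_card_of Field_natLeq by (rule card_of_mono1) simp
  ultimately show ?thesis using ordLeq_transitive by blast
qed

end

theorem theorem4p8:
  fixes T :: "('s, 'f, 'r) fm set"
    and M :: "('s, 'f, 'r, 'a) fo_struct"
    and \<kappa> :: "'k rel"
    and indep :: "'a set \<Rightarrow> 'a set \<Rightarrow> 'a set \<Rightarrow> bool"
    and B :: "'a set"
    and p :: "('s, 'f, 'r, 'i, 'a) pfm set"
  assumes "monster T M \<kappa>"
    and "star_independence M \<kappa> indep"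
    and "strong_type M \<kappa> B p"
    and "type_of_acl_set M B p \<or> acl_eq_dcl M B p"
  shows "(type_definable_on M \<kappa> (realizations M B p) (H1_equiv M B p) \<longleftrightarrow> H1_diam M B p \<noteq> \<infinity>) \<and>
         (card (carrier (homology M \<kappa> indep B p 1)) = 1 \<or>
          ctwo ^c natLeq \<le>o |carrier (homology M \<kappa> indep B p 1)| )"
proof -
  interpret monster T M \<kappa> by (rule assms(1))
  interpret star_independence M \<kappa> indep by (rule assms(2))
  interpret star_type T M \<kappa> B p indep by unfold_locales (rule assms(3))
  show ?thesis using type_definable_iff homology_dichotomy[OF assms(4)] by (rule conjI)
qed


end
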